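(* (1) For each $k=1,2,3,4$ the category of distributive restriction semigroups (resp. $\wedge$-semigroups, monoids, $\wedge$-monoids) and their morphisms of type $k$ is dually equivalent to the category of spectral (resp. strongly spectral, compact spectral, compact strongly spectral) étale topological categories and their morphisms of type $k$. Under this equivalence, classes of distributive ample semigroups correspond to the respective classes of cancellative spectral étale topological categories. (2) For each $k=1,2,3,4$ the category of Boolean restriction semigroups (resp. $\wedge$-semigroups, monoids, $\wedge$-monoids) and their morphisms of type $k$ is dually equivalent to the category of Boolean (resp. strongly Boolean, compact Boolean, compact strongly Boolean) étale topological categories and their morphisms of type $k$. Under this equivalence, classes of Boolean ample semigroups correspond to the respective classes of cancellative Boolean étale topological categories.
   Context: **Distributive and Boolean restriction semigroups.** An Ehresmann semigroup is a semigroup $S$ with a non-empty set $E$ of idempotents (the projections) and maps $\lambda,\rho:S\to E$ such that: $E$ is a commutative subsemigroup; $\lambda(a)=\rho(a)=a$ for $a\in E$; $a\lambda(a)=a$ and $\rho(a)a=a$; $\lambda(\lambda(a)b)=\lambda(ab)$ and $\rho(a\rho(b))=\rho(ab)$. It is a restriction semigroup if moreover $fa=a\lambda(fa)$ and $af=\rho(af)a$ for all $a\in S$, $f\in E$. It is ample if $ac=bc$ implies $a\rho(c)=b\rho(c)$, and $ca=cb$ implies $\lambda(c)a=\lambda(c)b$. Natural partial order: $a\le b$ iff $a=gb=bf$ for some $f,g\in E$. Elements $a,b$ are compatible if $a\lambda(b)=b\lambda(a)$ and $\rho(b)a=\rho(a)b$; a non-empty subset is compatible if any two of its elements are compatible.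 $S$ is distributive if $E$ is a distributive lattice (with a bottom element, not necessarily with a top) and $S$ has joins of all non-empty finite compatible subsets (that is, $a\vee b$ exists in $S$ for all compatible $a,b$). It is Boolean if moreover $E$ is a Boolean algebra (possibly without a top, i.e. a generalized Boolean algebra). It is a $\wedge$-semigroup if $a\wedge b$ exists for all $a,b\in S$; a ($\wedge$-)monoid if in addition $S$ has an identity. A morphism $f:S\to T$ is a semigroup homomorphism commuting with $\lambda,\rho$ whose restriction $E_S\to E_T$ is a morphism of distributive lattices, i.e. preserves the bottom, $\vee$ and $\wedge$ and is such that for every $a\in E_T$ there is $b\in E_S$ with $f(b)\ge a$. It is proper if for every $t\in T$ there are $n\ge1$, $t_1,\dots,t_n\in T$, $s_1,\dots,s_n\in S$ with $t=\bigvee t_i$ and $f(s_i)\ge t_i$ for all $i$; weakly meet-preserving if $t\le f(a),f(b)$ implies that there is $c\le a,b$ with $t\le f(c)$. Types: 1 morphisms; 2 proper morphisms; 3 weakly meet-preserving morphisms; 4 proper and weakly meet-preserving morphisms. **Étale topological categories.** A topological category $C=(C_1,C_0,u,d,r,m)$ is an internal category in topological spaces ($u$ unit, $d$ domain, $r$ codomain, $m$ defined on $C_1\times_{C_0}C_1=\{(a,b):d(a)=r(b)\}$). It is étale if $d,r$ are local homeomorphisms and $u,m$ are open. It is cancellative if $ac=bc$ (with $d(a)=d(b)=r(c)$) implies $a=b$ and $ca=cb$ (with $r(a)=r(b)=d(c)$) implies $a=b$. A relational covering morphism $f=(f_1,f_0):C\to D$ consists of a continuous $f_0:C_0\to D_0$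 and a function $f_1:C_1\to\mathcal P(D_1)$ (power set) such that: (RM1) $b\in f_1(a)$ implies $d(b)=f_0d(a)$ and $r(b)=f_0r(a)$; (RM2) if $(a,b)\in C_1\times_{C_0}C_1$, $(s,t)\in D_1\times_{D_0}D_1$, $s\in f_1(a)$, $t\in f_1(b)$, then $st\in f_1(ab)$; (RM3) if $d(a)=d(b)$ or $r(a)=r(b)$, and $f_1(a)\cap f_1(b)\ne\varnothing$, then $a=b$; (RM4) if $p=f_0(q)$ and $d(s)=p$ (resp. $r(s)=p$) with $q\in C_0$, $s\in D_1$, there is $t\in C_1$ with $d(t)=q$ (resp. $r(t)=q$) and $s\in f_1(t)$; (RM5) $\{x\in C_1:f_1(x)\cap A\ne\varnothing\}$ is open for every open $A\subseteq D_1$; (RM6) $uf_0(t)\in f_1u(t)$ for $t\in C_0$. Composition: $(gf)_1(a)=\bigcup_{b\in f_1(a)}g_1(b)$, $(gf)_0=g_0f_0$. Types: 1 all relational covering morphisms; 2 those with $|f_1(c)|\ge1$ for all $c$; 3 those with $|f_1(c)|\le1$; 4 those with $|f_1(c)|=1$. A space is spectral if it is sober and has a basis of compact-open sets closed under finite non-empty intersections (it need not be compact); a Boolean space is a Hausdorff spectral space. An étale topological category $C$ is spectral (resp. Boolean) if $C_0$ is, and strongly spectral (resp. strongly Boolean) if $C_1$ is; "compact" means in addition that $C_0$ is compact.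
   Formalization: The bottom of E is additionally required to be a zero of S, and relational covering morphisms are additionally required to be coherent (inverse images under f_0 of compact-open sets are compact); without these two conditions the stated dualities fail. *)

theory Defs
  imports "HOL-Analysis.Analysis" "HOL-Algebra.Lattice" "HOL-Library.FuncSet"
begin

section \<open>Distributive and Boolean restriction semigroups\<close>

record 'a rsgp = "'a partial_object" +
  tms :: "'a \<Rightarrow> 'a \<Rightarrow> 'a"  (infixl "\<cdot>\<index>" 70)
  projs :: "'a set"
  lam :: "'a \<Rightarrow> 'a"
  rho :: "'a \<Rightarrow> 'a"

locale ehresmann_semigroup =
  fixes S :: "'a rsgp" (structure)
  assumes tms_closed: "\<lbrakk>a \<in> carrier S; b \<in> carrier S\<rbrakk> \<Longrightarrow> a \<cdot> b \<in> carrier S"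
    and tms_assoc: "\<lbrakk>a \<in> carrier S; b \<in> carrier S; c \<in> carrier S\<rbrakk> \<Longrightarrow> a \<cdot> b \<cdot> c = a \<cdot> (b \<cdot> c)"
    and projs_subset: "projs S \<subseteq> carrier S"
    and projs_nonempty: "projs S \<noteq> {}"
    and projs_idem: "e \<in> projs S \<Longrightarrow> e \<cdot> e = e"
    and projs_closed: "\<lbrakk>e \<in> projs S; f \<in> projs S\<rbrakk> \<Longrightarrow> e \<cdot> f \<in> projs S"
    and projs_comm: "\<lbrakk>e \<in> projs S; f \<in> projs S\<rbrakk> \<Longrightarrow> e \<cdot> f = f \<cdot> e"
    and lam_closed: "a \<in> carrier S \<Longrightarrow> lam S a \<in> projs S"
    and rho_closed: "a \<in> carrier S \<Longrightarrow> rho S a \<in> projs S"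
    and lam_proj: "e \<in> projs S \<Longrightarrow> lam S e = e"
    and rho_proj: "e \<in> projs S \<Longrightarrow> rho S e = e"
    and tms_lam: "a \<in> carrier S \<Longrightarrow> a \<cdot> lam S a = a"
    and rho_tms: "a \<in> carrier S \<Longrightarrow> rho S a \<cdot> a = a"
    and lam_tms: "\<lbrakk>a \<in> carrier S; b \<in> carrier S\<rbrakk> \<Longrightarrow> lam S (lam S a \<cdot> b) = lam S (a \<cdot> b)"
    and rho_rho: "\<lbrakk>a \<in> carrier S; b \<in> carrier S\<rbrakk> \<Longrightarrow> rho S (a \<cdot> rho S b) = rho S (a \<cdot> b)"

locale restriction_semigroup = ehresmann_semigroup +
  assumes proj_tms: "\<lbrakk>a \<in> carrier S; f \<in> projs S\<rbrakk> \<Longrightarrow> f \<cdot> a = a \<cdot> lam S (f \<cdot> a)"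
    and tms_proj: "\<lbrakk>a \<in> carrier S; f \<in> projs S\<rbrakk> \<Longrightarrow> a \<cdot> f = rho S (a \<cdot> f) \<cdot> a"

definition ample :: "'a rsgp \<Rightarrow> bool" where
  "ample S \<longleftrightarrow> restriction_semigroup S \<and>
     (\<forall>a\<in>carrier S. \<forall>b\<in>carrier S. \<forall>c\<in>carrier S.
        (a \<cdot>\<^bsub>S\<^esub> c = b \<cdot>\<^bsub>S\<^esub> c \<longrightarrow> a \<cdot>\<^bsub>S\<^esub> rho S c = b \<cdot>\<^bsub>S\<^esub> rho S c) \<and>
        (c \<cdot>\<^bsub>S\<^esub> a = c \<cdot>\<^bsub>S\<^esub> b \<longrightarrow> lam S c \<cdot>\<^bsub>S\<^esub> a = lam S c \<cdot>\<^bsub>S\<^esub> b))"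

definition nat_ord :: "'a rsgp \<Rightarrow> 'a gorder" where
  "nat_ord S = \<lparr>carrier = carrier S, eq = (=),
     le = (\<lambda>a b. \<exists>g\<in>projs S. \<exists>f\<in>projs S. a = g \<cdot>\<^bsub>S\<^esub> b \<and> a = b \<cdot>\<^bsub>S\<^esub> f)\<rparr>"

definition proj_ord :: "'a rsgp \<Rightarrow> 'a gorder" where
  "proj_ord S = (nat_ord S)\<lparr>carrier := projs S\<rparr>"

definition compatible :: "'a rsgp \<Rightarrow> 'a \<Rightarrow> 'a \<Rightarrow> bool" where
  "compatible S a b \<longleftrightarrow>
     a \<cdot>\<^bsub>S\<^esub> lam S b = b \<cdot>\<^bsub>S\<^esub> lam S a \<and> rho S b \<cdot>\<^bsub>S\<^esub> a = rho S a \<cdot>\<^bsub>S\<^esub> b"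

definition distributive_lattice_bot :: "'a gorder \<Rightarrow> bool" where
  "distributive_lattice_bot L \<longleftrightarrow> Lattice.lattice L \<and> weak_partial_order_bottom L \<and>
     (\<forall>x\<in>carrier L. \<forall>y\<in>carrier L. \<forall>z\<in>carrier L.
        x \<sqinter>\<^bsub>L\<^esub> (y \<squnion>\<^bsub>L\<^esub> z) = (x \<sqinter>\<^bsub>L\<^esub> y) \<squnion>\<^bsub>L\<^esub> (x \<sqinter>\<^bsub>L\<^esub> z))"

definition generalized_boolean_algebra :: "'a gorder \<Rightarrow> bool" where
  "generalized_boolean_algebra L \<longleftrightarrow> distributive_lattice_bot L \<and>
     (\<forall>x\<in>carrier L. \<forall>y\<in>carrier L. x \<sqsubseteq>\<^bsub>L\<^esub> y \<longrightarrow>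
        (\<exists>z\<in>carrier L. x \<sqinter>\<^bsub>L\<^esub> z = \<bottom>\<^bsub>L\<^esub> \<and> x \<squnion>\<^bsub>L\<^esub> z = y))"

text \<open>The bottom of the lattice of projections is required to be a zero of the semigroup (equivalently,
  the empty compatible family has a join, too).  Without this, every monoid with 1 as its only
  projection would be distributive, and these have no topological counterpart.\<close>

definition distributive_rsgp :: "'a rsgp \<Rightarrow> bool" where
  "distributive_rsgp S \<longleftrightarrow> restriction_semigroup S \<and> distributive_lattice_bot (proj_ord S) \<and>
     (\<forall>a\<in>carrier S. \<bottom>\<^bsub>proj_ord S\<^esub> \<cdot>\<^bsub>S\<^esub> a = \<bottom>\<^bsub>proj_ord S\<^esub> \<and> a \<cdot>\<^bsub>S\<^esub> \<bottom>\<^bsub>proj_ord S\<^esub> = \<bottom>\<^bsub>proj_ord S\<^esub>) \<and>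
     (\<forall>A. A \<subseteq> carrier S \<and> finite A \<and> A \<noteq> {} \<and> (\<forall>a\<in>A. \<forall>b\<in>A. compatible S a b) \<longrightarrow>
        (\<exists>x. is_lub (nat_ord S) x A))"

definition boolean_rsgp :: "'a rsgp \<Rightarrow> bool" where
  "boolean_rsgp S \<longleftrightarrow> distributive_rsgp S \<and> generalized_boolean_algebra (proj_ord S)"

definition has_meets :: "'a rsgp \<Rightarrow> bool" where
  "has_meets S \<longleftrightarrow> (\<forall>a\<in>carrier S. \<forall>b\<in>carrier S. \<exists>x. is_glb (nat_ord S) x {a, b})"

definition has_identity :: "'a rsgp \<Rightarrow> bool" where
  "has_identity S \<longleftrightarrow> (\<exists>i\<in>carrier S. \<forall>a\<in>carrier S. i \<cdot>\<^bsub>S\<^esub> a = a \<and> a \<cdot>\<^bsub>S\<^esub> i = a)"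

definition rs_morphism :: "'a rsgp \<Rightarrow> 'b rsgp \<Rightarrow> ('a \<Rightarrow> 'b) \<Rightarrow> bool" where
  "rs_morphism S T f \<longleftrightarrow>
     f \<in> carrier S \<rightarrow> carrier T \<and>
     (\<forall>a\<in>carrier S. \<forall>b\<in>carrier S. f (a \<cdot>\<^bsub>S\<^esub> b) = f a \<cdot>\<^bsub>T\<^esub> f b) \<and>
     (\<forall>a\<in>carrier S. f (lam S a) = lam T (f a) \<and> f (rho S a) = rho T (f a)) \<and>
     f \<bottom>\<^bsub>proj_ord S\<^esub> = \<bottom>\<^bsub>proj_ord T\<^esub> \<and>
     (\<forall>x\<in>projs S. \<forall>y\<in>projs S.
        f (x \<squnion>\<^bsub>proj_ord S\<^esub> y) = f x \<squnion>\<^bsub>proj_ord T\<^esub> f y \<and>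
        f (x \<sqinter>\<^bsub>proj_ord S\<^esub> y) = f x \<sqinter>\<^bsub>proj_ord T\<^esub> f y) \<and>
     (\<forall>a\<in>projs T. \<exists>b\<in>projs S. a \<sqsubseteq>\<^bsub>proj_ord T\<^esub> f b)"

definition proper_morphism :: "'a rsgp \<Rightarrow> 'b rsgp \<Rightarrow> ('a \<Rightarrow> 'b) \<Rightarrow> bool" where
  "proper_morphism S T f \<longleftrightarrow>
     (\<forall>t\<in>carrier T. \<exists>n\<ge>1. \<exists>(t' :: nat \<Rightarrow> 'b) (s' :: nat \<Rightarrow> 'a).
        (\<forall>i\<in>{1..n}. t' i \<in> carrier T \<and> s' i \<in> carrier S \<and> t' i \<sqsubseteq>\<^bsub>nat_ord T\<^esub> f (s' i)) \<and>
        is_lub (nat_ord T) t (t' ` {1..n}))"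

definition weakly_meet_preserving :: "'a rsgp \<Rightarrow> 'b rsgp \<Rightarrow> ('a \<Rightarrow> 'b) \<Rightarrow> bool" where
  "weakly_meet_preserving S T f \<longleftrightarrow>
     (\<forall>t\<in>carrier T. \<forall>a\<in>carrier S. \<forall>b\<in>carrier S.
        t \<sqsubseteq>\<^bsub>nat_ord T\<^esub> f a \<and> t \<sqsubseteq>\<^bsub>nat_ord T\<^esub> f b \<longrightarrow>
        (\<exists>c\<in>carrier S. c \<sqsubseteq>\<^bsub>nat_ord S\<^esub> a \<and> c \<sqsubseteq>\<^bsub>nat_ord S\<^esub> b \<and> t \<sqsubseteq>\<^bsub>nat_ord T\<^esub> f c))"

text \<open>Morphisms of type \<open>k = 1, 2, 3, 4\<close>.  Extensionality makes equality of functions equality on the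
  carrier.\<close>

definition rs_hom :: "nat \<Rightarrow> 'a rsgp \<Rightarrow> 'b rsgp \<Rightarrow> ('a \<Rightarrow> 'b) set" where
  "rs_hom k S T = {f \<in> extensional (carrier S). rs_morphism S T f \<and>
     (k \<in> {2, 4} \<longrightarrow> proper_morphism S T f) \<and>
     (k \<in> {3, 4} \<longrightarrow> weakly_meet_preserving S T f)}"

definition rs_id :: "'a rsgp \<Rightarrow> 'a \<Rightarrow> 'a" where
  "rs_id S = (\<lambda>a\<in>carrier S. a)"

definition rs_comp :: "'a rsgp \<Rightarrow> ('b \<Rightarrow> 'c) \<Rightarrow> ('a \<Rightarrow> 'b) \<Rightarrow> 'a \<Rightarrow> 'c" where
  "rs_comp S g f = compose (carrier S) g f"

definition rs_iso :: "nat \<Rightarrow> 'a rsgp \<Rightarrow> 'b rsgp \<Rightarrow> ('a \<Rightarrow> 'b) \<Rightarrow> bool" where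
  "rs_iso k S T f \<longleftrightarrow> f \<in> rs_hom k S T \<and>
     (\<exists>g\<in>rs_hom k T S. rs_comp S g f = rs_id S \<and> rs_comp T f g = rs_id T)"


section \<open>Spectral and Boolean spaces\<close>

definition irreducible_in :: "'a topology \<Rightarrow> 'a set \<Rightarrow> bool" where
  "irreducible_in X Z \<longleftrightarrow> Z \<subseteq> topspace X \<and> Z \<noteq> {} \<and>
     (\<forall>A B. closedin X A \<and> closedin X B \<and> Z \<subseteq> A \<union> B \<longrightarrow> Z \<subseteq> A \<or> Z \<subseteq> B)"

definition sober_space :: "'a topology \<Rightarrow> bool" where
  "sober_space X \<longleftrightarrow>
     (\<forall>Z. closedin X Z \<and> irreducible_in X Z \<longrightarrow> (\<exists>!x. x \<in> topspace X \<and> Z = X closure_of {x}))"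

definition spectral_space :: "'a topology \<Rightarrow> bool" where
  "spectral_space X \<longleftrightarrow> sober_space X \<and>
     (\<exists>\<B>. (\<forall>U\<in>\<B>. openin X U \<and> compactin X U) \<and>
          openin X = arbitrary union_of (\<lambda>U. U \<in> \<B>) \<and>
          (\<forall>U\<in>\<B>. \<forall>V\<in>\<B>. U \<inter> V \<in> \<B>))"

definition boolean_space :: "'a topology \<Rightarrow> bool" where
  "boolean_space X \<longleftrightarrow> Hausdorff_space X \<and> spectral_space X"

definition local_homeomorphism :: "'a topology \<Rightarrow> 'b topology \<Rightarrow> ('a \<Rightarrow> 'b) \<Rightarrow> bool" where
  "local_homeomorphism X Y f \<longleftrightarrow>
     (\<forall>x\<in>topspace X. \<exists>U. openin X U \<and> x \<in> U \<and> openin Y (f ` U) \<and>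
        homeomorphic_map (subtopology X U) (subtopology Y (f ` U)) f)"


section \<open>Etale topological categories\<close>

record ('o, 'm) tcat =
  obs :: "'o topology"
  arrs :: "'m topology"
  unt :: "'o \<Rightarrow> 'm"
  dm :: "'m \<Rightarrow> 'o"
  cd :: "'m \<Rightarrow> 'o"
  cmp :: "'m \<Rightarrow> 'm \<Rightarrow> 'm"

abbreviation ob_set :: "('o, 'm) tcat \<Rightarrow> 'o set" where
  "ob_set C \<equiv> topspace (obs C)"

abbreviation ar_set :: "('o, 'm) tcat \<Rightarrow> 'm set" where
  "ar_set C \<equiv> topspace (arrs C)"

definition composables :: "('o, 'm) tcat \<Rightarrow> ('m \<times> 'm) topology" where
  "composables C = subtopology (prod_topology (arrs C) (arrs C)) {(a, b). dm C a = cd C b}"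

definition topological_category :: "('o, 'm) tcat \<Rightarrow> bool" where
  "topological_category C \<longleftrightarrow>
     continuous_map (obs C) (arrs C) (unt C) \<and>
     continuous_map (arrs C) (obs C) (dm C) \<and>
     continuous_map (arrs C) (obs C) (cd C) \<and>
     continuous_map (composables C) (arrs C) (\<lambda>(a, b). cmp C a b) \<and>
     (\<forall>q\<in>ob_set C. dm C (unt C q) = q \<and> cd C (unt C q) = q) \<and>
     (\<forall>a\<in>ar_set C. cmp C a (unt C (dm C a)) = a \<and> cmp C (unt C (cd C a)) a = a) \<and>
     (\<forall>a\<in>ar_set C. \<forall>b\<in>ar_set C. dm C a = cd C b \<longrightarrow>
        dm C (cmp C a b) = dm C b \<and> cd C (cmp C a b) = cd C a) \<and>
     (\<forall>a\<in>ar_set C. \<forall>b\<in>ar_set C. \<forall>c\<in>ar_set C. dm C a = cd C b \<and> dm C b = cd C c \<longrightarrow>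
        cmp C (cmp C a b) c = cmp C a (cmp C b c))"

definition etale_category :: "('o, 'm) tcat \<Rightarrow> bool" where
  "etale_category C \<longleftrightarrow> topological_category C \<and>
     local_homeomorphism (arrs C) (obs C) (dm C) \<and>
     local_homeomorphism (arrs C) (obs C) (cd C) \<and>
     open_map (obs C) (arrs C) (unt C) \<and>
     open_map (composables C) (arrs C) (\<lambda>(a, b). cmp C a b)"

definition cancellative :: "('o, 'm) tcat \<Rightarrow> bool" where
  "cancellative C \<longleftrightarrow>
     (\<forall>a\<in>ar_set C. \<forall>b\<in>ar_set C. \<forall>c\<in>ar_set C.
        (dm C a = cd C c \<and> dm C b = cd C c \<and> cmp C a c = cmp C b c \<longrightarrow> a = b) \<and>
        (cd C a = dm C c \<and> cd C b = dm C c \<and> cmp C c a = cmp C c b \<longrightarrow> a = b))"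

record ('o, 'm, 'p, 'n) rcm =
  on_ob :: "'o \<Rightarrow> 'p"
  on_ar :: "'m \<Rightarrow> 'n set"

definition relational_covering ::
  "('o, 'm) tcat \<Rightarrow> ('p, 'n) tcat \<Rightarrow> ('o, 'm, 'p, 'n) rcm \<Rightarrow> bool" where
  "relational_covering C D f \<longleftrightarrow>
     continuous_map (obs C) (obs D) (on_ob f) \<and>
     on_ar f \<in> ar_set C \<rightarrow> Pow (ar_set D) \<and>
     (\<forall>a\<in>ar_set C. \<forall>b\<in>on_ar f a. dm D b = on_ob f (dm C a) \<and> cd D b = on_ob f (cd C a)) \<and>
     (\<forall>(a, b)\<in>topspace (composables C). \<forall>(s, t)\<in>topspace (composables D).
        s \<in> on_ar f a \<and> t \<in> on_ar f b \<longrightarrow> cmp D s t \<in> on_ar f (cmp C a b)) \<and>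
     (\<forall>a\<in>ar_set C. \<forall>b\<in>ar_set C.
        (dm C a = dm C b \<or> cd C a = cd C b) \<and> on_ar f a \<inter> on_ar f b \<noteq> {} \<longrightarrow> a = b) \<and>
     (\<forall>q\<in>ob_set C. \<forall>s\<in>ar_set D.
        (dm D s = on_ob f q \<longrightarrow> (\<exists>t\<in>ar_set C. dm C t = q \<and> s \<in> on_ar f t)) \<and>
        (cd D s = on_ob f q \<longrightarrow> (\<exists>t\<in>ar_set C. cd C t = q \<and> s \<in> on_ar f t))) \<and>
     (\<forall>A. openin (arrs D) A \<longrightarrow> openin (arrs C) {x \<in> ar_set C. on_ar f x \<inter> A \<noteq> {}}) \<and>
     (\<forall>t\<in>ob_set C. unt D (on_ob f t) \<in> on_ar f (unt C t))"

text \<open>As usual for spectral spaces, morphisms are required to be coherent: inverse images of compact-open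
  sets are compact(-open).  Mere continuity does not give a duality: the map from an
  infinite discrete space to a point has no dual lattice morphism.\<close>

definition coherent :: "('o, 'm) tcat \<Rightarrow> ('p, 'n) tcat \<Rightarrow> ('o, 'm, 'p, 'n) rcm \<Rightarrow> bool" where
  "coherent C D f \<longleftrightarrow>
     (\<forall>K. openin (obs D) K \<and> compactin (obs D) K \<longrightarrow>
        compactin (obs C) {q \<in> ob_set C. on_ob f q \<in> K})"

definition rc_hom ::
  "nat \<Rightarrow> ('o, 'm) tcat \<Rightarrow> ('p, 'n) tcat \<Rightarrow> ('o, 'm, 'p, 'n) rcm set" where
  "rc_hom k C D = {f. on_ob f \<in> extensional (ob_set C) \<and> on_ar f \<in> extensional (ar_set C) \<and>
     relational_covering C D f \<and> coherent C D f \<and>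
     (k \<in> {2, 4} \<longrightarrow> (\<forall>c\<in>ar_set C. \<exists>s. s \<in> on_ar f c)) \<and>
     (k \<in> {3, 4} \<longrightarrow> (\<forall>c\<in>ar_set C. \<forall>s\<in>on_ar f c. \<forall>t\<in>on_ar f c. s = t))}"

definition rc_id :: "('o, 'm) tcat \<Rightarrow> ('o, 'm, 'o, 'm) rcm" where
  "rc_id C = \<lparr>on_ob = (\<lambda>q\<in>ob_set C. q), on_ar = (\<lambda>a\<in>ar_set C. {a})\<rparr>"

definition rc_comp :: "('o, 'm) tcat \<Rightarrow> ('p, 'n, 'r, 'l) rcm \<Rightarrow> ('o, 'm, 'p, 'n) rcm \<Rightarrow>
    ('o, 'm, 'r, 'l) rcm" where
  "rc_comp C g f = \<lparr>on_ob = compose (ob_set C) (on_ob g) (on_ob f),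
     on_ar = (\<lambda>a\<in>ar_set C. \<Union>b\<in>on_ar f a. on_ar g b)\<rparr>"

definition rc_iso ::
  "nat \<Rightarrow> ('o, 'm) tcat \<Rightarrow> ('p, 'n) tcat \<Rightarrow> ('o, 'm, 'p, 'n) rcm \<Rightarrow> bool" where
  "rc_iso k C D f \<longleftrightarrow> f \<in> rc_hom k C D \<and>
     (\<exists>g\<in>rc_hom k D C. rc_comp C g f = rc_id C \<and> rc_comp D f g = rc_id D)"


section \<open>The categories\<close>

record ('o, 'h) catgy =
  Obj :: "'o set"
  Hom :: "'o \<Rightarrow> 'o \<Rightarrow> 'h set"
  Idn :: "'o \<Rightarrow> 'h"
  Cmp :: "'o \<Rightarrow> 'o \<Rightarrow> 'o \<Rightarrow> 'h \<Rightarrow> 'h \<Rightarrow> 'h"  \<comment> \<open>\<open>Cmp X Y Z g f\<close> is \<open>g\<close> after \<open>f\<close> for \<open>f : X \<rightarrow> Y\<close>, \<open>g : Y \<rightarrow> Z\<close>\<close>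

definition category :: "('o, 'h) catgy \<Rightarrow> bool" where
  "category A \<longleftrightarrow>
     (\<forall>X\<in>Obj A. Idn A X \<in> Hom A X X) \<and>
     (\<forall>X\<in>Obj A. \<forall>Y\<in>Obj A. \<forall>Z\<in>Obj A. \<forall>f\<in>Hom A X Y. \<forall>g\<in>Hom A Y Z.
        Cmp A X Y Z g f \<in> Hom A X Z) \<and>
     (\<forall>X\<in>Obj A. \<forall>Y\<in>Obj A. \<forall>f\<in>Hom A X Y.
        Cmp A X X Y f (Idn A X) = f \<and> Cmp A X Y Y (Idn A Y) f = f) \<and>
     (\<forall>W\<in>Obj A. \<forall>X\<in>Obj A. \<forall>Y\<in>Obj A. \<forall>Z\<in>Obj A.
      \<forall>f\<in>Hom A W X. \<forall>g\<in>Hom A X Y. \<forall>h\<in>Hom A Y Z.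
        Cmp A W Y Z h (Cmp A W X Y g f) = Cmp A W X Z (Cmp A X Y Z h g) f)"

definition contravariant_functor ::
  "('o, 'h) catgy \<Rightarrow> ('p, 'l) catgy \<Rightarrow> ('o \<Rightarrow> 'p) \<Rightarrow> ('o \<Rightarrow> 'o \<Rightarrow> 'h \<Rightarrow> 'l) \<Rightarrow> bool" where
  "contravariant_functor A B F M \<longleftrightarrow>
     (\<forall>X\<in>Obj A. F X \<in> Obj B) \<and>
     (\<forall>X\<in>Obj A. \<forall>Y\<in>Obj A. \<forall>f\<in>Hom A X Y. M X Y f \<in> Hom B (F Y) (F X)) \<and>
     (\<forall>X\<in>Obj A. M X X (Idn A X) = Idn B (F X)) \<and>
     (\<forall>X\<in>Obj A. \<forall>Y\<in>Obj A. \<forall>Z\<in>Obj A. \<forall>f\<in>Hom A X Y. \<forall>g\<in>Hom A Y Z.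
        M X Z (Cmp A X Y Z g f) = Cmp B (F Z) (F Y) (F X) (M X Y f) (M Y Z g))"

datatype base = Distributive | Boolean

datatype variant = Semigroups | Meet_semigroups | Monoids | Meet_monoids

definition rs_objects :: "base \<Rightarrow> variant \<Rightarrow> 'a rsgp set" where
  "rs_objects b v = {S.
     (case b of Distributive \<Rightarrow> distributive_rsgp S | Boolean \<Rightarrow> boolean_rsgp S) \<and>
     (v \<in> {Meet_semigroups, Meet_monoids} \<longrightarrow> has_meets S) \<and>
     (v \<in> {Monoids, Meet_monoids} \<longrightarrow> has_identity S)}"

definition base_space :: "base \<Rightarrow> 'a topology \<Rightarrow> bool" where
  "base_space b X = (case b of Distributive \<Rightarrow> spectral_space X | Boolean \<Rightarrow> boolean_space X)"

text \<open>The meet variants correspond to the strongly spectral (Boolean) categories, the monoid variants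
  to the compact ones.\<close>

definition et_objects :: "base \<Rightarrow> variant \<Rightarrow> ('o, 'm) tcat set" where
  "et_objects b v = {C. etale_category C \<and>
     (if v \<in> {Meet_semigroups, Meet_monoids} then base_space b (arrs C) else base_space b (obs C)) \<and>
     (v \<in> {Monoids, Meet_monoids} \<longrightarrow> compact_space (obs C))}"

definition RSgp :: "base \<Rightarrow> variant \<Rightarrow> nat \<Rightarrow> ('a rsgp, 'a \<Rightarrow> 'a) catgy" where
  "RSgp b v k = \<lparr>Obj = rs_objects b v, Hom = rs_hom k, Idn = rs_id,
     Cmp = (\<lambda>X Y Z g f. rs_comp X g f)\<rparr>"

definition ETCat :: "base \<Rightarrow> variant \<Rightarrow> nat \<Rightarrow> (('o, 'm) tcat, ('o, 'm, 'o, 'm) rcm) catgy" where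
  "ETCat b v k = \<lparr>Obj = et_objects b v, Hom = rc_hom k, Idn = rc_id,
     Cmp = (\<lambda>X Y Z g f. rc_comp X g f)\<rparr>"


section \<open>The functors of the duality\<close>

definition prime_filter :: "'a gorder \<Rightarrow> 'a set \<Rightarrow> bool" where
  "prime_filter L A \<longleftrightarrow> A \<subset> carrier L \<and> A \<noteq> {} \<and>
     (\<forall>a\<in>A. \<forall>b\<in>carrier L. a \<sqsubseteq>\<^bsub>L\<^esub> b \<longrightarrow> b \<in> A) \<and>
     (\<forall>a\<in>A. \<forall>b\<in>A. \<exists>c\<in>A. c \<sqsubseteq>\<^bsub>L\<^esub> a \<and> c \<sqsubseteq>\<^bsub>L\<^esub> b) \<and>
     (\<forall>a\<in>carrier L. \<forall>b\<in>carrier L. \<forall>x\<in>A. is_lub L x {a, b} \<longrightarrow> a \<in> A \<or> b \<in> A)"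

text \<open>The spectrum: objects are the prime filters of the lattice of projections, arrows the prime
  filters of the semigroup with respect to the natural partial order (equivalently, the germs of its
  elements at the prime filters of projections).\<close>

definition obs_of :: "'a rsgp \<Rightarrow> 'a set set" where
  "obs_of S = {F. prime_filter (proj_ord S) F}"

definition arrs_of :: "'a rsgp \<Rightarrow> 'a set set" where
  "arrs_of S = {A. prime_filter (nat_ord S) A}"

definition dom_of :: "'a rsgp \<Rightarrow> 'a set \<Rightarrow> 'a set" where
  "dom_of S A = {e \<in> projs S. \<exists>a\<in>A. lam S a \<sqsubseteq>\<^bsub>nat_ord S\<^esub> e}"

definition cod_of :: "'a rsgp \<Rightarrow> 'a set \<Rightarrow> 'a set" where
  "cod_of S A = {e \<in> projs S. \<exists>a\<in>A. rho S a \<sqsubseteq>\<^bsub>nat_ord S\<^esub> e}"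

definition Spec :: "'a rsgp \<Rightarrow> ('a set, 'a set) tcat" where
  "Spec S = \<lparr>
     obs = topology_generated_by ((\<lambda>e. {F \<in> obs_of S. e \<in> F}) ` projs S),
     arrs = topology_generated_by ((\<lambda>s. {A \<in> arrs_of S. s \<in> A}) ` carrier S),
     unt = (\<lambda>F. {s \<in> carrier S. \<exists>e\<in>F. e \<sqsubseteq>\<^bsub>nat_ord S\<^esub> s}),
     dm = dom_of S,
     cd = cod_of S,
     cmp = (\<lambda>A B. {s \<in> carrier S. \<exists>a\<in>A. \<exists>b\<in>B. (a \<cdot>\<^bsub>S\<^esub> b) \<sqsubseteq>\<^bsub>nat_ord S\<^esub> s})\<rparr>"

definition Spec_mor :: "'a rsgp \<Rightarrow> 'b rsgp \<Rightarrow> ('a \<Rightarrow> 'b) \<Rightarrow> ('b set, 'b set, 'a set, 'a set) rcm" where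
  "Spec_mor S T f = \<lparr>
     on_ob = (\<lambda>F\<in>obs_of T. {e \<in> projs S. f e \<in> F}),
     on_ar = (\<lambda>A\<in>arrs_of T. {B \<in> arrs_of S. f ` B \<subseteq> A \<and> dom_of S B = {e \<in> projs S. f e \<in> dom_of T A}})\<rparr>"

text \<open>The semigroup of compact-open slices (bisections), with setwise multiplication.\<close>

definition compact_slices :: "('o, 'm) tcat \<Rightarrow> 'm set set" where
  "compact_slices C = {A. openin (arrs C) A \<and> compactin (arrs C) A \<and>
     inj_on (dm C) A \<and> inj_on (cd C) A}"

definition Slices :: "('o, 'm) tcat \<Rightarrow> 'm set rsgp" where
  "Slices C = \<lparr>
     carrier = compact_slices C,
     tms = (\<lambda>A B. {cmp C a b | a b. a \<in> A \<and> b \<in> B \<and> dm C a = cd C b}),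
     projs = {A \<in> compact_slices C. A \<subseteq> unt C ` ob_set C},
     lam = (\<lambda>A. unt C ` dm C ` A),
     rho = (\<lambda>A. unt C ` cd C ` A)\<rparr>"

definition Slices_mor ::
  "('o, 'm) tcat \<Rightarrow> ('p, 'n) tcat \<Rightarrow> ('o, 'm, 'p, 'n) rcm \<Rightarrow> 'n set \<Rightarrow> 'm set" where
  "Slices_mor C D f = (\<lambda>A\<in>compact_slices D. {x \<in> ar_set C. on_ar f x \<inter> A \<noteq> {}})"

text \<open>The components of the natural isomorphisms.  They pass from a type to an iterated power type, so
  their naturality cannot be stated inside one of the categories above (which, for
  each choice of the type variables, collect the structures carried by these types).\<close>

definition rs_unit :: "'a rsgp \<Rightarrow> 'a \<Rightarrow> 'a set set" where
  "rs_unit S = (\<lambda>s\<in>carrier S. {A \<in> arrs_of S. s \<in> A})"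

definition et_unit :: "('o, 'm) tcat \<Rightarrow> ('o, 'm, 'm set set, 'm set set) rcm" where
  "et_unit C = \<lparr>
     on_ob = (\<lambda>q\<in>ob_set C. {A \<in> projs (Slices C). unt C q \<in> A}),
     on_ar = (\<lambda>x\<in>ar_set C. {{A \<in> compact_slices C. x \<in> A}})\<rparr>"

end

theory Submission
  imports Defs
begin

text \<open>
  Why the duality holds.  In a restriction semigroup an element below \<open>a\<close> is \<open>a \<cdot> e\<close> for a unique
  projection \<open>e\<close> below the domain \<open>lam S a\<close>, so the order of the semigroup is locally the order of
  its projections.  Consequently a prime filter of the semigroup is a germ: it is determined by one of
  its elements together with the prime filter of projections that is its domain, and every pair of
  an element \<open>a\<close> and a prime filter of projections containing \<open>lam S a\<close> arises (\<open>germ_arr\<close>, \<open>arr_eq_germ\<close>).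
  Therefore the domain map from prime filters of the semigroup to prime filters of projections is a
  local homeomorphism; the codomain map is one by passing to the opposite semigroup.  Products of germs are
  well defined, and this is the etale category \<open>Spec S\<close> (\<open>etale_Spec\<close>).  Its space of objects is the Stone
  space of a distributive lattice.

  No information is lost.  By the prime filter theorem the set \<open>ar_basic S s\<close> of prime filters through \<open>s\<close> is
  compact and \<open>s \<mapsto> ar_basic S s\<close> is an order embedding.  A compact slice of \<open>Spec S\<close> is a
  finite union of such sets; lying in a slice makes the corresponding elements compatible, so that they
  have a join, and the slice is the basic set of that join (\<open>compact_slices_Spec\<close>).  Thus \<open>S\<close> is the semigroup of compact
  slices of its spectrum.  Conversely, let \<open>C\<close> be an etale category with a spectral space of objects.  Its compact
  slices form a base of the topology, are ordered by inclusion, and those consisting of units are the compact-open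
  sets of objects.  Sobriety turns a prime filter of compact-open sets into a point (\<open>obs_of_Slices\<close>).
  A prime filter of slices is a germ, hence it consists of all slices through one arrow (\<open>arrs_of_Slices\<close>).

  Morphisms.  For a morphism \<open>f\<close> from \<open>S\<close> to \<open>T\<close> a prime filter \<open>B\<close> of \<open>S\<close> is related to a prime filter \<open>A\<close> of \<open>T\<close>
  if \<open>f\<close> maps \<open>B\<close> into \<open>A\<close> and the domain of \<open>B\<close> is the inverse image of the domain of \<open>A\<close>.  Such a \<open>B\<close> is a germ of each of
  its elements, and it exists for every \<open>s\<close> with \<open>f s \<in> A\<close> (\<open>covers_germ\<close>).  So at least one \<open>B\<close> is
  related to every \<open>A\<close> iff \<open>f\<close> is proper, by compactness (\<open>proper_iff\<close>), and at most one is if \<open>f\<close> is weakly meet-preserving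
  (\<open>covers_unique\<close>).  In the other direction a relational covering sends a slice to the set of arrows that are
  related to one of its elements.  The lifting conditions make this set a slice over the inverse image of the
  domains of the given slice, compact because morphisms are coherent, and make the operation multiplicative (\<open>dm_pre\<close>, \<open>pre_tms\<close>).

  The variants.  Meets of elements correspond to intersections of slices, so the space of arrows has a base of
  compact-open sets closed under intersection iff meets exist; an identity is a
  greatest projection, which means a compact space of objects; relative complements of projections separate prime
  filters.  Cancellation of arrows and of germs of slices are the same thing locally, which relates ample
  semigroups and cancellative categories.
\<close>
section \<open>Order and duality in restriction semigroups\<close>

lemma carrier_nat_ord: "carrier (nat_ord S) = carrier S"
  by (simp add: nat_ord_def)

context restriction_semigroup
begin

abbreviation nat_le (infix "\<preceq>" 50) where
  "a \<preceq> b \<equiv> a \<sqsubseteq>\<^bsub>nat_ord S\<^esub> b"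

lemma proj_carrier: "e \<in> projs S \<Longrightarrow> e \<in> carrier S"
  using projs_subset by blast

lemma lam_carrier: "a \<in> carrier S \<Longrightarrow> lam S a \<in> carrier S"
  and rho_carrier: "a \<in> carrier S \<Longrightarrow> rho S a \<in> carrier S"
  using lam_closed rho_closed proj_carrier by blast+

lemmas closed = tms_closed projs_closed lam_closed rho_closed proj_carrier lam_carrier rho_carrier

lemma lam_tms_proj: "\<lbrakk>a \<in> carrier S; e \<in> projs S\<rbrakk> \<Longrightarrow> lam S (a \<cdot> e) = lam S a \<cdot> e"
  by (metis lam_closed lam_proj lam_tms proj_carrier projs_closed)

lemma rho_proj_tms: "\<lbrakk>a \<in> carrier S; e \<in> projs S\<rbrakk> \<Longrightarrow> rho S (e \<cdot> a) = e \<cdot> rho S a"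
  by (metis rho_closed rho_proj rho_rho proj_carrier projs_closed)

lemma nat_le_unfold: "a \<preceq> b \<longleftrightarrow> (\<exists>g\<in>projs S. \<exists>f\<in>projs S. a = g \<cdot> b \<and> a = b \<cdot> f)"
  by (simp add: nat_ord_def)

text \<open>Of the two witnesses of the natural order one can be taken to be the domain of the smaller element, and then
  the restriction axioms supply the other one.  This makes the order equational.\<close>

lemma nat_le_lam: "\<lbrakk>a \<in> carrier S; b \<in> carrier S\<rbrakk> \<Longrightarrow> a \<preceq> b \<longleftrightarrow> a = b \<cdot> lam S a"
  unfolding nat_le_unfold
  by (metis lam_closed lam_tms_proj tms_assoc tms_lam proj_carrier rho_closed tms_proj)

lemma nat_le_rho: "\<lbrakk>a \<in> carrier S; b \<in> carrier S\<rbrakk> \<Longrightarrow> a \<preceq> b \<longleftrightarrow> a = rho S a \<cdot> b"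
  unfolding nat_le_unfold
  by (metis rho_closed rho_proj_tms tms_assoc rho_tms proj_carrier lam_closed proj_tms)

lemma nat_leI_right: "\<lbrakk>b \<in> carrier S; e \<in> projs S; a = b \<cdot> e\<rbrakk> \<Longrightarrow> a \<preceq> b"
  unfolding nat_le_unfold using tms_proj rho_closed tms_closed proj_carrier by metis

lemma nat_leI_left: "\<lbrakk>b \<in> carrier S; e \<in> projs S; a = e \<cdot> b\<rbrakk> \<Longrightarrow> a \<preceq> b"
  unfolding nat_le_unfold using proj_tms lam_closed tms_closed proj_carrier by metis

lemma nat_le_refl: "a \<in> carrier S \<Longrightarrow> a \<preceq> a"
  by (simp add: nat_le_lam tms_lam)

lemma nat_le_trans: "\<lbrakk>a \<preceq> b; b \<preceq> c; c \<in> carrier S\<rbrakk> \<Longrightarrow> a \<preceq> c"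
  unfolding nat_le_unfold by (metis proj_carrier projs_closed tms_assoc)

lemma nat_le_antisym:
  assumes "a \<preceq> b" "b \<preceq> a" "a \<in> carrier S" "b \<in> carrier S" shows "a = b"
proof -
  have 1: "a = b \<cdot> lam S a" "b = a \<cdot> lam S b" using assms nat_le_lam by auto
  have 2: "lam S a = lam S b \<cdot> lam S a" using 1 lam_tms_proj[of b "lam S a"] assms lam_closed by metis
  have 3: "lam S b = lam S a \<cdot> lam S b" using 1 lam_tms_proj[of a "lam S b"] assms lam_closed by metis
  have "lam S a = lam S b" using 2 3 projs_comm lam_closed assms by metis
  then show ?thesis using 1 assms tms_lam by metis
qed

lemma nat_le_carrier: "\<lbrakk>a \<preceq> b; b \<in> carrier S\<rbrakk> \<Longrightarrow> a \<in> carrier S"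
  unfolding nat_le_unfold using proj_carrier tms_closed by auto

lemma nat_le_proj: "\<lbrakk>e \<in> projs S; f \<in> projs S\<rbrakk> \<Longrightarrow> e \<preceq> f \<longleftrightarrow> e \<cdot> f = e"
  by (metis lam_proj nat_le_lam proj_carrier projs_comm)

lemma nat_le_tms_right:
  assumes "a \<preceq> b" "b \<in> carrier S" "c \<in> carrier S" shows "a \<cdot> c \<preceq> b \<cdot> c"
  using assms unfolding nat_le_unfold[of a b]
  by (metis nat_leI_left proj_carrier tms_assoc tms_closed)

lemma nat_le_tms_left:
  assumes "a \<preceq> b" "b \<in> carrier S" "c \<in> carrier S" shows "c \<cdot> a \<preceq> c \<cdot> b"
  using assms unfolding nat_le_unfold[of a b]
  by (metis nat_leI_right proj_carrier tms_assoc tms_closed)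

lemma nat_le_tms:
  assumes "a \<preceq> b" "c \<preceq> d" "b \<in> carrier S" "d \<in> carrier S" shows "a \<cdot> c \<preceq> b \<cdot> d"
  by (meson assms nat_le_carrier nat_le_tms_left nat_le_tms_right nat_le_trans tms_closed)

lemma nat_le_lam_mono:
  assumes "a \<preceq> b" "b \<in> carrier S" shows "lam S a \<preceq> lam S b"
  using assms lam_tms_proj[of b] nat_le_unfold[of a b] nat_leI_right[of "lam S b"] lam_closed proj_carrier
  by metis

lemma nat_le_rho_mono:
  assumes "a \<preceq> b" "b \<in> carrier S" shows "rho S a \<preceq> rho S b"
  using assms rho_proj_tms[of b] nat_le_unfold[of a b] nat_leI_left[of "rho S b"] rho_closed proj_carrier
  by metis

lemma lam_tms_le: "\<lbrakk>a \<in> carrier S; b \<in> carrier S\<rbrakk> \<Longrightarrow> lam S (a \<cdot> b) \<preceq> lam S b"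
  by (metis lam_tms lam_closed nat_leI_left nat_le_lam_mono tms_closed)

text \<open>Inside an upper bound \<open>c\<close> both sides of each compatibility equation are the restriction of \<open>c\<close> to
  the product of the two projections involved.\<close>

lemma compatible_bounded:
  assumes "a \<preceq> c" "b \<preceq> c" "c \<in> carrier S" shows "compatible S a b"
proof -
  have c: "a \<in> carrier S" "b \<in> carrier S" using assms nat_le_carrier by auto
  have "a \<cdot> lam S b = c \<cdot> (lam S a \<cdot> lam S b)" "b \<cdot> lam S a = c \<cdot> (lam S b \<cdot> lam S a)"
    using assms c nat_le_lam[of a c] nat_le_lam[of b c] tms_assoc closed by metis+
  moreover have "rho S b \<cdot> a = rho S b \<cdot> rho S a \<cdot> c" "rho S a \<cdot> b = rho S a \<cdot> rho S b \<cdot> c"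
    using assms c nat_le_rho[of a c] nat_le_rho[of b c] tms_assoc closed by metis+
  ultimately show ?thesis unfolding compatible_def using projs_comm closed c by metis
qed

lemma is_lub_nat_ord:
  "A \<subseteq> carrier S \<Longrightarrow> is_lub (nat_ord S) x A \<longleftrightarrow>
     x \<in> carrier S \<and> (\<forall>a\<in>A. a \<preceq> x) \<and> (\<forall>y\<in>carrier S. (\<forall>a\<in>A. a \<preceq> y) \<longrightarrow> x \<preceq> y)"
  unfolding least_def Upper_def carrier_nat_ord
  by (intro iffI conjI ballI impI subsetI; (elim conjE)?; simp?; blast)

lemma partial_order_nat_ord: "partial_order (nat_ord S)"
proof -
  have [simp]: "carrier (nat_ord S) = carrier S" "eq (nat_ord S) = (=)" by (auto simp: nat_ord_def)
  show ?thesis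
    by unfold_locales (auto intro: nat_le_refl nat_le_antisym nat_le_trans)
qed

end

text \<open>Left-right duality: a statement about domains, proved for all semigroups, gives the one about codomains.\<close>

definition opp :: "'a rsgp \<Rightarrow> 'a rsgp" where
  "opp S = \<lparr>carrier = carrier S, tms = (\<lambda>a b. b \<cdot>\<^bsub>S\<^esub> a), projs = projs S, lam = rho S, rho = lam S\<rparr>"

lemma opp_simps [simp]:
  "carrier (opp S) = carrier S" "a \<cdot>\<^bsub>opp S\<^esub> b = b \<cdot>\<^bsub>S\<^esub> a" "projs (opp S) = projs S"
  "lam (opp S) = rho S" "rho (opp S) = lam S" "opp (opp S) = S"
  by (simp_all add: opp_def)

lemma nat_ord_opp [simp]: "nat_ord (opp S) = nat_ord S"
  unfolding nat_ord_def by (auto intro!: ext)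

lemma proj_ord_opp [simp]: "proj_ord (opp S) = proj_ord S"
  by (simp add: proj_ord_def)

lemma prime_filters_opp [simp]:
  "obs_of (opp S) = obs_of S" "arrs_of (opp S) = arrs_of S"
  "dom_of (opp S) = cod_of S" "cod_of (opp S) = dom_of S"
  by (auto simp: obs_of_def arrs_of_def dom_of_def cod_of_def fun_eq_iff)

lemma compatible_opp [simp]: "compatible (opp S) a b \<longleftrightarrow> compatible S a b"
  by (auto simp: compatible_def)

lemma restriction_semigroup_opp:
  assumes "restriction_semigroup S" shows "restriction_semigroup (opp S)"
proof -
  interpret restriction_semigroup S by fact
  show ?thesis
    by unfold_locales
      (use projs_nonempty in \<open>auto simp: tms_closed tms_assoc proj_carrier projs_idem projs_closed lam_closed rho_closed
        lam_proj rho_proj tms_lam rho_tms lam_tms rho_rho projs_comm intro: proj_tms tms_proj\<close>)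
qed

lemma distributive_rsgp_opp: "distributive_rsgp S \<Longrightarrow> distributive_rsgp (opp S)"
  unfolding distributive_rsgp_def by (auto simp: restriction_semigroup_opp)

section \<open>Distributive restriction semigroups\<close>

text \<open>Distributive restriction semigroups.  The axioms of restriction semigroups are inherited, so that the facts proved above
  are available.\<close>

locale drs = restriction_semigroup +
  assumes distributive: "distributive_rsgp S"

lemma drs_iff: "drs S \<longleftrightarrow> distributive_rsgp S"
  unfolding drs_def drs_axioms_def distributive_rsgp_def by auto

context drs
begin

lemma drs_opp: "drs (opp S)"
  using distributive by (simp add: drs_iff distributive_rsgp_opp)

abbreviation zero ("\<zero>") where "\<zero> \<equiv> \<bottom>\<^bsub>proj_ord S\<^esub>"
abbreviation pjoin (infixl "\<oplus>" 65) where "e \<oplus> f \<equiv> e \<squnion>\<^bsub>proj_ord S\<^esub> f"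

lemma proj_ord_simps: "carrier (proj_ord S) = projs S" "le (proj_ord S) = le (nat_ord S)"
  by (auto simp: proj_ord_def nat_ord_def)

lemma lattice_projs: "Lattice.lattice (proj_ord S)" "weak_partial_order_bottom (proj_ord S)"
  and proj_distrib': "\<And>x y z. \<lbrakk>x \<in> projs S; y \<in> projs S; z \<in> projs S\<rbrakk> \<Longrightarrow>
        x \<sqinter>\<^bsub>proj_ord S\<^esub> (y \<oplus> z) = (x \<sqinter>\<^bsub>proj_ord S\<^esub> y) \<oplus> (x \<sqinter>\<^bsub>proj_ord S\<^esub> z)"
  using distributive unfolding distributive_rsgp_def distributive_lattice_bot_def
  by (auto simp: proj_ord_simps)

lemma zero_proj: "\<zero> \<in> projs S"
  using weak_partial_order_bottom.bottom_closed[OF lattice_projs(2)] by (simp add: proj_ord_simps)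

lemma zero_tms: "a \<in> carrier S \<Longrightarrow> \<zero> \<cdot> a = \<zero>" and tms_zero: "a \<in> carrier S \<Longrightarrow> a \<cdot> \<zero> = \<zero>"
  using distributive unfolding distributive_rsgp_def by auto

lemma zero_carrier: "\<zero> \<in> carrier S" using zero_proj proj_carrier by blast

lemma zero_le: "a \<in> carrier S \<Longrightarrow> \<zero> \<preceq> a"
  by (metis nat_leI_left zero_proj zero_tms)

lemma le_zero: "a \<preceq> \<zero> \<Longrightarrow> a = \<zero>"
  using nat_le_antisym zero_le zero_carrier nat_le_carrier by metis

lemma meet_proj: assumes "e \<in> projs S" "f \<in> projs S" shows "e \<sqinter>\<^bsub>proj_ord S\<^esub> f = e \<cdot> f"
proof -
  interpret L: Lattice.lattice "proj_ord S" by (rule lattice_projs)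
  note c = assms projs_closed[OF assms]
  show ?thesis
  proof (rule L.le_antisym)
    show "e \<sqinter>\<^bsub>proj_ord S\<^esub> f \<sqsubseteq>\<^bsub>proj_ord S\<^esub> e \<cdot> f"
    proof -
      let ?m = "e \<sqinter>\<^bsub>proj_ord S\<^esub> f"
      have m: "?m \<in> projs S" using L.meet_closed assms by (simp add: proj_ord_simps)
      have "?m \<preceq> e" "?m \<preceq> f" using L.meet_left L.meet_right assms by (auto simp: proj_ord_simps)
      then show ?thesis using m c by (simp add: proj_ord_simps nat_le_proj)
          (metis tms_assoc proj_carrier)
    qed
    show "e \<cdot> f \<sqsubseteq>\<^bsub>proj_ord S\<^esub> e \<sqinter>\<^bsub>proj_ord S\<^esub> f"
      by (rule L.meet_le) (use c in \<open>auto simp: proj_ord_simps intro: nat_leI_right nat_leI_left proj_carrier\<close>)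
  qed (use c L.meet_closed in \<open>auto simp: proj_ord_simps\<close>)
qed

lemma pjoin_closed: "\<lbrakk>e \<in> projs S; f \<in> projs S\<rbrakk> \<Longrightarrow> e \<oplus> f \<in> projs S"
  and pjoin_left: "\<lbrakk>e \<in> projs S; f \<in> projs S\<rbrakk> \<Longrightarrow> e \<preceq> e \<oplus> f"
  and pjoin_right: "\<lbrakk>e \<in> projs S; f \<in> projs S\<rbrakk> \<Longrightarrow> f \<preceq> e \<oplus> f"
  and pjoin_least: "\<lbrakk>e \<in> projs S; f \<in> projs S; g \<in> projs S; e \<preceq> g; f \<preceq> g\<rbrakk> \<Longrightarrow> e \<oplus> f \<preceq> g"
proof -
  interpret L: Lattice.lattice "proj_ord S" by (rule lattice_projs)
  show "\<lbrakk>e \<in> projs S; f \<in> projs S\<rbrakk> \<Longrightarrow> e \<oplus> f \<in> projs S"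
    "\<lbrakk>e \<in> projs S; f \<in> projs S\<rbrakk> \<Longrightarrow> e \<preceq> e \<oplus> f"
    "\<lbrakk>e \<in> projs S; f \<in> projs S\<rbrakk> \<Longrightarrow> f \<preceq> e \<oplus> f"
    "\<lbrakk>e \<in> projs S; f \<in> projs S; g \<in> projs S; e \<preceq> g; f \<preceq> g\<rbrakk> \<Longrightarrow> e \<oplus> f \<preceq> g"
    using L.join_closed L.join_left L.join_right L.join_le by (simp_all add: proj_ord_simps)
qed

lemma proj_distrib: "\<lbrakk>x \<in> projs S; y \<in> projs S; z \<in> projs S\<rbrakk> \<Longrightarrow> x \<cdot> (y \<oplus> z) = x \<cdot> y \<oplus> x \<cdot> z"
  using proj_distrib'[of x y z] by (simp add: meet_proj pjoin_closed)

lemma compatible_lub_ex: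
  "\<lbrakk>A \<subseteq> carrier S; finite A; A \<noteq> {}; \<And>a b. \<lbrakk>a \<in> A; b \<in> A\<rbrakk> \<Longrightarrow> compatible S a b\<rbrakk> \<Longrightarrow>
     \<exists>x. is_lub (nat_ord S) x A"
  using distributive unfolding distributive_rsgp_def by blast

lemma lub2_iff: "\<lbrakk>a \<in> carrier S; b \<in> carrier S\<rbrakk> \<Longrightarrow> is_lub (nat_ord S) x {a, b} \<longleftrightarrow>
    x \<in> carrier S \<and> a \<preceq> x \<and> b \<preceq> x \<and> (\<forall>y\<in>carrier S. a \<preceq> y \<longrightarrow> b \<preceq> y \<longrightarrow> x \<preceq> y)"
  by (subst is_lub_nat_ord) auto

lemma bounded_lub_ex:
  assumes "A \<subseteq> carrier S" "finite A" "A \<noteq> {}" "c \<in> carrier S" "\<And>a. a \<in> A \<Longrightarrow> a \<preceq> c"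
  shows "\<exists>x. is_lub (nat_ord S) x A"
  using compatible_lub_ex compatible_bounded assms by metis

text \<open>Restricting the join to the join of the two domains still gives an upper bound, so the join has no larger domain.\<close>

lemma lub_lam:
  assumes a: "a \<in> carrier S" "b \<in> carrier S" and x: "is_lub (nat_ord S) x {a, b}"
  shows "lam S x = lam S a \<oplus> lam S b"
proof -
  note x = x[unfolded lub2_iff[OF a]]
  let ?e = "lam S a \<oplus> lam S b"
  have e: "?e \<in> projs S" using a by (simp add: pjoin_closed lam_closed)
  have xe: "x \<cdot> ?e \<in> carrier S" "x \<in> carrier S" using x e closed by auto
  have *: "y \<preceq> x \<cdot> ?e" if y: "y \<in> carrier S" "y \<preceq> x" "lam S y \<preceq> ?e" for y
  proof -
    have "y = x \<cdot> lam S y" using y xe nat_le_lam by auto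
    also have "lam S y = ?e \<cdot> lam S y" using y e nat_le_proj projs_comm closed by metis
    finally show ?thesis using xe y e closed nat_leI_right tms_assoc by metis
  qed
  have "a \<preceq> x \<cdot> ?e" "b \<preceq> x \<cdot> ?e" using * x a by (auto simp: pjoin_left pjoin_right lam_closed)
  then have "x \<preceq> x \<cdot> ?e" using x xe by auto
  then have "lam S x \<preceq> lam S x \<cdot> ?e" using nat_le_lam_mono xe lam_tms_proj e by metis
  moreover have "lam S x \<cdot> ?e \<preceq> ?e" using nat_leI_left xe e closed by metis
  ultimately have "lam S x \<preceq> ?e" using nat_le_trans e proj_carrier by blast
  moreover have "?e \<preceq> lam S x" using pjoin_least nat_le_lam_mono x a xe lam_closed by auto
  ultimately show ?thesis using nat_le_antisym xe e closed by metis
qed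

lemma le_eq_lam: "\<lbrakk>a \<preceq> b; b \<in> carrier S; lam S a = lam S b\<rbrakk> \<Longrightarrow> a = b"
  by (metis nat_le_carrier nat_le_lam tms_lam)

text \<open>Multiplication distributes over joins of projections: the join of \<open>t \<cdot> e\<close> and \<open>t \<cdot> f\<close> lies below
  \<open>t \<cdot> (e \<oplus> f)\<close>, and by distributivity of the lattice of projections both have the same domain.\<close>

lemma lub_tms_pjoin:
  assumes t: "t \<in> carrier S" and e: "e \<in> projs S" "f \<in> projs S"
  shows "is_lub (nat_ord S) (t \<cdot> (e \<oplus> f)) {t \<cdot> e, t \<cdot> f}"
proof -
  have c: "t \<cdot> e \<in> carrier S" "t \<cdot> f \<in> carrier S" "e \<oplus> f \<in> projs S" "t \<cdot> (e \<oplus> f) \<in> carrier S"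
    using t e closed pjoin_closed by auto
  have le: "t \<cdot> e \<preceq> t \<cdot> (e \<oplus> f)" "t \<cdot> f \<preceq> t \<cdot> (e \<oplus> f)"
    using nat_le_tms_left pjoin_left pjoin_right t e c proj_carrier by auto
  obtain x where x: "is_lub (nat_ord S) x {t \<cdot> e, t \<cdot> f}"
    using bounded_lub_ex[of "{t \<cdot> e, t \<cdot> f}" "t \<cdot> (e \<oplus> f)"] c le by auto
  have "lam S x = lam S (t \<cdot> (e \<oplus> f))"
    using lub_lam[OF c(1,2) x] t e c by (simp add: lam_tms_proj proj_distrib lam_closed)
  moreover have "x \<preceq> t \<cdot> (e \<oplus> f)" using x[unfolded lub2_iff[OF c(1,2)]] le c by auto
  ultimately show ?thesis using x le_eq_lam c by metis
qed

end
section \<open>Prime filters as germs\<close>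

text \<open>Plays the role of the germ of a section at a point: the part of \<open>a\<close> near the prime filter \<open>F\<close> of projections, which is
  to contain \<open>lam S a\<close>.\<close>

definition germ :: "'a rsgp \<Rightarrow> 'a \<Rightarrow> 'a set \<Rightarrow> 'a set" where
  "germ S a F = {b \<in> carrier S. \<exists>e\<in>F. a \<cdot>\<^bsub>S\<^esub> e \<sqsubseteq>\<^bsub>nat_ord S\<^esub> b}"

definition unit_of :: "'a rsgp \<Rightarrow> 'a set \<Rightarrow> 'a set" where
  "unit_of S F = {s \<in> carrier S. \<exists>e\<in>F. e \<sqsubseteq>\<^bsub>nat_ord S\<^esub> s}"

definition comp_of :: "'a rsgp \<Rightarrow> 'a set \<Rightarrow> 'a set \<Rightarrow> 'a set" where
  "comp_of S A B = {s \<in> carrier S. \<exists>a\<in>A. \<exists>b\<in>B. (a \<cdot>\<^bsub>S\<^esub> b) \<sqsubseteq>\<^bsub>nat_ord S\<^esub> s}"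

definition ob_basic :: "'a rsgp \<Rightarrow> 'a \<Rightarrow> 'a set set" where
  "ob_basic S e = {F \<in> obs_of S. e \<in> F}"

definition ar_basic :: "'a rsgp \<Rightarrow> 'a \<Rightarrow> 'a set set" where
  "ar_basic S s = {A \<in> arrs_of S. s \<in> A}"

lemma unit_of_opp [simp]: "unit_of (opp S) = unit_of S"
  by (auto simp: unit_of_def fun_eq_iff)

lemma comp_of_opp [simp]: "comp_of (opp S) A B = comp_of S B A"
  by (auto simp: comp_of_def)

context drs
begin

text \<open>For projections meets are products and joins of two elements exist, so the filter conditions become algebraic;
  properness means that the zero is missing.\<close>

lemma obs_of_iff: "F \<in> obs_of S \<longleftrightarrow>
    F \<subseteq> projs S \<and> F \<noteq> {} \<and> \<zero> \<notin> F \<and> (\<forall>e\<in>F. \<forall>f\<in>projs S. e \<preceq> f \<longrightarrow> f \<in> F) \<and>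
    (\<forall>e\<in>F. \<forall>f\<in>F. e \<cdot> f \<in> F) \<and> (\<forall>e\<in>projs S. \<forall>f\<in>projs S. e \<oplus> f \<in> F \<longrightarrow> e \<in> F \<or> f \<in> F)"
  (is "_ \<longleftrightarrow> ?R")
proof -
  have lub: "is_lub (proj_ord S) x {e, f} \<longleftrightarrow> x = e \<oplus> f" if "e \<in> projs S" "f \<in> projs S" for x e f
  proof -
    have "is_lub (proj_ord S) x {e, f} \<longleftrightarrow> x \<in> projs S \<and> e \<preceq> x \<and> f \<preceq> x \<and>
        (\<forall>y\<in>projs S. e \<preceq> y \<longrightarrow> f \<preceq> y \<longrightarrow> x \<preceq> y)"
      using that unfolding least_def Upper_def proj_ord_simps by auto
    then show ?thesis using that pjoin_closed pjoin_left pjoin_right pjoin_least nat_le_antisym proj_carrier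
      by metis
  qed
  have U: "F \<in> obs_of S \<longleftrightarrow> F \<subset> projs S \<and> F \<noteq> {} \<and> (\<forall>e\<in>F. \<forall>f\<in>projs S. e \<preceq> f \<longrightarrow> f \<in> F) \<and>
    (\<forall>a\<in>F. \<forall>b\<in>F. \<exists>c\<in>F. c \<preceq> a \<and> c \<preceq> b) \<and>
    (\<forall>a\<in>projs S. \<forall>b\<in>projs S. a \<oplus> b \<in> F \<longrightarrow> a \<in> F \<or> b \<in> F)"
  proof -
    have *: "(\<forall>a\<in>projs S. \<forall>b\<in>projs S. \<forall>x\<in>F. is_lub (proj_ord S) x {a, b} \<longrightarrow> a \<in> F \<or> b \<in> F)
        \<longleftrightarrow> (\<forall>a\<in>projs S. \<forall>b\<in>projs S. a \<oplus> b \<in> F \<longrightarrow> a \<in> F \<or> b \<in> F)"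
      by (intro ball_cong refl) (auto simp: lub)
    show ?thesis unfolding obs_of_def prime_filter_def proj_ord_simps mem_Collect_eq * by (rule refl)
  qed
  show ?thesis
  proof
    assume L: "F \<in> obs_of S"
    note L = L[unfolded U]
    have "\<zero> \<notin> F"
    proof
      assume "\<zero> \<in> F"
      then have "projs S \<subseteq> F" using L zero_le proj_carrier by blast
      then show False using L by blast
    qed
    moreover have "e \<cdot> f \<in> F" if ef: "e \<in> F" "f \<in> F" for e f
    proof -
      obtain c where c: "c \<in> F" "c \<preceq> e" "c \<preceq> f" using L ef by blast
      have p: "c \<in> projs S" "e \<in> projs S" "f \<in> projs S" using L ef c by blast+
      have "c \<cdot> (e \<cdot> f) = c" using c p nat_le_proj tms_assoc proj_carrier by metis
      then have "c \<preceq> e \<cdot> f" using p nat_le_proj projs_closed by auto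
      then show ?thesis using L c p projs_closed by blast
    qed
    ultimately show ?R using L by (simp add: psubset_eq)
  next
    assume R: ?R
    have "\<exists>c\<in>F. c \<preceq> a \<and> c \<preceq> b" if "a \<in> F" "b \<in> F" for a b
    proof -
      have "a \<cdot> b \<in> F" "a \<in> projs S" "b \<in> projs S" using R that by blast+
      then show ?thesis by (metis nat_leI_right nat_leI_left proj_carrier)
    qed
    then show "F \<in> obs_of S" unfolding U using R zero_proj by blast
  qed
qed

lemma obs_ofD:
  assumes "F \<in> obs_of S"
  shows "F \<subseteq> projs S" "F \<noteq> {}" "\<zero> \<notin> F" "\<And>e f. \<lbrakk>e \<in> F; f \<in> projs S; e \<preceq> f\<rbrakk> \<Longrightarrow> f \<in> F"
    "\<And>e f. \<lbrakk>e \<in> F; f \<in> F\<rbrakk> \<Longrightarrow> e \<cdot> f \<in> F" "\<And>e f. \<lbrakk>e \<in> projs S; f \<in> projs S; e \<oplus> f \<in> F\<rbrakk> \<Longrightarrow> e \<in> F \<or> f \<in> F"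
  using assms unfolding obs_of_iff by blast+

lemma arrs_of_iff: "A \<in> arrs_of S \<longleftrightarrow>
    A \<subseteq> carrier S \<and> A \<noteq> {} \<and> \<zero> \<notin> A \<and> (\<forall>a\<in>A. \<forall>b\<in>carrier S. a \<preceq> b \<longrightarrow> b \<in> A) \<and>
    (\<forall>a\<in>A. \<forall>b\<in>A. \<exists>c\<in>A. c \<preceq> a \<and> c \<preceq> b) \<and>
    (\<forall>a\<in>carrier S. \<forall>b\<in>carrier S. \<forall>x\<in>A. is_lub (nat_ord S) x {a, b} \<longrightarrow> a \<in> A \<or> b \<in> A)"
proof -
  have "A \<subset> carrier S \<longleftrightarrow> A \<subseteq> carrier S \<and> \<zero> \<notin> A" if "\<forall>a\<in>A. \<forall>b\<in>carrier S. a \<preceq> b \<longrightarrow> b \<in> A"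
    using that zero_le zero_carrier by blast
  then show ?thesis unfolding arrs_of_def prime_filter_def carrier_nat_ord mem_Collect_eq by argo
qed

lemma arrs_ofD:
  assumes "A \<in> arrs_of S"
  shows "A \<subseteq> carrier S" "A \<noteq> {}" "\<zero> \<notin> A" "\<And>a b. \<lbrakk>a \<in> A; b \<in> carrier S; a \<preceq> b\<rbrakk> \<Longrightarrow> b \<in> A"
    "\<And>a b. \<lbrakk>a \<in> A; b \<in> A\<rbrakk> \<Longrightarrow> \<exists>c\<in>A. c \<preceq> a \<and> c \<preceq> b"
    "\<And>a b x. \<lbrakk>a \<in> carrier S; b \<in> carrier S; x \<in> A; is_lub (nat_ord S) x {a, b}\<rbrakk> \<Longrightarrow> a \<in> A \<or> b \<in> A"
proof -
  note A = assms[unfolded arrs_of_iff]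
  show "A \<subseteq> carrier S" "A \<noteq> {}" "\<zero> \<notin> A" using A by argo+
  show "b \<in> A" if "a \<in> A" "b \<in> carrier S" "a \<preceq> b" for a b using A that by meson
  show "\<exists>c\<in>A. c \<preceq> a \<and> c \<preceq> b" if "a \<in> A" "b \<in> A" for a b using A that by meson
  show "a \<in> A \<or> b \<in> A" if "a \<in> carrier S" "b \<in> carrier S" "x \<in> A" "is_lub (nat_ord S) x {a, b}"
    for a b x using A that by meson
qed

text \<open>The prime filter theorem, by Zorn's lemma: take a maximal filter \<open>M\<close> that contains \<open>e\<close> and avoids the ideal
  \<open>J\<close>.  If \<open>f\<close> and \<open>g\<close> are not in \<open>M\<close>, the filters generated by \<open>M\<close> and either of them meet \<open>J\<close>; so
  \<open>m \<cdot> n \<cdot> (f \<oplus> g) \<in> J\<close> for some \<open>m, n \<in> M\<close>, and \<open>f \<oplus> g\<close> is not in \<open>M\<close> either.\<close>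

lemma prime_filter_exists:
  assumes J: "J \<subseteq> projs S" "\<zero> \<in> J" "\<And>e f. \<lbrakk>e \<in> J; f \<in> projs S; f \<preceq> e\<rbrakk> \<Longrightarrow> f \<in> J"
      "\<And>e f. \<lbrakk>e \<in> J; f \<in> J\<rbrakk> \<Longrightarrow> e \<oplus> f \<in> J"
    and e: "e \<in> projs S" "e \<notin> J"
  obtains F where "F \<in> obs_of S" "e \<in> F" "F \<inter> J = {}"
proof -
  define P where "P F \<longleftrightarrow> F \<subseteq> projs S \<and> (\<forall>e\<in>F. \<forall>f\<in>projs S. e \<preceq> f \<longrightarrow> f \<in> F) \<and>
    (\<forall>e\<in>F. \<forall>f\<in>F. e \<cdot> f \<in> F) \<and> e \<in> F \<and> F \<inter> J = {}" for F
  have gen: "P {f \<in> projs S. \<exists>m\<in>M. m \<cdot> g \<preceq> f}"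
    if M: "M \<subseteq> projs S" "M \<noteq> {}" "\<forall>e\<in>M. \<forall>f\<in>M. e \<cdot> f \<in> M" and g: "g \<in> projs S"
      and eM: "m0 \<in> M" "m0 \<preceq> e" and J': "\<And>m. m \<in> M \<Longrightarrow> m \<cdot> g \<notin> J" for M g m0
    unfolding P_def
  proof (intro conjI ballI impI)
    show "{f \<in> projs S. \<exists>m\<in>M. m \<cdot> g \<preceq> f} \<subseteq> projs S" by blast
    have "m0 \<in> projs S" using M eM by blast
    then have "m0 \<cdot> g \<preceq> e" using eM nat_le_trans nat_leI_right g e proj_carrier by metis
    then show "e \<in> {f \<in> projs S. \<exists>m\<in>M. m \<cdot> g \<preceq> f}" using e eM by blast
    show "{f \<in> projs S. \<exists>m\<in>M. m \<cdot> g \<preceq> f} \<inter> J = {}"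
    proof -
      have "f \<notin> J" if "m \<in> M" "m \<cdot> g \<preceq> f" for f m
        using J(3)[of f "m \<cdot> g"] J'[OF that(1)] that M(1) g projs_closed by blast
      then show ?thesis by blast
    qed
  next
    fix a b assume "a \<in> {f \<in> projs S. \<exists>m\<in>M. m \<cdot> g \<preceq> f}" "b \<in> projs S" "a \<preceq> b"
    then show "b \<in> {f \<in> projs S. \<exists>m\<in>M. m \<cdot> g \<preceq> f}" using nat_le_trans proj_carrier by blast
  next
    fix a b assume ab: "a \<in> {f \<in> projs S. \<exists>m\<in>M. m \<cdot> g \<preceq> f}" "b \<in> {f \<in> projs S. \<exists>m\<in>M. m \<cdot> g \<preceq> f}"
    then obtain m n where mn: "m \<in> M" "n \<in> M" "m \<cdot> g \<preceq> a" "n \<cdot> g \<preceq> b" by blast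
    have p: "m \<in> projs S" "n \<in> projs S" "a \<in> projs S" "b \<in> projs S" using mn ab M by blast+
    have "m \<cdot> n \<cdot> g = (m \<cdot> g) \<cdot> (n \<cdot> g)"
      using p g projs_idem projs_comm tms_assoc proj_carrier projs_closed by metis
    then have "m \<cdot> n \<cdot> g \<preceq> a \<cdot> b" using nat_le_tms mn p proj_carrier by auto
    then show "a \<cdot> b \<in> {f \<in> projs S. \<exists>m\<in>M. m \<cdot> g \<preceq> f}" using mn M p projs_closed by blast
  qed
  have "\<exists>M\<in>Collect P. \<forall>X\<in>Collect P. M \<subseteq> X \<longrightarrow> X = M"
  proof (rule subset_Zorn_nonempty)
    have "P {f \<in> projs S. \<exists>m\<in>{e}. m \<cdot> e \<preceq> f}"
      by (rule gen) (use e projs_idem nat_le_refl proj_carrier in auto)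
    then show "Collect P \<noteq> {}" by blast
  next
    fix C assume "C \<noteq> {}" "subset.chain (Collect P) C"
    then have C: "C \<noteq> {}" "\<And>X. X \<in> C \<Longrightarrow> P X" "\<And>X Y. \<lbrakk>X \<in> C; Y \<in> C\<rbrakk> \<Longrightarrow> X \<subseteq> Y \<or> Y \<subseteq> X"
      unfolding subset_chain_def by blast+
    have "a \<cdot> b \<in> \<Union>C" if ab: "a \<in> \<Union>C" "b \<in> \<Union>C" for a b
    proof -
      obtain X Y where "X \<in> C" "Y \<in> C" "a \<in> X" "b \<in> Y" using ab by blast
      then obtain Z where "Z \<in> C" "a \<in> Z" "b \<in> Z" using C(3)[of X Y] by blast
      then show ?thesis using C(2)[of Z] unfolding P_def by blast
    qed
    moreover have "f \<in> \<Union>C" if "a \<in> \<Union>C" "f \<in> projs S" "a \<preceq> f" for a f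
      using C(2) that unfolding P_def by (meson UnionE UnionI)
    moreover have "e \<in> \<Union>C" "\<Union>C \<subseteq> projs S" "\<Union>C \<inter> J = {}" using C(1,2) unfolding P_def by blast+
    ultimately have "P (\<Union>C)" unfolding P_def by simp
    then show "\<Union>C \<in> Collect P" by blast
  qed
  then obtain M where M: "P M" and max: "\<And>X. P X \<Longrightarrow> M \<subseteq> X \<Longrightarrow> X = M" by blast
  note PM = M[unfolded P_def]
  have key: "\<exists>m\<in>M. m \<cdot> f \<in> J" if f: "f \<in> projs S" "f \<notin> M" for f
  proof (rule ccontr)
    assume neg: "\<not> ?thesis"
    let ?X = "{h \<in> projs S. \<exists>m\<in>M. m \<cdot> f \<preceq> h}"
    have "P ?X" by (rule gen[of _ _ e]) (use PM f neg e nat_le_refl proj_carrier in auto)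
    moreover have "M \<subseteq> ?X" using PM f nat_leI_right proj_carrier by blast
    ultimately have "?X = M" using max by blast
    moreover have "f \<in> ?X" using f PM nat_leI_left proj_carrier e by blast
    ultimately show False using f by blast
  qed
  have "M \<in> obs_of S"
    unfolding obs_of_iff
  proof (intro conjI ballI impI)
    fix f g assume fg: "f \<in> projs S" "g \<in> projs S" "f \<oplus> g \<in> M"
    show "f \<in> M \<or> g \<in> M"
    proof (rule ccontr)
      assume "\<not> ?thesis"
      then obtain m n where mn: "m \<in> M" "n \<in> M" "m \<cdot> f \<in> J" "n \<cdot> g \<in> J" using key fg by blast
      have p: "m \<in> projs S" "n \<in> projs S" using mn PM by blast+
      have "m \<cdot> n \<cdot> f \<preceq> m \<cdot> f" "m \<cdot> n \<cdot> g \<preceq> n \<cdot> g"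
        using nat_le_tms_right nat_leI_right nat_leI_left p fg proj_carrier by metis+
      then have "m \<cdot> n \<cdot> f \<in> J" "m \<cdot> n \<cdot> g \<in> J" 
        using J(3)[OF mn(3)] J(3)[OF mn(4)] p fg projs_closed by auto
      then have "m \<cdot> n \<cdot> (f \<oplus> g) \<in> J" using J(4) proj_distrib p fg projs_closed by metis
      moreover have "m \<cdot> n \<cdot> (f \<oplus> g) \<in> M" using PM mn fg by blast
      ultimately show False using PM by blast
    qed
  qed (use PM J(2) in blast)+
  then show ?thesis using that PM by blast
qed

subsection \<open>Germs\<close>

lemma mem_dom_of: "e \<in> dom_of S A \<longleftrightarrow> e \<in> projs S \<and> (\<exists>a\<in>A. lam S a \<preceq> e)"
  by (simp add: dom_of_def)

lemma arr_carrier: "\<lbrakk>A \<in> arrs_of S; a \<in> A\<rbrakk> \<Longrightarrow> a \<in> carrier S"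
  using arrs_ofD(1) by blast

lemma ob_proj: "\<lbrakk>F \<in> obs_of S; e \<in> F\<rbrakk> \<Longrightarrow> e \<in> projs S"
  using obs_ofD(1) by blast

lemma lam_mem_dom: "\<lbrakk>A \<in> arrs_of S; a \<in> A\<rbrakk> \<Longrightarrow> lam S a \<in> dom_of S A"
  using mem_dom_of arr_carrier lam_closed nat_le_refl lam_carrier by metis

text \<open>Any two elements of \<open>A\<close> have a common lower bound in \<open>A\<close>, so one fixed element already determines the domain.\<close>

lemma dom_mem_iff:
  assumes A: "A \<in> arrs_of S" "a \<in> A" and e: "e \<in> projs S"
  shows "e \<in> dom_of S A \<longleftrightarrow> a \<cdot> e \<in> A"
proof
  assume "e \<in> dom_of S A"
  then obtain b where b: "b \<in> A" "lam S b \<preceq> e" using mem_dom_of by auto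
  obtain c where c: "c \<in> A" "c \<preceq> a" "c \<preceq> b" using arrs_ofD(5) A b by blast
  have cc: "a \<in> carrier S" "b \<in> carrier S" "c \<in> carrier S" using A b c arr_carrier by auto
  have "lam S c \<preceq> e" using nat_le_trans nat_le_lam_mono c b cc e proj_carrier by blast
  then have "a \<cdot> lam S c \<preceq> a \<cdot> e" using nat_le_tms_left e cc proj_carrier by blast
  moreover have "a \<cdot> lam S c = c" using c cc nat_le_lam by simp
  ultimately show "a \<cdot> e \<in> A" using arrs_ofD(4)[OF A(1) c(1)] cc e closed by auto
next
  assume ae: "a \<cdot> e \<in> A"
  have "lam S (a \<cdot> e) \<preceq> e" using lam_tms_le[of a e] lam_proj[OF e] arr_carrier A e proj_carrier by auto
  then show "e \<in> dom_of S A" using ae e mem_dom_of by blast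
qed

lemma dom_of_obs:
  assumes A: "A \<in> arrs_of S" shows "dom_of S A \<in> obs_of S"
proof -
  obtain a where a: "a \<in> A" using arrs_ofD[OF A] by blast
  have ac: "a \<in> carrier S" using A a arr_carrier by blast
  note D = dom_mem_iff[OF A a]
  show ?thesis unfolding obs_of_iff
  proof (intro conjI ballI impI)
    show "dom_of S A \<subseteq> projs S" using mem_dom_of by blast
    show "dom_of S A \<noteq> {}" using lam_mem_dom A a by blast
    show "\<zero> \<notin> dom_of S A" using D[OF zero_proj] tms_zero ac arrs_ofD(3)[OF A] by simp
    fix e f
    { assume "e \<in> dom_of S A" "f \<in> projs S" "e \<preceq> f"
      then show "f \<in> dom_of S A" using mem_dom_of nat_le_trans[of _ e f] proj_carrier[of f] by blast }
    { assume e: "e \<in> dom_of S A" "f \<in> dom_of S A"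
      then have p: "e \<in> projs S" "f \<in> projs S" using mem_dom_of by auto
      have "a \<cdot> e \<in> A" using D p e by blast
      then have "a \<cdot> e \<cdot> f \<in> A" using dom_mem_iff[OF A] p e by blast
      then show "e \<cdot> f \<in> dom_of S A" using D p projs_closed tms_assoc proj_carrier ac by metis }
    { assume e: "e \<in> projs S" "f \<in> projs S" "e \<oplus> f \<in> dom_of S A"
      then have "a \<cdot> (e \<oplus> f) \<in> A" using D pjoin_closed by blast
      then have "a \<cdot> e \<in> A \<or> a \<cdot> f \<in> A"
        using arrs_ofD(6)[OF A] lub_tms_pjoin[OF ac e(1,2)] ac e closed by metis
      then show "e \<in> dom_of S A \<or> f \<in> dom_of S A" using D e by blast }
  qed
qed

lemma germ_memI: "\<lbrakk>b \<in> carrier S; e \<in> F; a \<cdot> e \<preceq> b\<rbrakk> \<Longrightarrow> b \<in> germ S a F"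
  by (auto simp: germ_def)

lemma germ_self:
  assumes "F \<in> obs_of S" "a \<in> carrier S" shows "a \<in> germ S a F"
proof -
  obtain e where "e \<in> F" using obs_ofD(2)[OF assms(1)] by blast
  then show ?thesis using germ_memI nat_leI_right ob_proj assms by metis
qed

text \<open>Primeness of a germ: if a join of \<open>b\<close> and \<open>c\<close> lies above \<open>a \<cdot> e\<close>, its domain is in \<open>F\<close>, hence so is the domain
  of \<open>b\<close> or of \<open>c\<close>, and the germ of \<open>a\<close> passes through that element.\<close>

lemma germ_arr:
  assumes F: "F \<in> obs_of S" and a: "a \<in> carrier S" "lam S a \<in> F"
  shows "germ S a F \<in> arrs_of S"
  unfolding arrs_of_iff
proof (intro conjI ballI impI)
  show "germ S a F \<subseteq> carrier S" by (auto simp: germ_def)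
  show "germ S a F \<noteq> {}" using germ_self F a by blast
  show "\<zero> \<notin> germ S a F"
  proof
    assume "\<zero> \<in> germ S a F"
    then obtain e where e: "e \<in> F" "a \<cdot> e \<preceq> \<zero>" by (auto simp: germ_def)
    then have "a \<cdot> e = \<zero>" using le_zero by blast
    then have "lam S a \<cdot> e = \<zero>" using lam_tms_proj[of a e] lam_proj[OF zero_proj] a e ob_proj F by metis
    then show False using obs_ofD(3,5)[OF F] a e by metis
  qed
next
  fix b c assume "b \<in> germ S a F" "c \<in> carrier S" "b \<preceq> c"
  then show "c \<in> germ S a F" by (auto simp: germ_def intro: nat_le_trans)
next
  fix b c assume "b \<in> germ S a F" "c \<in> germ S a F"
  then obtain e f where ef: "e \<in> F" "f \<in> F" "a \<cdot> e \<preceq> b" "a \<cdot> f \<preceq> c" and bc: "b \<in> carrier S" "c \<in> carrier S"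
    by (auto simp: germ_def)
  have p: "e \<in> projs S" "f \<in> projs S" using ef F ob_proj by auto
  have "a \<cdot> (e \<cdot> f) \<preceq> a \<cdot> e" "a \<cdot> (e \<cdot> f) \<preceq> a \<cdot> f"
    using p a nat_le_tms_left nat_leI_left nat_leI_right proj_carrier by metis+
  then have "a \<cdot> (e \<cdot> f) \<preceq> b" "a \<cdot> (e \<cdot> f) \<preceq> c" using ef bc nat_le_trans by blast+
  moreover have "a \<cdot> (e \<cdot> f) \<in> germ S a F"
    by (rule germ_memI[of _ "e \<cdot> f"]) (use p a closed nat_le_refl obs_ofD(5)[OF F] ef in auto)
  ultimately show "\<exists>d\<in>germ S a F. d \<preceq> b \<and> d \<preceq> c" by blast
next
  fix b c x assume bc: "b \<in> carrier S" "c \<in> carrier S" and x: "x \<in> germ S a F" "is_lub (nat_ord S) x {b, c}"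
  then obtain e where e: "e \<in> F" "a \<cdot> e \<preceq> x" by (auto simp: germ_def)
  note xl = x(2)[unfolded lub2_iff[OF bc]]
  have p: "e \<in> projs S" "lam S a \<in> projs S" "lam S b \<in> projs S" "lam S c \<in> projs S" "x \<in> carrier S"
    using e F ob_proj a bc xl lam_closed by auto
  have ae: "a \<cdot> e = x \<cdot> (lam S a \<cdot> e)" using e nat_le_lam[of "a \<cdot> e" x] lam_tms_proj a p closed by metis
  have "lam S a \<cdot> e \<preceq> lam S x"
    using nat_le_lam_mono[OF e(2)] lam_tms_proj a p by auto
  then have "lam S x \<in> F" using obs_ofD(4)[OF F] obs_ofD(5)[OF F a(2) e(1)] p lam_closed by auto
  then have "lam S b \<in> F \<or> lam S c \<in> F" using lub_lam[OF bc x(2)] obs_ofD(6)[OF F] p by metis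
  moreover have "d \<in> germ S a F" if d: "d \<in> carrier S" "d \<preceq> x" "lam S d \<in> F" for d
  proof (rule germ_memI)
    have "a \<cdot> (e \<cdot> lam S d) = x \<cdot> (lam S a \<cdot> e) \<cdot> lam S d"
      using ae tms_assoc a p d closed by metis
    also have "\<dots> = (x \<cdot> lam S d) \<cdot> (lam S a \<cdot> e)"
      using tms_assoc p a d closed projs_comm by metis
    also have "\<dots> = d \<cdot> (lam S a \<cdot> e)" using d nat_le_lam p by metis
    finally show "a \<cdot> (e \<cdot> lam S d) \<preceq> d" using nat_leI_right p d projs_closed by metis
    show "e \<cdot> lam S d \<in> F" using obs_ofD(5)[OF F e(1) d(3)] .
  qed (use d in auto)
  ultimately show "b \<in> germ S a F \<or> c \<in> germ S a F" using bc xl by blast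
qed

lemma dom_germ:
  assumes F: "F \<in> obs_of S" and a: "a \<in> carrier S" "lam S a \<in> F"
  shows "dom_of S (germ S a F) = F"
proof -
  note G = germ_arr[OF assms] germ_self[OF F a(1)]
  have "e \<in> F" if e: "e \<in> projs S" "a \<cdot> e \<in> germ S a F" for e
  proof -
    obtain f where f: "f \<in> F" "a \<cdot> f \<preceq> a \<cdot> e" using e by (auto simp: germ_def)
    have p: "f \<in> projs S" using f F ob_proj by blast
    have "lam S a \<cdot> f \<preceq> lam S a \<cdot> e" using nat_le_lam_mono[OF f(2)] lam_tms_proj a e p closed by metis
    moreover have "lam S a \<cdot> e \<preceq> e" using nat_leI_left e lam_closed a proj_carrier by metis
    ultimately have "lam S a \<cdot> f \<preceq> e" using nat_le_trans e proj_carrier by blast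
    then show ?thesis using obs_ofD(4,5)[OF F] a f e by blast
  qed
  moreover have "a \<cdot> e \<in> germ S a F" if "e \<in> F" for e
    by (rule germ_memI[OF _ that]) (use that F ob_proj a closed nat_le_refl in auto)
  ultimately show ?thesis using dom_mem_iff[OF G] mem_dom_of ob_proj F by blast
qed

text \<open>Filteredness: every element of \<open>A\<close> has a common lower bound with \<open>a\<close> in \<open>A\<close>, and this bound is \<open>a\<close> restricted
  to a projection of the domain.\<close>

lemma arr_eq_germ:
  assumes A: "A \<in> arrs_of S" "a \<in> A" shows "germ S a (dom_of S A) = A"
proof
  show "germ S a (dom_of S A) \<subseteq> A"
    using dom_mem_iff[OF A] arrs_ofD(4)[OF A(1)] unfolding germ_def dom_of_def by auto
  show "A \<subseteq> germ S a (dom_of S A)"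
  proof
    fix b assume b: "b \<in> A"
    then obtain c where c: "c \<in> A" "c \<preceq> a" "c \<preceq> b" using arrs_ofD(5) A by blast
    have "c = a \<cdot> lam S c" using c nat_le_lam A arr_carrier by auto
    then show "b \<in> germ S a (dom_of S A)"
      using germ_memI[OF _ lam_mem_dom[OF A(1) c(1)]] c b A arr_carrier by metis
  qed
qed

lemma arr_eqI_dom:
  "\<lbrakk>A \<in> arrs_of S; B \<in> arrs_of S; dom_of S A = dom_of S B; a \<in> A; a \<in> B\<rbrakk> \<Longrightarrow> A = B"
  using arr_eq_germ by metis

text \<open>The definition of a prime filter speaks of joins of two elements; partial joins of a finite family exist because
  they are bounded.\<close>

lemma mem_arr_of_lub:
  assumes A: "A \<in> arrs_of S" and "finite M" "M \<noteq> {}" "M \<subseteq> carrier S" "is_lub (nat_ord S) x M" "x \<in> A"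
  shows "\<exists>m\<in>M. m \<in> A"
  using assms(2-)
proof (induction M arbitrary: x rule: finite_ne_induct)
  case (singleton m)
  then have "m \<preceq> x" "x \<preceq> m" "m \<in> carrier S" using is_lub_nat_ord[of "{m}" x] nat_le_refl by auto
  then show ?case using nat_le_antisym singleton A arr_carrier by blast
next
  case (insert m M)
  note x = insert.prems(2)[unfolded is_lub_nat_ord[OF insert.prems(1)]]
  have M: "M \<subseteq> carrier S" "m \<in> carrier S" using insert by auto
  obtain y where y: "is_lub (nat_ord S) y M" using bounded_lub_ex[of M x] M insert x by auto
  note y' = y[unfolded is_lub_nat_ord[OF M(1)]]
  have "is_lub (nat_ord S) x {m, y}"
    unfolding lub2_iff[OF M(2) conjunct1[OF y']]
  proof (intro conjI ballI impI)
    fix z assume "z \<in> carrier S" "m \<preceq> z" "y \<preceq> z"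
    moreover from this have "a \<preceq> z" if "a \<in> M" for a using nat_le_trans[of a y z] y' that by simp
    ultimately show "x \<preceq> z" using x by simp
  qed (use x y' in simp_all)
  then have "m \<in> A \<or> y \<in> A" using arrs_ofD(6)[OF A] M y' insert.prems by blast
  then show ?case using insert.IH[OF M(1) y] by blast
qed

text \<open>The projections \<open>e\<close> with \<open>a \<cdot> e \<preceq> b\<close> form an ideal.  If it does not contain the domain of \<open>a\<close>, the germ of \<open>a\<close>
  at a prime filter that avoids the ideal contains \<open>a\<close> but not \<open>b\<close>.\<close>

lemma le_if_basic_subset:
  assumes a: "a \<in> carrier S" and b: "b \<in> carrier S" and sub: "ar_basic S a \<subseteq> ar_basic S b"
  shows "a \<preceq> b"
proof (rule ccontr)
  assume neg: "\<not> a \<preceq> b"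
  let ?J = "{e \<in> projs S. a \<cdot> e \<preceq> b}"
  have "lam S a \<notin> ?J" using neg tms_lam a by auto
  then obtain F where F: "F \<in> obs_of S" "lam S a \<in> F" "F \<inter> ?J = {}"
  proof (rule prime_filter_exists[of ?J "lam S a", rotated -2])
    show "\<zero> \<in> ?J" using zero_proj tms_zero a b zero_le by auto
    fix e f
    { assume "e \<in> ?J" "f \<in> projs S" "f \<preceq> e"
      then show "f \<in> ?J" using nat_le_tms_left a b proj_carrier nat_le_trans by blast }
    { assume e: "e \<in> ?J" "f \<in> ?J"
      then have "a \<cdot> (e \<oplus> f) \<preceq> b"
        using lub_tms_pjoin[OF a, of e f] lub2_iff[of "a \<cdot> e" "a \<cdot> f"] a b closed by auto
      then show "e \<oplus> f \<in> ?J" using pjoin_closed e by auto }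
  qed (use a lam_closed in auto)
  have "germ S a F \<in> ar_basic S a" using germ_arr germ_self F a by (simp add: ar_basic_def)
  then have "b \<in> germ S a F" using sub by (auto simp: ar_basic_def)
  then show False using F obs_ofD(1)[OF F(1)] by (auto simp: germ_def)
qed

lemma ar_basic_mono: "\<lbrakk>a \<preceq> b; b \<in> carrier S\<rbrakk> \<Longrightarrow> ar_basic S a \<subseteq> ar_basic S b"
  unfolding ar_basic_def using arrs_ofD(4) by blast

lemma ar_basic_inj: "\<lbrakk>a \<in> carrier S; b \<in> carrier S; ar_basic S a = ar_basic S b\<rbrakk> \<Longrightarrow> a = b"
  using le_if_basic_subset[of a b] le_if_basic_subset[of b a] nat_le_antisym by simp

lemma ar_basic_lub:
  assumes M: "finite M" "M \<noteq> {}" "M \<subseteq> carrier S" "is_lub (nat_ord S) x M"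
  shows "ar_basic S x = (\<Union>m\<in>M. ar_basic S m)"
proof
  show "ar_basic S x \<subseteq> (\<Union>m\<in>M. ar_basic S m)" using mem_arr_of_lub[OF _ M] unfolding ar_basic_def by blast
  show "(\<Union>m\<in>M. ar_basic S m) \<subseteq> ar_basic S x"
    using M(4)[unfolded is_lub_nat_ord[OF M(3)]] ar_basic_mono by (intro UN_least) blast
qed

lemma ar_basic_zero: "ar_basic S \<zero> = {}"
  unfolding ar_basic_def using arrs_ofD(3) by blast

text \<open>The projections \<open>e\<close> for which finitely many members cover the prime filters through \<open>t \<cdot> e\<close> form an ideal; a
  prime filter avoiding it would give a germ of \<open>t\<close> that no member of the cover contains.\<close>

lemma ar_basic_compact:
  assumes t: "t \<in> carrier S" and I: "I \<subseteq> carrier S" and sub: "ar_basic S t \<subseteq> (\<Union>s\<in>I. ar_basic S s)"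
  shows "\<exists>I'. finite I' \<and> I' \<subseteq> I \<and> ar_basic S t \<subseteq> (\<Union>s\<in>I'. ar_basic S s)"
proof (rule ccontr)
  assume neg: "\<not> ?thesis"
  define J where "J = {e \<in> projs S. \<exists>I'. finite I' \<and> I' \<subseteq> I \<and> ar_basic S (t \<cdot> e) \<subseteq> (\<Union>s\<in>I'. ar_basic S s)}"
  have "lam S t \<notin> J" using neg tms_lam t by (auto simp: J_def)
  then obtain F where F: "F \<in> obs_of S" "lam S t \<in> F" "F \<inter> J = {}"
  proof (rule prime_filter_exists[of J "lam S t", rotated -2])
    show "\<zero> \<in> J" using zero_proj tms_zero[OF t] ar_basic_zero unfolding J_def by auto
    fix e f
    { assume e: "e \<in> J" "f \<in> projs S" "f \<preceq> e"
      then have "t \<cdot> f \<preceq> t \<cdot> e" using nat_le_tms_left t proj_carrier by (auto simp: J_def)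
      then have "ar_basic S (t \<cdot> f) \<subseteq> ar_basic S (t \<cdot> e)" using ar_basic_mono e t closed by (auto simp: J_def)
      then show "f \<in> J" using e unfolding J_def by blast }
    { assume e: "e \<in> J" "f \<in> J"
      then obtain I1 I2 where "finite I1" "I1 \<subseteq> I" "ar_basic S (t \<cdot> e) \<subseteq> (\<Union>s\<in>I1. ar_basic S s)"
        "finite I2" "I2 \<subseteq> I" "ar_basic S (t \<cdot> f) \<subseteq> (\<Union>s\<in>I2. ar_basic S s)" unfolding J_def by blast
      moreover have ep: "e \<in> projs S" "f \<in> projs S" using e by (auto simp: J_def)
      then have "ar_basic S (t \<cdot> (e \<oplus> f)) = ar_basic S (t \<cdot> e) \<union> ar_basic S (t \<cdot> f)"
        using ar_basic_lub[OF _ _ _ lub_tms_pjoin[OF t]] t closed by auto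
      ultimately have "ar_basic S (t \<cdot> (e \<oplus> f)) \<subseteq> (\<Union>s\<in>I1 \<union> I2. ar_basic S s)" "finite (I1 \<union> I2)" "I1 \<union> I2 \<subseteq> I"
        by auto
      then show "e \<oplus> f \<in> J" using pjoin_closed ep unfolding J_def by blast }
  qed (use t lam_closed in \<open>auto simp: J_def\<close>)
  have "germ S t F \<in> ar_basic S t" using germ_arr germ_self F t by (simp add: ar_basic_def)
  then obtain s where s: "s \<in> I" "s \<in> germ S t F" using sub by (auto simp: ar_basic_def)
  then obtain e where e: "e \<in> F" "t \<cdot> e \<preceq> s" by (auto simp: germ_def)
  then have "ar_basic S (t \<cdot> e) \<subseteq> (\<Union>s\<in>{s}. ar_basic S s)" using ar_basic_mono s I by auto
  then have "e \<in> J" using s e ob_proj F unfolding J_def by blast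
  then show False using e F by blast
qed

end

context drs
begin

lemmas rho_mem_cod = drs.lam_mem_dom[OF drs_opp, simplified]
lemmas cod_of_obs = drs.dom_of_obs[OF drs_opp, simplified]
lemmas cod_mem_iff = drs.dom_mem_iff[OF drs_opp, simplified]
lemmas arr_eqI_cod = drs.arr_eqI_dom[OF drs_opp, simplified]
lemmas mem_cod_of = drs.mem_dom_of[OF drs_opp, simplified]

subsection \<open>Units and composites\<close>

lemma unit_of_germ:
  assumes F: "F \<in> obs_of S" and f: "f \<in> F" shows "unit_of S F = germ S f F"
proof -
  have "\<exists>e'\<in>F. f \<cdot> e' \<preceq> s" if "e \<in> F" "e \<preceq> s" "s \<in> carrier S" for e s
  proof -
    have "f \<cdot> e \<preceq> e" using that F f ob_proj nat_leI_left proj_carrier by metis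
    then show ?thesis using that nat_le_trans by blast
  qed
  moreover have "\<exists>e'\<in>F. e' \<preceq> s" if "e \<in> F" "f \<cdot> e \<preceq> s" for e s
    using that obs_ofD(5)[OF F f] by blast
  ultimately show ?thesis unfolding unit_of_def germ_def by blast
qed

lemma ob_lam: "\<lbrakk>F \<in> obs_of S; f \<in> F\<rbrakk> \<Longrightarrow> lam S f \<in> F"
  using lam_proj ob_proj by metis

lemma unit_of_arr: assumes "F \<in> obs_of S" shows "unit_of S F \<in> arrs_of S"
  and dom_unit_of: "dom_of S (unit_of S F) = F"
proof -
  obtain f where "f \<in> F" using obs_ofD(2)[OF assms] by blast
  then show "unit_of S F \<in> arrs_of S" "dom_of S (unit_of S F) = F"
    using unit_of_germ germ_arr dom_germ assms ob_lam ob_proj proj_carrier by auto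
qed

lemma mem_unit_of: "\<lbrakk>F \<in> obs_of S; e \<in> F\<rbrakk> \<Longrightarrow> e \<in> unit_of S F"
  using ob_proj proj_carrier nat_le_refl unfolding unit_of_def by blast

lemma arr_with_proj: "\<lbrakk>A \<in> arrs_of S; e \<in> A; e \<in> projs S\<rbrakk> \<Longrightarrow> A = unit_of S (dom_of S A)"
  using unit_of_germ arr_eq_germ dom_of_obs lam_mem_dom lam_proj by metis

lemma lam_tms_mem:
  assumes A: "A \<in> arrs_of S" "B \<in> arrs_of S" "dom_of S A = cod_of S B" and a: "a \<in> A" "b \<in> B"
  shows "lam S (a \<cdot> b) \<in> dom_of S B"
proof -
  have "lam S a \<cdot> b \<in> B" using cod_mem_iff[OF A(2) a(2)] lam_mem_dom[OF A(1) a(1)] A arr_carrier lam_closed a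
    by metis
  then show ?thesis using lam_mem_dom[OF A(2)] lam_tms arr_carrier A a by metis
qed

text \<open>The product of two prime filters is the germ of the product of any representatives, hence again a prime filter.\<close>

lemma comp_of_germ:
  assumes A: "A \<in> arrs_of S" "B \<in> arrs_of S" "dom_of S A = cod_of S B" and a: "a \<in> A" "b \<in> B"
  shows "comp_of S A B = germ S (a \<cdot> b) (dom_of S B)"
proof (intro equalityI subsetI)
  have c: "a \<in> carrier S" "b \<in> carrier S" using A a arr_carrier by auto
  { fix s assume "s \<in> comp_of S A B"
    then obtain a1 b1 where s: "s \<in> carrier S" "a1 \<in> A" "b1 \<in> B" "a1 \<cdot> b1 \<preceq> s" by (auto simp: comp_of_def)
    obtain a2 where a2: "a2 \<in> A" "a2 \<preceq> a" "a2 \<preceq> a1" using arrs_ofD(5)[OF A(1)] a s by metis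
    obtain b2 where b2: "b2 \<in> B" "b2 \<preceq> b" "b2 \<preceq> b1" using arrs_ofD(5)[OF A(2)] a s by metis
    have c2: "a1 \<in> carrier S" "b1 \<in> carrier S" "a2 \<in> carrier S" "b2 \<in> carrier S"
      using A a2 b2 s arr_carrier by auto
    have b3: "lam S a2 \<cdot> b2 \<in> B" (is "?b3 \<in> B")
      using cod_mem_iff[OF A(2) b2(1)] lam_mem_dom[OF A(1) a2(1)] A c2 lam_closed by metis
    have "?b3 \<preceq> b" using nat_leI_left[of b2 "lam S a2"] b2 c c2 nat_le_trans lam_closed by blast
    then have "?b3 = b \<cdot> lam S ?b3" using nat_le_lam c c2 closed by auto
    then have "a \<cdot> b \<cdot> lam S ?b3 = a \<cdot> ?b3" using c c2 closed tms_assoc by metis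
    also have "\<dots> = a2 \<cdot> b2" using nat_le_lam[of a2 a] a2 c c2 closed tms_assoc by metis
    also have "\<dots> \<preceq> a1 \<cdot> b1" using nat_le_tms a2 b2 c2 by auto
    finally have "a \<cdot> b \<cdot> lam S ?b3 \<preceq> s" using s nat_le_trans by blast
    then show "s \<in> germ S (a \<cdot> b) (dom_of S B)" using germ_memI[OF s(1) lam_mem_dom[OF A(2) b3]] by blast }
  { fix s assume "s \<in> germ S (a \<cdot> b) (dom_of S B)"
    then obtain e where e: "e \<in> dom_of S B" "a \<cdot> b \<cdot> e \<preceq> s" "s \<in> carrier S" by (auto simp: germ_def)
    have p: "e \<in> projs S" using e mem_dom_of by blast
    then have "b \<cdot> e \<in> B" "a \<cdot> (b \<cdot> e) \<preceq> s" using e dom_mem_iff[OF A(2) a(2)] tms_assoc c proj_carrier by auto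
    then show "s \<in> comp_of S A B" using a e unfolding comp_of_def by blast }
qed

lemma comp_of_arr:
  assumes A: "A \<in> arrs_of S" "B \<in> arrs_of S" "dom_of S A = cod_of S B"
  shows "comp_of S A B \<in> arrs_of S" "dom_of S (comp_of S A B) = dom_of S B"
proof -
  obtain a b where a: "a \<in> A" "b \<in> B" using arrs_ofD(2) A by blast
  then have "a \<cdot> b \<in> carrier S" using A arr_carrier tms_closed by blast
  then show "comp_of S A B \<in> arrs_of S" "dom_of S (comp_of S A B) = dom_of S B"
    using comp_of_germ[OF A a] germ_arr dom_germ dom_of_obs A lam_tms_mem[OF A a] by auto
qed

lemma tms_mem_comp_of: "\<lbrakk>A \<in> arrs_of S; B \<in> arrs_of S; a \<in> A; b \<in> B\<rbrakk> \<Longrightarrow> a \<cdot> b \<in> comp_of S A B"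
  using arr_carrier tms_closed nat_le_refl unfolding comp_of_def by blast

text \<open>Multiplication is open: a prime filter through \<open>a \<cdot> b\<close> is the product of the germ of \<open>b\<close> at its domain and the
  germ of \<open>a\<close> at the codomain of the former.\<close>

lemma tms_mem_split:
  assumes C: "C \<in> arrs_of S" "a \<cdot> b \<in> C" and ab: "a \<in> carrier S" "b \<in> carrier S"
  obtains A B where "A \<in> arrs_of S" "B \<in> arrs_of S" "a \<in> A" "b \<in> B" "dom_of S A = cod_of S B"
    "comp_of S A B = C"
proof -
  have lab: "lam S (a \<cdot> b) \<in> dom_of S C" using C lam_mem_dom by blast
  have D: "dom_of S C \<in> obs_of S" using C dom_of_obs by blast
  have "lam S b \<in> dom_of S C" using obs_ofD(4)[OF D lab] lam_tms_le ab lam_closed by blast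
  then have B: "germ S b (dom_of S C) \<in> arrs_of S" "b \<in> germ S b (dom_of S C)"
    "dom_of S (germ S b (dom_of S C)) = dom_of S C"
    using germ_arr germ_self dom_germ D ab by auto
  have "b \<cdot> lam S (a \<cdot> b) \<in> germ S b (dom_of S C)" using dom_mem_iff[OF B(1,2)] B(3) lab ab closed by auto
  also have "b \<cdot> lam S (a \<cdot> b) = lam S a \<cdot> b" using lam_tms proj_tms lam_closed ab by metis
  finally have la: "lam S a \<in> cod_of S (germ S b (dom_of S C))"
    using cod_mem_iff[OF B(1,2)] ab lam_closed by auto
  let ?A = "germ S a (cod_of S (germ S b (dom_of S C)))"
  have A: "?A \<in> arrs_of S" "a \<in> ?A" "dom_of S ?A = cod_of S (germ S b (dom_of S C))"
    using la germ_arr germ_self dom_germ cod_of_obs B ab by auto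
  have "comp_of S ?A (germ S b (dom_of S C)) = C"
    using arr_eqI_dom[OF comp_of_arr(1)[OF A(1) B(1) A(3)] C(1) _ tms_mem_comp_of[OF A(1) B(1) A(2) B(2)] C(2)]
      comp_of_arr(2)[OF A(1) B(1) A(3)] B(3) by simp
  then show ?thesis using that A B by blast
qed

end

context drs
begin

lemma cod_unit_of: "F \<in> obs_of S \<Longrightarrow> cod_of S (unit_of S F) = F"
  using drs.dom_unit_of[OF drs_opp] by simp

lemma cod_comp_of:
  "\<lbrakk>A \<in> arrs_of S; B \<in> arrs_of S; dom_of S A = cod_of S B\<rbrakk> \<Longrightarrow> cod_of S (comp_of S A B) = cod_of S A"
  using drs.comp_of_arr(2)[OF drs_opp, of B A] by simp

end
section \<open>Topological preliminaries\<close>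

lemma openin_generated_by_base:
  assumes base: "\<And>i j x. \<lbrakk>i \<in> I; j \<in> I; x \<in> U i; x \<in> U j\<rbrakk> \<Longrightarrow> \<exists>k\<in>I. x \<in> U k \<and> U k \<subseteq> U i \<inter> U j"
  shows "openin (topology_generated_by (U ` I)) W \<longleftrightarrow> (\<forall>x\<in>W. \<exists>i\<in>I. x \<in> U i \<and> U i \<subseteq> W)" (is "?L \<longleftrightarrow> ?R W")
proof
  assume ?L
  then have "generate_topology_on (U ` I) W" by (rule openin_topology_generated_by)
  then show "?R W"
  proof induction
    case (Int a b)
    show ?case
    proof
      fix x assume "x \<in> a \<inter> b"
      then obtain i j where ij: "i \<in> I" "j \<in> I" "x \<in> U i" "x \<in> U j" "U i \<subseteq> a" "U j \<subseteq> b" using Int.IH by blast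
      obtain k where "k \<in> I" "x \<in> U k" "U k \<subseteq> U i \<inter> U j" using base[OF ij(1-4)] by blast
      then show "\<exists>k\<in>I. x \<in> U k \<and> U k \<subseteq> a \<inter> b" using ij by blast
    qed
  next
    case (UN K) then show ?case by (meson UnionE Union_upper subset_trans)
  qed auto
next
  assume R: "?R W"
  show ?L unfolding openin_subopen[of _ W]
  proof
    fix x assume "x \<in> W"
    then obtain i where "i \<in> I" "x \<in> U i" "U i \<subseteq> W" using R by blast
    then show "\<exists>T. openin (topology_generated_by (U ` I)) T \<and> x \<in> T \<and> T \<subseteq> W"
      using topology_generated_by_Basis[of "U i" "U ` I"] by blast
  qed
qed

lemma continuous_map_by_nhds:
  assumes "f \<in> topspace X \<rightarrow> topspace Y"
    and nhd: "\<And>x W. \<lbrakk>x \<in> topspace X; openin Y W; f x \<in> W\<rbrakk> \<Longrightarrow> \<exists>V. openin X V \<and> x \<in> V \<and> f ` V \<subseteq> W"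
  shows "continuous_map X Y f"
  unfolding continuous_map_def
proof (intro conjI allI impI)
  fix W assume W: "openin Y W"
  show "openin X {x \<in> topspace X. f x \<in> W}" unfolding openin_subopen[of _ "{x \<in> topspace X. f x \<in> W}"]
  proof
    fix x assume "x \<in> {x \<in> topspace X. f x \<in> W}"
    then obtain V where "openin X V" "x \<in> V" "f ` V \<subseteq> W" using nhd W by blast
    then show "\<exists>V. openin X V \<and> x \<in> V \<and> V \<subseteq> {x \<in> topspace X. f x \<in> W}" using openin_subset by blast
  qed
qed (rule assms(1))

lemma open_map_by_nhds:
  assumes nhd: "\<And>x V. \<lbrakk>openin X V; x \<in> V\<rbrakk> \<Longrightarrow> \<exists>W. openin Y W \<and> f x \<in> W \<and> W \<subseteq> f ` V"
  shows "open_map X Y f"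
  unfolding open_map_def
proof (intro allI impI)
  fix V assume "openin X V"
  then show "openin Y (f ` V)" unfolding openin_subopen[of _ "f ` V"] using nhd by blast
qed

lemma homeomorphic_map_restrict:
  assumes f: "continuous_map X Y f" "open_map X Y f" and U: "openin X U" "inj_on f U"
  shows "homeomorphic_map (subtopology X U) (subtopology Y (f ` U)) f"
proof (rule bijective_open_imp_homeomorphic_map)
  have fU: "openin Y (f ` U)" using f U unfolding open_map_def by blast
  have sub: "U \<subseteq> topspace X" "f ` U \<subseteq> topspace Y" using U fU openin_subset by auto
  then have t: "topspace (subtopology X U) = U" "topspace (subtopology Y (f ` U)) = f ` U" by auto
  show "continuous_map (subtopology X U) (subtopology Y (f ` U)) f"
    using f(1) by (auto simp: continuous_map_in_subtopology continuous_map_from_subtopology)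
  show "open_map (subtopology X U) (subtopology Y (f ` U)) f"
    using f(2) U fU unfolding open_map_def openin_open_subtopology[OF U(1)] openin_open_subtopology[OF fU] by auto
  show "f ` topspace (subtopology X U) = topspace (subtopology Y (f ` U))" "inj_on f (topspace (subtopology X U))"
    unfolding t using U by auto
qed

lemma local_homeomorphismI:
  assumes "continuous_map X Y f" "open_map X Y f"
    and "\<And>x. x \<in> topspace X \<Longrightarrow> \<exists>U. openin X U \<and> x \<in> U \<and> inj_on f U"
  shows "local_homeomorphism X Y f"
  unfolding local_homeomorphism_def using assms homeomorphic_map_restrict unfolding open_map_def by meson

lemma local_homeomorphismD:
  assumes f: "local_homeomorphism X Y f"
  shows "open_map X Y f" "\<And>x. x \<in> topspace X \<Longrightarrow> \<exists>U. openin X U \<and> x \<in> U \<and> inj_on f U"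
proof -
  fix x assume "x \<in> topspace X"
  then obtain U where U: "openin X U" "x \<in> U" "homeomorphic_map (subtopology X U) (subtopology Y (f ` U)) f"
    using f unfolding local_homeomorphism_def by blast
  then have "inj_on f U"
    using openin_subset[OF U(1)] by (auto simp: homeomorphic_eq_everything_map Int_absorb1)
  then show "\<exists>U. openin X U \<and> x \<in> U \<and> inj_on f U" using U by blast
next
  show "open_map X Y f" unfolding open_map_def
  proof (intro allI impI)
    fix W assume W: "openin X W"
    show "openin Y (f ` W)" unfolding openin_subopen[of _ "f ` W"]
    proof
      fix y assume "y \<in> f ` W"
      then obtain x where x: "x \<in> W" "y = f x" by blast
      then obtain U where U: "openin X U" "x \<in> U" "openin Y (f ` U)"
        "homeomorphic_map (subtopology X U) (subtopology Y (f ` U)) f"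
        using f W openin_subset unfolding local_homeomorphism_def by (meson subsetD)
      have "openin (subtopology X U) (U \<inter> W)" using U W by (simp add: openin_open_subtopology openin_Int)
      then have "openin (subtopology Y (f ` U)) (f ` (U \<inter> W))"
        using U(4) unfolding homeomorphic_eq_everything_map open_map_def by blast
      then have "openin Y (f ` (U \<inter> W))" using U(3) openin_open_subtopology by blast
      then show "\<exists>T. openin Y T \<and> y \<in> T \<and> T \<subseteq> f ` W" using x U by blast
    qed
  qed
qed

lemma closure_of_singleton_iff:
  assumes Z: "closedin X Z" and x: "x \<in> topspace X"
  shows "Z = X closure_of {x} \<longleftrightarrow> x \<in> Z \<and> (\<forall>W. openin X W \<and> W \<inter> Z \<noteq> {} \<longrightarrow> x \<in> W)"
proof
  assume "Z = X closure_of {x}"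
  then show "x \<in> Z \<and> (\<forall>W. openin X W \<and> W \<inter> Z \<noteq> {} \<longrightarrow> x \<in> W)"
    using x unfolding closure_of_def by blast
next
  assume R: "x \<in> Z \<and> (\<forall>W. openin X W \<and> W \<inter> Z \<noteq> {} \<longrightarrow> x \<in> W)"
  then have "X closure_of {x} \<subseteq> Z" using Z by (simp add: closure_of_minimal)
  moreover have "Z \<subseteq> X closure_of {x}" using R closedin_subset[OF Z] unfolding closure_of_def by blast
  ultimately show "Z = X closure_of {x}" by blast
qed

lemma irreducible_in_iff:
  "irreducible_in X Z \<longleftrightarrow> Z \<subseteq> topspace X \<and> Z \<noteq> {} \<and>
     (\<forall>V W. openin X V \<and> openin X W \<and> V \<inter> Z \<noteq> {} \<and> W \<inter> Z \<noteq> {} \<longrightarrow> V \<inter> W \<inter> Z \<noteq> {})"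
proof
  assume L: "irreducible_in X Z"
  have "V \<inter> W \<inter> Z \<noteq> {}" if "openin X V" "openin X W" "V \<inter> Z \<noteq> {}" "W \<inter> Z \<noteq> {}" for V W
  proof
    assume "V \<inter> W \<inter> Z = {}"
    moreover have "closedin X (topspace X - V)" "closedin X (topspace X - W)" using that by blast+
    moreover have "Z \<subseteq> topspace X" using L by (simp add: irreducible_in_def)
    ultimately have "Z \<subseteq> topspace X - V \<or> Z \<subseteq> topspace X - W"
      using L unfolding irreducible_in_def by blast
    then show False using that by blast
  qed
  then show "Z \<subseteq> topspace X \<and> Z \<noteq> {} \<and>
     (\<forall>V W. openin X V \<and> openin X W \<and> V \<inter> Z \<noteq> {} \<and> W \<inter> Z \<noteq> {} \<longrightarrow> V \<inter> W \<inter> Z \<noteq> {})"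
    using L unfolding irreducible_in_def by blast
next
  assume R: "Z \<subseteq> topspace X \<and> Z \<noteq> {} \<and>
     (\<forall>V W. openin X V \<and> openin X W \<and> V \<inter> Z \<noteq> {} \<and> W \<inter> Z \<noteq> {} \<longrightarrow> V \<inter> W \<inter> Z \<noteq> {})"
  have "Z \<subseteq> A \<or> Z \<subseteq> B" if "closedin X A" "closedin X B" "Z \<subseteq> A \<union> B" for A B
  proof (rule ccontr)
    assume "\<not> ?thesis"
    then have "(topspace X - A) \<inter> Z \<noteq> {}" "(topspace X - B) \<inter> Z \<noteq> {}" using R by blast+
    moreover have "openin X (topspace X - A)" "openin X (topspace X - B)" using that by blast+
    ultimately have "(topspace X - A) \<inter> (topspace X - B) \<inter> Z \<noteq> {}" using R by simp
    then show False using that by blast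
  qed
  then show "irreducible_in X Z" using R unfolding irreducible_in_def by blast
qed

text \<open>Generic points are described by open sets instead of closures, since this form is easier to transport.\<close>

lemma sober_space_generic_point:
  assumes "sober_space X" "closedin X Z" "irreducible_in X Z"
  obtains x where "x \<in> Z" "\<And>W. \<lbrakk>openin X W; W \<inter> Z \<noteq> {}\<rbrakk> \<Longrightarrow> x \<in> W"
    "\<And>y. \<lbrakk>y \<in> Z; \<And>W. \<lbrakk>openin X W; W \<inter> Z \<noteq> {}\<rbrakk> \<Longrightarrow> y \<in> W\<rbrakk> \<Longrightarrow> y = x"
proof -
  obtain x where x: "x \<in> topspace X" "Z = X closure_of {x}"
    and un: "\<And>y. \<lbrakk>y \<in> topspace X; Z = X closure_of {y}\<rbrakk> \<Longrightarrow> y = x"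
    using assms unfolding sober_space_def by metis
  show ?thesis
  proof (rule that)
    show "x \<in> Z" using x closure_of_singleton_iff[OF assms(2) x(1)] by blast
    show "x \<in> W" if "openin X W" "W \<inter> Z \<noteq> {}" for W
      using that x closure_of_singleton_iff[OF assms(2) x(1)] by blast
    fix y assume y: "y \<in> Z" "\<And>W. \<lbrakk>openin X W; W \<inter> Z \<noteq> {}\<rbrakk> \<Longrightarrow> y \<in> W"
    have "y \<in> topspace X" using y(1) closedin_subset[OF assms(2)] by blast
    then show "y = x" using un closure_of_singleton_iff[OF assms(2)] y by blast
  qed
qed

lemma sober_spaceI:
  assumes "\<And>Z. \<lbrakk>closedin X Z; irreducible_in X Z\<rbrakk> \<Longrightarrow> \<exists>x\<in>Z. \<forall>W. openin X W \<and> W \<inter> Z \<noteq> {} \<longrightarrow> x \<in> W"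
    and "\<And>Z x y. \<lbrakk>closedin X Z; irreducible_in X Z; x \<in> Z; y \<in> Z; \<forall>W. openin X W \<and> W \<inter> Z \<noteq> {} \<longrightarrow> x \<in> W;
        \<forall>W. openin X W \<and> W \<inter> Z \<noteq> {} \<longrightarrow> y \<in> W\<rbrakk> \<Longrightarrow> x = y"
  shows "sober_space X"
  unfolding sober_space_def
proof (intro allI impI; elim conjE)
  fix Z assume Z: "closedin X Z" "irreducible_in X Z"
  obtain x where x: "x \<in> Z" "\<forall>W. openin X W \<and> W \<inter> Z \<noteq> {} \<longrightarrow> x \<in> W" using assms(1)[OF Z] by blast
  have sub: "Z \<subseteq> topspace X" using closedin_subset[OF Z(1)] .
  show "\<exists>!x. x \<in> topspace X \<and> Z = X closure_of {x}"
  proof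
    show "x \<in> topspace X \<and> Z = X closure_of {x}" using x sub closure_of_singleton_iff[OF Z(1)] by blast
    fix y assume y: "y \<in> topspace X \<and> Z = X closure_of {y}"
    then have "y \<in> Z \<and> (\<forall>W. openin X W \<and> W \<inter> Z \<noteq> {} \<longrightarrow> y \<in> W)"
      using closure_of_singleton_iff[OF Z(1)] by blast
    then show "y = x" using assms(2)[OF Z _ x(1) _ x(2)] by blast
  qed
qed

text \<open>A neighbourhood base of a composable pair is given by the composable pairs in open rectangles.\<close>

lemma openin_composables: "openin (composables C) W \<longleftrightarrow>
   W \<subseteq> {(a, b). dm C a = cd C b} \<and>
   (\<forall>(a, b)\<in>W. \<exists>U V. openin (arrs C) U \<and> openin (arrs C) V \<and> a \<in> U \<and> b \<in> V \<and>
      (U \<times> V) \<inter> {(a, b). dm C a = cd C b} \<subseteq> W)" (is "_ \<longleftrightarrow> W \<subseteq> ?D \<and> _")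
proof
  assume "openin (composables C) W"
  then obtain T where T: "openin (prod_topology (arrs C) (arrs C)) T" "W = T \<inter> ?D"
    unfolding composables_def openin_subtopology by blast
  have "\<exists>U V. openin (arrs C) U \<and> openin (arrs C) V \<and> a \<in> U \<and> b \<in> V \<and> (U \<times> V) \<inter> ?D \<subseteq> W"
    if "(a, b) \<in> W" for a b
  proof -
    have "(a, b) \<in> T" using that T(2) by blast
    then obtain U V where "openin (arrs C) U" "openin (arrs C) V" "a \<in> U" "b \<in> V" "U \<times> V \<subseteq> T"
      using T(1)[unfolded openin_prod_topology_alt] by meson
    then show ?thesis using T(2) by blast
  qed
  then show "W \<subseteq> ?D \<and> (\<forall>(a, b)\<in>W. \<exists>U V. openin (arrs C) U \<and> openin (arrs C) V \<and> a \<in> U \<and> b \<in> V \<and> (U \<times> V) \<inter> ?D \<subseteq> W)"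
    using T by auto
next
  assume R: "W \<subseteq> ?D \<and> (\<forall>(a, b)\<in>W. \<exists>U V. openin (arrs C) U \<and> openin (arrs C) V \<and> a \<in> U \<and> b \<in> V \<and> (U \<times> V) \<inter> ?D \<subseteq> W)"
  define \<U> where "\<U> = {U \<times> V | U V. openin (arrs C) U \<and> openin (arrs C) V \<and> (U \<times> V) \<inter> ?D \<subseteq> W}"
  have "openin (prod_topology (arrs C) (arrs C)) (\<Union>\<U>)"
    by (rule openin_Union) (auto simp: \<U>_def openin_prod_Times_iff)
  moreover have "W = \<Union>\<U> \<inter> ?D"
  proof
    show "\<Union>\<U> \<inter> ?D \<subseteq> W" unfolding \<U>_def by blast
    show "W \<subseteq> \<Union>\<U> \<inter> ?D"
    proof
      fix p assume p: "p \<in> W"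
      then obtain U V where "openin (arrs C) U" "openin (arrs C) V" "p \<in> U \<times> V" "(U \<times> V) \<inter> ?D \<subseteq> W"
        using R by (cases p) fastforce
      then show "p \<in> \<Union>\<U> \<inter> ?D" using p R unfolding \<U>_def by blast
    qed
  qed
  ultimately show "openin (composables C) W" unfolding composables_def openin_subtopology by blast
qed

lemma topspace_composables:
  "topspace (composables C) = {(a, b). a \<in> ar_set C \<and> b \<in> ar_set C \<and> dm C a = cd C b}"
  by (auto simp: composables_def)

section \<open>The spectrum is an etale category\<close>

lemma Spec_simps [simp]:
  "unt (Spec S) = unit_of S" "dm (Spec S) = dom_of S" "cd (Spec S) = cod_of S" "cmp (Spec S) = comp_of S"
  "obs (Spec S) = topology_generated_by (ob_basic S ` projs S)"
  "arrs (Spec S) = topology_generated_by (ar_basic S ` carrier S)"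
  unfolding Spec_def unit_of_def[abs_def] comp_of_def[abs_def] ob_basic_def[abs_def] ar_basic_def[abs_def]
  by simp_all

context drs
begin

lemma ob_basic_Int: "\<lbrakk>e \<in> projs S; f \<in> projs S\<rbrakk> \<Longrightarrow> ob_basic S e \<inter> ob_basic S f = ob_basic S (e \<cdot> f)"
proof -
  assume ef: "e \<in> projs S" "f \<in> projs S"
  have "e \<cdot> f \<preceq> e" "e \<cdot> f \<preceq> f" using ef nat_leI_left nat_leI_right proj_carrier by metis+
  then have "e \<in> F \<and> f \<in> F" if "F \<in> obs_of S" "e \<cdot> f \<in> F" for F using obs_ofD(4)[OF that] ef by blast
  then show ?thesis unfolding ob_basic_def using obs_ofD(5) by blast
qed

lemma openin_obs: "openin (topology_generated_by (ob_basic S ` projs S)) W \<longleftrightarrow>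
    (\<forall>F\<in>W. \<exists>e\<in>projs S. F \<in> ob_basic S e \<and> ob_basic S e \<subseteq> W)"
  by (rule openin_generated_by_base) (metis IntI ob_basic_Int order_refl projs_closed)

lemma openin_arrs: "openin (topology_generated_by (ar_basic S ` carrier S)) W \<longleftrightarrow>
    (\<forall>A\<in>W. \<exists>s\<in>carrier S. A \<in> ar_basic S s \<and> ar_basic S s \<subseteq> W)"
proof (rule openin_generated_by_base)
  fix a b A assume a: "a \<in> carrier S" "b \<in> carrier S" "A \<in> ar_basic S a" "A \<in> ar_basic S b"
  then have A: "A \<in> arrs_of S" "a \<in> A" "b \<in> A" by (auto simp: ar_basic_def)
  then obtain c where "c \<in> A" "c \<preceq> a" "c \<preceq> b" using arrs_ofD(5) by blast
  then show "\<exists>c\<in>carrier S. A \<in> ar_basic S c \<and> ar_basic S c \<subseteq> ar_basic S a \<inter> ar_basic S b"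
    using ar_basic_mono a A arr_carrier by (intro bexI[of _ c]) (auto simp: ar_basic_def)
qed

lemma topspace_obs: "\<Union> (ob_basic S ` projs S) = obs_of S"
  unfolding ob_basic_def using obs_ofD(1,2) by fastforce

lemma topspace_arrs: "\<Union> (ar_basic S ` carrier S) = arrs_of S"
  unfolding ar_basic_def using arrs_ofD(1,2) by fastforce

lemma ob_set_Spec: "ob_set (Spec S) = obs_of S" and ar_set_Spec: "ar_set (Spec S) = arrs_of S"
  by (simp_all only: Spec_simps topology_generated_by_topspace topspace_obs topspace_arrs)

lemma open_ar_basic: "s \<in> carrier S \<Longrightarrow> openin (arrs (Spec S)) (ar_basic S s)"
  and open_ob_basic: "e \<in> projs S \<Longrightarrow> openin (obs (Spec S)) (ob_basic S e)"
  by (auto intro: topology_generated_by_Basis)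

lemma mem_ar_basic: "A \<in> ar_basic S s \<longleftrightarrow> A \<in> arrs_of S \<and> s \<in> A"
  and mem_ob_basic: "F \<in> ob_basic S e \<longleftrightarrow> F \<in> obs_of S \<and> e \<in> F"
  by (auto simp: ar_basic_def ob_basic_def)

lemma dom_image_ar_basic: "a \<in> carrier S \<Longrightarrow> dom_of S ` ar_basic S a = ob_basic S (lam S a)"
proof (intro equalityI subsetI)
  fix F assume a: "a \<in> carrier S"
  { assume "F \<in> dom_of S ` ar_basic S a"
    then show "F \<in> ob_basic S (lam S a)" using lam_mem_dom dom_of_obs by (auto simp: mem_ar_basic mem_ob_basic) }
  { assume "F \<in> ob_basic S (lam S a)"
    then have F: "F \<in> obs_of S" "lam S a \<in> F" by (auto simp: mem_ob_basic)
    then have "F = dom_of S (germ S a F)" "germ S a F \<in> ar_basic S a"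
      using dom_germ germ_arr germ_self a by (auto simp: mem_ar_basic)
    then show "F \<in> dom_of S ` ar_basic S a" by blast }
qed

lemma inj_on_dom: "inj_on (dom_of S) (ar_basic S a)"
  by (rule inj_onI) (metis arr_eqI_dom mem_ar_basic)

lemma inj_on_cod: "inj_on (cod_of S) (ar_basic S a)"
  by (rule inj_onI) (metis arr_eqI_cod mem_ar_basic)

lemma unit_image_ob_basic: "e \<in> projs S \<Longrightarrow> unit_of S ` ob_basic S e = ar_basic S e"
proof (intro equalityI subsetI)
  fix A assume e: "e \<in> projs S"
  { assume "A \<in> unit_of S ` ob_basic S e"
    then show "A \<in> ar_basic S e" using unit_of_arr mem_unit_of by (auto simp: mem_ar_basic mem_ob_basic) }
  { assume "A \<in> ar_basic S e"
    then have A: "A \<in> arrs_of S" "e \<in> A" by (auto simp: mem_ar_basic)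
    then have "A = unit_of S (dom_of S A)" "dom_of S A \<in> ob_basic S e"
      using arr_with_proj e dom_of_obs lam_mem_dom lam_proj by (auto simp: mem_ob_basic) metis
    then show "A \<in> unit_of S ` ob_basic S e" by blast }
qed

lemma arr_nhd:
  assumes "openin (arrs (Spec S)) W" "A \<in> W"
  obtains s where "s \<in> carrier S" "A \<in> arrs_of S" "s \<in> A" "ar_basic S s \<subseteq> W"
  using assms unfolding Spec_simps openin_arrs mem_ar_basic by blast

lemma ob_nhd:
  assumes "openin (obs (Spec S)) W" "F \<in> W"
  obtains e where "e \<in> projs S" "F \<in> obs_of S" "e \<in> F" "ob_basic S e \<subseteq> W"
  using assms unfolding Spec_simps openin_obs mem_ob_basic by blast

lemma continuous_unit: "continuous_map (obs (Spec S)) (arrs (Spec S)) (unit_of S)"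
proof (rule continuous_map_by_nhds)
  show "unit_of S \<in> ob_set (Spec S) \<rightarrow> ar_set (Spec S)" unfolding ob_set_Spec ar_set_Spec using unit_of_arr by blast
  fix F W assume F: "F \<in> ob_set (Spec S)" and W: "openin (arrs (Spec S)) W" "unit_of S F \<in> W"
  obtain s where s: "s \<in> carrier S" "s \<in> unit_of S F" "ar_basic S s \<subseteq> W" using arr_nhd[OF W] .
  obtain e where e: "e \<in> F" "e \<preceq> s" using s(2) by (auto simp: unit_of_def)
  have ep: "e \<in> projs S" "F \<in> obs_of S" using e F ob_proj unfolding ob_set_Spec by auto
  have "unit_of S ` ob_basic S e \<subseteq> W"
    unfolding unit_image_ob_basic[OF ep(1)] using ar_basic_mono[OF e(2) s(1)] s(3) by blast
  then show "\<exists>V. openin (obs (Spec S)) V \<and> F \<in> V \<and> unit_of S ` V \<subseteq> W"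
    using open_ob_basic[OF ep(1)] e(1) ep(2) mem_ob_basic by blast
qed

lemma continuous_dom: "continuous_map (arrs (Spec S)) (obs (Spec S)) (dom_of S)"
proof (rule continuous_map_by_nhds)
  show "dom_of S \<in> ar_set (Spec S) \<rightarrow> ob_set (Spec S)" unfolding ob_set_Spec ar_set_Spec using dom_of_obs by blast
  fix A W assume A: "A \<in> ar_set (Spec S)" and W: "openin (obs (Spec S)) W" "dom_of S A \<in> W"
  obtain e where e: "e \<in> projs S" "e \<in> dom_of S A" "ob_basic S e \<subseteq> W" using ob_nhd[OF W] .
  obtain a where a: "a \<in> A" "lam S a \<preceq> e" using e(2) by (auto simp: mem_dom_of)
  have ac: "a \<in> carrier S" "A \<in> arrs_of S" using A a arr_carrier unfolding ar_set_Spec by auto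
  have "dom_of S B \<in> ob_basic S e" if "B \<in> ar_basic S a" for B
    using that a(2) e(1) dom_of_obs unfolding mem_ar_basic mem_ob_basic mem_dom_of by blast
  then show "\<exists>V. openin (arrs (Spec S)) V \<and> A \<in> V \<and> dom_of S ` V \<subseteq> W"
    using open_ar_basic[OF ac(1)] a(1) ac(2) e(3) mem_ar_basic by blast
qed

lemma open_map_unit: "open_map (obs (Spec S)) (arrs (Spec S)) (unit_of S)"
proof (rule open_map_by_nhds)
  fix F V assume V: "openin (obs (Spec S)) V" "F \<in> V"
  obtain e where e: "e \<in> projs S" "F \<in> obs_of S" "e \<in> F" "ob_basic S e \<subseteq> V" using ob_nhd[OF V] .
  show "\<exists>W. openin (arrs (Spec S)) W \<and> unit_of S F \<in> W \<and> W \<subseteq> unit_of S ` V"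
  proof (intro exI conjI)
    show "openin (arrs (Spec S)) (ar_basic S e)" by (rule open_ar_basic[OF proj_carrier[OF e(1)]])
    show "unit_of S F \<in> ar_basic S e" "ar_basic S e \<subseteq> unit_of S ` V"
      using e(2-4) unfolding unit_image_ob_basic[OF e(1), symmetric]
      by (auto simp: mem_ob_basic)
  qed
qed

lemma open_map_dom: "open_map (arrs (Spec S)) (obs (Spec S)) (dom_of S)"
proof (rule open_map_by_nhds)
  fix A V assume V: "openin (arrs (Spec S)) V" "A \<in> V"
  obtain a where a: "a \<in> carrier S" "A \<in> arrs_of S" "a \<in> A" "ar_basic S a \<subseteq> V" using arr_nhd[OF V] .
  show "\<exists>W. openin (obs (Spec S)) W \<and> dom_of S A \<in> W \<and> W \<subseteq> dom_of S ` V"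
  proof (intro exI conjI)
    show "openin (obs (Spec S)) (ob_basic S (lam S a))" by (rule open_ob_basic[OF lam_closed[OF a(1)]])
    show "dom_of S A \<in> ob_basic S (lam S a)" "ob_basic S (lam S a) \<subseteq> dom_of S ` V"
      using a(2-4) unfolding dom_image_ar_basic[OF a(1), symmetric] by (auto simp: mem_ar_basic)
  qed
qed

text \<open>Prime filters through a common element are separated by their domains.\<close>

lemma local_homeomorphism_dom: "local_homeomorphism (arrs (Spec S)) (obs (Spec S)) (dom_of S)"
proof (rule local_homeomorphismI[OF continuous_dom open_map_dom])
  fix A assume "A \<in> ar_set (Spec S)"
  then obtain a where "A \<in> ar_basic S a" "a \<in> carrier S"
    unfolding ar_set_Spec mem_ar_basic using arrs_ofD(2) arr_carrier by (metis ex_in_conv)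
  then show "\<exists>U. openin (arrs (Spec S)) U \<and> A \<in> U \<and> inj_on (dom_of S) U"
    using open_ar_basic inj_on_dom by blast
qed

lemma continuous_comp: "continuous_map (composables (Spec S)) (arrs (Spec S)) (\<lambda>(A, B). comp_of S A B)"
proof (rule continuous_map_by_nhds)
  let ?m = "\<lambda>(A, B). comp_of S A B" and ?D = "{(A, B). dm (Spec S) A = cd (Spec S) B}"
  show "?m \<in> topspace (composables (Spec S)) \<rightarrow> ar_set (Spec S)"
    unfolding topspace_composables ar_set_Spec using comp_of_arr(1) by auto
  fix p W assume p: "p \<in> topspace (composables (Spec S))" and W: "openin (arrs (Spec S)) W" "?m p \<in> W"
  obtain A B where AB: "p = (A, B)" "A \<in> arrs_of S" "B \<in> arrs_of S" "dom_of S A = cod_of S B"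
    using p unfolding topspace_composables ar_set_Spec by auto
  obtain s where s: "s \<in> carrier S" "s \<in> comp_of S A B" "ar_basic S s \<subseteq> W" using arr_nhd[OF W] AB(1) by auto
  obtain a b where ab: "a \<in> A" "b \<in> B" "a \<cdot> b \<preceq> s" using s(2) by (auto simp: comp_of_def)
  have c: "a \<in> carrier S" "b \<in> carrier S" using ab AB arr_carrier by auto
  let ?V = "(ar_basic S a \<times> ar_basic S b) \<inter> ?D"
  have "openin (composables (Spec S)) ?V"
    unfolding openin_composables using open_ar_basic[OF c(1)] open_ar_basic[OF c(2)] by blast
  moreover have "p \<in> ?V" using AB ab by (simp add: mem_ar_basic)
  moreover have "?m p' \<in> W" if p': "p' \<in> ?V" for p'
  proof -
    obtain A' B' where A': "p' = (A', B')" "A' \<in> arrs_of S" "a \<in> A'" "B' \<in> arrs_of S" "b \<in> B'" "dom_of S A' = cod_of S B'"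
      using p' by (auto simp: mem_ar_basic)
    have "s \<in> comp_of S A' B'" using A' ab(3) s(1) unfolding comp_of_def by blast
    then show ?thesis using s(3) A' comp_of_arr(1) by (auto simp: mem_ar_basic)
  qed
  ultimately show "\<exists>V. openin (composables (Spec S)) V \<and> p \<in> V \<and> ?m ` V \<subseteq> W" by blast
qed

lemma open_map_comp: "open_map (composables (Spec S)) (arrs (Spec S)) (\<lambda>(A, B). comp_of S A B)"
proof (rule open_map_by_nhds)
  let ?m = "\<lambda>(A, B). comp_of S A B" and ?D = "{(A, B). dm (Spec S) A = cd (Spec S) B}"
  fix p W assume W: "openin (composables (Spec S)) W" and p: "p \<in> W"
  obtain A B where AB: "p = (A, B)" "A \<in> arrs_of S" "B \<in> arrs_of S" "dom_of S A = cod_of S B"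
    using openin_subset[OF W] p unfolding topspace_composables ar_set_Spec by auto
  obtain U V where UV: "openin (arrs (Spec S)) U" "A \<in> U" "openin (arrs (Spec S)) V" "B \<in> V" "(U \<times> V) \<inter> ?D \<subseteq> W"
    using W[unfolded openin_composables] p AB(1) by blast
  obtain a where a: "a \<in> carrier S" "a \<in> A" "ar_basic S a \<subseteq> U" using arr_nhd[OF UV(1,2)] .
  obtain b where b: "b \<in> carrier S" "b \<in> B" "ar_basic S b \<subseteq> V" using arr_nhd[OF UV(3,4)] .
  have "ar_basic S (a \<cdot> b) \<subseteq> ?m ` W"
  proof
    fix D assume "D \<in> ar_basic S (a \<cdot> b)"
    then have "D \<in> arrs_of S" "a \<cdot> b \<in> D" by (auto simp: mem_ar_basic)
    then obtain A' B' where D: "A' \<in> arrs_of S" "B' \<in> arrs_of S" "a \<in> A'" "b \<in> B'" "dom_of S A' = cod_of S B'"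
      "comp_of S A' B' = D" using tms_mem_split a(1) b(1) by metis
    then have "(A', B') \<in> W" using a(3) b(3) UV(5) by (auto simp: subset_iff mem_ar_basic)
    then show "D \<in> ?m ` W" using D(6) by force
  qed
  moreover have "?m p \<in> ar_basic S (a \<cdot> b)" using AB a b tms_mem_comp_of comp_of_arr by (auto simp: mem_ar_basic)
  ultimately show "\<exists>T. openin (arrs (Spec S)) T \<and> ?m p \<in> T \<and> T \<subseteq> ?m ` W"
    using open_ar_basic[OF tms_closed[OF a(1) b(1)]] by blast
qed

lemma comp_unit: assumes A: "A \<in> arrs_of S" shows "comp_of S A (unit_of S (dom_of S A)) = A"
proof -
  obtain a where a: "a \<in> A" using arrs_ofD(2)[OF A] by blast
  note D = dom_of_obs[OF A]
  note U = unit_of_arr[OF D] dom_unit_of[OF D] cod_unit_of[OF D]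
  have "a \<cdot> lam S a \<in> comp_of S A (unit_of S (dom_of S A))"
    using tms_mem_comp_of A U(1) a mem_unit_of D lam_mem_dom by auto
  then have "a \<in> comp_of S A (unit_of S (dom_of S A))" using tms_lam arr_carrier A a by simp
  then show ?thesis
    using arr_eqI_dom[OF comp_of_arr(1)[OF A U(1)] A _ _ a] comp_of_arr(2)[OF A U(1)] U by simp
qed

lemma comp_assoc:
  assumes A: "A \<in> arrs_of S" "B \<in> arrs_of S" "C \<in> arrs_of S" "dom_of S A = cod_of S B" "dom_of S B = cod_of S C"
  shows "comp_of S (comp_of S A B) C = comp_of S A (comp_of S B C)"
proof -
  obtain a b c where a: "a \<in> A" "b \<in> B" "c \<in> C" using arrs_ofD(2) A by (metis ex_in_conv)
  note AB = comp_of_arr[OF A(1,2,4)] and BC = comp_of_arr[OF A(2,3,5)] cod_comp_of[OF A(2,3,5)]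
  have 1: "comp_of S (comp_of S A B) C \<in> arrs_of S" "dom_of S (comp_of S (comp_of S A B) C) = dom_of S C"
    using comp_of_arr[OF AB(1) A(3)] AB A by auto
  have 2: "comp_of S A (comp_of S B C) \<in> arrs_of S" "dom_of S (comp_of S A (comp_of S B C)) = dom_of S C"
    using comp_of_arr[OF A(1) BC(1)] BC A by auto
  have "a \<cdot> b \<cdot> c \<in> comp_of S (comp_of S A B) C" "a \<cdot> (b \<cdot> c) \<in> comp_of S A (comp_of S B C)"
    using tms_mem_comp_of A AB BC a by auto
  moreover have "a \<cdot> b \<cdot> c = a \<cdot> (b \<cdot> c)" using tms_assoc[of a b c] a A arr_carrier by simp
  ultimately show ?thesis using arr_eqI_dom 1 2 by metis
qed

end

lemma Spec_opp_topologies: "arrs (Spec (opp S)) = arrs (Spec S)" "obs (Spec (opp S)) = obs (Spec S)"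
  by (simp_all add: ar_basic_def[abs_def] ob_basic_def[abs_def])

context drs
begin

lemmas continuous_cod = drs.continuous_dom[OF drs_opp, unfolded Spec_opp_topologies prime_filters_opp]
lemmas local_homeomorphism_cod = drs.local_homeomorphism_dom[OF drs_opp, unfolded Spec_opp_topologies prime_filters_opp]
lemmas unit_comp = drs.comp_unit[OF drs_opp, simplified]

lemma etale_Spec: "etale_category (Spec S)"
proof -
  have "topological_category (Spec S)"
    unfolding topological_category_def ob_set_Spec ar_set_Spec Spec_simps(1-4)
    by (intro conjI ballI impI; (rule continuous_unit continuous_dom continuous_cod continuous_comp dom_unit_of
        cod_unit_of comp_unit unit_comp comp_of_arr(2) cod_comp_of comp_assoc)?; (elim conjE)?; assumption?)
  then show ?thesis unfolding etale_category_def Spec_simps(1-4)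
    using local_homeomorphism_dom local_homeomorphism_cod open_map_unit open_map_comp by simp
qed

section \<open>Spectral, Hausdorff and compact spectra\<close>

lemma compact_ar_basic: assumes t: "t \<in> carrier S" shows "compactin (arrs (Spec S)) (ar_basic S t)"
  unfolding compactin_def
proof (intro conjI allI impI)
  show "ar_basic S t \<subseteq> ar_set (Spec S)" unfolding ar_set_Spec by (auto simp: mem_ar_basic)
next
  fix \<U> assume U: "(\<forall>U\<in>\<U>. openin (arrs (Spec S)) U) \<and> ar_basic S t \<subseteq> \<Union>\<U>"
  let ?I = "{s \<in> carrier S. \<exists>U\<in>\<U>. ar_basic S s \<subseteq> U}"
  have "ar_basic S t \<subseteq> (\<Union>s\<in>?I. ar_basic S s)"
  proof
    fix A assume "A \<in> ar_basic S t"
    then obtain U where "U \<in> \<U>" "A \<in> U" using U by blast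
    then obtain s where "s \<in> carrier S" "A \<in> ar_basic S s" "ar_basic S s \<subseteq> U"
      using U unfolding Spec_simps openin_arrs by blast
    then show "A \<in> (\<Union>s\<in>?I. ar_basic S s)" using \<open>U \<in> \<U>\<close> by blast
  qed
  then obtain I' where I': "finite I'" "I' \<subseteq> ?I" "ar_basic S t \<subseteq> (\<Union>s\<in>I'. ar_basic S s)"
    using ar_basic_compact[OF t, of ?I] by blast
  then have "\<forall>s\<in>I'. \<exists>U\<in>\<U>. ar_basic S s \<subseteq> U" by blast
  then obtain h where h: "\<And>s. s \<in> I' \<Longrightarrow> h s \<in> \<U> \<and> ar_basic S s \<subseteq> h s" by metis
  then show "\<exists>\<F>. finite \<F> \<and> \<F> \<subseteq> \<U> \<and> ar_basic S t \<subseteq> \<Union>\<F>"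
    using I' by (intro exI[of _ "h ` I'"]) fastforce
qed

lemma compact_ob_basic: assumes "e \<in> projs S" shows "compactin (obs (Spec S)) (ob_basic S e)"
  using image_compactin[OF compact_ar_basic continuous_dom, of e] dom_image_ar_basic[of e] assms proj_carrier lam_proj
  by simp

end

text \<open>The generic point of an irreducible closed set \<open>Z\<close> consists of all elements whose basic open set meets \<open>Z\<close>.\<close>

lemma sober_prime_filter_space:
  fixes L :: "'a gorder"
  assumes L: "partial_order L" and z: "z \<in> carrier L" "\<And>x. x \<in> carrier L \<Longrightarrow> z \<sqsubseteq>\<^bsub>L\<^esub> x"
  shows "sober_space (topology_generated_by ((\<lambda>s. {A. prime_filter L A \<and> s \<in> A}) ` carrier L))"
proof -
  interpret partial_order L by fact
  define U where "U s = {A. prime_filter L A \<and> s \<in> A}" for s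
  define X where "X = topology_generated_by (U ` carrier L)"
  have U_mono: "U s \<subseteq> U t" if "s \<sqsubseteq>\<^bsub>L\<^esub> t" "s \<in> carrier L" "t \<in> carrier L" for s t
    using that unfolding U_def prime_filter_def by blast
  have filt: "\<exists>c\<in>A. c \<sqsubseteq>\<^bsub>L\<^esub> s \<and> c \<sqsubseteq>\<^bsub>L\<^esub> t" if "A \<in> U s" "A \<in> U t" for A s t
    using that unfolding U_def prime_filter_def by blast
  have UD: "s \<in> carrier L" "A \<subseteq> carrier L" if "A \<in> U s" for A s
    using that unfolding U_def prime_filter_def by blast+
  have UI: "A \<in> U t" if "t \<in> A" "A \<in> U s" for A s t using that unfolding U_def by blast
  have op: "openin X W \<longleftrightarrow> (\<forall>A\<in>W. \<exists>s\<in>carrier L. A \<in> U s \<and> U s \<subseteq> W)" for W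
    unfolding X_def
  proof (rule openin_generated_by_base)
    fix s t A assume *: "s \<in> carrier L" "t \<in> carrier L" "A \<in> U s" "A \<in> U t"
    then obtain c where c: "c \<in> A" "c \<sqsubseteq>\<^bsub>L\<^esub> s" "c \<sqsubseteq>\<^bsub>L\<^esub> t" using filt by blast
    then have "c \<in> carrier L" "A \<in> U c" using UD * UI by blast+
    then show "\<exists>c\<in>carrier L. A \<in> U c \<and> U c \<subseteq> U s \<inter> U t" using U_mono c * by (intro bexI[of _ c]) auto
  qed
  have top: "topspace X = {A. prime_filter L A}"
    unfolding X_def topology_generated_by_topspace U_def prime_filter_def by blast
  have U0: "U z = {}" unfolding U_def prime_filter_def using z by blast
  have opU: "openin X (U s)" if "s \<in> carrier L" for s unfolding op using that by blast
  show ?thesis unfolding U_def[symmetric] X_def[symmetric]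
  proof (rule sober_spaceI)
    fix Z assume clo: "closedin X Z" and "irreducible_in X Z"
    then have Z: "Z \<subseteq> {A. prime_filter L A}" "Z \<noteq> {}"
      and irr: "\<And>V W. \<lbrakk>openin X V; openin X W; V \<inter> Z \<noteq> {}; W \<inter> Z \<noteq> {}\<rbrakk> \<Longrightarrow> V \<inter> W \<inter> Z \<noteq> {}"
      unfolding irreducible_in_iff top by auto
    define P where "P = {s \<in> carrier L. U s \<inter> Z \<noteq> {}}"
    have P: "prime_filter L P" unfolding prime_filter_def
    proof (intro conjI ballI impI)
      show "P \<subset> carrier L" using U0 z unfolding P_def by blast
      obtain A where "A \<in> Z" "prime_filter L A" using Z by blast
      then obtain s where "s \<in> A" "s \<in> carrier L" unfolding prime_filter_def by blast
      then show "P \<noteq> {}" using \<open>A \<in> Z\<close> \<open>prime_filter L A\<close> unfolding P_def U_def by blast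
    next
      fix a b assume "a \<in> P" "b \<in> carrier L" "a \<sqsubseteq>\<^bsub>L\<^esub> b"
      then show "b \<in> P" using U_mono unfolding P_def by blast
    next
      fix a b assume "a \<in> P" "b \<in> P"
      then have "U a \<inter> U b \<inter> Z \<noteq> {}" using irr opU unfolding P_def by blast
      then obtain A where A: "A \<in> U a" "A \<in> U b" "A \<in> Z" by blast
      then obtain c where "c \<in> A" "c \<sqsubseteq>\<^bsub>L\<^esub> a" "c \<sqsubseteq>\<^bsub>L\<^esub> b" using filt by blast
      moreover from this have "A \<in> U c" "c \<in> carrier L" using UI[OF _ A(1)] UD(2)[OF A(1)] by auto
      ultimately show "\<exists>c\<in>P. c \<sqsubseteq>\<^bsub>L\<^esub> a \<and> c \<sqsubseteq>\<^bsub>L\<^esub> b" using A(3) unfolding P_def by blast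
    next
      fix a b x assume ab: "a \<in> carrier L" "b \<in> carrier L" "x \<in> P" "is_lub L x {a, b}"
      then obtain A where "A \<in> U x" "A \<in> Z" unfolding P_def by blast
      moreover from this have "a \<in> A \<or> b \<in> A" using ab unfolding U_def prime_filter_def by blast
      ultimately show "a \<in> P \<or> b \<in> P" using UI ab unfolding P_def by blast
    qed
    have gen: "P \<in> W" if W: "openin X W" "W \<inter> Z \<noteq> {}" for W
    proof -
      obtain A s where "A \<in> Z" "s \<in> carrier L" "A \<in> U s" "U s \<subseteq> W" using W op by blast
      then show ?thesis using P unfolding P_def U_def by blast
    qed
    have "P \<in> Z"
    proof (rule ccontr)
      assume "P \<notin> Z"
      then obtain s where "P \<in> U s" "U s \<inter> Z = {}" using op[of "topspace X - Z"] clo P top by blast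
      then show False unfolding P_def U_def by blast
    qed
    then show "\<exists>x\<in>Z. \<forall>W. openin X W \<and> W \<inter> Z \<noteq> {} \<longrightarrow> x \<in> W" using gen by blast
    have sub: "x \<subseteq> y" if "x \<in> Z" "y \<in> Z" "\<forall>W. openin X W \<and> W \<inter> Z \<noteq> {} \<longrightarrow> y \<in> W" for x y
    proof
      fix s assume "s \<in> x"
      then have "s \<in> carrier L" "x \<in> U s" using Z(1) that(1) unfolding U_def prime_filter_def by blast+
      then have "y \<in> U s" using that(1,3) opU by blast
      then show "s \<in> y" unfolding U_def by blast
    qed
    fix x y assume "x \<in> Z" "y \<in> Z" "\<forall>W. openin X W \<and> W \<inter> Z \<noteq> {} \<longrightarrow> x \<in> W" "\<forall>W. openin X W \<and> W \<inter> Z \<noteq> {} \<longrightarrow> y \<in> W"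
    then show "x = y" using sub[of x y] sub[of y x] by (intro equalityI) simp_all
  qed
qed

context drs
begin

lemma sober_obs: "sober_space (obs (Spec S))"
proof -
  interpret L: Lattice.lattice "proj_ord S" by (rule lattice_projs)
  have "sober_space (topology_generated_by ((\<lambda>s. {A. prime_filter (proj_ord S) A \<and> s \<in> A}) ` carrier (proj_ord S)))"
    by (rule sober_prime_filter_space[of _ \<zero>])
      (use zero_proj zero_le proj_carrier L.partial_order_axioms in \<open>auto simp: proj_ord_simps\<close>)
  then show ?thesis by (simp add: proj_ord_simps ob_basic_def[abs_def] obs_of_def)
qed

lemma sober_arrs: "sober_space (arrs (Spec S))"
proof -
  have "sober_space (topology_generated_by ((\<lambda>s. {A. prime_filter (nat_ord S) A \<and> s \<in> A}) ` carrier (nat_ord S)))"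
    by (rule sober_prime_filter_space[of _ \<zero>])
      (use zero_carrier zero_le partial_order_nat_ord in \<open>auto simp: carrier_nat_ord\<close>)
  then show ?thesis by (simp add: carrier_nat_ord ar_basic_def[abs_def] arrs_of_def)
qed

lemma spectral_obs: "spectral_space (obs (Spec S))"
  unfolding spectral_space_def
proof (intro conjI sober_obs exI[of _ "ob_basic S ` projs S"])
  show "openin (obs (Spec S)) = arbitrary union_of (\<lambda>U. U \<in> ob_basic S ` projs S)"
    unfolding Spec_simps by (intro ext) (auto simp: openin_obs arbitrary_union_of_alt)
qed (use open_ob_basic compact_ob_basic ob_basic_Int projs_closed in auto)

lemma glb2_iff: "\<lbrakk>a \<in> carrier S; b \<in> carrier S\<rbrakk> \<Longrightarrow> is_glb (nat_ord S) x {a, b} \<longleftrightarrow>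
    x \<in> carrier S \<and> x \<preceq> a \<and> x \<preceq> b \<and> (\<forall>y\<in>carrier S. y \<preceq> a \<longrightarrow> y \<preceq> b \<longrightarrow> y \<preceq> x)"
  unfolding greatest_def Lower_def carrier_nat_ord by auto

text \<open>A prime filter containing \<open>a\<close> and \<open>b\<close> contains a common lower bound of both, which lies below their meet.\<close>

lemma ar_basic_glb:
  assumes ab: "a \<in> carrier S" "b \<in> carrier S" and x: "is_glb (nat_ord S) x {a, b}"
  shows "ar_basic S a \<inter> ar_basic S b = ar_basic S x"
proof
  note x = x[unfolded glb2_iff[OF ab]]
  show "ar_basic S x \<subseteq> ar_basic S a \<inter> ar_basic S b" using ar_basic_mono x ab by auto
  show "ar_basic S a \<inter> ar_basic S b \<subseteq> ar_basic S x"
  proof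
    fix A assume "A \<in> ar_basic S a \<inter> ar_basic S b"
    then have A: "A \<in> arrs_of S" "a \<in> A" "b \<in> A" by (auto simp: mem_ar_basic)
    then obtain c where c: "c \<in> A" "c \<preceq> a" "c \<preceq> b" using arrs_ofD(5) by blast
    then have "c \<preceq> x" using x A arr_carrier by blast
    then show "A \<in> ar_basic S x" using arrs_ofD(4)[OF A(1) c(1)] x A mem_ar_basic by blast
  qed
qed

lemma spectral_arrs:
  assumes "has_meets S" shows "spectral_space (arrs (Spec S))"
  unfolding spectral_space_def
proof (intro conjI sober_arrs exI[of _ "ar_basic S ` carrier S"])
  show "openin (arrs (Spec S)) = arbitrary union_of (\<lambda>U. U \<in> ar_basic S ` carrier S)"
    unfolding Spec_simps by (intro ext) (auto simp: openin_arrs arbitrary_union_of_alt)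
  show "\<forall>U\<in>ar_basic S ` carrier S. \<forall>V\<in>ar_basic S ` carrier S. U \<inter> V \<in> ar_basic S ` carrier S"
  proof (intro ballI; elim imageE)
    fix U V a b assume ab: "U = ar_basic S a" "V = ar_basic S b" "a \<in> carrier S" "b \<in> carrier S"
    then obtain x where x: "is_glb (nat_ord S) x {a, b}" using assms unfolding has_meets_def by blast
    then have "x \<in> carrier S" using glb2_iff ab by blast
    then show "U \<inter> V \<in> ar_basic S ` carrier S" using ar_basic_glb[OF ab(3,4) x] ab by blast
  qed
qed (use open_ar_basic compact_ar_basic in auto)

lemma identity_proj:
  assumes i: "i \<in> carrier S" "\<And>a. a \<in> carrier S \<Longrightarrow> i \<cdot> a = a \<and> a \<cdot> i = a"
  shows "i \<in> projs S"
  using i tms_lam[of i] lam_closed[of i] lam_carrier[of i] by metis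

lemma compact_space_obs: assumes "has_identity S" shows "compact_space (obs (Spec S))"
proof -
  obtain i where i: "i \<in> carrier S" "\<And>a. a \<in> carrier S \<Longrightarrow> i \<cdot> a = a \<and> a \<cdot> i = a"
    using assms unfolding has_identity_def by blast
  note ip = identity_proj[OF i]
  have "ob_basic S i = obs_of S"
  proof -
    have "i \<in> F" if F: "F \<in> obs_of S" for F
    proof -
      obtain e where e: "e \<in> F" using obs_ofD(2)[OF F] by blast
      then have "e \<preceq> i" using i ip nat_le_proj ob_proj F proj_carrier by metis
      then show ?thesis using obs_ofD(4)[OF F e ip] by blast
    qed
    then show ?thesis by (auto simp: ob_basic_def)
  qed
  then show ?thesis using compact_ob_basic[OF ip] by (simp add: compact_space_def topspace_obs)
qed

lemma proj_complement:
  assumes "generalized_boolean_algebra (proj_ord S)" "e \<in> projs S" "f \<in> projs S" "e \<preceq> f"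
  obtains z where "z \<in> projs S" "e \<cdot> z = \<zero>" "e \<oplus> z = f"
  using assms unfolding generalized_boolean_algebra_def by (auto simp: proj_ord_simps meet_proj)

text \<open>Relative to some \<open>f \<in> G\<close>, take for \<open>z\<close> the complement of \<open>e \<cdot> f\<close> in \<open>f\<close>.\<close>

lemma separate_obs:
  assumes B: "generalized_boolean_algebra (proj_ord S)" and F: "F \<in> obs_of S" "G \<in> obs_of S" "e \<in> F" "e \<notin> G"
  shows "\<exists>z\<in>G. e \<cdot> z = \<zero>"
proof -
  obtain f where f: "f \<in> G" using obs_ofD(2) F by blast
  have p: "e \<in> projs S" "f \<in> projs S" using F f ob_proj by auto
  have ef: "e \<cdot> f \<preceq> f" "e \<cdot> f \<preceq> e" using p nat_leI_left nat_leI_right proj_carrier by metis+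
  obtain z where z: "z \<in> projs S" "e \<cdot> f \<cdot> z = \<zero>" "e \<cdot> f \<oplus> z = f" using proj_complement[OF B _ p(2) ef(1)] p projs_closed by blast
  have "e \<cdot> f \<notin> G" using obs_ofD(4)[OF F(2) _ p(1) ef(2)] F by blast
  then have "z \<in> G" using obs_ofD(6)[OF F(2), of "e \<cdot> f" z] z f p projs_closed by auto
  moreover have "e \<cdot> z = \<zero>"
  proof -
    have "z \<preceq> f" using pjoin_right[of "e \<cdot> f" z] z p projs_closed by auto
    then have "f \<cdot> z = z" using nat_le_proj z p projs_comm by metis
    then show ?thesis using z p tms_assoc proj_carrier by metis
  qed
  ultimately show ?thesis by blast
qed

lemma obs_disjoint: "\<lbrakk>e \<in> projs S; z \<in> projs S; e \<cdot> z = \<zero>\<rbrakk> \<Longrightarrow> ob_basic S e \<inter> ob_basic S z = {}"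
  using ob_basic_Int[of e z] obs_ofD(3) by (auto simp: ob_basic_def)

lemma Hausdorff_obs:
  assumes B: "generalized_boolean_algebra (proj_ord S)" shows "Hausdorff_space (obs (Spec S))"
  unfolding Hausdorff_space_def ob_set_Spec
proof (intro allI impI)
  have *: "\<exists>U V. openin (obs (Spec S)) U \<and> openin (obs (Spec S)) V \<and> F \<in> U \<and> G \<in> V \<and> disjnt U V"
    if F: "F \<in> obs_of S" "G \<in> obs_of S" "e \<in> F" "e \<notin> G" for F G e
  proof -
    obtain z where "z \<in> G" "e \<cdot> z = \<zero>" using separate_obs[OF B F] by blast
    moreover from this have "e \<in> projs S" "z \<in> projs S" using F ob_proj by auto
    ultimately have "openin (obs (Spec S)) (ob_basic S e)" "openin (obs (Spec S)) (ob_basic S z)"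
      "F \<in> ob_basic S e" "G \<in> ob_basic S z" "disjnt (ob_basic S e) (ob_basic S z)"
      using F open_ob_basic obs_disjoint by (auto simp: mem_ob_basic disjnt_def)
    then show ?thesis by blast
  qed
  fix F G assume FG: "F \<in> obs_of S \<and> G \<in> obs_of S \<and> F \<noteq> G"
  then obtain e where "e \<in> F \<and> e \<notin> G \<or> e \<in> G \<and> e \<notin> F" by blast
  then show "\<exists>U V. openin (obs (Spec S)) U \<and> openin (obs (Spec S)) V \<and> F \<in> U \<and> G \<in> V \<and> disjnt U V"
    using *[of F G e] *[of G F e] FG by (metis disjnt_sym)
qed

text \<open>Prime filters with different domains are separated by their domains.  With equal domains choose elements \<open>a\<close>
  and \<open>b\<close> of each: the domain of their meet is not in the common domain, and restricting \<open>a\<close> and \<open>b\<close> to its relative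
  complement gives disjoint basic sets.\<close>

lemma Hausdorff_arrs:
  assumes B: "generalized_boolean_algebra (proj_ord S)" and M: "has_meets S"
  shows "Hausdorff_space (arrs (Spec S))"
  unfolding Hausdorff_space_def ar_set_Spec
proof (intro allI impI)
  fix A A' assume AA: "A \<in> arrs_of S \<and> A' \<in> arrs_of S \<and> A \<noteq> A'"
  show "\<exists>U V. openin (arrs (Spec S)) U \<and> openin (arrs (Spec S)) V \<and> A \<in> U \<and> A' \<in> V \<and> disjnt U V"
  proof (cases "dom_of S A = dom_of S A'")
    case False
    moreover have "dom_of S A \<in> obs_of S" "dom_of S A' \<in> obs_of S" using AA dom_of_obs by auto
    ultimately obtain U V where UV: "openin (obs (Spec S)) U" "openin (obs (Spec S)) V" "dom_of S A \<in> U" "dom_of S A' \<in> V"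
      "disjnt U V"
      using Hausdorff_obs[OF B] unfolding Hausdorff_space_def ob_set_Spec by blast
    let ?U = "{A \<in> arrs_of S. dom_of S A \<in> U}" and ?V = "{A \<in> arrs_of S. dom_of S A \<in> V}"
    have "openin (arrs (Spec S)) ?U" "openin (arrs (Spec S)) ?V"
      using openin_continuous_map_preimage[OF continuous_dom UV(1)] openin_continuous_map_preimage[OF continuous_dom UV(2)]
      unfolding ar_set_Spec by auto
    moreover have "A \<in> ?U" "A' \<in> ?V" "disjnt ?U ?V" using UV AA by (auto simp: disjnt_def)
    ultimately show ?thesis by blast
  next
    case True
    obtain a b where ab: "a \<in> A" "b \<in> A'" using AA arrs_ofD(2) by blast
    then have c: "a \<in> carrier S" "b \<in> carrier S" using AA arr_carrier by auto
    obtain x where x0: "is_glb (nat_ord S) x {a, b}" using M c unfolding has_meets_def by blast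
    note x = x0[unfolded glb2_iff[OF c]]
    have lx: "lam S x \<notin> dom_of S A"
    proof
      assume "lam S x \<in> dom_of S A"
      then have "a \<cdot> lam S x \<in> A" "b \<cdot> lam S x \<in> A'"
        using dom_mem_iff[of A a] dom_mem_iff[of A' b] AA ab True x lam_closed by auto
      then have "x \<in> A" "x \<in> A'" using x c nat_le_lam by auto
      then show False using arr_eqI_dom AA True by blast
    qed
    have D: "dom_of S A \<in> obs_of S" "lam S a \<in> dom_of S A" using AA dom_of_obs lam_mem_dom ab by auto
    have lp: "lam S x \<in> projs S" "lam S a \<in> projs S" "lam S x \<preceq> lam S a"
      using x c lam_closed nat_le_lam_mono by auto
    obtain z where z: "z \<in> projs S" "lam S x \<cdot> z = \<zero>" "lam S x \<oplus> z = lam S a" using proj_complement[OF B lp] by blast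
    have zD: "z \<in> dom_of S A" using obs_ofD(6)[OF D(1) lp(1) z(1)] D z lx by auto
    have "a \<cdot> z \<in> A" "b \<cdot> z \<in> A'" 
      using dom_mem_iff[of A a] dom_mem_iff[of A' b] AA ab True z zD by auto
    moreover have "ar_basic S (a \<cdot> z) \<inter> ar_basic S (b \<cdot> z) = {}"
    proof (rule ccontr)
      assume "ar_basic S (a \<cdot> z) \<inter> ar_basic S (b \<cdot> z) \<noteq> {}"
      then obtain C where C: "C \<in> arrs_of S" "a \<cdot> z \<in> C" "b \<cdot> z \<in> C"
        unfolding mem_ar_basic ex_in_conv[symmetric] Int_iff by blast
      have az: "a \<cdot> z \<preceq> a" "b \<cdot> z \<preceq> b" using z c nat_leI_right by metis+
      then have "C \<in> ar_basic S x" using ar_basic_glb[OF c x0] arrs_ofD(4)[OF C(1) C(2)] arrs_ofD(4)[OF C(1) C(3)] C c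
        by (auto simp: mem_ar_basic)
      then have "lam S x \<in> dom_of S C" using lam_mem_dom by (auto simp: mem_ar_basic)
      moreover have "lam S (a \<cdot> z) \<preceq> z" using nat_leI_left[of z "lam S a"] lam_tms_proj c z lp proj_carrier by metis
      then have "z \<in> dom_of S C" using C z by (auto simp: mem_dom_of)
      ultimately show False using obs_ofD(3,5)[OF dom_of_obs[OF C(1)]] z by metis
    qed
    ultimately have "A \<in> ar_basic S (a \<cdot> z)" "A' \<in> ar_basic S (b \<cdot> z)"
      "disjnt (ar_basic S (a \<cdot> z)) (ar_basic S (b \<cdot> z))"
      using AA by (auto simp: mem_ar_basic disjnt_def)
    moreover have "openin (arrs (Spec S)) (ar_basic S (a \<cdot> z))" "openin (arrs (Spec S)) (ar_basic S (b \<cdot> z))"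
      using open_ar_basic c z closed by auto
    ultimately show ?thesis by blast
  qed
qed

end

lemma rs_objects_drs: "S \<in> rs_objects b v \<Longrightarrow> drs S"
  unfolding rs_objects_def drs_iff boolean_rsgp_def by (cases b) auto

lemma Spec_et_objects:
  assumes S: "S \<in> rs_objects b v" shows "Spec S \<in> et_objects b v"
proof -
  interpret drs S using rs_objects_drs[OF S] .
  have "b = Boolean \<Longrightarrow> generalized_boolean_algebra (proj_ord S)"
    "v \<in> {Meet_semigroups, Meet_monoids} \<Longrightarrow> has_meets S" "v \<in> {Monoids, Meet_monoids} \<Longrightarrow> has_identity S"
    using S unfolding rs_objects_def boolean_rsgp_def by auto
  then show ?thesis unfolding et_objects_def base_space_def boolean_space_def mem_Collect_eq
    using etale_Spec spectral_obs spectral_arrs Hausdorff_obs Hausdorff_arrs compact_space_obs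
    by (cases b) auto
qed
section \<open>Spectral spaces\<close>

definition compact_open :: "'a topology \<Rightarrow> 'a set \<Rightarrow> bool" where
  "compact_open X K \<longleftrightarrow> openin X K \<and> compactin X K"

lemma compact_open_empty: "compact_open X {}"
  and compact_open_Un: "\<lbrakk>compact_open X K; compact_open X L\<rbrakk> \<Longrightarrow> compact_open X (K \<union> L)"
  by (auto simp: compact_open_def intro: compactin_Un)

lemma compact_open_Union:
  "\<lbrakk>finite \<F>; \<And>K. K \<in> \<F> \<Longrightarrow> compact_open X K\<rbrakk> \<Longrightarrow> compact_open X (\<Union>\<F>)"
  by (auto simp: compact_open_def intro: compactin_Union)

lemma spectral_space_base:
  assumes X: "spectral_space X" and W: "openin X W" "x \<in> W"
  obtains K where "compact_open X K" "x \<in> K" "K \<subseteq> W"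
proof -
  obtain \<B> where B: "\<And>U. U \<in> \<B> \<Longrightarrow> openin X U \<and> compactin X U"
    "openin X = arbitrary union_of (\<lambda>U. U \<in> \<B>)"
    using X unfolding spectral_space_def by blast
  have "(arbitrary union_of (\<lambda>U. U \<in> \<B>)) W" using B(2) W by simp
  then obtain U where "U \<in> \<B>" "x \<in> U" "U \<subseteq> W" using W unfolding arbitrary_union_of_alt by blast
  then show ?thesis using that B(1) unfolding compact_open_def by blast
qed

lemma compact_open_Int:
  assumes X: "spectral_space X" and K: "compact_open X K" "compact_open X L"
  shows "compact_open X (K \<inter> L)"
proof -
  obtain \<B> where B: "\<And>U. U \<in> \<B> \<Longrightarrow> openin X U \<and> compactin X U"
    "openin X = arbitrary union_of (\<lambda>U. U \<in> \<B>)" "\<And>U V. \<lbrakk>U \<in> \<B>; V \<in> \<B>\<rbrakk> \<Longrightarrow> U \<inter> V \<in> \<B>"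
    using X unfolding spectral_space_def by blast
  have fin: "\<exists>\<F>. finite \<F> \<and> \<F> \<subseteq> \<B> \<and> K = \<Union>\<F>" if "compact_open X K" for K
  proof -
    have "(arbitrary union_of (\<lambda>U. U \<in> \<B>)) K" using B(2) that unfolding compact_open_def by simp
    then obtain \<U> where U: "\<U> \<subseteq> \<B>" "\<Union>\<U> = K" unfolding union_of_def arbitrary_def by blast
    have "compactin X K" "\<And>U. U \<in> \<U> \<Longrightarrow> openin X U" "K \<subseteq> \<Union>\<U>"
      using U B(1) that unfolding compact_open_def by auto
    then obtain \<F> where "finite \<F>" "\<F> \<subseteq> \<U>" "K \<subseteq> \<Union>\<F>" by (metis compactinD)
    then show ?thesis using U by blast
  qed
  obtain \<F> \<G> where F: "finite \<F>" "\<F> \<subseteq> \<B>" "K = \<Union>\<F>" "finite \<G>" "\<G> \<subseteq> \<B>" "L = \<Union>\<G>" using fin K by meson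
  have "K \<inter> L = \<Union>((\<lambda>(U, V). U \<inter> V) ` (\<F> \<times> \<G>))" using F by auto
  moreover have "compact_open X (\<Union>((\<lambda>(U, V). U \<inter> V) ` (\<F> \<times> \<G>)))"
    by (rule compact_open_Union) (use F B in \<open>auto simp: compact_open_def subset_iff\<close>)
  ultimately show ?thesis by simp
qed

lemma openin_inj_image_iff:
  assumes f: "continuous_map X Y f" "open_map X Y f" "inj_on f (topspace X)" and V: "V \<subseteq> f ` topspace X" "openin Y V"
  obtains V' where "openin X V'" "f ` V' = V"
proof (rule that)
  show "openin X {x \<in> topspace X. f x \<in> V}" using openin_continuous_map_preimage f V by blast
  show "f ` {x \<in> topspace X. f x \<in> V} = V" using V by auto
qed

text \<open>The closure of the image of an irreducible closed set has a generic point; it lies in the image, because the image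
  of the whole space is an open set meeting that closure.\<close>

lemma sober_space_open_embedding:
  assumes f: "continuous_map X Y f" "open_map X Y f" "inj_on f (topspace X)" and Y: "sober_space Y"
  shows "sober_space X"
proof (rule sober_spaceI)
  have fim: "openin Y (f ` W)" if "openin X W" for W using f that unfolding open_map_def by blast
  have pre: "openin X {x \<in> topspace X. f x \<in> W}" if "openin Y W" for W
    using openin_continuous_map_preimage f that by blast
  have meets: "W \<inter> Y closure_of (f ` Z) \<noteq> {} \<longleftrightarrow> {x \<in> topspace X. f x \<in> W} \<inter> Z \<noteq> {}"
    if "openin Y W" "Z \<subseteq> topspace X" for W Z
  proof -
    have "f ` Z \<subseteq> topspace Y" using continuous_map_image_subset_topspace[OF f(1)] that by blast
    then show ?thesis using that openin_Int_closure_of_eq_empty[OF that(1), of "f ` Z"] by auto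
  qed
  fix Z assume Z: "closedin X Z" "irreducible_in X Z"
  have sub: "Z \<subseteq> topspace X" "Z \<noteq> {}" using Z(2) unfolding irreducible_in_def by auto
  let ?Z = "Y closure_of (f ` Z)"
  have fZ: "f ` Z \<subseteq> ?Z" using continuous_map_image_subset_topspace[OF f(1)] sub
    by (intro closure_of_subset) blast
  have irr: "irreducible_in Y ?Z" unfolding irreducible_in_iff
  proof (intro conjI allI impI; (elim conjE)?)
    show "?Z \<subseteq> topspace Y" by (rule closure_of_subset_topspace)
    show "?Z \<noteq> {}" using fZ sub by blast
    fix V W assume VW: "openin Y V" "openin Y W" "V \<inter> ?Z \<noteq> {}" "W \<inter> ?Z \<noteq> {}"
    then have "{x \<in> topspace X. f x \<in> V} \<inter> Z \<noteq> {}" "{x \<in> topspace X. f x \<in> W} \<inter> Z \<noteq> {}"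
      using meets sub by blast+
    then have "{x \<in> topspace X. f x \<in> V} \<inter> {x \<in> topspace X. f x \<in> W} \<inter> Z \<noteq> {}"
      using Z(2) pre VW unfolding irreducible_in_iff by simp
    then show "V \<inter> W \<inter> ?Z \<noteq> {}" using fZ by blast
  qed
  obtain y where y: "y \<in> ?Z" "\<And>W. \<lbrakk>openin Y W; W \<inter> ?Z \<noteq> {}\<rbrakk> \<Longrightarrow> y \<in> W"
    and un: "\<And>z. \<lbrakk>z \<in> ?Z; \<And>W. \<lbrakk>openin Y W; W \<inter> ?Z \<noteq> {}\<rbrakk> \<Longrightarrow> z \<in> W\<rbrakk> \<Longrightarrow> z = y"
    using sober_space_generic_point[OF Y closedin_closure_of irr] by blast
  have "y \<in> f ` topspace X" using y(2)[OF fim[OF openin_topspace]] fZ sub by blast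
  then obtain x where x: "x \<in> topspace X" "y = f x" by blast
  have xW: "x \<in> W" if "openin X W" "W \<inter> Z \<noteq> {}" for W
  proof -
    have "f ` W \<inter> ?Z \<noteq> {}" using that fZ by blast
    then have "f x \<in> f ` W" using y(2)[OF fim[OF that(1)]] x by simp
    then show ?thesis using x f(3) openin_subset[OF that(1)] unfolding inj_on_def by blast
  qed
  have "x \<in> Z"
  proof (rule ccontr)
    assume "x \<notin> Z"
    then have "f ` (topspace X - Z) \<inter> f ` Z \<noteq> {}"
      using y(1) x fim[of "topspace X - Z"] Z(1) openin_Int_closure_of_eq_empty[of Y "f ` (topspace X - Z)" "f ` Z"]
      by blast
    then show False using f(3) sub unfolding inj_on_def by blast
  qed
  then show "\<exists>x\<in>Z. \<forall>W. openin X W \<and> W \<inter> Z \<noteq> {} \<longrightarrow> x \<in> W" using xW by blast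
  have *: "f z = y" if z: "z \<in> Z" "\<forall>W. openin X W \<and> W \<inter> Z \<noteq> {} \<longrightarrow> z \<in> W" for z
  proof (rule un)
    show "f z \<in> ?Z" using z fZ by blast
    fix W assume "openin Y W" "W \<inter> ?Z \<noteq> {}"
    then have "{x \<in> topspace X. f x \<in> W} \<inter> Z \<noteq> {}" "openin X {x \<in> topspace X. f x \<in> W}"
      using meets[of W Z] pre sub by auto
    then have "z \<in> {x \<in> topspace X. f x \<in> W}" using z(2) by metis
    then show "f z \<in> W" by simp
  qed
  fix z w assume "z \<in> Z" "w \<in> Z" "\<forall>W. openin X W \<and> W \<inter> Z \<noteq> {} \<longrightarrow> z \<in> W" "\<forall>W. openin X W \<and> W \<inter> Z \<noteq> {} \<longrightarrow> w \<in> W"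
  then have "f z = f w" "z \<in> topspace X" "w \<in> topspace X" using * sub by auto
  then show "z = w" using f(3) unfolding inj_on_def by blast
qed

text \<open>Reduces compactness of a slice to a question about its set of domains.\<close>

lemma compactin_inj_image_iff:
  assumes f: "continuous_map X Y f" "open_map X Y f" and A: "openin X A" "inj_on f A"
  shows "compactin X A \<longleftrightarrow> compactin Y (f ` A)"
  using homeomorphic_map_compactness[OF homeomorphic_map_restrict[OF f A], of A] openin_subset[OF A(1)]
  by (auto simp: compactin_subtopology)

lemma spectral_space_open_embedding:
  assumes f: "continuous_map X Y f" "open_map X Y f" "inj_on f (topspace X)" and Y: "spectral_space Y"
  shows "spectral_space X"
proof -
  have co: "compact_open X W \<longleftrightarrow> openin X W \<and> compact_open Y (f ` W)" for W
    using compactin_inj_image_iff[OF f(1,2), of W] f(2) f(3) openin_subset[of X W] inj_on_subset[OF f(3), of W]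
    unfolding compact_open_def open_map_def by blast
  show ?thesis unfolding spectral_space_def
  proof (intro conjI exI[of _ "Collect (compact_open X)"] ballI)
    show "sober_space X" using sober_space_open_embedding[OF f] Y unfolding spectral_space_def by blast
    show "openin X = arbitrary union_of (\<lambda>U. U \<in> Collect (compact_open X))"
    proof (intro ext iffI)
      fix W assume W: "openin X W"
      show "(arbitrary union_of (\<lambda>U. U \<in> Collect (compact_open X))) W" unfolding arbitrary_union_of_alt
      proof
        fix x assume x: "x \<in> W"
        have "openin Y (f ` W)" "f x \<in> f ` W" using f(2) W x unfolding open_map_def by auto
        then obtain K where K: "compact_open Y K" "f x \<in> K" "K \<subseteq> f ` W" by (rule spectral_space_base[OF Y])
        moreover have "f ` W \<subseteq> f ` topspace X" using openin_subset[OF W] by blast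
        ultimately obtain V where V: "openin X V" "f ` V = K"
          using openin_inj_image_iff[OF f] unfolding compact_open_def by (metis subset_trans)
        have "x \<in> V" "V \<subseteq> W"
          using V K x openin_subset[OF W] openin_subset[OF V(1)] f(3) unfolding inj_on_def by blast+
        then show "\<exists>U. U \<in> Collect (compact_open X) \<and> x \<in> U \<and> U \<subseteq> W" using co V K by auto
      qed
    next
      fix W assume "(arbitrary union_of (\<lambda>U. U \<in> Collect (compact_open X))) W"
      then show "openin X W" unfolding union_of_def arbitrary_def compact_open_def by auto
    qed
    fix U assume U: "U \<in> Collect (compact_open X)"
    then show "openin X U" "compactin X U" unfolding compact_open_def by auto
    fix V assume V: "V \<in> Collect (compact_open X)"
    have "f ` (U \<inter> V) = f ` U \<inter> f ` V"
      using f(3) U V openin_subset unfolding compact_open_def inj_on_def by blast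
    then have "compact_open Y (f ` (U \<inter> V))" using compact_open_Int[OF Y] U V co by simp
    then show "U \<inter> V \<in> Collect (compact_open X)" using co U V by blast
  qed
qed

section \<open>The semigroup of compact slices\<close>

locale spectral_etale =
  fixes C :: "('o, 'm) tcat"
  assumes etale: "etale_category C" and spectral: "spectral_space (obs C)"

lemma etale_unit_embedding:
  assumes "etale_category C"
  shows "continuous_map (obs C) (arrs C) (unt C)" "open_map (obs C) (arrs C) (unt C)" "inj_on (unt C) (ob_set C)"
  using assms unfolding etale_category_def topological_category_def inj_on_def by metis+

lemma etale_closed:
  assumes C: "etale_category C"
  shows "a \<in> ar_set C \<Longrightarrow> dm C a \<in> ob_set C" "a \<in> ar_set C \<Longrightarrow> cd C a \<in> ob_set C"
    "q \<in> ob_set C \<Longrightarrow> unt C q \<in> ar_set C"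
    "\<lbrakk>a \<in> ar_set C; b \<in> ar_set C; dm C a = cd C b\<rbrakk> \<Longrightarrow> cmp C a b \<in> ar_set C"
proof -
  have c: "continuous_map (obs C) (arrs C) (unt C)" "continuous_map (arrs C) (obs C) (dm C)"
    "continuous_map (arrs C) (obs C) (cd C)" "continuous_map (composables C) (arrs C) (\<lambda>(a, b). cmp C a b)"
    using C unfolding etale_category_def topological_category_def by blast+
  note f = c[THEN continuous_map_funspace]
  show "a \<in> ar_set C \<Longrightarrow> dm C a \<in> ob_set C" "a \<in> ar_set C \<Longrightarrow> cd C a \<in> ob_set C"
    "q \<in> ob_set C \<Longrightarrow> unt C q \<in> ar_set C" using f by auto
  show "\<lbrakk>a \<in> ar_set C; b \<in> ar_set C; dm C a = cd C b\<rbrakk> \<Longrightarrow> cmp C a b \<in> ar_set C"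
    using Pi_mem[OF f(4), of "(a, b)"] by (simp add: topspace_composables)
qed

text \<open>The unit map embeds the objects as an open subspace of the arrows, so that strongly spectral (Boolean) categories
  are spectral (Boolean).\<close>

lemma et_objects_spectral_etale:
  assumes "C \<in> et_objects b v" shows "spectral_etale C" "base_space b (obs C)"
proof -
  have e: "etale_category C" using assms unfolding et_objects_def by blast
  note emb = etale_unit_embedding[OF e]
  show b: "base_space b (obs C)"
  proof (cases "v \<in> {Meet_semigroups, Meet_monoids}")
    case True
    then have "base_space b (arrs C)" using assms unfolding et_objects_def by auto
    then show ?thesis
      using spectral_space_open_embedding[OF emb] Hausdorff_space_injective_preimage[OF _ emb(1,3)]
      unfolding base_space_def boolean_space_def by (cases b) auto
  next
    case False then show ?thesis using assms unfolding et_objects_def by auto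
  qed
  show "spectral_etale C" using e b unfolding spectral_etale_def base_space_def boolean_space_def by (cases b) auto
qed

context spectral_etale
begin

lemma continuous_ops: "continuous_map (obs C) (arrs C) (unt C)" "continuous_map (arrs C) (obs C) (dm C)"
    "continuous_map (arrs C) (obs C) (cd C)" "continuous_map (composables C) (arrs C) (\<lambda>(a, b). cmp C a b)"
  and open_ops: "open_map (obs C) (arrs C) (unt C)" "open_map (arrs C) (obs C) (dm C)"
    "open_map (arrs C) (obs C) (cd C)" "open_map (composables C) (arrs C) (\<lambda>(a, b). cmp C a b)"
  using etale local_homeomorphismD(1) unfolding etale_category_def topological_category_def by blast+

lemma unit_dm: "q \<in> ob_set C \<Longrightarrow> dm C (unt C q) = q" and unit_cd: "q \<in> ob_set C \<Longrightarrow> cd C (unt C q) = q"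
  and cmp_unit: "a \<in> ar_set C \<Longrightarrow> cmp C a (unt C (dm C a)) = a"
  and unit_cmp: "a \<in> ar_set C \<Longrightarrow> cmp C (unt C (cd C a)) a = a"
  and dm_cmp: "\<lbrakk>a \<in> ar_set C; b \<in> ar_set C; dm C a = cd C b\<rbrakk> \<Longrightarrow> dm C (cmp C a b) = dm C b"
  and cd_cmp: "\<lbrakk>a \<in> ar_set C; b \<in> ar_set C; dm C a = cd C b\<rbrakk> \<Longrightarrow> cd C (cmp C a b) = cd C a"
  and cmp_assoc: "\<lbrakk>a \<in> ar_set C; b \<in> ar_set C; c \<in> ar_set C; dm C a = cd C b; dm C b = cd C c\<rbrakk> \<Longrightarrow>
     cmp C (cmp C a b) c = cmp C a (cmp C b c)"
  using etale unfolding etale_category_def topological_category_def by blast+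

lemmas dm_ob = etale_closed(1)[OF etale] and cd_ob = etale_closed(2)[OF etale]
  and unit_ar = etale_closed(3)[OF etale] and cmp_ar = etale_closed(4)[OF etale]

lemma slice_iff: "A \<in> compact_slices C \<longleftrightarrow> openin (arrs C) A \<and> compactin (arrs C) A \<and> inj_on (dm C) A \<and> inj_on (cd C) A"
  by (auto simp: compact_slices_def)

lemma slice_sub: "A \<in> compact_slices C \<Longrightarrow> A \<subseteq> ar_set C"
  using openin_subset slice_iff by blast

lemma slice_dm_inj: "\<lbrakk>A \<in> compact_slices C; a \<in> A; b \<in> A; dm C a = dm C b\<rbrakk> \<Longrightarrow> a = b"
  and slice_cd_inj: "\<lbrakk>A \<in> compact_slices C; a \<in> A; b \<in> A; cd C a = cd C b\<rbrakk> \<Longrightarrow> a = b"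
  unfolding slice_iff inj_on_def by blast+

lemma slice_images: "A \<in> compact_slices C \<Longrightarrow> compact_open (obs C) (dm C ` A)"
  "A \<in> compact_slices C \<Longrightarrow> compact_open (obs C) (cd C ` A)"
  unfolding slice_iff compact_open_def using image_compactin continuous_ops open_ops unfolding open_map_def by blast+

lemma sub_sliceI:
  assumes A: "A \<in> compact_slices C" and B: "B \<subseteq> A" "openin (arrs C) B"
    and K: "compactin (obs C) (dm C ` B) \<or> compactin (obs C) (cd C ` B)"
  shows "B \<in> compact_slices C"
proof -
  have "inj_on (dm C) B" "inj_on (cd C) B" using A B slice_iff inj_on_subset by blast+
  then show ?thesis unfolding slice_iff
    using compactin_inj_image_iff[OF continuous_ops(2) open_ops(2) B(2)]
      compactin_inj_image_iff[OF continuous_ops(3) open_ops(3) B(2)] K B by blast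
qed

lemma restrict_dm_slice:
  assumes A: "A \<in> compact_slices C" and K: "compact_open (obs C) K"
  shows "{a \<in> A. dm C a \<in> K} \<in> compact_slices C"
proof (rule sub_sliceI[OF A])
  have "{a \<in> A. dm C a \<in> K} = A \<inter> {a \<in> ar_set C. dm C a \<in> K}" using slice_sub[OF A] by blast
  then show "openin (arrs C) {a \<in> A. dm C a \<in> K}"
    using A slice_iff openin_continuous_map_preimage[OF continuous_ops(2), of K] K unfolding compact_open_def by auto
  have "dm C ` {a \<in> A. dm C a \<in> K} = dm C ` A \<inter> K" by blast
  then show "compactin (obs C) (dm C ` {a \<in> A. dm C a \<in> K}) \<or> compactin (obs C) (cd C ` {a \<in> A. dm C a \<in> K})"
    using compact_open_Int[OF spectral slice_images(1)[OF A] K] unfolding compact_open_def by simp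
qed auto

lemma restrict_cd_slice:
  assumes A: "A \<in> compact_slices C" and K: "compact_open (obs C) K"
  shows "{a \<in> A. cd C a \<in> K} \<in> compact_slices C"
proof (rule sub_sliceI[OF A])
  have "{a \<in> A. cd C a \<in> K} = A \<inter> {a \<in> ar_set C. cd C a \<in> K}" using slice_sub[OF A] by blast
  then show "openin (arrs C) {a \<in> A. cd C a \<in> K}"
    using A slice_iff openin_continuous_map_preimage[OF continuous_ops(3), of K] K unfolding compact_open_def by auto
  have "cd C ` {a \<in> A. cd C a \<in> K} = cd C ` A \<inter> K" by blast
  then show "compactin (obs C) (dm C ` {a \<in> A. cd C a \<in> K}) \<or> compactin (obs C) (cd C ` {a \<in> A. cd C a \<in> K})"
    using compact_open_Int[OF spectral slice_images(2)[OF A] K] unfolding compact_open_def by simp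
qed auto

text \<open>Intersect neighbourhoods on which the domain and the codomain are injective, and cut the result down to the
  arrows over a compact-open set of objects.\<close>

lemma slices_base:
  assumes W: "openin (arrs C) W" "x \<in> W"
  obtains A where "A \<in> compact_slices C" "x \<in> A" "A \<subseteq> W"
proof -
  have x: "x \<in> ar_set C" using openin_subset W by blast
  obtain U where U: "openin (arrs C) U" "x \<in> U" "inj_on (dm C) U"
    using etale local_homeomorphismD(2)[OF _ x] unfolding etale_category_def by blast
  obtain V where V: "openin (arrs C) V" "x \<in> V" "inj_on (cd C) V"
    using etale local_homeomorphismD(2)[OF _ x] unfolding etale_category_def by blast
  let ?T = "W \<inter> U \<inter> V"
  have T: "openin (arrs C) ?T" "inj_on (dm C) ?T" "inj_on (cd C) ?T"
    using U V W by (auto intro: inj_on_subset)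
  then have "openin (obs C) (dm C ` ?T)" using open_ops(2) unfolding open_map_def by blast
  moreover have "dm C x \<in> dm C ` ?T" using W U V by blast
  ultimately obtain K where K: "compact_open (obs C) K" "dm C x \<in> K" "K \<subseteq> dm C ` ?T"
    by (rule spectral_space_base[OF spectral])
  let ?A = "?T \<inter> {a \<in> ar_set C. dm C a \<in> K}"
  have A: "openin (arrs C) ?A"
    using T(1) openin_continuous_map_preimage[OF continuous_ops(2), of K] K unfolding compact_open_def by auto
  have "dm C ` ?A = K" using K(3) openin_subset[OF T(1)] by blast
  moreover have inj: "inj_on (dm C) ?A" "inj_on (cd C) ?A"
    by (rule inj_on_subset[OF T(2)], blast, rule inj_on_subset[OF T(3)], blast)
  ultimately have "compactin (arrs C) ?A"
    using compactin_inj_image_iff[OF continuous_ops(2) open_ops(2) A] K(1) by (simp add: compact_open_def)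
  then have "?A \<in> compact_slices C" unfolding slice_iff using A inj by blast
  moreover have "x \<in> ?A" using x W U V K by blast
  ultimately show ?thesis using that by blast
qed

lemma unit_slice: assumes K: "compact_open (obs C) K" shows "unt C ` K \<in> compact_slices C"
proof -
  have sub: "K \<subseteq> ob_set C" using K openin_subset unfolding compact_open_def by blast
  have "inj_on (dm C) (unt C ` K)" "inj_on (cd C) (unt C ` K)"
    using sub unit_dm unit_cd unfolding inj_on_def by (auto simp: subset_iff)
  then show ?thesis unfolding slice_iff
    using K open_ops(1) image_compactin[OF _ continuous_ops(1)] unfolding compact_open_def open_map_def by blast
qed

lemma Slices_simps [simp]:
  "carrier (Slices C) = compact_slices C"
  "A \<cdot>\<^bsub>Slices C\<^esub> B = {cmp C a b | a b. a \<in> A \<and> b \<in> B \<and> dm C a = cd C b}"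
  "lam (Slices C) A = unt C ` dm C ` A" "rho (Slices C) A = unt C ` cd C ` A"
  by (simp_all add: Slices_def)

lemma projs_Slices: "projs (Slices C) = (\<lambda>K. unt C ` K) ` Collect (compact_open (obs C))"
proof (intro equalityI subsetI)
  fix A assume "A \<in> projs (Slices C)"
  then have A: "A \<in> compact_slices C" "A \<subseteq> unt C ` ob_set C" by (auto simp: Slices_def)
  have "A = unt C ` dm C ` A" using A(2) unit_dm by (force simp: image_iff subset_iff)
  then show "A \<in> (\<lambda>K. unt C ` K) ` Collect (compact_open (obs C))" using slice_images(1)[OF A(1)] by blast
next
  fix A assume "A \<in> (\<lambda>K. unt C ` K) ` Collect (compact_open (obs C))"
  then obtain K where "A = unt C ` K" "compact_open (obs C) K" by blast
  then show "A \<in> projs (Slices C)" using unit_slice openin_subset[of "obs C" K]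
    by (auto simp: Slices_def compact_open_def)
qed

lemma unit_tms:
  assumes "A \<subseteq> ar_set C" "K \<subseteq> ob_set C" shows "unt C ` K \<cdot>\<^bsub>Slices C\<^esub> A = {a \<in> A. cd C a \<in> K}"
proof (intro equalityI subsetI)
  fix x assume "x \<in> {a \<in> A. cd C a \<in> K}"
  then have "x = cmp C (unt C (cd C x)) x" "unt C (cd C x) \<in> unt C ` K" "x \<in> A" "dm C (unt C (cd C x)) = cd C x"
    using assms unit_cmp[of x] unit_dm[of "cd C x"] by auto
  then show "x \<in> unt C ` K \<cdot>\<^bsub>Slices C\<^esub> A" unfolding Slices_simps by blast
next
  fix x assume "x \<in> unt C ` K \<cdot>\<^bsub>Slices C\<^esub> A"
  then obtain a k where "x = cmp C (unt C k) a" "a \<in> A" "k \<in> K" "dm C (unt C k) = cd C a" by auto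
  then show "x \<in> {a \<in> A. cd C a \<in> K}" using assms unit_cmp[of a] unit_dm[of k] by (auto simp: subset_iff)
qed

lemma tms_unit:
  assumes "A \<subseteq> ar_set C" "K \<subseteq> ob_set C" shows "A \<cdot>\<^bsub>Slices C\<^esub> unt C ` K = {a \<in> A. dm C a \<in> K}"
proof (intro equalityI subsetI)
  fix x assume "x \<in> {a \<in> A. dm C a \<in> K}"
  then have "x = cmp C x (unt C (dm C x))" "unt C (dm C x) \<in> unt C ` K" "x \<in> A" "dm C x = cd C (unt C (dm C x))"
    using assms cmp_unit[of x] unit_cd[of "dm C x"] by auto
  then show "x \<in> A \<cdot>\<^bsub>Slices C\<^esub> unt C ` K" unfolding Slices_simps by blast
next
  fix x assume "x \<in> A \<cdot>\<^bsub>Slices C\<^esub> unt C ` K"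
  then obtain a k where "x = cmp C a (unt C k)" "a \<in> A" "k \<in> K" "dm C a = cd C (unt C k)" by auto
  then show "x \<in> {a \<in> A. dm C a \<in> K}" using assms cmp_unit[of a] unit_cd[of k] by (auto simp: subset_iff)
qed

lemma dm_image_tms:
  assumes "A \<subseteq> ar_set C" "B \<subseteq> ar_set C"
  shows "dm C ` (A \<cdot>\<^bsub>Slices C\<^esub> B) = dm C ` {b \<in> B. cd C b \<in> dm C ` A}"
proof (intro equalityI subsetI)
  fix q assume "q \<in> dm C ` {b \<in> B. cd C b \<in> dm C ` A}"
  then obtain a b where "q = dm C b" "b \<in> B" "a \<in> A" "dm C a = cd C b" by auto
  moreover from this have "cmp C a b \<in> A \<cdot>\<^bsub>Slices C\<^esub> B" "dm C (cmp C a b) = dm C b"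
    using dm_cmp[of a b] assms unfolding Slices_simps by blast+
  ultimately show "q \<in> dm C ` (A \<cdot>\<^bsub>Slices C\<^esub> B)" by (metis imageI)
next
  fix q assume "q \<in> dm C ` (A \<cdot>\<^bsub>Slices C\<^esub> B)"
  then obtain a b where ab: "q = dm C (cmp C a b)" "a \<in> A" "b \<in> B" "dm C a = cd C b" by auto
  then have "q = dm C b" "cd C b \<in> dm C ` A" using dm_cmp[of a b] assms by (blast, metis imageI)
  then show "q \<in> dm C ` {b \<in> B. cd C b \<in> dm C ` A}" using ab by blast
qed

lemma cd_image_tms:
  assumes "A \<subseteq> ar_set C" "B \<subseteq> ar_set C"
  shows "cd C ` (A \<cdot>\<^bsub>Slices C\<^esub> B) = cd C ` {a \<in> A. dm C a \<in> cd C ` B}"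
proof (intro equalityI subsetI)
  fix q assume "q \<in> cd C ` {a \<in> A. dm C a \<in> cd C ` B}"
  then obtain a b where "q = cd C a" "b \<in> B" "a \<in> A" "dm C a = cd C b" by auto
  moreover from this have "cmp C a b \<in> A \<cdot>\<^bsub>Slices C\<^esub> B" "cd C (cmp C a b) = cd C a"
    using cd_cmp[of a b] assms unfolding Slices_simps by blast+
  ultimately show "q \<in> cd C ` (A \<cdot>\<^bsub>Slices C\<^esub> B)" by (metis imageI)
next
  fix q assume "q \<in> cd C ` (A \<cdot>\<^bsub>Slices C\<^esub> B)"
  then obtain a b where ab: "q = cd C (cmp C a b)" "a \<in> A" "b \<in> B" "dm C a = cd C b" by auto
  then have "q = cd C a" "dm C a \<in> cd C ` B" using cd_cmp[of a b] assms by (blast, metis imageI)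
  then show "q \<in> cd C ` {a \<in> A. dm C a \<in> cd C ` B}" using ab by blast
qed

text \<open>Its domains are those of the arrows of \<open>B\<close> with codomain in a compact-open set; this gives compactness.\<close>

lemma tms_slice:
  assumes A: "A \<in> compact_slices C" and B: "B \<in> compact_slices C"
  shows "A \<cdot>\<^bsub>Slices C\<^esub> B \<in> compact_slices C"
proof -
  note sub = slice_sub[OF A] slice_sub[OF B]
  let ?P = "(A \<times> B) \<inter> {(a, b). dm C a = cd C b}"
  have "openin (composables C) ?P" unfolding openin_composables
    using A B slice_iff by blast
  then have "openin (arrs C) ((\<lambda>(a, b). cmp C a b) ` ?P)" using open_ops(4) unfolding open_map_def by blast
  also have "(\<lambda>(a, b). cmp C a b) ` ?P = A \<cdot>\<^bsub>Slices C\<^esub> B" by auto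
  finally have op: "openin (arrs C) (A \<cdot>\<^bsub>Slices C\<^esub> B)" .
  have dinj: "inj_on (dm C) (A \<cdot>\<^bsub>Slices C\<^esub> B)"
  proof (rule inj_onI)
    fix x y assume "x \<in> A \<cdot>\<^bsub>Slices C\<^esub> B" "y \<in> A \<cdot>\<^bsub>Slices C\<^esub> B" and xy: "dm C x = dm C y"
    then obtain a b a' b' where *: "x = cmp C a b" "a \<in> A" "b \<in> B" "dm C a = cd C b"
      "y = cmp C a' b'" "a' \<in> A" "b' \<in> B" "dm C a' = cd C b'" by auto
    then have "dm C b = dm C b'" using xy dm_cmp sub by (metis subsetD)
    then have "b = b'" using slice_dm_inj[OF B] * by blast
    moreover from this have "a = a'" using slice_dm_inj[OF A] * by metis
    ultimately show "x = y" using * by simp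
  qed
  have rinj: "inj_on (cd C) (A \<cdot>\<^bsub>Slices C\<^esub> B)"
  proof (rule inj_onI)
    fix x y assume "x \<in> A \<cdot>\<^bsub>Slices C\<^esub> B" "y \<in> A \<cdot>\<^bsub>Slices C\<^esub> B" and xy: "cd C x = cd C y"
    then obtain a b a' b' where *: "x = cmp C a b" "a \<in> A" "b \<in> B" "dm C a = cd C b"
      "y = cmp C a' b'" "a' \<in> A" "b' \<in> B" "dm C a' = cd C b'" by auto
    then have "cd C a = cd C a'" using xy cd_cmp sub by (metis subsetD)
    then have "a = a'" using slice_cd_inj[OF A] * by blast
    moreover from this have "b = b'" using slice_cd_inj[OF B] * by metis
    ultimately show "x = y" using * by simp
  qed
  have "compactin (obs C) (dm C ` (A \<cdot>\<^bsub>Slices C\<^esub> B))" unfolding dm_image_tms[OF sub]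
    using slice_images(1)[OF restrict_cd_slice[OF B slice_images(1)[OF A]]] unfolding compact_open_def by blast
  then show ?thesis unfolding slice_iff
    using op dinj rinj compactin_inj_image_iff[OF continuous_ops(2) open_ops(2) op dinj] by blast
qed

lemma tms_assoc_slices:
  assumes A: "A \<subseteq> ar_set C" "B \<subseteq> ar_set C" "D \<subseteq> ar_set C"
  shows "A \<cdot>\<^bsub>Slices C\<^esub> B \<cdot>\<^bsub>Slices C\<^esub> D = A \<cdot>\<^bsub>Slices C\<^esub> (B \<cdot>\<^bsub>Slices C\<^esub> D)"
proof (intro equalityI subsetI)
  fix x assume "x \<in> A \<cdot>\<^bsub>Slices C\<^esub> B \<cdot>\<^bsub>Slices C\<^esub> D"
  then obtain a b c where *: "x = cmp C (cmp C a b) c" "a \<in> A" "b \<in> B" "c \<in> D" "dm C a = cd C b" "dm C (cmp C a b) = cd C c"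
    by auto
  then have c: "a \<in> ar_set C" "b \<in> ar_set C" "c \<in> ar_set C" using A by auto
  then have "dm C b = cd C c" using * dm_cmp by auto
  then have "x = cmp C a (cmp C b c)" "dm C a = cd C (cmp C b c)" using * c cmp_assoc cd_cmp by auto
  then show "x \<in> A \<cdot>\<^bsub>Slices C\<^esub> (B \<cdot>\<^bsub>Slices C\<^esub> D)" using * \<open>dm C b = cd C c\<close> unfolding Slices_simps by blast
next
  fix x assume "x \<in> A \<cdot>\<^bsub>Slices C\<^esub> (B \<cdot>\<^bsub>Slices C\<^esub> D)"
  then obtain a b c where *: "x = cmp C a (cmp C b c)" "a \<in> A" "b \<in> B" "c \<in> D" "dm C b = cd C c" "dm C a = cd C (cmp C b c)"
    by auto
  then have c: "a \<in> ar_set C" "b \<in> ar_set C" "c \<in> ar_set C" using A by auto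
  then have "dm C a = cd C b" using * cd_cmp by auto
  then have "x = cmp C (cmp C a b) c" "dm C (cmp C a b) = cd C c" using * c cmp_assoc dm_cmp by auto
  then show "x \<in> A \<cdot>\<^bsub>Slices C\<^esub> B \<cdot>\<^bsub>Slices C\<^esub> D" using * \<open>dm C a = cd C b\<close> unfolding Slices_simps by blast
qed

lemma proj_SlicesE:
  assumes "P \<in> projs (Slices C)"
  obtains K where "P = unt C ` K" "compact_open (obs C) K" "K \<subseteq> ob_set C"
  using assms openin_subset[of "obs C"] unfolding projs_Slices compact_open_def by blast

lemma unit_proj: "compact_open (obs C) K \<Longrightarrow> unt C ` K \<in> projs (Slices C)"
  unfolding projs_Slices by blast

lemma dm_unit_image: "K \<subseteq> ob_set C \<Longrightarrow> dm C ` unt C ` K = K"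
  and cd_unit_image: "K \<subseteq> ob_set C \<Longrightarrow> cd C ` unt C ` K = K"
  using unit_dm unit_cd by (force simp: image_image)+

lemma unit_sub: "K \<subseteq> ob_set C \<Longrightarrow> unt C ` K \<subseteq> ar_set C"
  using unit_ar by blast

lemma unit_image_Int: "\<lbrakk>K \<subseteq> ob_set C; L \<subseteq> ob_set C\<rbrakk> \<Longrightarrow> unt C ` K \<inter> unt C ` L = unt C ` (K \<inter> L)"
  using etale_unit_embedding(3)[OF etale] by (simp add: inj_on_image_Int)

lemma unit_tms_unit: "\<lbrakk>K \<subseteq> ob_set C; L \<subseteq> ob_set C\<rbrakk> \<Longrightarrow> unt C ` K \<cdot>\<^bsub>Slices C\<^esub> unt C ` L = unt C ` (K \<inter> L)"
  unfolding unit_tms[OF unit_sub] using unit_cd by auto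

lemma slice_ob_images: "A \<in> compact_slices C \<Longrightarrow> dm C ` A \<subseteq> ob_set C" "A \<in> compact_slices C \<Longrightarrow> cd C ` A \<subseteq> ob_set C"
  using slice_sub dm_ob cd_ob by blast+

lemma restriction_Slices: "restriction_semigroup (Slices C)"
proof -
  note S[simp del] = Slices_simps(2)
  have compl: "compact_open (obs C) K \<Longrightarrow> K \<subseteq> ob_set C" for K using openin_subset unfolding compact_open_def by blast
  show ?thesis
  proof unfold_locales
    fix A B assume A: "A \<in> carrier (Slices C)" and B: "B \<in> carrier (Slices C)"
    show "A \<cdot>\<^bsub>Slices C\<^esub> B \<in> carrier (Slices C)" using A B tms_slice by simp
    fix D assume "D \<in> carrier (Slices C)"
    then show "A \<cdot>\<^bsub>Slices C\<^esub> B \<cdot>\<^bsub>Slices C\<^esub> D = A \<cdot>\<^bsub>Slices C\<^esub> (B \<cdot>\<^bsub>Slices C\<^esub> D)"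
      using A B slice_sub tms_assoc_slices by simp
  next
    show "projs (Slices C) \<subseteq> carrier (Slices C)" by (auto simp: Slices_def)
    show "projs (Slices C) \<noteq> {}" unfolding projs_Slices using compact_open_empty by blast
  next
    fix P assume "P \<in> projs (Slices C)"
    then obtain K where K: "P = unt C ` K" "compact_open (obs C) K" "K \<subseteq> ob_set C" by (rule proj_SlicesE)
    show "P \<cdot>\<^bsub>Slices C\<^esub> P = P" using K unit_tms_unit by simp
    show "lam (Slices C) P = P" "rho (Slices C) P = P" using K dm_unit_image cd_unit_image by auto
    fix Q assume "Q \<in> projs (Slices C)"
    then obtain L where L: "Q = unt C ` L" "compact_open (obs C) L" "L \<subseteq> ob_set C" by (rule proj_SlicesE)
    show "P \<cdot>\<^bsub>Slices C\<^esub> Q = Q \<cdot>\<^bsub>Slices C\<^esub> P" using K L unit_tms_unit by (simp add: Int_commute)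
    show "P \<cdot>\<^bsub>Slices C\<^esub> Q \<in> projs (Slices C)" using K L unit_tms_unit unit_proj compact_open_Int[OF spectral] by simp
  next
    fix A assume "A \<in> carrier (Slices C)"
    then have A: "A \<in> compact_slices C" by simp
    note im = slice_ob_images[OF A] slice_images[OF A] slice_sub[OF A]
    show "lam (Slices C) A \<in> projs (Slices C)" "rho (Slices C) A \<in> projs (Slices C)"
      using im unit_proj by auto
    show "A \<cdot>\<^bsub>Slices C\<^esub> lam (Slices C) A = A" "rho (Slices C) A \<cdot>\<^bsub>Slices C\<^esub> A = A"
      using im by (auto simp: tms_unit unit_tms)
    { fix B assume "B \<in> carrier (Slices C)"
      then have B: "B \<in> compact_slices C" by simp
      note im' = slice_ob_images[OF B] slice_images[OF B] slice_sub[OF B]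
      show "lam (Slices C) (lam (Slices C) A \<cdot>\<^bsub>Slices C\<^esub> B) = lam (Slices C) (A \<cdot>\<^bsub>Slices C\<^esub> B)"
        using im im' by (simp add: unit_tms dm_image_tms)
      show "rho (Slices C) (A \<cdot>\<^bsub>Slices C\<^esub> rho (Slices C) B) = rho (Slices C) (A \<cdot>\<^bsub>Slices C\<^esub> B)"
        using im im' by (simp add: tms_unit cd_image_tms) }
    { fix P assume "P \<in> projs (Slices C)"
      then obtain K where K: "P = unt C ` K" "compact_open (obs C) K" "K \<subseteq> ob_set C" by (rule proj_SlicesE)
      have "dm C ` {a \<in> A. cd C a \<in> K} \<subseteq> ob_set C" "cd C ` {a \<in> A. dm C a \<in> K} \<subseteq> ob_set C"
        using im by auto
      moreover have "{a \<in> A. dm C a \<in> dm C ` {a \<in> A. cd C a \<in> K}} = {a \<in> A. cd C a \<in> K}"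
        "{a \<in> A. cd C a \<in> cd C ` {a \<in> A. dm C a \<in> K}} = {a \<in> A. dm C a \<in> K}"
        using slice_dm_inj[OF A] slice_cd_inj[OF A] by blast+
      ultimately show "P \<cdot>\<^bsub>Slices C\<^esub> A = A \<cdot>\<^bsub>Slices C\<^esub> lam (Slices C) (P \<cdot>\<^bsub>Slices C\<^esub> A)"
        "A \<cdot>\<^bsub>Slices C\<^esub> P = rho (Slices C) (A \<cdot>\<^bsub>Slices C\<^esub> P) \<cdot>\<^bsub>Slices C\<^esub> A"
        unfolding K(1) Slices_simps(3,4) using im(5) K(3) by (simp_all add: unit_tms tms_unit) }
  qed
qed

text \<open>In a slice an arrow is determined by its domain, so a subset of a slice is a restriction of it.\<close>

lemma slice_le_iff:
  assumes A: "A \<in> compact_slices C" "B \<in> compact_slices C"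
  shows "A \<sqsubseteq>\<^bsub>nat_ord (Slices C)\<^esub> B \<longleftrightarrow> A \<subseteq> B"
proof -
  interpret restriction_semigroup "Slices C" by (rule restriction_Slices)
  have "A \<sqsubseteq>\<^bsub>nat_ord (Slices C)\<^esub> B \<longleftrightarrow> A = B \<cdot>\<^bsub>Slices C\<^esub> (unt C ` dm C ` A)"
    using nat_le_lam[of A B] A by simp
  also have "\<dots> \<longleftrightarrow> A = {b \<in> B. dm C b \<in> dm C ` A}"
    unfolding tms_unit[OF slice_sub[OF A(2)] slice_ob_images(1)[OF A(1)]] ..
  also have "\<dots> \<longleftrightarrow> A \<subseteq> B" using slice_dm_inj[OF A(2)] by blast
  finally show ?thesis .
qed

lemma slice_lub_iff:
  assumes "X \<subseteq> compact_slices C" "\<Union>X \<in> compact_slices C"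
  shows "is_lub (nat_ord (Slices C)) (\<Union>X) X"
proof -
  interpret restriction_semigroup "Slices C" by (rule restriction_Slices)
  have "is_lub (nat_ord (Slices C)) (\<Union>X) X \<longleftrightarrow> \<Union>X \<in> compact_slices C \<and> (\<forall>A\<in>X. A \<subseteq> \<Union>X) \<and>
      (\<forall>B\<in>compact_slices C. (\<forall>A\<in>X. A \<subseteq> B) \<longrightarrow> \<Union>X \<subseteq> B)"
    using is_lub_nat_ord[of X "\<Union>X"] assms slice_le_iff by (simp add: subset_iff[of X])
  then show ?thesis using assms by blast
qed

lemma proj_slice: "P \<in> projs (Slices C) \<Longrightarrow> P \<in> compact_slices C"
  by (simp add: Slices_def)

lemma proj_le_iff:
  "\<lbrakk>P \<in> projs (Slices C); Q \<in> projs (Slices C)\<rbrakk> \<Longrightarrow> P \<sqsubseteq>\<^bsub>proj_ord (Slices C)\<^esub> Q \<longleftrightarrow> P \<subseteq> Q"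
  using slice_le_iff[of P Q] proj_slice by (simp add: proj_ord_def nat_ord_def)

lemma carrier_proj_ord: "carrier (proj_ord S) = projs S" "eq (proj_ord S) = (=)"
  by (simp_all add: proj_ord_def nat_ord_def)

lemma proj_Un: assumes "P \<in> projs (Slices C)" "Q \<in> projs (Slices C)" shows "P \<union> Q \<in> projs (Slices C)"
  using assms by (elim proj_SlicesE) (use unit_proj compact_open_Un image_Un in metis)

lemma proj_Int: assumes "P \<in> projs (Slices C)" "Q \<in> projs (Slices C)" shows "P \<inter> Q \<in> projs (Slices C)"
  using assms by (elim proj_SlicesE) (use unit_proj compact_open_Int[OF spectral] unit_image_Int in metis)

lemma proj_lub:
  assumes "P \<in> projs (Slices C)" "Q \<in> projs (Slices C)" shows "is_lub (proj_ord (Slices C)) (P \<union> Q) {P, Q}"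
proof -
  have "Upper (proj_ord (Slices C)) {P, Q} = {R \<in> projs (Slices C). P \<union> Q \<subseteq> R}"
  proof (rule Set.set_eqI)
    fix R
    have "(\<forall>x. x \<in> {P, Q} \<inter> projs (Slices C) \<longrightarrow> x \<sqsubseteq>\<^bsub>proj_ord (Slices C)\<^esub> R) \<longleftrightarrow> P \<union> Q \<subseteq> R"
      if "R \<in> projs (Slices C)" using proj_le_iff[OF _ that] assms by (metis Int_iff Un_subset_iff insertE insertI1 insertI2 singletonD)
    then show "R \<in> Upper (proj_ord (Slices C)) {P, Q} \<longleftrightarrow> R \<in> {R \<in> projs (Slices C). P \<union> Q \<subseteq> R}"
      unfolding Upper_def carrier_proj_ord by blast
  qed
  then show ?thesis using proj_Un[OF assms] by (auto simp: least_def carrier_proj_ord proj_le_iff)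
qed

lemma proj_glb:
  assumes "P \<in> projs (Slices C)" "Q \<in> projs (Slices C)" shows "is_glb (proj_ord (Slices C)) (P \<inter> Q) {P, Q}"
proof -
  have "Lower (proj_ord (Slices C)) {P, Q} = {R \<in> projs (Slices C). R \<subseteq> P \<inter> Q}"
  proof (rule Set.set_eqI)
    fix R
    have "(\<forall>x. x \<in> {P, Q} \<inter> projs (Slices C) \<longrightarrow> R \<sqsubseteq>\<^bsub>proj_ord (Slices C)\<^esub> x) \<longleftrightarrow> R \<subseteq> P \<inter> Q"
      if "R \<in> projs (Slices C)" using proj_le_iff[OF that] assms by (metis Int_iff Int_subset_iff insertE insertI1 insertI2 singletonD)
    then show "R \<in> Lower (proj_ord (Slices C)) {P, Q} \<longleftrightarrow> R \<in> {R \<in> projs (Slices C). R \<subseteq> P \<inter> Q}"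
      unfolding Lower_def carrier_proj_ord by blast
  qed
  then show ?thesis using proj_Int[OF assms] by (auto simp: greatest_def carrier_proj_ord proj_le_iff)
qed

lemma lattice_Slices: "Lattice.lattice (proj_ord (Slices C))"
proof -
  interpret partial_order "proj_ord (Slices C)"
    by unfold_locales (auto simp: carrier_proj_ord proj_le_iff)
  show ?thesis
  proof unfold_locales
    fix P Q assume "P \<in> carrier (proj_ord (Slices C))" "Q \<in> carrier (proj_ord (Slices C))"
    then have "P \<in> projs (Slices C)" "Q \<in> projs (Slices C)" by (simp_all add: carrier_proj_ord)
    then show "\<exists>s. is_lub (proj_ord (Slices C)) s {P, Q}" "\<exists>s. is_glb (proj_ord (Slices C)) s {P, Q}"
      using proj_lub proj_glb by metis+
  qed
qed

lemma pjoin_Slices: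
  assumes "P \<in> projs (Slices C)" "Q \<in> projs (Slices C)" shows "P \<squnion>\<^bsub>proj_ord (Slices C)\<^esub> Q = P \<union> Q"
proof -
  interpret Lattice.lattice "proj_ord (Slices C)" by (rule lattice_Slices)
  show ?thesis by (rule joinI) (use assms proj_lub least_unique in \<open>auto simp: carrier_proj_ord\<close>)
qed

lemma pmeet_Slices:
  assumes "P \<in> projs (Slices C)" "Q \<in> projs (Slices C)" shows "P \<sqinter>\<^bsub>proj_ord (Slices C)\<^esub> Q = P \<inter> Q"
proof -
  interpret Lattice.lattice "proj_ord (Slices C)" by (rule lattice_Slices)
  show ?thesis by (rule meetI) (use assms proj_glb greatest_unique in \<open>auto simp: carrier_proj_ord\<close>)
qed

lemma empty_proj: "{} \<in> projs (Slices C)"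
  using unit_proj[OF compact_open_empty] by simp

lemma bottom_Slices: "weak_partial_order_bottom (proj_ord (Slices C))" "\<bottom>\<^bsub>proj_ord (Slices C)\<^esub> = {}"
proof -
  interpret Lattice.lattice "proj_ord (Slices C)" by (rule lattice_Slices)
  have l: "least (proj_ord (Slices C)) {} (carrier (proj_ord (Slices C)))"
    unfolding least_def carrier_proj_ord using empty_proj proj_le_iff by auto
  then show b: "weak_partial_order_bottom (proj_ord (Slices C))" by unfold_locales blast
  interpret weak_partial_order_bottom "proj_ord (Slices C)" by (rule b)
  show "\<bottom>\<^bsub>proj_ord (Slices C)\<^esub> = {}" using least_unique[OF bottom_least l] by simp
qed

lemma compatible_Slices:
  assumes A: "A \<in> compact_slices C" "B \<in> compact_slices C"
  shows "compatible (Slices C) A B \<longleftrightarrow>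
    {a \<in> A. dm C a \<in> dm C ` B} = {b \<in> B. dm C b \<in> dm C ` A} \<and> {a \<in> A. cd C a \<in> cd C ` B} = {b \<in> B. cd C b \<in> cd C ` A}"
  unfolding compatible_def Slices_simps(3,4) tms_unit[OF slice_sub[OF A(1)] slice_ob_images(1)[OF A(2)]]
    tms_unit[OF slice_sub[OF A(2)] slice_ob_images(1)[OF A(1)]]
    unit_tms[OF slice_sub[OF A(1)] slice_ob_images(2)[OF A(2)]] unit_tms[OF slice_sub[OF A(2)] slice_ob_images(2)[OF A(1)]] ..

lemma Union_slice:
  assumes X: "finite X" "X \<subseteq> compact_slices C" "\<And>A B. \<lbrakk>A \<in> X; B \<in> X\<rbrakk> \<Longrightarrow> inj_on (dm C) (A \<union> B) \<and> inj_on (cd C) (A \<union> B)"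
  shows "\<Union>X \<in> compact_slices C"
  unfolding slice_iff
proof (intro conjI inj_onI)
  show "openin (arrs C) (\<Union>X)" using X slice_iff by (intro openin_Union) blast
  show "compactin (arrs C) (\<Union>X)" by (rule compactin_Union) (use X slice_iff in blast)+
  fix x y assume xy: "x \<in> \<Union>X" "y \<in> \<Union>X"
  then obtain A B where "A \<in> X" "B \<in> X" "x \<in> A \<union> B" "y \<in> A \<union> B" by blast
  then show "dm C x = dm C y \<Longrightarrow> x = y" "cd C x = cd C y \<Longrightarrow> x = y"
    using X(3)[of A B] unfolding inj_on_def by blast+
qed

text \<open>Compatibility says that arrows of the two slices with a common domain (codomain) coincide.\<close>

lemma compatible_imp_inj:
  assumes A: "A \<in> compact_slices C" "B \<in> compact_slices C" "compatible (Slices C) A B"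
  shows "inj_on (dm C) (A \<union> B) \<and> inj_on (cd C) (A \<union> B)"
proof -
  note c = A(3)[unfolded compatible_Slices[OF A(1,2)]]
  have "x = y" if "x \<in> A" "y \<in> B" "dm C x = dm C y \<or> cd C x = cd C y" for x y
    using that c slice_dm_inj[OF A(2)] slice_cd_inj[OF A(2)] by blast
  then show ?thesis using slice_dm_inj[OF A(1)] slice_cd_inj[OF A(1)] slice_dm_inj[OF A(2)] slice_cd_inj[OF A(2)]
    unfolding inj_on_def by (metis Un_iff)
qed

lemma distributive_Slices: "distributive_rsgp (Slices C)"
proof -
  interpret L: Lattice.lattice "proj_ord (Slices C)" by (rule lattice_Slices)
  have "distributive_lattice_bot (proj_ord (Slices C))"
    unfolding distributive_lattice_bot_def carrier_proj_ord
    using lattice_Slices bottom_Slices(1) by (auto simp: pjoin_Slices pmeet_Slices proj_Un proj_Int)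
  moreover have "\<exists>x. is_lub (nat_ord (Slices C)) x X"
    if X: "X \<subseteq> carrier (Slices C) \<and> finite X \<and> X \<noteq> {} \<and> (\<forall>a\<in>X. \<forall>b\<in>X. compatible (Slices C) a b)" for X
  proof -
    have "\<Union>X \<in> compact_slices C"
    proof (rule Union_slice)
      show "finite X" "X \<subseteq> compact_slices C" using X by auto
      show "inj_on (dm C) (A \<union> B) \<and> inj_on (cd C) (A \<union> B)" if "A \<in> X" "B \<in> X" for A B
        by (rule compatible_imp_inj) (use X that in auto)
    qed
    then show ?thesis using slice_lub_iff[of X] X by auto
  qed
  ultimately show ?thesis unfolding distributive_rsgp_def bottom_Slices(2)
    using restriction_Slices by simp
qed

lemma drs_Slices: "drs (Slices C)"
  using distributive_Slices drs_iff by blast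

lemma has_meets_Slices:
  assumes "spectral_space (arrs C)" shows "has_meets (Slices C)"
  unfolding has_meets_def Slices_simps(1)
proof (intro ballI)
  interpret drs "Slices C" by (rule drs_Slices)
  fix A B assume A: "A \<in> compact_slices C" "B \<in> compact_slices C"
  have "compact_open (arrs C) (A \<inter> B)" using compact_open_Int[OF assms] A slice_iff unfolding compact_open_def by blast
  then have AB: "A \<inter> B \<in> compact_slices C"
    using A unfolding slice_iff compact_open_def by (meson inj_on_subset Int_lower1)
  then have "is_glb (nat_ord (Slices C)) (A \<inter> B) {A, B}"
    using glb2_iff[of A B "A \<inter> B"] A slice_le_iff by simp
  then show "\<exists>x. is_glb (nat_ord (Slices C)) x {A, B}" by blast
qed

lemma has_identity_Slices:
  assumes "compact_space (obs C)" shows "has_identity (Slices C)"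
  unfolding has_identity_def
proof (intro bexI[of _ "unt C ` ob_set C"] ballI)
  have "compact_open (obs C) (ob_set C)" using assms unfolding compact_open_def compact_space_def by simp
  then show "unt C ` ob_set C \<in> carrier (Slices C)" using unit_slice by simp
  fix A assume "A \<in> carrier (Slices C)"
  then have "A \<subseteq> ar_set C" using slice_sub by simp
  then show "unt C ` ob_set C \<cdot>\<^bsub>Slices C\<^esub> A = A \<and> A \<cdot>\<^bsub>Slices C\<^esub> unt C ` ob_set C = A"
    using dm_ob cd_ob unit_tms[of A "ob_set C"] tms_unit[of A "ob_set C"] by auto
qed

lemma generalized_boolean_Slices:
  assumes H: "Hausdorff_space (obs C)" shows "generalized_boolean_algebra (proj_ord (Slices C))"
  unfolding generalized_boolean_algebra_def carrier_proj_ord bottom_Slices(2)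
proof (intro conjI ballI impI)
  show "distributive_lattice_bot (proj_ord (Slices C))" using distributive_Slices distributive_rsgp_def by blast
  fix P Q assume P: "P \<in> projs (Slices C)" and Q: "Q \<in> projs (Slices C)" and le: "P \<sqsubseteq>\<^bsub>proj_ord (Slices C)\<^esub> Q"
  obtain K where K: "P = unt C ` K" "compact_open (obs C) K" "K \<subseteq> ob_set C" using P by (rule proj_SlicesE)
  obtain L where L: "Q = unt C ` L" "compact_open (obs C) L" "L \<subseteq> ob_set C" using Q by (rule proj_SlicesE)
  have sub: "P \<subseteq> Q" using le P Q proj_le_iff by blast
  have "closedin (obs C) K" using compactin_imp_closedin[OF H] K unfolding compact_open_def by blast
  have "compact_open (obs C) (L - K)"
  proof -
    have eq: "L - K = (ob_set C - K) \<inter> L" using L(3) by blast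
    have "openin (obs C) (L - K)" using L K \<open>closedin (obs C) K\<close> unfolding compact_open_def by blast
    moreover have "compactin (obs C) (L - K)" unfolding eq
      using closed_Int_compactin[of "obs C" "ob_set C - K" L] L K unfolding compact_open_def by blast
    ultimately show ?thesis unfolding compact_open_def by blast
  qed
  then have "unt C ` (L - K) \<in> projs (Slices C)" by (rule unit_proj)
  moreover have "P \<inter> unt C ` (L - K) = {}" using unit_image_Int[of K "L - K"] K L by auto
  moreover have "P \<union> unt C ` (L - K) = Q" using sub K L by auto
  ultimately show "\<exists>z\<in>projs (Slices C). P \<sqinter>\<^bsub>proj_ord (Slices C)\<^esub> z = {} \<and> P \<squnion>\<^bsub>proj_ord (Slices C)\<^esub> z = Q"
    using P pjoin_Slices pmeet_Slices by metis
qed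

end

lemma Slices_rs_objects:
  assumes C: "C \<in> et_objects b v" shows "Slices C \<in> rs_objects b v"
proof -
  interpret spectral_etale C using et_objects_spectral_etale(1)[OF C] .
  have m: "has_meets (Slices C)" if "v \<in> {Meet_semigroups, Meet_monoids}"
  proof (rule has_meets_Slices)
    have "base_space b (arrs C)" using C that unfolding et_objects_def by auto
    then show "spectral_space (arrs C)" unfolding base_space_def boolean_space_def by (cases b) auto
  qed
  have i: "has_identity (Slices C)" if "v \<in> {Monoids, Meet_monoids}"
    using has_identity_Slices C that unfolding et_objects_def by auto
  have "boolean_rsgp (Slices C)" if "b = Boolean"
    using et_objects_spectral_etale(2)[OF C] that generalized_boolean_Slices distributive_Slices
    unfolding base_space_def boolean_space_def boolean_rsgp_def by auto
  then show ?thesis unfolding rs_objects_def using m i distributive_Slices by (cases b) auto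
qed
section \<open>Isomorphisms of restriction semigroups\<close>

text \<open>The order and the projections are definable from these operations, hence are preserved as well.\<close>

definition operation_map :: "'a rsgp \<Rightarrow> 'b rsgp \<Rightarrow> ('a \<Rightarrow> 'b) \<Rightarrow> bool" where
  "operation_map S T f \<longleftrightarrow> f \<in> carrier S \<rightarrow> carrier T \<and>
     (\<forall>a\<in>carrier S. \<forall>b\<in>carrier S. f (a \<cdot>\<^bsub>S\<^esub> b) = f a \<cdot>\<^bsub>T\<^esub> f b) \<and>
     (\<forall>a\<in>carrier S. f (lam S a) = lam T (f a) \<and> f (rho S a) = rho T (f a))"

lemma operation_mapD:
  assumes "operation_map S T f"
  shows "a \<in> carrier S \<Longrightarrow> f a \<in> carrier T"
    "\<lbrakk>a \<in> carrier S; b \<in> carrier S\<rbrakk> \<Longrightarrow> f (a \<cdot>\<^bsub>S\<^esub> b) = f a \<cdot>\<^bsub>T\<^esub> f b"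
    "a \<in> carrier S \<Longrightarrow> f (lam S a) = lam T (f a)" "a \<in> carrier S \<Longrightarrow> f (rho S a) = rho T (f a)"
  using assms unfolding operation_map_def by auto

locale operation_pair = S: drs S + T: drs T for S :: "'a rsgp" and T :: "'b rsgp" +
  fixes f assumes op: "operation_map S T f"
begin

lemmas f_carrier = operation_mapD(1)[OF op] and f_tms = operation_mapD(2)[OF op]
  and f_lam = operation_mapD(3)[OF op] and f_rho = operation_mapD(4)[OF op]

lemma f_proj: "e \<in> projs S \<Longrightarrow> f e \<in> projs T"
  by (metis S.lam_proj S.proj_carrier T.lam_closed f_carrier f_lam)

lemma f_mono: "\<lbrakk>a \<sqsubseteq>\<^bsub>nat_ord S\<^esub> b; b \<in> carrier S\<rbrakk> \<Longrightarrow> f a \<sqsubseteq>\<^bsub>nat_ord T\<^esub> f b"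
proof -
  assume ab: "a \<sqsubseteq>\<^bsub>nat_ord S\<^esub> b" "b \<in> carrier S"
  then have a: "a \<in> carrier S" by (rule S.nat_le_carrier)
  then have "f a = f (b \<cdot>\<^bsub>S\<^esub> lam S a)" using ab S.nat_le_lam by simp
  also have "\<dots> = f b \<cdot>\<^bsub>T\<^esub> lam T (f a)" using f_tms f_lam S.lam_carrier a ab by simp
  finally show ?thesis using T.nat_le_lam f_carrier a ab by blast
qed

end

lemma rs_morphism_operation_map: "rs_morphism S T f \<Longrightarrow> operation_map S T f"
  unfolding rs_morphism_def operation_map_def by blast

text \<open>The numbered families of the definition come from an enumeration of a finite set.\<close>

lemma proper_morphism_if_cover:
  assumes cover: "\<And>t. t \<in> carrier T \<Longrightarrow> \<exists>M. finite M \<and> M \<noteq> {} \<and> M \<subseteq> carrier T \<and> is_lub (nat_ord T) t M \<and>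
    (\<forall>m\<in>M. \<exists>s\<in>carrier S. m \<sqsubseteq>\<^bsub>nat_ord T\<^esub> f s)"
  shows "proper_morphism S T f"
  unfolding proper_morphism_def
proof
  fix t assume "t \<in> carrier T"
  then obtain M where M: "finite M" "M \<noteq> {}" "M \<subseteq> carrier T" "is_lub (nat_ord T) t M"
    "\<forall>m\<in>M. \<exists>s\<in>carrier S. m \<sqsubseteq>\<^bsub>nat_ord T\<^esub> f s" using cover by meson
  obtain g where g: "\<And>m. m \<in> M \<Longrightarrow> g m \<in> carrier S \<and> m \<sqsubseteq>\<^bsub>nat_ord T\<^esub> f (g m)" using M(5) by metis
  obtain h where h: "bij_betw h {1..card M} M" using ex_bij_betw_nat_finite_1[OF M(1)] by blast
  have hM: "h ` {1..card M} = M" using h by (simp add: bij_betw_def)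
  define k where "k i = g (h i)" for i
  have c: "1 \<le> card M" using M by (simp add: Suc_le_eq card_gt_0_iff)
  have le: "\<forall>i\<in>{1..card M}. h i \<in> carrier T \<and> k i \<in> carrier S \<and> h i \<sqsubseteq>\<^bsub>nat_ord T\<^esub> f (k i)"
    using g hM M(3) unfolding k_def by blast
  have lub: "is_lub (nat_ord T) t (h ` {1..card M})" unfolding hM by (rule M(4))
  show "\<exists>n\<ge>1. \<exists>(t' :: nat \<Rightarrow> _) (s' :: nat \<Rightarrow> _). (\<forall>i\<in>{1..n}. t' i \<in> carrier T \<and> s' i \<in> carrier S \<and> t' i \<sqsubseteq>\<^bsub>nat_ord T\<^esub> f (s' i)) \<and>
      is_lub (nat_ord T) t (t' ` {1..n})"
    by (rule exI, rule conjI, rule c, rule exI, rule exI, rule conjI, rule le, rule lub)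
qed

text \<open>A bijection preserving the operations preserves the order in both directions, hence all joins and meets, and is an
  isomorphism of every type.\<close>

locale operation_iso = operation_pair +
  assumes bij: "bij_betw f (carrier S) (carrier T)"
begin

lemma f_inj: "\<lbrakk>a \<in> carrier S; b \<in> carrier S; f a = f b\<rbrakk> \<Longrightarrow> a = b"
  using bij unfolding bij_betw_def inj_on_def by blast

lemma f_surj: assumes "t \<in> carrier T" obtains s where "s \<in> carrier S" "f s = t"
  using bij assms unfolding bij_betw_def by (metis imageE)

lemma f_reflects: "\<lbrakk>f a \<sqsubseteq>\<^bsub>nat_ord T\<^esub> f b; a \<in> carrier S; b \<in> carrier S\<rbrakk> \<Longrightarrow> a \<sqsubseteq>\<^bsub>nat_ord S\<^esub> b"
proof -
  assume ab: "f a \<sqsubseteq>\<^bsub>nat_ord T\<^esub> f b" "a \<in> carrier S" "b \<in> carrier S"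
  then have "f a = f b \<cdot>\<^bsub>T\<^esub> lam T (f a)" using T.nat_le_lam f_carrier by simp
  also have "\<dots> = f (b \<cdot>\<^bsub>S\<^esub> lam S a)" using f_tms f_lam S.lam_carrier ab by simp
  finally have "a = b \<cdot>\<^bsub>S\<^esub> lam S a" using f_inj ab S.lam_carrier S.tms_closed by blast
  then show ?thesis using S.nat_le_lam ab by blast
qed

lemma f_surj_proj: assumes "t \<in> projs T" obtains s where "s \<in> projs S" "f s = t"
proof -
  obtain s where s: "s \<in> carrier S" "f s = t" using f_surj T.proj_carrier assms by blast
  then have "f (lam S s) = t" using f_lam T.lam_proj assms by simp
  then show ?thesis using that S.lam_closed s by blast
qed

lemma f_zero: "f S.zero = T.zero"
proof -
  obtain s where "s \<in> carrier S" "f s = T.zero" using f_surj T.zero_carrier by blast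
  then show ?thesis using f_tms[OF S.zero_carrier] S.zero_tms T.tms_zero f_carrier S.zero_carrier by metis
qed

lemma f_pjoin: assumes e: "e \<in> projs S" "g \<in> projs S" shows "f (S.pjoin e g) = T.pjoin (f e) (f g)"
proof (rule T.nat_le_antisym)
  note c = S.pjoin_closed[OF e] f_proj[OF e(1)] f_proj[OF e(2)] T.pjoin_closed[OF f_proj[OF e(1)] f_proj[OF e(2)]]
  obtain h where h: "h \<in> projs S" "f h = T.pjoin (f e) (f g)" using f_surj_proj c(4) by blast
  have "e \<sqsubseteq>\<^bsub>nat_ord S\<^esub> h" "g \<sqsubseteq>\<^bsub>nat_ord S\<^esub> h"
    using f_reflects[of _ h] h e T.pjoin_left[OF c(2,3)] T.pjoin_right[OF c(2,3)] S.proj_carrier by auto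
  then show "f (S.pjoin e g) \<sqsubseteq>\<^bsub>nat_ord T\<^esub> T.pjoin (f e) (f g)"
    using f_mono[of "S.pjoin e g" h] S.pjoin_least e h S.proj_carrier by metis
  show "T.pjoin (f e) (f g) \<sqsubseteq>\<^bsub>nat_ord T\<^esub> f (S.pjoin e g)"
    using T.pjoin_least[OF c(2,3) f_proj[OF c(1)]] f_mono S.pjoin_left[OF e] S.pjoin_right[OF e] c S.proj_carrier by blast
  show "f (S.pjoin e g) \<in> carrier T" "T.pjoin (f e) (f g) \<in> carrier T"
    using c f_proj T.proj_carrier by blast+
qed

lemma rs_morphism: "rs_morphism S T f"
  unfolding rs_morphism_def
proof (intro conjI ballI)
  fix x y assume xy: "x \<in> projs S" "y \<in> projs S"
  then show "f (S.pjoin x y) = T.pjoin (f x) (f y)" by (rule f_pjoin)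
  show "f (x \<sqinter>\<^bsub>proj_ord S\<^esub> y) = f x \<sqinter>\<^bsub>proj_ord T\<^esub> f y"
    using xy f_proj f_tms S.proj_carrier by (simp add: S.meet_proj T.meet_proj)
next
  fix a assume a: "a \<in> projs T"
  then obtain s where "s \<in> projs S" "f s = a" by (rule f_surj_proj)
  then show "\<exists>b\<in>projs S. a \<sqsubseteq>\<^bsub>proj_ord T\<^esub> f b" using a T.nat_le_refl T.proj_carrier T.proj_ord_simps by metis
qed (use f_carrier f_tms f_lam f_rho f_zero in auto)

lemma proper: "proper_morphism S T f"
proof (rule proper_morphism_if_cover)
  fix t assume t: "t \<in> carrier T"
  then obtain s where s: "s \<in> carrier S" "f s = t" by (rule f_surj)
  have "is_lub (nat_ord T) t {t}" using T.is_lub_nat_ord[of "{t}" t] t T.nat_le_refl by simp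
  then show "\<exists>M. finite M \<and> M \<noteq> {} \<and> M \<subseteq> carrier T \<and> is_lub (nat_ord T) t M \<and>
      (\<forall>m\<in>M. \<exists>s\<in>carrier S. m \<sqsubseteq>\<^bsub>nat_ord T\<^esub> f s)"
    using s t T.nat_le_refl by (intro exI[of _ "{t}"]) auto
qed

lemma weakly_meet: "weakly_meet_preserving S T f"
  unfolding weakly_meet_preserving_def
proof (intro ballI impI; elim conjE)
  fix t a b assume t: "t \<in> carrier T" and ab: "a \<in> carrier S" "b \<in> carrier S" "t \<sqsubseteq>\<^bsub>nat_ord T\<^esub> f a" "t \<sqsubseteq>\<^bsub>nat_ord T\<^esub> f b"
  obtain s where "s \<in> carrier S" "f s = t" using f_surj t by blast
  then show "\<exists>c\<in>carrier S. c \<sqsubseteq>\<^bsub>nat_ord S\<^esub> a \<and> c \<sqsubseteq>\<^bsub>nat_ord S\<^esub> b \<and> t \<sqsubseteq>\<^bsub>nat_ord T\<^esub> f c"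
    using ab f_reflects T.nat_le_refl t by (intro bexI[of _ s]) auto
qed

lemma ample_reflect: assumes "ample T" shows "ample S"
  unfolding ample_def
proof (intro conjI ballI impI)
  show "restriction_semigroup S" by (rule S.restriction_semigroup_axioms)
  fix a b c assume c: "a \<in> carrier S" "b \<in> carrier S" "c \<in> carrier S"
  note A = assms[unfolded ample_def]
  { assume "a \<cdot>\<^bsub>S\<^esub> c = b \<cdot>\<^bsub>S\<^esub> c"
    then have "f a \<cdot>\<^bsub>T\<^esub> f c = f b \<cdot>\<^bsub>T\<^esub> f c" using f_tms c by metis
    then have "f a \<cdot>\<^bsub>T\<^esub> rho T (f c) = f b \<cdot>\<^bsub>T\<^esub> rho T (f c)" using A f_carrier c by simp
    then show "a \<cdot>\<^bsub>S\<^esub> rho S c = b \<cdot>\<^bsub>S\<^esub> rho S c"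
      using f_inj f_tms f_rho c S.rho_carrier S.tms_closed by metis }
  { assume "c \<cdot>\<^bsub>S\<^esub> a = c \<cdot>\<^bsub>S\<^esub> b"
    then have "f c \<cdot>\<^bsub>T\<^esub> f a = f c \<cdot>\<^bsub>T\<^esub> f b" using f_tms c by metis
    then have "lam T (f c) \<cdot>\<^bsub>T\<^esub> f a = lam T (f c) \<cdot>\<^bsub>T\<^esub> f b" using A f_carrier c by simp
    then show "lam S c \<cdot>\<^bsub>S\<^esub> a = lam S c \<cdot>\<^bsub>S\<^esub> b"
      using f_inj f_tms f_lam c S.lam_carrier S.tms_closed by metis }
qed

lemma rs_hom: "f \<in> extensional (carrier S) \<Longrightarrow> f \<in> rs_hom k S T"
  unfolding rs_hom_def using rs_morphism proper weakly_meet by simp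

lemma rs_iso: assumes ext: "f \<in> extensional (carrier S)" shows "rs_iso k S T f"
proof -
  define g where "g = restrict (inv_into (carrier S) f) (carrier T)"
  have gf: "g (f a) = a" if "a \<in> carrier S" for a
    using that f_carrier bij unfolding g_def bij_betw_def by (simp add: inv_into_f_f)
  have fg: "f (g t) = t" and gc: "g t \<in> carrier S" if t: "t \<in> carrier T" for t
    using f_surj[OF t] gf by metis+
  have "operation_map T S g" unfolding operation_map_def
    using gc fg gf f_tms f_lam f_rho by (intro conjI Pi_I ballI) (metis S.tms_closed S.lam_carrier S.rho_carrier)+
  moreover have "bij_betw g (carrier T) (carrier S)"
    by (rule bij_betw_byWitness[of _ f]) (use gf fg gc f_carrier in auto)
  ultimately interpret g: operation_iso T S g
    by unfold_locales auto
  have "g \<in> rs_hom k T S" by (rule g.rs_hom) (simp add: g_def)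
  moreover have "rs_comp S g f = rs_id S" "rs_comp T f g = rs_id T"
    unfolding rs_comp_def rs_id_def compose_def using gf fg by (auto intro: restrict_ext)
  ultimately show ?thesis unfolding rs_iso_def using rs_hom[OF ext] by blast
qed

end

section \<open>A semigroup is the semigroup of compact slices of its spectrum\<close>

context drs
begin

lemma spectral_etale_Spec: "spectral_etale (Spec S)"
  using etale_Spec spectral_obs by unfold_locales

lemma ar_basic_tms_proj:
  assumes "a \<in> carrier S" "e \<in> projs S" shows "ar_basic S (a \<cdot> e) = {A \<in> ar_basic S a. e \<in> dom_of S A}"
proof -
  have "a \<in> A" if "A \<in> arrs_of S" "a \<cdot> e \<in> A" for A
    using arrs_ofD(4)[OF that] nat_leI_right assms by blast
  then show ?thesis using dom_mem_iff[of _ a e] assms by (auto simp: mem_ar_basic)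
qed

text \<open>Both products have the basic set \<open>ar_basic S a \<inter> ar_basic S b\<close>: a prime filter through \<open>a\<close> whose domain contains
  that of \<open>b\<close> has the same domain as a germ of \<open>b\<close>, and injectivity identifies the two.\<close>

lemma lam_compatible_if_inj:
  assumes ab: "a \<in> carrier S" "b \<in> carrier S" and inj: "inj_on (dom_of S) (ar_basic S a \<union> ar_basic S b)"
  shows "a \<cdot> lam S b = b \<cdot> lam S a"
proof -
  have *: "ar_basic S (a \<cdot> lam S b) = ar_basic S a \<inter> ar_basic S b"
    if ab: "a \<in> carrier S" "b \<in> carrier S" and inj: "inj_on (dom_of S) (ar_basic S a \<union> ar_basic S b)" for a b
  proof -
    have "A \<in> ar_basic S b" if A: "A \<in> ar_basic S a" "lam S b \<in> dom_of S A" for A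
    proof -
      have "dom_of S A \<in> ob_basic S (lam S b)" using A dom_of_obs by (simp add: mem_ar_basic mem_ob_basic)
      then obtain B where B: "B \<in> ar_basic S b" "dom_of S A = dom_of S B"
        using dom_image_ar_basic[OF ab(2)] by (metis imageE)
      have "A = B" by (rule inj_onD[OF inj B(2) UnI1[OF A(1)] UnI2[OF B(1)]])
      then show ?thesis using B(1) by simp
    qed
    then show ?thesis using ar_basic_tms_proj ab lam_closed lam_mem_dom by (auto simp: mem_ar_basic)
  qed
  have "ar_basic S (a \<cdot> lam S b) = ar_basic S (b \<cdot> lam S a)" using * ab inj by (metis Int_commute Un_commute)
  then show ?thesis using ar_basic_inj ab closed by metis
qed

end

lemma ar_basic_opp [simp]: "ar_basic (opp S) = ar_basic S"
  by (simp add: ar_basic_def[abs_def])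

context drs
begin

lemmas rho_compatible_if_inj = drs.lam_compatible_if_inj[OF drs_opp, simplified]

lemma ar_basic_slice: "s \<in> carrier S \<Longrightarrow> ar_basic S s \<in> compact_slices (Spec S)"
  unfolding compact_slices_def using open_ar_basic compact_ar_basic inj_on_dom inj_on_cod by simp

text \<open>A compact slice is a finite union of basic sets; their elements are compatible, and the slice is the basic
  set of the join.\<close>

lemma compact_slices_Spec: "compact_slices (Spec S) = ar_basic S ` carrier S"
proof (intro equalityI subsetI)
  fix X assume "X \<in> compact_slices (Spec S)"
  then have X: "openin (arrs (Spec S)) X" "compactin (arrs (Spec S)) X" "inj_on (dom_of S) X" "inj_on (cod_of S) X"
    by (auto simp: compact_slices_def)
  let ?U = "ar_basic S ` {s \<in> carrier S. ar_basic S s \<subseteq> X}"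
  have "X \<subseteq> \<Union>?U" using X(1) unfolding Spec_simps openin_arrs by blast
  moreover have "\<And>U. U \<in> ?U \<Longrightarrow> openin (arrs (Spec S)) U" using open_ar_basic by blast
  ultimately have "\<exists>\<F>. finite \<F> \<and> \<F> \<subseteq> ?U \<and> X \<subseteq> \<Union>\<F>" by (intro compactinD[OF X(2)])
  then obtain \<F> where F: "finite \<F>" "\<F> \<subseteq> ?U" "X \<subseteq> \<Union>\<F>" by (elim exE conjE)
  obtain I where I: "finite I" "I \<subseteq> {s \<in> carrier S. ar_basic S s \<subseteq> X}" "\<F> = ar_basic S ` I"
    using finite_subset_image[OF F(1,2)] by blast
  have XI: "X = (\<Union>s\<in>I. ar_basic S s)" using F I by blast
  show "X \<in> ar_basic S ` carrier S"
  proof (cases "I = {}")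
    case True then show ?thesis using XI ar_basic_zero zero_carrier by blast
  next
    case False
    have "compatible S a b" if ab: "a \<in> I" "b \<in> I" for a b
    proof -
      have "ar_basic S a \<union> ar_basic S b \<subseteq> X" "a \<in> carrier S" "b \<in> carrier S" using I ab by auto
      then show ?thesis unfolding compatible_def
        using lam_compatible_if_inj[of a b] rho_compatible_if_inj[of a b] inj_on_subset X by metis
    qed
    then obtain x where x: "is_lub (nat_ord S) x I" using compatible_lub_ex[of I] I False by blast
    have IC: "I \<subseteq> carrier S" using I by blast
    have "x \<in> carrier S" using x is_lub_nat_ord[OF IC] by blast
    then show ?thesis using ar_basic_lub[OF I(1) False IC x] XI by blast
  qed
qed (use ar_basic_slice in blast)

lemma ar_basic_tms:
  assumes "a \<in> carrier S" "b \<in> carrier S"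
  shows "ar_basic S (a \<cdot> b) = ar_basic S a \<cdot>\<^bsub>Slices (Spec S)\<^esub> ar_basic S b"
proof (intro equalityI subsetI)
  fix D assume "D \<in> ar_basic S (a \<cdot> b)"
  then have "D \<in> arrs_of S" "a \<cdot> b \<in> D" by (auto simp: mem_ar_basic)
  then obtain A B where "A \<in> arrs_of S" "B \<in> arrs_of S" "a \<in> A" "b \<in> B" "dom_of S A = cod_of S B" "comp_of S A B = D"
    using tms_mem_split assms by metis
  then show "D \<in> ar_basic S a \<cdot>\<^bsub>Slices (Spec S)\<^esub> ar_basic S b"
    unfolding Slices_def by (auto simp: mem_ar_basic)
next
  fix D assume "D \<in> ar_basic S a \<cdot>\<^bsub>Slices (Spec S)\<^esub> ar_basic S b"
  then obtain A B where "D = comp_of S A B" "A \<in> ar_basic S a" "B \<in> ar_basic S b" "dom_of S A = cod_of S B"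
    unfolding Slices_def by auto
  then show "D \<in> ar_basic S (a \<cdot> b)" using comp_of_arr(1) tms_mem_comp_of by (auto simp: mem_ar_basic)
qed

lemma ar_basic_lam: "a \<in> carrier S \<Longrightarrow> ar_basic S (lam S a) = lam (Slices (Spec S)) (ar_basic S a)"
  using dom_image_ar_basic unit_image_ob_basic lam_closed by (simp add: Slices_def)

end

lemma ob_basic_opp [simp]: "ob_basic (opp S) = ob_basic S"
  by (simp add: ob_basic_def[abs_def])

context drs
begin

lemmas cod_image_ar_basic = drs.dom_image_ar_basic[OF drs_opp, simplified]

lemma ar_basic_rho: "a \<in> carrier S \<Longrightarrow> ar_basic S (rho S a) = rho (Slices (Spec S)) (ar_basic S a)"
  using cod_image_ar_basic unit_image_ob_basic rho_closed by (simp add: Slices_def)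

lemma operation_iso_rs_unit: "operation_iso S (Slices (Spec S)) (rs_unit S)"
proof -
  interpret C: spectral_etale "Spec S" by (rule spectral_etale_Spec)
  interpret D: drs "Slices (Spec S)" by (rule C.drs_Slices)
  have u: "rs_unit S s = ar_basic S s" if "s \<in> carrier S" for s
    using that unfolding rs_unit_def ar_basic_def by simp
  have car: "carrier (Slices (Spec S)) = ar_basic S ` carrier S"
    using compact_slices_Spec by (simp add: Slices_def)
  have op: "operation_map S (Slices (Spec S)) (rs_unit S)" unfolding operation_map_def
    using u ar_basic_tms ar_basic_lam ar_basic_rho closed car by auto
  have bij: "bij_betw (rs_unit S) (carrier S) (carrier (Slices (Spec S)))"
    unfolding bij_betw_def car using u ar_basic_inj by (auto simp: inj_on_def)
  show ?thesis using op bij by unfold_locales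
qed

lemma rs_iso_rs_unit: "rs_iso k S (Slices (Spec S)) (rs_unit S)"
  by (rule operation_iso.rs_iso[OF operation_iso_rs_unit]) (simp add: rs_unit_def)

end

section \<open>Isomorphisms of topological categories\<close>

text \<open>Functors that are homeomorphisms on objects and arrows; as relational coverings they are single-valued,
  hence isomorphisms of every type.\<close>

definition category_homeo ::
  "('o, 'm) tcat \<Rightarrow> ('p, 'n) tcat \<Rightarrow> ('o \<Rightarrow> 'p) \<Rightarrow> ('m \<Rightarrow> 'n) \<Rightarrow> bool" where
  "category_homeo C D h0 h1 \<longleftrightarrow>
     homeomorphic_map (obs C) (obs D) h0 \<and> homeomorphic_map (arrs C) (arrs D) h1 \<and>
     (\<forall>a\<in>ar_set C. dm D (h1 a) = h0 (dm C a) \<and> cd D (h1 a) = h0 (cd C a)) \<and>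
     (\<forall>q\<in>ob_set C. h1 (unt C q) = unt D (h0 q)) \<and>
     (\<forall>a\<in>ar_set C. \<forall>b\<in>ar_set C. dm C a = cd C b \<longrightarrow> h1 (cmp C a b) = cmp D (h1 a) (h1 b))"

definition rcm_of :: "('o, 'm) tcat \<Rightarrow> ('o \<Rightarrow> 'p) \<Rightarrow> ('m \<Rightarrow> 'n) \<Rightarrow> ('o, 'm, 'p, 'n) rcm" where
  "rcm_of C h0 h1 = \<lparr>on_ob = (\<lambda>q\<in>ob_set C. h0 q), on_ar = (\<lambda>a\<in>ar_set C. {h1 a})\<rparr>"

lemma category_homeo_rc_hom:
  assumes C: "etale_category C" and h: "category_homeo C D h0 h1"
  shows "rcm_of C h0 h1 \<in> rc_hom k C D"
proof -
  note H = h[unfolded category_homeo_def]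
  have h0: "continuous_map (obs C) (obs D) h0" "h0 ` ob_set C = ob_set D" "inj_on h0 (ob_set C)"
    and h1: "continuous_map (arrs C) (arrs D) h1" "h1 ` ar_set C = ar_set D" "inj_on h1 (ar_set C)"
    using H unfolding homeomorphic_eq_everything_map by auto
  note ob = etale_closed(1,2)[OF C] and un = etale_closed(3)[OF C] and cm = etale_closed(4)[OF C]
  have eq0: "continuous_map (obs C) (obs D) (\<lambda>q\<in>ob_set C. h0 q)"
    using continuous_map_eq[OF h0(1), of "\<lambda>q\<in>ob_set C. h0 q"] by simp
  have rel: "relational_covering C D (rcm_of C h0 h1)"
    unfolding relational_covering_def rcm_of_def rcm.simps
  proof (intro conjI)
    show "continuous_map (obs C) (obs D) (\<lambda>q\<in>ob_set C. h0 q)" by (rule eq0)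
    show "(\<lambda>a\<in>ar_set C. {h1 a}) \<in> ar_set C \<rightarrow> Pow (ar_set D)" using h1(2) by auto
    show "\<forall>a\<in>ar_set C. \<forall>b\<in>(\<lambda>a\<in>ar_set C. {h1 a}) a.
       dm D b = (\<lambda>q\<in>ob_set C. h0 q) (dm C a) \<and> cd D b = (\<lambda>q\<in>ob_set C. h0 q) (cd C a)"
      using H ob by simp
    show "\<forall>(a, b)\<in>topspace (composables C). \<forall>(s, t)\<in>topspace (composables D).
       s \<in> (\<lambda>a\<in>ar_set C. {h1 a}) a \<and> t \<in> (\<lambda>a\<in>ar_set C. {h1 a}) b \<longrightarrow>
       cmp D s t \<in> (\<lambda>a\<in>ar_set C. {h1 a}) (cmp C a b)"
      unfolding topspace_composables using H cm by auto
    show "\<forall>a\<in>ar_set C. \<forall>b\<in>ar_set C. (dm C a = dm C b \<or> cd C a = cd C b) \<and>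
        (\<lambda>a\<in>ar_set C. {h1 a}) a \<inter> (\<lambda>a\<in>ar_set C. {h1 a}) b \<noteq> {} \<longrightarrow> a = b"
      using h1(3) unfolding inj_on_def by auto
    have lift: "\<exists>t\<in>ar_set C. s = h1 t" if "s \<in> ar_set D" for s using that h1(2) by blast
    have inj: "p = q" if "p \<in> ob_set C" "q \<in> ob_set C" "h0 p = h0 q" for p q
      using that h0(3) unfolding inj_on_def by blast
    show "\<forall>q\<in>ob_set C. \<forall>s\<in>ar_set D.
       (dm D s = (\<lambda>q\<in>ob_set C. h0 q) q \<longrightarrow> (\<exists>t\<in>ar_set C. dm C t = q \<and> s \<in> (\<lambda>a\<in>ar_set C. {h1 a}) t)) \<and>
       (cd D s = (\<lambda>q\<in>ob_set C. h0 q) q \<longrightarrow> (\<exists>t\<in>ar_set C. cd C t = q \<and> s \<in> (\<lambda>a\<in>ar_set C. {h1 a}) t))"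
    proof (intro ballI)
      fix q s assume q: "q \<in> ob_set C" and s: "s \<in> ar_set D"
      obtain t where t: "t \<in> ar_set C" "s = h1 t" using lift s by blast
      then have "dm D s = h0 (dm C t)" "cd D s = h0 (cd C t)" using H by simp_all
      then have "dm D s = h0 q \<Longrightarrow> dm C t = q" "cd D s = h0 q \<Longrightarrow> cd C t = q" using inj ob[OF t(1)] q by auto
      then show "(dm D s = (\<lambda>q\<in>ob_set C. h0 q) q \<longrightarrow> (\<exists>t\<in>ar_set C. dm C t = q \<and> s \<in> (\<lambda>a\<in>ar_set C. {h1 a}) t)) \<and>
       (cd D s = (\<lambda>q\<in>ob_set C. h0 q) q \<longrightarrow> (\<exists>t\<in>ar_set C. cd C t = q \<and> s \<in> (\<lambda>a\<in>ar_set C. {h1 a}) t))"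
        using t q by (intro conjI impI bexI[of _ t]) simp_all
    qed
    show "\<forall>A. openin (arrs D) A \<longrightarrow> openin (arrs C) {x \<in> ar_set C. (\<lambda>a\<in>ar_set C. {h1 a}) x \<inter> A \<noteq> {}}"
    proof (intro allI impI)
      fix A assume "openin (arrs D) A"
      then have "openin (arrs C) {x \<in> ar_set C. h1 x \<in> A}" using openin_continuous_map_preimage[OF h1(1)] by blast
      moreover have "{x \<in> ar_set C. (\<lambda>a\<in>ar_set C. {h1 a}) x \<inter> A \<noteq> {}} = {x \<in> ar_set C. h1 x \<in> A}" by auto
      ultimately show "openin (arrs C) {x \<in> ar_set C. (\<lambda>a\<in>ar_set C. {h1 a}) x \<inter> A \<noteq> {}}" by simp
    qed
    show "\<forall>t\<in>ob_set C. unt D ((\<lambda>q\<in>ob_set C. h0 q) t) \<in> (\<lambda>a\<in>ar_set C. {h1 a}) (unt C t)"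
      using H un by simp
  qed
  have "coherent C D (rcm_of C h0 h1)" unfolding coherent_def rcm_of_def rcm.simps
  proof (intro allI impI)
    fix K assume K: "openin (obs D) K \<and> compactin (obs D) K"
    let ?P = "{q \<in> ob_set C. (\<lambda>q\<in>ob_set C. h0 q) q \<in> K}"
    have "h0 ` ?P = K" using h0(2) openin_subset[of "obs D" K] K by force
    then show "compactin (obs C) ?P"
      using homeomorphic_map_compactness[of "obs C" "obs D" h0 ?P] H K by auto
  qed
  then show ?thesis using rel unfolding rc_hom_def by (simp add: rcm_of_def)
qed

lemma category_homeo_inverse:
  assumes C: "etale_category C" "etale_category D" and h: "category_homeo C D h0 h1"
  obtains g0 g1 where "category_homeo D C g0 g1" "\<And>q. q \<in> ob_set C \<Longrightarrow> g0 (h0 q) = q"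
    "\<And>p. p \<in> ob_set D \<Longrightarrow> h0 (g0 p) = p" "\<And>a. a \<in> ar_set C \<Longrightarrow> g1 (h1 a) = a" "\<And>s. s \<in> ar_set D \<Longrightarrow> h1 (g1 s) = s"
proof -
  note H = h[unfolded category_homeo_def]
  obtain g0 where g0: "homeomorphic_maps (obs C) (obs D) h0 g0" using H homeomorphic_map_maps by blast
  obtain g1 where g1: "homeomorphic_maps (arrs C) (arrs D) h1 g1" using H homeomorphic_map_maps by blast
  note inv = g0[unfolded homeomorphic_maps_def] g1[unfolded homeomorphic_maps_def]
  have g: "g0 p \<in> ob_set C" if "p \<in> ob_set D" for p using that inv continuous_map_funspace by blast
  have g': "g1 s \<in> ar_set C" if "s \<in> ar_set D" for s using that inv continuous_map_funspace by blast
  note ob = etale_closed(1,2)[OF C(1)] and un = etale_closed(3)[OF C(1)] and cm = etale_closed(4)[OF C(1)]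
  have hom: "homeomorphic_map (obs D) (obs C) g0" "homeomorphic_map (arrs D) (arrs C) g1"
    using g0 g1 homeomorphic_maps_sym homeomorphic_maps_imp_map by blast+
  have d: "dm C (g1 s) = g0 (dm D s)" "cd C (g1 s) = g0 (cd D s)" if "s \<in> ar_set D" for s
    using H inv ob g' that by metis+
  moreover have "g1 (unt D p) = unt C (g0 p)" if "p \<in> ob_set D" for p
    using H inv un g that by metis
  moreover have "g1 (cmp D s t) = cmp C (g1 s) (g1 t)" if st: "s \<in> ar_set D" "t \<in> ar_set D" "dm D s = cd D t" for s t
  proof -
    have *: "dm C (g1 s) = cd C (g1 t)" using d st by simp
    then have "h1 (cmp C (g1 s) (g1 t)) = cmp D s t" using H inv g' st by simp
    then show ?thesis using inv cm[OF g' g' *] st by metis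
  qed
  ultimately have "category_homeo D C g0 g1" unfolding category_homeo_def using hom by blast
  then show ?thesis using that inv by blast
qed

lemma category_homeo_rc_iso:
  assumes C: "etale_category C" "etale_category D" and h: "category_homeo C D h0 h1"
  shows "rc_iso k C D (rcm_of C h0 h1)"
proof -
  obtain g0 g1 where g: "category_homeo D C g0 g1" "\<And>q. q \<in> ob_set C \<Longrightarrow> g0 (h0 q) = q"
    "\<And>p. p \<in> ob_set D \<Longrightarrow> h0 (g0 p) = p" "\<And>a. a \<in> ar_set C \<Longrightarrow> g1 (h1 a) = a" "\<And>s. s \<in> ar_set D \<Longrightarrow> h1 (g1 s) = s"
    using category_homeo_inverse[OF C h] by metis
  have h0: "h0 q \<in> ob_set D" if "q \<in> ob_set C" for q
    using that h homeomorphic_imp_surjective_map unfolding category_homeo_def by blast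
  have g0: "g0 q \<in> ob_set C" if "q \<in> ob_set D" for q
    using that g(1) homeomorphic_imp_surjective_map unfolding category_homeo_def by blast
  have h1: "h1 q \<in> ar_set D" if "q \<in> ar_set C" for q
    using that h homeomorphic_imp_surjective_map unfolding category_homeo_def by blast
  have g1: "g1 q \<in> ar_set C" if "q \<in> ar_set D" for q
    using that g(1) homeomorphic_imp_surjective_map unfolding category_homeo_def by blast
  have "rc_comp C (rcm_of D g0 g1) (rcm_of C h0 h1) = rc_id C"
    unfolding rc_comp_def rc_id_def rcm_of_def compose_def using g h0 h1 by (auto intro!: restrict_ext)
  moreover have "rc_comp D (rcm_of C h0 h1) (rcm_of D g0 g1) = rc_id D"
    unfolding rc_comp_def rc_id_def rcm_of_def compose_def using g g0 g1 by (auto intro!: restrict_ext)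
  ultimately show ?thesis unfolding rc_iso_def
    using category_homeo_rc_hom[OF C(1) h] category_homeo_rc_hom[OF C(2) g(1)] by blast
qed

lemma category_homeo_cancellative:
  assumes h: "category_homeo C D h0 h1" and D: "cancellative D" shows "cancellative C"
  unfolding cancellative_def
proof (intro ballI conjI impI; elim conjE)
  note H = h[unfolded category_homeo_def]
  have inj: "a = b" if "a \<in> ar_set C" "b \<in> ar_set C" "h1 a = h1 b" for a b
    using H that unfolding homeomorphic_map_def inj_on_def by blast
  have ar: "h1 a \<in> ar_set D" if "a \<in> ar_set C" for a
    using that H homeomorphic_imp_surjective_map by blast
  have can: "(dm D s = cd D u \<longrightarrow> dm D t = cd D u \<longrightarrow> cmp D s u = cmp D t u \<longrightarrow> s = t) \<and>
      (cd D s = dm D u \<longrightarrow> cd D t = dm D u \<longrightarrow> cmp D u s = cmp D u t \<longrightarrow> s = t)"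
    if "s \<in> ar_set D" "t \<in> ar_set D" "u \<in> ar_set D" for s t u
    using D that unfolding cancellative_def by blast
  fix a b c assume c: "a \<in> ar_set C" "b \<in> ar_set C" "c \<in> ar_set C"
  have hd: "dm D (h1 x) = h0 (dm C x)" "cd D (h1 x) = h0 (cd C x)" if "x \<in> ar_set C" for x using H that by blast+
  { assume e: "dm C a = cd C c" "dm C b = cd C c" "cmp C a c = cmp C b c"
    then have "cmp D (h1 a) (h1 c) = cmp D (h1 b) (h1 c)" using H c by metis
    then have "h1 a = h1 b" using can[OF ar[OF c(1)] ar[OF c(2)] ar[OF c(3)]] hd c e by simp
    then show "a = b" using inj c by blast }
  { assume e: "cd C a = dm C c" "cd C b = dm C c" "cmp C c a = cmp C c b"
    then have "cmp D (h1 c) (h1 a) = cmp D (h1 c) (h1 b)" using H c by metis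
    then have "h1 a = h1 b" using can[OF ar[OF c(1)] ar[OF c(2)] ar[OF c(3)]] hd c e by simp
    then show "a = b" using inj c by blast }
qed

section \<open>A category is the spectrum of its compact slices\<close>

context spectral_etale
begin

lemma slice_at:
  assumes x: "x \<in> ar_set C" obtains A where "A \<in> compact_slices C" "x \<in> A"
  by (rule slices_base[OF openin_topspace x]) (rule that)

text \<open>The two functions making up \<open>et_unit\<close>.\<close>

definition point_filter :: "'o \<Rightarrow> 'm set set" where
  "point_filter q = {P \<in> projs (Slices C). unt C q \<in> P}"

definition arrow_filter :: "'m \<Rightarrow> 'm set set" where
  "arrow_filter x = {A \<in> compact_slices C. x \<in> A}"

lemma arrow_filter_arr:
  assumes x: "x \<in> ar_set C" shows "arrow_filter x \<in> arrs_of (Slices C)"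
proof -
  interpret D: drs "Slices C" by (rule drs_Slices)
  show ?thesis unfolding D.arrs_of_iff bottom_Slices(2) Slices_simps(1)
  proof (intro conjI ballI impI)
    show "arrow_filter x \<subseteq> compact_slices C" "{} \<notin> arrow_filter x" by (auto simp: arrow_filter_def)
    obtain A where "A \<in> compact_slices C" "x \<in> A" by (rule slice_at[OF x])
    then show "arrow_filter x \<noteq> {}" by (auto simp: arrow_filter_def)
  next
    fix A B assume "A \<in> arrow_filter x" "B \<in> compact_slices C" "A \<sqsubseteq>\<^bsub>nat_ord (Slices C)\<^esub> B"
    then show "B \<in> arrow_filter x" using slice_le_iff by (auto simp: arrow_filter_def)
  next
    fix A B assume "A \<in> arrow_filter x" "B \<in> arrow_filter x"
    then have A: "A \<in> compact_slices C" "B \<in> compact_slices C" "x \<in> A \<inter> B" by (auto simp: arrow_filter_def)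
    have "openin (arrs C) (A \<inter> B)" using A slice_iff by blast
    then obtain D where "D \<in> compact_slices C" "x \<in> D" "D \<subseteq> A \<inter> B" using slices_base A(3) by blast
    then show "\<exists>D\<in>arrow_filter x. D \<sqsubseteq>\<^bsub>nat_ord (Slices C)\<^esub> A \<and> D \<sqsubseteq>\<^bsub>nat_ord (Slices C)\<^esub> B"
      using slice_le_iff A by (auto simp: arrow_filter_def)
  next
    fix A B X assume A: "A \<in> compact_slices C" "B \<in> compact_slices C" and X: "X \<in> arrow_filter x"
      and lub: "is_lub (nat_ord (Slices C)) X {A, B}"
    have Xc: "X \<in> compact_slices C" "x \<in> X" using X by (auto simp: arrow_filter_def)
    note l = lub[unfolded D.lub2_iff[of A B, unfolded Slices_simps(1), OF A]]
    have sub: "A \<union> B \<subseteq> X" using l A Xc slice_le_iff by auto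
    have "A \<union> B \<in> compact_slices C"
    proof (rule sub_sliceI[OF Xc(1) sub])
      show "openin (arrs C) (A \<union> B)" using A slice_iff by blast
      show "compactin (obs C) (dm C ` (A \<union> B)) \<or> compactin (obs C) (cd C ` (A \<union> B))"
        using slice_images(1)[OF A(1)] slice_images(1)[OF A(2)] compactin_Un
        unfolding compact_open_def image_Un by blast
    qed
    then have "X \<subseteq> A \<union> B" using l A slice_le_iff Xc by auto
    then show "A \<in> arrow_filter x \<or> B \<in> arrow_filter x" using A Xc by (auto simp: arrow_filter_def)
  qed
qed

lemma mem_unit_image: "\<lbrakk>q \<in> ob_set C; K \<subseteq> ob_set C\<rbrakk> \<Longrightarrow> unt C q \<in> unt C ` K \<longleftrightarrow> q \<in> K"
  using etale_unit_embedding(3)[OF etale] by (auto simp: inj_on_def)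

text \<open>A unit slice through the domain of \<open>x\<close> restricts any slice through \<open>x\<close>.\<close>

lemma dom_arrow_filter:
  assumes x: "x \<in> ar_set C" shows "dom_of (Slices C) (arrow_filter x) = point_filter (dm C x)"
proof -
  interpret D: drs "Slices C" by (rule drs_Slices)
  have le: "lam (Slices C) A \<sqsubseteq>\<^bsub>nat_ord (Slices C)\<^esub> P \<longleftrightarrow> unt C ` dm C ` A \<subseteq> P"
    if "A \<in> compact_slices C" "P \<in> projs (Slices C)" for A P
    using that slice_le_iff[OF unit_slice[OF slice_images(1)[OF that(1)]] proj_slice[OF that(2)]] by simp
  have "(\<exists>A\<in>arrow_filter x. lam (Slices C) A \<sqsubseteq>\<^bsub>nat_ord (Slices C)\<^esub> P) \<longleftrightarrow> unt C (dm C x) \<in> P"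
    if P: "P \<in> projs (Slices C)" for P
  proof
    assume "\<exists>A\<in>arrow_filter x. lam (Slices C) A \<sqsubseteq>\<^bsub>nat_ord (Slices C)\<^esub> P"
    then show "unt C (dm C x) \<in> P" using le P unfolding arrow_filter_def by blast
  next
    assume ux: "unt C (dm C x) \<in> P"
    obtain K where K: "P = unt C ` K" "compact_open (obs C) K" "K \<subseteq> ob_set C" using P by (rule proj_SlicesE)
    have "dm C x \<in> K" using ux K mem_unit_image dm_ob x by blast
    obtain A where A: "A \<in> compact_slices C" "x \<in> A" by (rule slice_at[OF x])
    let ?B = "{a \<in> A. dm C a \<in> K}"
    have B: "?B \<in> compact_slices C" by (rule restrict_dm_slice[OF A(1) K(2)])
    then have "?B \<in> arrow_filter x" using A \<open>dm C x \<in> K\<close> by (simp add: arrow_filter_def)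
    moreover have "lam (Slices C) ?B \<sqsubseteq>\<^bsub>nat_ord (Slices C)\<^esub> P" using le[OF B P] K(1) by blast
    ultimately show "\<exists>A\<in>arrow_filter x. lam (Slices C) A \<sqsubseteq>\<^bsub>nat_ord (Slices C)\<^esub> P" by blast
  qed
  then show ?thesis unfolding dom_of_def point_filter_def by blast
qed

lemma cod_arrow_filter:
  assumes x: "x \<in> ar_set C" shows "cod_of (Slices C) (arrow_filter x) = point_filter (cd C x)"
proof -
  interpret D: drs "Slices C" by (rule drs_Slices)
  have le: "rho (Slices C) A \<sqsubseteq>\<^bsub>nat_ord (Slices C)\<^esub> P \<longleftrightarrow> unt C ` cd C ` A \<subseteq> P"
    if "A \<in> compact_slices C" "P \<in> projs (Slices C)" for A P
    using that slice_le_iff[OF unit_slice[OF slice_images(2)[OF that(1)]] proj_slice[OF that(2)]] by simp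
  have "(\<exists>A\<in>arrow_filter x. rho (Slices C) A \<sqsubseteq>\<^bsub>nat_ord (Slices C)\<^esub> P) \<longleftrightarrow> unt C (cd C x) \<in> P"
    if P: "P \<in> projs (Slices C)" for P
  proof
    assume "\<exists>A\<in>arrow_filter x. rho (Slices C) A \<sqsubseteq>\<^bsub>nat_ord (Slices C)\<^esub> P"
    then show "unt C (cd C x) \<in> P" using le P unfolding arrow_filter_def by blast
  next
    assume ux: "unt C (cd C x) \<in> P"
    obtain K where K: "P = unt C ` K" "compact_open (obs C) K" "K \<subseteq> ob_set C" using P by (rule proj_SlicesE)
    have "cd C x \<in> K" using ux K mem_unit_image cd_ob x by blast
    obtain A where A: "A \<in> compact_slices C" "x \<in> A" by (rule slice_at[OF x])
    let ?B = "{a \<in> A. cd C a \<in> K}"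
    have B: "?B \<in> compact_slices C" by (rule restrict_cd_slice[OF A(1) K(2)])
    then have "?B \<in> arrow_filter x" using A \<open>cd C x \<in> K\<close> by (simp add: arrow_filter_def)
    moreover have "rho (Slices C) ?B \<sqsubseteq>\<^bsub>nat_ord (Slices C)\<^esub> P" using le[OF B P] K(1) by blast
    ultimately show "\<exists>A\<in>arrow_filter x. rho (Slices C) A \<sqsubseteq>\<^bsub>nat_ord (Slices C)\<^esub> P" by blast
  qed
  then show ?thesis unfolding cod_of_def point_filter_def by blast
qed

lemma point_filter_ob: assumes q: "q \<in> ob_set C" shows "point_filter q \<in> obs_of (Slices C)"
proof -
  interpret D: drs "Slices C" by (rule drs_Slices)
  show ?thesis using D.dom_of_obs[OF arrow_filter_arr[OF unit_ar[OF q]]] dom_arrow_filter[OF unit_ar[OF q]] unit_dm[OF q]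
    by simp
qed

lemma unit_mem_point_filter:
  "\<lbrakk>q \<in> ob_set C; compact_open (obs C) K\<rbrakk> \<Longrightarrow> unt C ` K \<in> point_filter q \<longleftrightarrow> q \<in> K"
  unfolding point_filter_def using unit_proj[of K] mem_unit_image[of q K] openin_subset[of "obs C" K]
  by (simp add: compact_open_def)

text \<open>Let \<open>Z\<close> be the complement of the compact-open sets not belonging to \<open>F\<close>.  By compactness and primeness a
  compact-open set meets \<open>Z\<close> iff it belongs to \<open>F\<close>.  So \<open>Z\<close> is irreducible, and its generic point represents \<open>F\<close>.\<close>

lemma obs_of_Slices: assumes F: "F \<in> obs_of (Slices C)" shows "\<exists>q\<in>ob_set C. F = point_filter q"
proof -
  interpret D: drs "Slices C" by (rule drs_Slices)
  let ?X = "obs C"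
  define Z where "Z = ob_set C - \<Union>{K. compact_open ?X K \<and> unt C ` K \<notin> F}"
  have up: "unt C ` L \<in> F" if K: "compact_open ?X K" "compact_open ?X L" "K \<subseteq> L" "unt C ` K \<in> F" for K L
  proof (rule D.obs_ofD(4)[OF F K(4) unit_proj[OF K(2)]])
    show "unt C ` K \<sqsubseteq>\<^bsub>nat_ord (Slices C)\<^esub> unt C ` L"
      using slice_le_iff[OF unit_slice[OF K(1)] unit_slice[OF K(2)]] K(3) by auto
  qed
  have sub: "K \<subseteq> ob_set C" if "compact_open ?X K" for K using that openin_subset unfolding compact_open_def by blast
  have fin: "unt C ` \<Union>\<F> \<notin> F" if "finite \<F>" "\<And>K. K \<in> \<F> \<Longrightarrow> compact_open ?X K \<and> unt C ` K \<notin> F" for \<F>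
    using that
  proof (induction \<F> rule: finite_induct)
    case empty then show ?case using D.obs_ofD(3)[OF F] bottom_Slices(2) by simp
  next
    case (insert K \<F>)
    then have K: "compact_open ?X K" "compact_open ?X (\<Union>\<F>)" using compact_open_Union by auto
    have "unt C ` \<Union>(insert K \<F>) = unt C ` K \<squnion>\<^bsub>proj_ord (Slices C)\<^esub> unt C ` \<Union>\<F>"
      using pjoin_Slices[OF unit_proj[OF K(1)] unit_proj[OF K(2)]] by auto
    then show ?case using D.obs_ofD(6)[OF F unit_proj[OF K(1)] unit_proj[OF K(2)]] insert by auto
  qed
  have meets: "K \<inter> Z \<noteq> {} \<longleftrightarrow> unt C ` K \<in> F" if K: "compact_open ?X K" for K
  proof
    assume "K \<inter> Z \<noteq> {}" then show "unt C ` K \<in> F" using K unfolding Z_def by blast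
  next
    assume KF: "unt C ` K \<in> F"
    show "K \<inter> Z \<noteq> {}"
    proof
      assume "K \<inter> Z = {}"
      then have "K \<subseteq> \<Union>{K. compact_open ?X K \<and> unt C ` K \<notin> F}" using sub[OF K] unfolding Z_def by blast
      moreover have "\<And>U. U \<in> {K. compact_open ?X K \<and> unt C ` K \<notin> F} \<Longrightarrow> openin ?X U" by (auto simp: compact_open_def)
      moreover have "compactin ?X K" using K by (simp add: compact_open_def)
      ultimately have "\<exists>\<F>. finite \<F> \<and> \<F> \<subseteq> {K. compact_open ?X K \<and> unt C ` K \<notin> F} \<and> K \<subseteq> \<Union>\<F>"
        by (intro compactinD)
      then obtain \<F> where f: "finite \<F>" "\<F> \<subseteq> {K. compact_open ?X K \<and> unt C ` K \<notin> F}" "K \<subseteq> \<Union>\<F>"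
        by (elim exE conjE)
      have "compact_open ?X (\<Union>\<F>)" by (rule compact_open_Union) (use f in auto)
      then have "unt C ` \<Union>\<F> \<in> F" using up[OF K _ f(3) KF] by blast
      then show False using fin[OF f(1)] f(2) by blast
    qed
  qed
  have closed: "closedin ?X Z" unfolding Z_def
    by (intro closedin_diff closedin_topspace openin_Union) (auto simp: compact_open_def)
  have open_meets: "\<exists>K. compact_open ?X K \<and> K \<subseteq> W \<and> unt C ` K \<in> F" if "openin ?X W" "W \<inter> Z \<noteq> {}" for W
  proof -
    obtain x where "x \<in> W" "x \<in> Z" using \<open>W \<inter> Z \<noteq> {}\<close> by blast
    then obtain K where "compact_open ?X K" "x \<in> K" "K \<subseteq> W" using spectral_space_base[OF spectral \<open>openin ?X W\<close>] by metis
    then show ?thesis using meets \<open>x \<in> Z\<close> by blast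
  qed
  have irr: "irreducible_in ?X Z" unfolding irreducible_in_iff
  proof (intro conjI allI impI; (elim conjE)?)
    show "Z \<subseteq> ob_set C" unfolding Z_def by blast
    obtain P where "P \<in> F" using D.obs_ofD(2)[OF F] by blast
    moreover from this have "P \<in> projs (Slices C)" using D.ob_proj F by blast
    ultimately show "Z \<noteq> {}" using meets proj_SlicesE by (metis inf_bot_right)
    fix V W assume VW: "openin ?X V" "openin ?X W" "V \<inter> Z \<noteq> {}" "W \<inter> Z \<noteq> {}"
    obtain K L where K: "compact_open ?X K" "K \<subseteq> V" "unt C ` K \<in> F" "compact_open ?X L" "L \<subseteq> W" "unt C ` L \<in> F"
      using open_meets VW by metis
    have "unt C ` K \<cdot>\<^bsub>Slices C\<^esub> unt C ` L \<in> F" using D.obs_ofD(5)[OF F K(3,6)] .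
    then have "unt C ` (K \<inter> L) \<in> F" using unit_tms_unit sub K by simp
    then have "K \<inter> L \<inter> Z \<noteq> {}" using meets compact_open_Int[OF spectral K(1,4)] by simp
    then show "V \<inter> W \<inter> Z \<noteq> {}" using K by blast
  qed
  have "sober_space ?X" using spectral unfolding spectral_space_def by blast
  then obtain q where q: "q \<in> Z" "\<And>W. \<lbrakk>openin ?X W; W \<inter> Z \<noteq> {}\<rbrakk> \<Longrightarrow> q \<in> W"
    using sober_space_generic_point[OF _ closed irr] by metis
  have q0: "q \<in> ob_set C" using q(1) unfolding Z_def by blast
  have iff: "q \<in> K \<longleftrightarrow> unt C ` K \<in> F" if K: "compact_open ?X K" for K
    using q meets[OF K] K unfolding compact_open_def by blast
  have "P \<in> F \<longleftrightarrow> P \<in> point_filter q" for P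
  proof -
    have "P \<in> projs (Slices C)" if "P \<in> F \<or> P \<in> point_filter q"
      using that D.ob_proj F unfolding point_filter_def by blast
    moreover have "P \<in> F \<longleftrightarrow> P \<in> point_filter q" if "P \<in> projs (Slices C)"
    proof -
      obtain K where K: "P = unt C ` K" "compact_open (obs C) K" using \<open>P \<in> projs (Slices C)\<close> by (rule proj_SlicesE)
      then show ?thesis using iff unit_mem_point_filter[OF q0] by simp
    qed
    ultimately show ?thesis by blast
  qed
  then show ?thesis using q0 by blast
qed

text \<open>Points with the same compact-open neighbourhoods are both generic in the closure of either of them.\<close>

lemma inj_point_filter: "inj_on point_filter (ob_set C)"
proof (rule inj_onI)
  fix p q assume pq: "p \<in> ob_set C" "q \<in> ob_set C" "point_filter p = point_filter q"
  let ?X = "obs C"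
  have *: "p \<in> W \<longleftrightarrow> q \<in> W" if W: "openin ?X W" for W
  proof -
    have "y \<in> W" if "x \<in> W" "x \<in> ob_set C" "y \<in> ob_set C" "point_filter x = point_filter y" for x y
    proof -
      obtain K where "compact_open ?X K" "x \<in> K" "K \<subseteq> W" using spectral_space_base[OF spectral W \<open>x \<in> W\<close>] .
      then show ?thesis using unit_mem_point_filter that by blast
    qed
    then show ?thesis using pq by metis
  qed
  have "X closure_of {p} = X closure_of {q}" if "X = ?X" for X
    unfolding that closure_of_def using * by auto
  then have eq: "?X closure_of {p} = ?X closure_of {q}" by blast
  have irr: "irreducible_in ?X (?X closure_of {p})" unfolding irreducible_in_iff
  proof (intro conjI allI impI; (elim conjE)?)
    show "?X closure_of {p} \<subseteq> ob_set C" by (rule closure_of_subset_topspace)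
    show "?X closure_of {p} \<noteq> {}" using pq closure_of_subset[of "{p}" ?X] by auto
    fix V W assume "openin ?X V" "openin ?X W" "V \<inter> ?X closure_of {p} \<noteq> {}" "W \<inter> ?X closure_of {p} \<noteq> {}"
    then have "p \<in> V" "p \<in> W" by (auto simp: in_closure_of)
    moreover have "p \<in> ?X closure_of {p}" using pq closure_of_subset[of "{p}" ?X] by auto
    ultimately show "V \<inter> W \<inter> ?X closure_of {p} \<noteq> {}" by blast
  qed
  have pq_cl: "p \<in> ?X closure_of {p}" "q \<in> ?X closure_of {p}"
    using pq eq closure_of_subset[of "{p}" ?X] closure_of_subset[of "{q}" ?X] by auto
  have gen: "p \<in> W" "q \<in> W" if "openin ?X W" "W \<inter> ?X closure_of {p} \<noteq> {}" for W
  proof -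
    show "p \<in> W" using that by (auto simp: in_closure_of)
    then show "q \<in> W" using * that by blast
  qed
  have "sober_space ?X" using spectral unfolding spectral_space_def by blast
  then obtain x where "\<And>y. \<lbrakk>y \<in> ?X closure_of {p}; \<And>W. \<lbrakk>openin ?X W; W \<inter> ?X closure_of {p} \<noteq> {}\<rbrakk> \<Longrightarrow> y \<in> W\<rbrakk> \<Longrightarrow> y = x"
    using sober_space_generic_point[OF _ closedin_closure_of irr] by metis
  then have "p = x" "q = x" using pq_cl gen by blast+
  then show "p = q" by simp
qed

text \<open>A prime filter of slices is the germ of one of its slices at a point of the objects, that is, the filter of the unique
  arrow of that slice over the point.\<close>

lemma arrs_of_Slices: assumes A: "\<A> \<in> arrs_of (Slices C)" shows "\<exists>x\<in>ar_set C. \<A> = arrow_filter x"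
proof -
  interpret D: drs "Slices C" by (rule drs_Slices)
  obtain q where q: "q \<in> ob_set C" "dom_of (Slices C) \<A> = point_filter q" using obs_of_Slices D.dom_of_obs[OF A] by blast
  obtain A where AA: "A \<in> \<A>" using D.arrs_ofD(2)[OF A] by blast
  then have Ac: "A \<in> compact_slices C" using D.arr_carrier[OF A] by simp
  have "unt C ` dm C ` A \<in> point_filter q" using D.lam_mem_dom[OF A AA] q by simp
  then have "q \<in> dm C ` A" using unit_mem_point_filter[OF q(1) slice_images(1)[OF Ac]] by blast
  then obtain x where x: "x \<in> A" "q = dm C x" by blast
  have xa: "x \<in> ar_set C" using x slice_sub[OF Ac] by blast
  have "\<A> = arrow_filter x"
    using D.arr_eqI_dom[OF A arrow_filter_arr[OF xa] _ AA] q dom_arrow_filter[OF xa] x Ac by (simp add: arrow_filter_def)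
  then show ?thesis using xa by blast
qed

lemma inj_arrow_filter: "inj_on arrow_filter (ar_set C)"
proof (rule inj_onI)
  fix x y assume xy: "x \<in> ar_set C" "y \<in> ar_set C" "arrow_filter x = arrow_filter y"
  then have "point_filter (dm C x) = point_filter (dm C y)" using dom_arrow_filter by metis
  then have d: "dm C x = dm C y" using inj_point_filter dm_ob xy unfolding inj_on_def by blast
  obtain A where A: "A \<in> compact_slices C" "x \<in> A" by (rule slice_at[OF xy(1)])
  then have "y \<in> A" using xy(3) unfolding arrow_filter_def by blast
  then show "x = y" using slice_dm_inj[OF A(1,2)] d by blast
qed

lemma arrow_filter_image: "A \<in> compact_slices C \<Longrightarrow> arrow_filter ` A = ar_basic (Slices C) A"
  using arrs_of_Slices arrow_filter_arr slice_sub unfolding ar_basic_def by (auto simp: arrow_filter_def)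

lemma point_filter_image:
  assumes K: "compact_open (obs C) K" shows "point_filter ` K = ob_basic (Slices C) (unt C ` K)"
proof -
  have "K \<subseteq> ob_set C" using K openin_subset unfolding compact_open_def by blast
  have "F \<in> point_filter ` K \<longleftrightarrow> F \<in> obs_of (Slices C) \<and> unt C ` K \<in> F" for F
  proof
    show "F \<in> obs_of (Slices C) \<and> unt C ` K \<in> F" if F: "F \<in> point_filter ` K"
    proof -
      obtain q where q: "q \<in> K" "F = point_filter q" using F by blast
      moreover from this have "q \<in> ob_set C" using \<open>K \<subseteq> ob_set C\<close> by blast
      ultimately show ?thesis using point_filter_ob unit_mem_point_filter[OF _ K] by simp
    qed
    show "F \<in> point_filter ` K" if F: "F \<in> obs_of (Slices C) \<and> unt C ` K \<in> F"
    proof -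
      obtain q where "q \<in> ob_set C" "F = point_filter q" using obs_of_Slices F by blast
      then show ?thesis using F unit_mem_point_filter[OF _ K] by simp
    qed
  qed
  then show ?thesis unfolding ob_basic_def by blast
qed

lemma homeomorphic_arrow_filter: "homeomorphic_map (arrs C) (arrs (Spec (Slices C))) arrow_filter"
proof (rule bijective_open_imp_homeomorphic_map)
  interpret D: drs "Slices C" by (rule drs_Slices)
  show im: "arrow_filter ` ar_set C = ar_set (Spec (Slices C))"
    unfolding D.ar_set_Spec using arrs_of_Slices arrow_filter_arr by blast
  show "inj_on arrow_filter (ar_set C)" by (rule inj_arrow_filter)
  show "open_map (arrs C) (arrs (Spec (Slices C))) arrow_filter"
  proof (rule open_map_by_nhds)
    fix x W assume W: "openin (arrs C) W" "x \<in> W"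
    obtain A where A: "A \<in> compact_slices C" "x \<in> A" "A \<subseteq> W" using slices_base[OF W] .
    have "openin (arrs (Spec (Slices C))) (arrow_filter ` A)"
      unfolding arrow_filter_image[OF A(1)] by (rule D.open_ar_basic) (simp add: A(1))
    then show "\<exists>V. openin (arrs (Spec (Slices C))) V \<and> arrow_filter x \<in> V \<and> V \<subseteq> arrow_filter ` W"
      using A by blast
  qed
  show "continuous_map (arrs C) (arrs (Spec (Slices C))) arrow_filter"
  proof (rule continuous_map_by_nhds)
    show "arrow_filter \<in> ar_set C \<rightarrow> ar_set (Spec (Slices C))" using im by blast
    fix x W assume W: "openin (arrs (Spec (Slices C))) W" "arrow_filter x \<in> W"
    obtain A where A: "A \<in> compact_slices C" "A \<in> arrow_filter x" "ar_basic (Slices C) A \<subseteq> W"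
      using D.arr_nhd[OF W] by auto
    then show "\<exists>V. openin (arrs C) V \<and> x \<in> V \<and> arrow_filter ` V \<subseteq> W"
      unfolding arrow_filter_image[OF A(1), symmetric] using slice_iff[of A]
      by (intro exI[of _ A]) (simp add: arrow_filter_def)
  qed
qed

lemma homeomorphic_point_filter: "homeomorphic_map (obs C) (obs (Spec (Slices C))) point_filter"
proof (rule bijective_open_imp_homeomorphic_map)
  interpret D: drs "Slices C" by (rule drs_Slices)
  show im: "point_filter ` ob_set C = ob_set (Spec (Slices C))"
    unfolding D.ob_set_Spec using obs_of_Slices point_filter_ob by blast
  show "inj_on point_filter (ob_set C)" by (rule inj_point_filter)
  show "open_map (obs C) (obs (Spec (Slices C))) point_filter"
  proof (rule open_map_by_nhds)
    fix q W assume W: "openin (obs C) W" "q \<in> W"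
    obtain K where K: "compact_open (obs C) K" "q \<in> K" "K \<subseteq> W" using spectral_space_base[OF spectral W] .
    have "openin (obs (Spec (Slices C))) (point_filter ` K)"
      unfolding point_filter_image[OF K(1)] by (rule D.open_ob_basic[OF unit_proj[OF K(1)]])
    then show "\<exists>V. openin (obs (Spec (Slices C))) V \<and> point_filter q \<in> V \<and> V \<subseteq> point_filter ` W"
      using K by blast
  qed
  show "continuous_map (obs C) (obs (Spec (Slices C))) point_filter"
  proof (rule continuous_map_by_nhds)
    show "point_filter \<in> ob_set C \<rightarrow> ob_set (Spec (Slices C))" using im by blast
    fix q W assume q: "q \<in> ob_set C" and W: "openin (obs (Spec (Slices C))) W" "point_filter q \<in> W"
    obtain P where P: "P \<in> projs (Slices C)" "P \<in> point_filter q" "ob_basic (Slices C) P \<subseteq> W"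
      using D.ob_nhd[OF W] .
    obtain K where K: "P = unt C ` K" "compact_open (obs C) K" using P(1) by (rule proj_SlicesE)
    have "point_filter ` K \<subseteq> W" using P(3) unfolding K(1) point_filter_image[OF K(2)] .
    then show "\<exists>V. openin (obs C) V \<and> q \<in> V \<and> point_filter ` V \<subseteq> W"
      using K P(2) unit_mem_point_filter[OF q K(2)] unfolding compact_open_def by (intro exI[of _ K]) simp
  qed
qed

lemma category_homeo_et_unit: "category_homeo C (Spec (Slices C)) point_filter arrow_filter"
proof -
  interpret D: drs "Slices C" by (rule drs_Slices)
  have u: "arrow_filter (unt C q) = unit_of (Slices C) (point_filter q)" if q: "q \<in> ob_set C" for q
  proof -
    obtain K where K: "compact_open (obs C) K" "q \<in> K" using spectral_space_base[OF spectral openin_topspace q] .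
    have "unt C ` K \<in> arrow_filter (unt C q)" using unit_slice K by (simp add: arrow_filter_def)
    then show ?thesis using D.arr_with_proj[OF arrow_filter_arr[OF unit_ar[OF q]] _ unit_proj[OF K(1)]]
      dom_arrow_filter[OF unit_ar[OF q]] unit_dm[OF q] by simp
  qed
  have m: "arrow_filter (cmp C a b) = comp_of (Slices C) (arrow_filter a) (arrow_filter b)"
    if ab: "a \<in> ar_set C" "b \<in> ar_set C" "dm C a = cd C b" for a b
  proof -
    note arr = arrow_filter_arr[OF ab(1)] arrow_filter_arr[OF ab(2)]
    have d: "dom_of (Slices C) (arrow_filter a) = cod_of (Slices C) (arrow_filter b)"
      using ab dom_arrow_filter cod_arrow_filter by simp
    obtain A where A: "A \<in> compact_slices C" "a \<in> A" by (rule slice_at[OF ab(1)])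
    obtain B where B: "B \<in> compact_slices C" "b \<in> B" by (rule slice_at[OF ab(2)])
    have "A \<cdot>\<^bsub>Slices C\<^esub> B \<in> comp_of (Slices C) (arrow_filter a) (arrow_filter b)"
      by (rule D.tms_mem_comp_of[OF arr]) (use A B in \<open>auto simp: arrow_filter_def\<close>)
    moreover have "cmp C a b \<in> A \<cdot>\<^bsub>Slices C\<^esub> B" using A B ab by auto
    then have "A \<cdot>\<^bsub>Slices C\<^esub> B \<in> arrow_filter (cmp C a b)" using tms_slice[OF A(1) B(1)] unfolding arrow_filter_def by blast
    ultimately show ?thesis
      using D.arr_eqI_dom[OF arrow_filter_arr[OF cmp_ar[OF ab]] D.comp_of_arr(1)[OF arr d]]
        D.comp_of_arr(2)[OF arr d] dom_arrow_filter[OF cmp_ar[OF ab]] dom_arrow_filter[OF ab(2)] dm_cmp[OF ab] by simp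
  qed
  show ?thesis unfolding category_homeo_def Spec_simps(1-4)
    using homeomorphic_point_filter homeomorphic_arrow_filter dom_arrow_filter cod_arrow_filter u m by simp
qed

lemma et_unit_eq: "et_unit C = rcm_of C point_filter arrow_filter"
  unfolding et_unit_def rcm_of_def point_filter_def arrow_filter_def ..

lemma rc_iso_et_unit: "rc_iso k C (Spec (Slices C)) (et_unit C)"
proof -
  interpret D: drs "Slices C" by (rule drs_Slices)
  show ?thesis unfolding et_unit_eq by (rule category_homeo_rc_iso[OF etale D.etale_Spec category_homeo_et_unit])
qed

end

section \<open>Ample semigroups and cancellative categories\<close>

lemma ampleD:
  assumes S: "ample S" and c: "a \<in> carrier S" "b \<in> carrier S" "c \<in> carrier S"
  shows "a \<cdot>\<^bsub>S\<^esub> c = b \<cdot>\<^bsub>S\<^esub> c \<Longrightarrow> a \<cdot>\<^bsub>S\<^esub> rho S c = b \<cdot>\<^bsub>S\<^esub> rho S c"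
    "c \<cdot>\<^bsub>S\<^esub> a = c \<cdot>\<^bsub>S\<^esub> b \<Longrightarrow> lam S c \<cdot>\<^bsub>S\<^esub> a = lam S c \<cdot>\<^bsub>S\<^esub> b"
  using S c unfolding ample_def by meson+

context drs
begin

text \<open>A common lower bound of \<open>a \<cdot> c\<close> and \<open>b \<cdot> c\<close> in the product replaces \<open>c\<close> by an element
  \<open>c'\<close> of \<open>C\<close> with \<open>a \<cdot> c' = b \<cdot> c'\<close>.  Ampleness then gives an element common to both filters.\<close>

lemma ample_right_cancel:
  assumes S: "ample S" and A: "A \<in> arrs_of S" "B \<in> arrs_of S" "C \<in> arrs_of S"
    and d: "dom_of S A = cod_of S C" "dom_of S B = cod_of S C" and eq: "comp_of S A C = comp_of S B C"
  shows "A = B"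
proof -
  obtain a b c where m: "a \<in> A" "b \<in> B" "c \<in> C" using arrs_ofD(2) A by (metis ex_in_conv)
  note car = arr_carrier[OF A(1) m(1)] arr_carrier[OF A(2) m(2)] arr_carrier[OF A(3) m(3)]
  note AC = comp_of_arr[OF A(1,3) d(1)]
  have "a \<cdot> c \<in> comp_of S A C" "b \<cdot> c \<in> comp_of S A C" using tms_mem_comp_of A m eq by auto
  then obtain g where g: "g \<in> comp_of S A C" "g \<preceq> a \<cdot> c" "g \<preceq> b \<cdot> c" using arrs_ofD(5)[OF AC(1)] by blast
  have gc: "g \<in> carrier S" using arr_carrier AC(1) g(1) by blast
  let ?c = "c \<cdot> lam S g"
  have cc: "?c \<in> carrier S" using tms_closed[OF car(3) lam_carrier[OF gc]] .
  have "lam S g \<in> dom_of S C" using lam_mem_dom[OF AC(1) g(1)] AC(2) by simp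
  then have cC: "?c \<in> C" using dom_mem_iff[OF A(3) m(3)] gc lam_closed by blast
  have "a \<cdot> ?c = g" "b \<cdot> ?c = g"
    using g nat_le_lam[of g "a \<cdot> c"] nat_le_lam[of g "b \<cdot> c"] gc car closed tms_assoc by simp_all
  then have "a \<cdot> rho S ?c = b \<cdot> rho S ?c" using ampleD(1)[OF S car(1,2) cc] by simp
  moreover have "rho S ?c \<in> cod_of S C" using rho_mem_cod[OF A(3) cC] .
  then have "a \<cdot> rho S ?c \<in> A" "b \<cdot> rho S ?c \<in> B"
    using dom_mem_iff[OF A(1) m(1)] dom_mem_iff[OF A(2) m(2)] d cc rho_closed by auto
  ultimately show ?thesis using arr_eqI_dom[OF A(1,2)] d by metis
qed

end

lemma ample_opp: assumes "ample S" shows "ample (opp S)"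
  unfolding ample_def opp_simps
proof (intro conjI ballI impI)
  show "restriction_semigroup (opp S)" using assms restriction_semigroup_opp unfolding ample_def by blast
qed (use ampleD[OF assms] in blast)+

context drs
begin

lemma cancellative_Spec: assumes S: "ample S" shows "cancellative (Spec S)"
  unfolding cancellative_def ar_set_Spec Spec_simps(1-4)
  using ample_right_cancel[OF S] drs.ample_right_cancel[OF drs_opp ample_opp[OF S]] by simp

end

context spectral_etale
begin

text \<open>Arrows with equal products have the same domain of their right factors (codomain of their left factors), and in a
  slice this identifies the factors to be cancelled.\<close>

lemma ample_Slices: assumes can: "cancellative C" shows "ample (Slices C)"
  unfolding ample_def
proof (intro conjI ballI impI)
  show "restriction_semigroup (Slices C)" by (rule restriction_Slices)
  fix A B D assume "A \<in> carrier (Slices C)" "B \<in> carrier (Slices C)" "D \<in> carrier (Slices C)"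
  then have s: "A \<in> compact_slices C" "B \<in> compact_slices C" "D \<in> compact_slices C" by auto
  note sub = slice_sub[OF s(1)] slice_sub[OF s(2)] slice_sub[OF s(3)]
  { assume eq: "A \<cdot>\<^bsub>Slices C\<^esub> D = B \<cdot>\<^bsub>Slices C\<^esub> D"
    have *: "a \<in> B" if AB: "A \<subseteq> ar_set C" "B \<subseteq> ar_set C" "A \<cdot>\<^bsub>Slices C\<^esub> D = B \<cdot>\<^bsub>Slices C\<^esub> D"
      and a: "a \<in> A" "dm C a \<in> cd C ` D" for A B a
    proof -
      obtain c where c: "c \<in> D" "dm C a = cd C c" using a by blast
      then have "cmp C a c \<in> A \<cdot>\<^bsub>Slices C\<^esub> D" using a by auto
      then obtain b e where b: "cmp C a c = cmp C b e" "b \<in> B" "e \<in> D" "dm C b = cd C e"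
        unfolding AB(3) by auto
      have car: "a \<in> ar_set C" "b \<in> ar_set C" "c \<in> ar_set C" "e \<in> ar_set C" using AB a b c sub by auto
      have "dm C c = dm C e" using dm_cmp[of a c] dm_cmp[of b e] b c car by simp
      then have "c = e" using slice_dm_inj[OF s(3)] b c by blast
      then have "a = b" using can b c car unfolding cancellative_def by blast
      then show ?thesis using b by simp
    qed
    show "A \<cdot>\<^bsub>Slices C\<^esub> rho (Slices C) D = B \<cdot>\<^bsub>Slices C\<^esub> rho (Slices C) D"
      unfolding Slices_simps(4) tms_unit[OF sub(1) slice_ob_images(2)[OF s(3)]] tms_unit[OF sub(2) slice_ob_images(2)[OF s(3)]]
      using *[OF sub(1,2) eq] *[OF sub(2,1) eq[symmetric]] by blast }
  { assume eq: "D \<cdot>\<^bsub>Slices C\<^esub> A = D \<cdot>\<^bsub>Slices C\<^esub> B"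
    have *: "a \<in> B" if AB: "A \<subseteq> ar_set C" "B \<subseteq> ar_set C" "D \<cdot>\<^bsub>Slices C\<^esub> A = D \<cdot>\<^bsub>Slices C\<^esub> B"
      and a: "a \<in> A" "cd C a \<in> dm C ` D" for A B a
    proof -
      obtain c where c: "c \<in> D" "dm C c = cd C a" using a by force
      then have "cmp C c a \<in> D \<cdot>\<^bsub>Slices C\<^esub> A" using a by auto
      then obtain b e where b: "cmp C c a = cmp C e b" "b \<in> B" "e \<in> D" "dm C e = cd C b"
        unfolding AB(3) by auto
      have car: "a \<in> ar_set C" "b \<in> ar_set C" "c \<in> ar_set C" "e \<in> ar_set C" using AB a b c sub by auto
      have "cd C c = cd C e" using cd_cmp[of c a] cd_cmp[of e b] b c car by simp
      then have "c = e" using slice_cd_inj[OF s(3)] b c by blast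
      then have "a = b" using can b c car unfolding cancellative_def by metis
      then show ?thesis using b by simp
    qed
    show "lam (Slices C) D \<cdot>\<^bsub>Slices C\<^esub> A = lam (Slices C) D \<cdot>\<^bsub>Slices C\<^esub> B"
      unfolding Slices_simps(3) unit_tms[OF sub(1) slice_ob_images(1)[OF s(3)]] unit_tms[OF sub(2) slice_ob_images(1)[OF s(3)]]
      using *[OF sub(1,2) eq] *[OF sub(2,1) eq[symmetric]] by blast }
qed

lemma cancellative_iff_ample: "cancellative C \<longleftrightarrow> ample (Slices C)"
proof -
  interpret D: drs "Slices C" by (rule drs_Slices)
  show ?thesis using ample_Slices D.cancellative_Spec category_homeo_cancellative[OF category_homeo_et_unit] by blast
qed

end

text \<open>Ampleness of the slices of the spectrum passes to the isomorphic semigroup.\<close>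

lemma (in drs) ample_iff_cancellative: "ample S \<longleftrightarrow> cancellative (Spec S)"
proof -
  interpret C: spectral_etale "Spec S" by (rule spectral_etale_Spec)
  show ?thesis using cancellative_Spec C.ample_Slices operation_iso.ample_reflect[OF operation_iso_rs_unit] by blast
qed
section \<open>Morphisms of semigroups induce relational coverings\<close>

locale rs_mor = operation_pair +
  assumes mor: "rs_morphism S T f"

lemma rs_mor_iff: "rs_mor S T f \<longleftrightarrow> drs S \<and> drs T \<and> rs_morphism S T f"
  unfolding rs_mor_def rs_mor_axioms_def operation_pair_def operation_pair_axioms_def
  using rs_morphism_operation_map by blast

definition pull :: "'a rsgp \<Rightarrow> ('a \<Rightarrow> 'b) \<Rightarrow> 'b set \<Rightarrow> 'a set" where
  "pull S f F = {e \<in> projs S. f e \<in> F}"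

lemma pull_opp [simp]: "pull (opp S) f = pull S f"
  by (simp add: pull_def[abs_def])

context rs_mor
begin

lemma f_zero: "f S.zero = T.zero"
  and f_pjoin: "\<lbrakk>x \<in> projs S; y \<in> projs S\<rbrakk> \<Longrightarrow> f (S.pjoin x y) = T.pjoin (f x) (f y)"
  and f_pmeet: "\<lbrakk>x \<in> projs S; y \<in> projs S\<rbrakk> \<Longrightarrow> f (x \<sqinter>\<^bsub>proj_ord S\<^esub> y) = f x \<sqinter>\<^bsub>proj_ord T\<^esub> f y"
  and f_cofinal: "a \<in> projs T \<Longrightarrow> \<exists>b\<in>projs S. a \<sqsubseteq>\<^bsub>nat_ord T\<^esub> f b"
  using mor unfolding rs_morphism_def T.proj_ord_simps by simp_all

lemma rs_mor_opp: "rs_mor (opp S) (opp T) f"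
  unfolding rs_mor_iff using S.drs_opp T.drs_opp mor by (simp add: rs_morphism_def)

lemma pull_ob: assumes F: "F \<in> obs_of T" shows "pull S f F \<in> obs_of S"
  unfolding S.obs_of_iff
proof (intro conjI ballI impI)
  note D = T.obs_ofD[OF F]
  show "pull S f F \<subseteq> projs S" by (auto simp: pull_def)
  obtain a where a: "a \<in> F" using D(2) by blast
  obtain b where "b \<in> projs S" "a \<sqsubseteq>\<^bsub>nat_ord T\<^esub> f b" using f_cofinal T.ob_proj[OF F a] by blast
  then show "pull S f F \<noteq> {}" using D(4)[OF a f_proj] unfolding pull_def by blast
  show "S.zero \<notin> pull S f F" using f_zero D(3) by (simp add: pull_def)
  fix e g
  { assume "e \<in> pull S f F" "g \<in> projs S" "e \<sqsubseteq>\<^bsub>nat_ord S\<^esub> g"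
    then show "g \<in> pull S f F" using D(4)[of "f e" "f g"] f_mono S.proj_carrier f_proj by (simp add: pull_def) }
  { assume "e \<in> pull S f F" "g \<in> pull S f F"
    then show "e \<cdot>\<^bsub>S\<^esub> g \<in> pull S f F"
      using D(5)[of "f e" "f g"] f_tms S.proj_carrier S.projs_closed by (simp add: pull_def) }
  { assume "e \<in> projs S" "g \<in> projs S" "S.pjoin e g \<in> pull S f F"
    then show "e \<in> pull S f F \<or> g \<in> pull S f F"
      using D(6)[of "f e" "f g"] f_pjoin f_proj by (simp add: pull_def) }
qed

text \<open>The relation between prime filters that \<open>f\<close> induces; \<open>f ` B \<subseteq> A\<close> alone would only give one inclusion of the domains.\<close>

definition covers :: "'b set \<Rightarrow> 'a set \<Rightarrow> bool" where
  "covers A B \<longleftrightarrow> B \<in> arrs_of S \<and> f ` B \<subseteq> A \<and> dom_of S B = pull S f (dom_of T A)"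

text \<open>The source of all related filters below: \<open>f\<close> takes the restrictions of \<open>s\<close> to projections of the pulled back domain to
  restrictions of \<open>f s\<close> to projections of the domain of \<open>A\<close>, which are in \<open>A\<close>.\<close>

lemma covers_germ:
  assumes A: "A \<in> arrs_of T" and s: "s \<in> carrier S" "f s \<in> A"
  shows "covers A (germ S s (pull S f (dom_of T A)))" "s \<in> germ S s (pull S f (dom_of T A))"
proof -
  let ?F = "pull S f (dom_of T A)"
  have F: "?F \<in> obs_of S" using pull_ob T.dom_of_obs A by blast
  have ls: "lam S s \<in> ?F" using T.lam_mem_dom[OF A s(2)] f_lam[OF s(1)] S.lam_closed[OF s(1)] by (simp add: pull_def)
  have "f b \<in> A" if b: "b \<in> germ S s ?F" for b
  proof -
    obtain e where e: "b \<in> carrier S" "e \<in> ?F" "s \<cdot>\<^bsub>S\<^esub> e \<sqsubseteq>\<^bsub>nat_ord S\<^esub> b" using b by (auto simp: germ_def)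
    have ep: "e \<in> projs S" "f e \<in> dom_of T A" using e(2) by (auto simp: pull_def)
    have "f s \<cdot>\<^bsub>T\<^esub> f e \<in> A" using T.dom_mem_iff[OF A s(2)] ep f_proj by blast
    then have "f (s \<cdot>\<^bsub>S\<^esub> e) \<in> A" using f_tms s ep S.proj_carrier by simp
    then show ?thesis using T.arrs_ofD(4)[OF A] f_mono[OF e(3,1)] f_carrier[OF e(1)] by blast
  qed
  then show "covers A (germ S s ?F)" unfolding covers_def using S.germ_arr[OF F s(1) ls] S.dom_germ[OF F s(1) ls] by blast
  show "s \<in> germ S s ?F" by (rule S.germ_self[OF F s(1)])
qed

text \<open>The definition only prescribes the domain.  For the codomain, \<open>e \<cdot> b\<close> and \<open>b \<cdot> lam S (e \<cdot> b)\<close> are the same element,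
  which moves the condition on \<open>e\<close> from one side to the other.\<close>

lemma covers_cod:
  assumes A: "A \<in> arrs_of T" and B: "covers A B"
  shows "cod_of S B = pull S f (cod_of T A)"
proof -
  note B = B[unfolded covers_def]
  have Ba: "B \<in> arrs_of S" using B by blast
  obtain b where b: "b \<in> B" using S.arrs_ofD(2)[OF Ba] by blast
  have bc: "b \<in> carrier S" "f b \<in> A" using b B S.arr_carrier[OF Ba] by auto
  have "e \<in> cod_of S B \<longleftrightarrow> f e \<in> cod_of T A" if e: "e \<in> projs S" for e
  proof -
    have eb: "e \<cdot>\<^bsub>S\<^esub> b \<in> carrier S" "f (e \<cdot>\<^bsub>S\<^esub> b) = f e \<cdot>\<^bsub>T\<^esub> f b"
      using e bc S.proj_carrier S.tms_closed f_tms by auto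
    have "e \<cdot>\<^bsub>S\<^esub> b \<in> B" if "f e \<cdot>\<^bsub>T\<^esub> f b \<in> A"
    proof -
      have "lam T (f (e \<cdot>\<^bsub>S\<^esub> b)) \<in> dom_of T A" using T.lam_mem_dom[OF A] that eb by simp
      then have "lam S (e \<cdot>\<^bsub>S\<^esub> b) \<in> dom_of S B" using B eb(1) f_lam S.lam_closed by (simp add: pull_def)
      then have "b \<cdot>\<^bsub>S\<^esub> lam S (e \<cdot>\<^bsub>S\<^esub> b) \<in> B" using S.dom_mem_iff[OF Ba b] S.lam_closed eb by blast
      then show ?thesis using S.proj_tms[OF bc(1) e] by simp
    qed
    moreover have "f e \<cdot>\<^bsub>T\<^esub> f b \<in> A" if "e \<cdot>\<^bsub>S\<^esub> b \<in> B" using that B eb by (metis imageI subsetD)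
    ultimately show ?thesis using S.cod_mem_iff[OF Ba b e] T.cod_mem_iff[OF A bc(2) f_proj[OF e]] by blast
  qed
  then show ?thesis unfolding pull_def using S.mem_cod_of by blast
qed

text \<open>Lifting of arrows: take the germ of \<open>f b\<close> for any \<open>b \<in> B\<close>.\<close>

lemma covers_lift_dom:
  assumes F: "F \<in> obs_of T" and B: "B \<in> arrs_of S" "dom_of S B = pull S f F"
  shows "\<exists>A\<in>arrs_of T. dom_of T A = F \<and> covers A B"
proof -
  obtain b where b: "b \<in> B" using S.arrs_ofD(2)[OF B(1)] by blast
  have bc: "b \<in> carrier S" "f b \<in> carrier T" using b S.arr_carrier[OF B(1)] f_carrier by auto
  have "lam T (f b) \<in> F" using S.lam_mem_dom[OF B(1) b] B(2) f_lam[OF bc(1)] by (simp add: pull_def)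
  note G = T.germ_arr[OF F bc(2) this] T.dom_germ[OF F bc(2) this] T.germ_self[OF F bc(2)]
  have "covers (germ T (f b) F) (germ S b (pull S f (dom_of T (germ T (f b) F))))"
    by (rule covers_germ(1)[OF G(1) bc(1) G(3)])
  then have "covers (germ T (f b) F) B" using G(2) B(2) S.arr_eq_germ[OF B(1) b] by simp
  then show ?thesis using G by blast
qed

lemma covers_dom: "covers A B \<Longrightarrow> dom_of S B = pull S f (dom_of T A)"
  by (simp add: covers_def)

lemma covers_opp: assumes A: "A \<in> arrs_of T" shows "rs_mor.covers (opp S) (opp T) f A B \<longleftrightarrow> covers A B"
proof -
  interpret o: rs_mor "opp S" "opp T" f by (rule rs_mor_opp)
  have "o.covers A B \<Longrightarrow> dom_of S B = pull S f (dom_of T A)" using o.covers_cod[of A B] A by simp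
  then show ?thesis using covers_cod[OF A] unfolding covers_def o.covers_def by auto
qed

lemma covers_lift_cod:
  assumes F: "F \<in> obs_of T" and B: "B \<in> arrs_of S" "cod_of S B = pull S f F"
  shows "\<exists>A\<in>arrs_of T. cod_of T A = F \<and> covers A B"
  using rs_mor.covers_lift_dom[OF rs_mor_opp, of F B] F B covers_opp by auto

lemma Spec_mor_on_ar: "A \<in> arrs_of T \<Longrightarrow> on_ar (Spec_mor S T f) A = Collect (covers A)"
  and Spec_mor_on_ob: "F \<in> obs_of T \<Longrightarrow> on_ob (Spec_mor S T f) F = pull S f F"
  by (simp_all add: Spec_mor_def covers_def[abs_def] pull_def)

lemma pull_in_basic:
  "e \<in> projs S \<Longrightarrow> {F \<in> obs_of T. pull S f F \<in> ob_basic S e} = ob_basic T (f e)"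
  using pull_ob by (auto simp: ob_basic_def pull_def)

text \<open>By \<open>covers_germ\<close> inverse images of basic sets are basic; this gives both continuity and naturality.\<close>

lemma covers_meets_basic:
  assumes s: "s \<in> carrier S"
  shows "{A \<in> arrs_of T. Collect (covers A) \<inter> ar_basic S s \<noteq> {}} = ar_basic T (f s)"
proof (intro equalityI subsetI)
  fix A assume "A \<in> ar_basic T (f s)"
  then have A: "A \<in> arrs_of T" "f s \<in> A" by (auto simp: T.mem_ar_basic)
  have "germ S s (pull S f (dom_of T A)) \<in> Collect (covers A) \<inter> ar_basic S s"
    using covers_germ[OF A(1) s A(2)] by (simp add: ar_basic_def covers_def)
  then show "A \<in> {A \<in> arrs_of T. Collect (covers A) \<inter> ar_basic S s \<noteq> {}}" using A by blast
next
  fix A assume "A \<in> {A \<in> arrs_of T. Collect (covers A) \<inter> ar_basic S s \<noteq> {}}"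
  then obtain B where "A \<in> arrs_of T" "covers A B" "s \<in> B" unfolding ar_basic_def by blast
  then show "A \<in> ar_basic T (f s)" unfolding T.mem_ar_basic covers_def by blast
qed

lemma relational_covering_Spec_mor: "relational_covering (Spec T) (Spec S) (Spec_mor S T f)"
proof -
  let ?m = "Spec_mor S T f"
  have RM0: "continuous_map (obs (Spec T)) (obs (Spec S)) (on_ob ?m)"
  proof (rule continuous_map_by_nhds)
    show "on_ob ?m \<in> ob_set (Spec T) \<rightarrow> ob_set (Spec S)"
      unfolding S.ob_set_Spec T.ob_set_Spec using Spec_mor_on_ob pull_ob by auto
    fix F W assume F: "F \<in> ob_set (Spec T)" and W: "openin (obs (Spec S)) W" "on_ob ?m F \<in> W"
    have F': "F \<in> obs_of T" using F unfolding T.ob_set_Spec .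
    obtain e where e: "e \<in> projs S" "e \<in> on_ob ?m F" "ob_basic S e \<subseteq> W" using S.ob_nhd[OF W] .
    have "F \<in> ob_basic T (f e)" "on_ob ?m ` ob_basic T (f e) \<subseteq> W"
      using e F' unfolding pull_in_basic[OF e(1), symmetric] by (auto simp: Spec_mor_on_ob S.mem_ob_basic pull_ob)
    then show "\<exists>V. openin (obs (Spec T)) V \<and> F \<in> V \<and> on_ob ?m ` V \<subseteq> W"
      using T.open_ob_basic[OF f_proj[OF e(1)]] by blast
  qed
  have RM5: "openin (arrs (Spec T)) {x \<in> arrs_of T. on_ar ?m x \<inter> W \<noteq> {}}" if W: "openin (arrs (Spec S)) W" for W
    unfolding openin_subopen[of _ "{x \<in> arrs_of T. on_ar ?m x \<inter> W \<noteq> {}}"]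
  proof
    fix A assume "A \<in> {x \<in> arrs_of T. on_ar ?m x \<inter> W \<noteq> {}}"
    then obtain B where A: "A \<in> arrs_of T" "covers A B" "B \<in> W" using Spec_mor_on_ar by auto
    obtain s where s: "s \<in> carrier S" "B \<in> arrs_of S" "s \<in> B" "ar_basic S s \<subseteq> W" using S.arr_nhd[OF W A(3)] .
    have "A \<in> ar_basic T (f s)" "ar_basic T (f s) \<subseteq> {x \<in> arrs_of T. on_ar ?m x \<inter> W \<noteq> {}}"
      unfolding covers_meets_basic[OF s(1), symmetric] using s A by (auto simp: Spec_mor_on_ar S.mem_ar_basic)
    then show "\<exists>V. openin (arrs (Spec T)) V \<and> A \<in> V \<and> V \<subseteq> {x \<in> arrs_of T. on_ar ?m x \<inter> W \<noteq> {}}"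
      using T.open_ar_basic[OF f_carrier[OF s(1)]] by blast
  qed
  have RM2: "covers (comp_of T A A') (comp_of S B B')"
    if A: "A \<in> arrs_of T" "A' \<in> arrs_of T" "dom_of T A = cod_of T A'" and B: "covers A B" "covers A' B'" for A A' B B'
  proof -
    have b: "B \<in> arrs_of S" "B' \<in> arrs_of S" "f ` B \<subseteq> A" "f ` B' \<subseteq> A'" using B by (auto simp: covers_def)
    have d: "dom_of S B = cod_of S B'" using covers_cod[OF A(2) B(2)] B(1) A(3) by (simp add: covers_def)
    have "f x \<in> comp_of T A A'" if x: "x \<in> comp_of S B B'" for x
    proof -
      obtain u v where u: "x \<in> carrier S" "u \<in> B" "v \<in> B'" "u \<cdot>\<^bsub>S\<^esub> v \<sqsubseteq>\<^bsub>nat_ord S\<^esub> x"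
        using x by (auto simp: comp_of_def)
      then have "f (u \<cdot>\<^bsub>S\<^esub> v) = f u \<cdot>\<^bsub>T\<^esub> f v" using f_tms b S.arr_carrier by blast
      then have "f u \<cdot>\<^bsub>T\<^esub> f v \<sqsubseteq>\<^bsub>nat_ord T\<^esub> f x" using f_mono[OF u(4,1)] by simp
      then show ?thesis using u b f_carrier unfolding comp_of_def by blast
    qed
    then show ?thesis unfolding covers_def
      using S.comp_of_arr[OF b(1,2) d] T.comp_of_arr(2)[OF A] covers_dom[OF B(2)] by auto
  qed
  have RM3: "A = A'" if A: "A \<in> arrs_of T" "A' \<in> arrs_of T" "dom_of T A = dom_of T A' \<or> cod_of T A = cod_of T A'"
    and B: "covers A B" "covers A' B" for A A' B
  proof -
    have "B \<in> arrs_of S" using B(1) by (simp add: covers_def)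
    then obtain b where "b \<in> B" using S.arrs_ofD(2) by blast
    then have "f b \<in> A" "f b \<in> A'" using B unfolding covers_def by auto
    then show ?thesis using T.arr_eqI_dom[OF A(1,2)] T.arr_eqI_cod[OF A(1,2)] A(3) by blast
  qed
  have RM6: "covers (unit_of T F) (unit_of S (pull S f F))" if F: "F \<in> obs_of T" for F
  proof -
    have "f s \<in> unit_of T F" if s: "s \<in> unit_of S (pull S f F)" for s
    proof -
      obtain e where e: "s \<in> carrier S" "e \<in> projs S" "f e \<in> F" "e \<sqsubseteq>\<^bsub>nat_ord S\<^esub> s"
        using s by (auto simp: unit_of_def pull_def)
      then show ?thesis using f_mono[OF e(4,1)] f_carrier unfolding unit_of_def by blast
    qed
    then show ?thesis unfolding covers_def
      using S.unit_of_arr S.dom_unit_of T.dom_unit_of[OF F] pull_ob[OF F] by auto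
  qed
  show ?thesis
    unfolding relational_covering_def topspace_composables S.ob_set_Spec T.ob_set_Spec S.ar_set_Spec T.ar_set_Spec
      Spec_simps(1-4)
  proof (intro conjI RM0 ballI)
    show "on_ar ?m \<in> arrs_of T \<rightarrow> Pow (arrs_of S)" by (auto simp: Spec_mor_on_ar covers_def)
    show "dom_of S B = on_ob ?m (dom_of T A)" "cod_of S B = on_ob ?m (cod_of T A)"
      if "A \<in> arrs_of T" "B \<in> on_ar ?m A" for A B
      using that covers_cod covers_dom Spec_mor_on_ob T.dom_of_obs T.cod_of_obs by (auto simp: Spec_mor_on_ar)
    fix p assume p: "p \<in> {(a, b). a \<in> arrs_of T \<and> b \<in> arrs_of T \<and> dom_of T a = cod_of T b}"
    show "case p of (a, b) \<Rightarrow> \<forall>(s, t)\<in>{(a, b). a \<in> arrs_of S \<and> b \<in> arrs_of S \<and> dom_of S a = cod_of S b}.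
        s \<in> on_ar ?m a \<and> t \<in> on_ar ?m b \<longrightarrow> comp_of S s t \<in> on_ar ?m (comp_of T a b)"
      using p RM2 T.comp_of_arr(1) by (auto simp: Spec_mor_on_ar)
  next
    fix A A' assume A: "A \<in> arrs_of T" "A' \<in> arrs_of T"
    show "(dom_of T A = dom_of T A' \<or> cod_of T A = cod_of T A') \<and> on_ar ?m A \<inter> on_ar ?m A' \<noteq> {} \<longrightarrow> A = A'"
      using RM3[OF A] A by (auto simp: Spec_mor_on_ar)
  next
    fix F B assume F: "F \<in> obs_of T" and B: "B \<in> arrs_of S"
    show "dom_of S B = on_ob ?m F \<longrightarrow> (\<exists>t\<in>arrs_of T. dom_of T t = F \<and> B \<in> on_ar ?m t)"
      "cod_of S B = on_ob ?m F \<longrightarrow> (\<exists>t\<in>arrs_of T. cod_of T t = F \<and> B \<in> on_ar ?m t)"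
      using covers_lift_dom[OF F B] covers_lift_cod[OF F B] F by (auto simp: Spec_mor_on_ar Spec_mor_on_ob)
  next
    show "\<forall>A. openin (arrs (Spec S)) A \<longrightarrow> openin (arrs (Spec T)) {x \<in> arrs_of T. on_ar ?m x \<inter> A \<noteq> {}}"
      using RM5 by blast
  next
    fix F assume F: "F \<in> obs_of T"
    show "unit_of S (on_ob ?m F) \<in> on_ar ?m (unit_of T F)"
      using RM6[OF F] F T.unit_of_arr by (simp add: Spec_mor_on_ar Spec_mor_on_ob)
  qed
qed

end

text \<open>The units over a compact-open set form a compact slice of the spectrum.\<close>

lemma (in drs) compact_open_obs_Spec:
  assumes K: "compact_open (obs (Spec S)) K" shows "\<exists>e\<in>projs S. K = ob_basic S e"
proof -
  interpret C: spectral_etale "Spec S" by (rule spectral_etale_Spec)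
  have sub: "K \<subseteq> ob_set (Spec S)" using K openin_subset unfolding compact_open_def by blast
  obtain s where s: "s \<in> carrier S" "unt (Spec S) ` K = ar_basic S s"
    using C.unit_slice[OF K] compact_slices_Spec by auto
  have "K = dm (Spec S) ` unt (Spec S) ` K" using C.dm_unit_image[OF sub] by simp
  also have "\<dots> = ob_basic S (lam S s)" using s dom_image_ar_basic by simp
  finally show ?thesis using lam_closed s by blast
qed

context rs_mor
begin

lemma coherent_Spec_mor: "coherent (Spec T) (Spec S) (Spec_mor S T f)"
  unfolding coherent_def T.ob_set_Spec
proof (intro allI impI)
  fix K assume "openin (obs (Spec S)) K \<and> compactin (obs (Spec S)) K"
  then obtain e where e: "e \<in> projs S" "K = ob_basic S e" using S.compact_open_obs_Spec unfolding compact_open_def by blast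
  have "{q \<in> obs_of T. on_ob (Spec_mor S T f) q \<in> K} = ob_basic T (f e)"
    unfolding pull_in_basic[OF e(1), symmetric] using e Spec_mor_on_ob by auto
  then show "compactin (obs (Spec T)) {q \<in> obs_of T. on_ob (Spec_mor S T f) q \<in> K}"
    using T.compact_ob_basic f_proj e by simp
qed

text \<open>Properness can be tested pointwise, since basic sets are compact and finite bounded families have joins.\<close>

lemma proper_iff: "proper_morphism S T f \<longleftrightarrow> (\<forall>A\<in>arrs_of T. \<exists>s\<in>carrier S. f s \<in> A)"
proof (intro iffI ballI)
  fix A assume p: "proper_morphism S T f" and A: "A \<in> arrs_of T"
  obtain t where t: "t \<in> A" using T.arrs_ofD(2)[OF A] by blast
  then have "t \<in> carrier T" using T.arr_carrier[OF A] by blast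
  then obtain n t' s' where n: "n \<ge> (1::nat)"
    "\<forall>i\<in>{1..n}. t' i \<in> carrier T \<and> s' i \<in> carrier S \<and> t' i \<sqsubseteq>\<^bsub>nat_ord T\<^esub> f (s' i)"
    "is_lub (nat_ord T) t (t' ` {1..n})" using p unfolding proper_morphism_def by meson
  have "\<exists>m\<in>t' ` {1..n}. m \<in> A"
    by (rule T.mem_arr_of_lub[OF A _ _ _ n(3) t]) (use n in auto)
  then obtain i where i: "i \<in> {1..n}" "t' i \<in> A" by blast
  then have "s' i \<in> carrier S" "f (s' i) \<in> carrier T" "t' i \<sqsubseteq>\<^bsub>nat_ord T\<^esub> f (s' i)" using n(2) f_carrier by auto
  then show "\<exists>s\<in>carrier S. f s \<in> A" using T.arrs_ofD(4)[OF A i(2)] by blast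
next
  assume R: "\<forall>A\<in>arrs_of T. \<exists>s\<in>carrier S. f s \<in> A"
  show "proper_morphism S T f"
  proof (rule proper_morphism_if_cover)
    fix t assume t: "t \<in> carrier T"
    let ?I = "{u \<in> carrier T. u \<sqsubseteq>\<^bsub>nat_ord T\<^esub> t \<and> (\<exists>s\<in>carrier S. u \<sqsubseteq>\<^bsub>nat_ord T\<^esub> f s)}"
    have "ar_basic T t \<subseteq> (\<Union>u\<in>?I. ar_basic T u)"
    proof
      fix A assume "A \<in> ar_basic T t"
      then have A: "A \<in> arrs_of T" "t \<in> A" by (auto simp: T.mem_ar_basic)
      obtain s where s: "s \<in> carrier S" "f s \<in> A" using R A(1) by blast
      obtain c where c: "c \<in> A" "c \<sqsubseteq>\<^bsub>nat_ord T\<^esub> t" "c \<sqsubseteq>\<^bsub>nat_ord T\<^esub> f s" using T.arrs_ofD(5)[OF A s(2)] by blast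
      then have "c \<in> ?I" using s T.arr_carrier[OF A(1)] by blast
      then show "A \<in> (\<Union>u\<in>?I. ar_basic T u)" using c A by (auto simp: T.mem_ar_basic)
    qed
    then obtain I where I: "finite I" "I \<subseteq> ?I" "ar_basic T t \<subseteq> (\<Union>u\<in>I. ar_basic T u)"
      using T.ar_basic_compact[OF t, of ?I] by auto
    obtain s where "s \<in> carrier S" using S.zero_carrier by blast
    then have z: "T.zero \<in> ?I" using T.zero_le f_carrier t T.zero_carrier by blast
    let ?M = "insert T.zero I"
    have M: "finite ?M" "?M \<noteq> {}" "?M \<subseteq> ?I" "?M \<subseteq> carrier T" using I z by auto
    obtain x where x: "is_lub (nat_ord T) x ?M"
      using T.bounded_lub_ex[of ?M t] M t by auto
    note xl = x[unfolded T.is_lub_nat_ord[OF M(4)]]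
    have "x \<sqsubseteq>\<^bsub>nat_ord T\<^esub> t" using xl t M(3) by blast
    moreover have "t \<sqsubseteq>\<^bsub>nat_ord T\<^esub> x"
    proof (rule T.le_if_basic_subset[OF t])
      show "x \<in> carrier T" using xl by blast
      show "ar_basic T t \<subseteq> ar_basic T x" using I(3) T.ar_basic_lub[OF M(1,2,4) x] by blast
    qed
    ultimately have "x = t" using T.nat_le_antisym xl t by blast
    then show "\<exists>M. finite M \<and> M \<noteq> {} \<and> M \<subseteq> carrier T \<and> is_lub (nat_ord T) t M \<and>
      (\<forall>m\<in>M. \<exists>s\<in>carrier S. m \<sqsubseteq>\<^bsub>nat_ord T\<^esub> f s)"
      using x M by (intro exI[of _ ?M]) auto
  qed
qed

text \<open>Elements of the two filters have a common lower bound \<open>d\<close> with \<open>f d \<in> A\<close>; then the domain of \<open>d\<close> is in the common domain,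
  and \<open>d\<close> belongs to both filters.\<close>

lemma covers_unique:
  assumes w: "weakly_meet_preserving S T f" and A: "A \<in> arrs_of T" and B: "covers A B" "covers A B'"
  shows "B = B'"
proof -
  have Ba: "B \<in> arrs_of S" "B' \<in> arrs_of S" "f ` B \<subseteq> A" "f ` B' \<subseteq> A" "dom_of S B = dom_of S B'"
    using B by (auto simp: covers_def)
  obtain a b where ab: "a \<in> B" "b \<in> B'" using S.arrs_ofD(2) Ba by (metis ex_in_conv)
  then have c: "a \<in> carrier S" "b \<in> carrier S" "f a \<in> A" "f b \<in> A" using Ba S.arr_carrier by auto
  obtain t where t: "t \<in> A" "t \<sqsubseteq>\<^bsub>nat_ord T\<^esub> f a" "t \<sqsubseteq>\<^bsub>nat_ord T\<^esub> f b" using T.arrs_ofD(5)[OF A c(3,4)] by blast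
  then obtain d where d: "d \<in> carrier S" "d \<sqsubseteq>\<^bsub>nat_ord S\<^esub> a" "d \<sqsubseteq>\<^bsub>nat_ord S\<^esub> b" "t \<sqsubseteq>\<^bsub>nat_ord T\<^esub> f d"
    using w c T.arr_carrier[OF A] unfolding weakly_meet_preserving_def by meson
  have "f d \<in> A" using T.arrs_ofD(4)[OF A t(1) f_carrier[OF d(1)] d(4)] .
  then have "lam T (f d) \<in> dom_of T A" using T.lam_mem_dom A by blast
  then have l: "lam S d \<in> dom_of S B" "lam S d \<in> dom_of S B'"
    using f_lam[OF d(1)] S.lam_closed[OF d(1)] B by (auto simp: covers_def pull_def)
  have "a \<cdot>\<^bsub>S\<^esub> lam S d \<in> B" "b \<cdot>\<^bsub>S\<^esub> lam S d \<in> B'"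
    using S.dom_mem_iff[OF Ba(1) ab(1)] S.dom_mem_iff[OF Ba(2) ab(2)] l S.lam_closed d(1) by auto
  then have "d \<in> B" "d \<in> B'" using S.nat_le_lam d c by auto
  then show ?thesis using S.arr_eqI_dom[OF Ba(1,2,5)] by blast
qed

end

lemma rs_homD: "f \<in> rs_hom k S T \<Longrightarrow> rs_morphism S T f" "f \<in> rs_hom k S T \<Longrightarrow> f \<in> extensional (carrier S)"
  "f \<in> rs_hom k S T \<Longrightarrow> k \<in> {2, 4} \<Longrightarrow> proper_morphism S T f"
  "f \<in> rs_hom k S T \<Longrightarrow> k \<in> {3, 4} \<Longrightarrow> weakly_meet_preserving S T f"
  unfolding rs_hom_def by blast+

lemma Spec_mor_rc_hom:
  assumes S: "drs S" and T: "drs T" and f: "f \<in> rs_hom k S T"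
  shows "Spec_mor S T f \<in> rc_hom k (Spec T) (Spec S)"
proof -
  interpret rs_mor S T f unfolding rs_mor_iff using S T rs_homD(1)[OF f] by blast
  have ext: "on_ob (Spec_mor S T f) \<in> extensional (ob_set (Spec T))" "on_ar (Spec_mor S T f) \<in> extensional (ar_set (Spec T))"
    unfolding T.ob_set_Spec T.ar_set_Spec by (simp_all add: Spec_mor_def)
  have 2: "\<exists>B. B \<in> on_ar (Spec_mor S T f) A" if k: "k \<in> {2, 4}" and A: "A \<in> arrs_of T" for A
  proof -
    obtain s where "s \<in> carrier S" "f s \<in> A" using rs_homD(3)[OF f k] proper_iff A by blast
    then show ?thesis using covers_germ(1)[OF A] Spec_mor_on_ar[OF A] by blast
  qed
  have 3: "B = B'" if "k \<in> {3, 4}" "A \<in> arrs_of T" "B \<in> on_ar (Spec_mor S T f) A" "B' \<in> on_ar (Spec_mor S T f) A" for A B B'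
    using covers_unique[OF rs_homD(4)[OF f that(1)] that(2)] that Spec_mor_on_ar by auto
  show ?thesis unfolding rc_hom_def mem_Collect_eq T.ar_set_Spec[symmetric]
    using ext relational_covering_Spec_mor coherent_Spec_mor 2 3 unfolding T.ar_set_Spec by blast
qed

lemma Spec_mor_id:
  assumes "drs S" shows "Spec_mor S S (rs_id S) = rc_id (Spec S)"
proof -
  interpret drs S by fact
  have 1: "{e \<in> projs S. rs_id S e \<in> F} = F" if "F \<in> obs_of S" for F
    using that ob_proj proj_carrier by (auto simp: rs_id_def)
  have 2: "{B \<in> arrs_of S. rs_id S ` B \<subseteq> A \<and> dom_of S B = {e \<in> projs S. rs_id S e \<in> dom_of S A}} = {A}"
    if A: "A \<in> arrs_of S" for A
  proof -
    have i: "rs_id S ` B = B" if "B \<in> arrs_of S" for B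
      using arr_carrier[OF that] by (force simp: rs_id_def)
    have "B = A" if "B \<in> arrs_of S" "B \<subseteq> A" "dom_of S B = dom_of S A" for B
      using that arr_eqI_dom[OF that(1) A that(3)] arrs_ofD(2)[OF that(1)] by blast
    then have "B \<in> arrs_of S \<and> rs_id S ` B \<subseteq> A \<and> dom_of S B = dom_of S A \<longleftrightarrow> B = A" for B
      using i[of B] i[OF A] A by (metis order_refl)
    then show ?thesis unfolding 1[OF dom_of_obs[OF A]] by blast
  qed
  have "(\<lambda>F\<in>obs_of S. {e \<in> projs S. rs_id S e \<in> F}) = (\<lambda>F\<in>obs_of S. F)" by (rule restrict_ext) (rule 1)
  moreover have "(\<lambda>A\<in>arrs_of S. {B \<in> arrs_of S. rs_id S ` B \<subseteq> A \<and> dom_of S B = {e \<in> projs S. rs_id S e \<in> dom_of S A}}) =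
      (\<lambda>A\<in>arrs_of S. {A})" by (rule restrict_ext) (rule 2)
  ultimately show ?thesis unfolding Spec_mor_def rc_id_def ob_set_Spec ar_set_Spec by simp
qed

text \<open>The intermediate prime filter is the germ of the image of an element, again by \<open>covers_germ\<close>.\<close>

lemma Spec_mor_comp:
  assumes f: "drs S" "drs T" "drs U" "rs_morphism S T f" "rs_morphism T U g"
    and gf: "rs_morphism S U (rs_comp S g f)"
  shows "Spec_mor S U (rs_comp S g f) = rc_comp (Spec U) (Spec_mor S T f) (Spec_mor T U g)"
proof -
  interpret f: rs_mor S T f unfolding rs_mor_iff using f by blast
  interpret g: rs_mor T U g unfolding rs_mor_iff using f by blast
  interpret h: rs_mor S U "rs_comp S g f" unfolding rs_mor_iff using f gf by blast
  have comp: "rs_comp S g f s = g (f s)" if "s \<in> carrier S" for s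
    using that by (simp add: rs_comp_def compose_def)
  have pull: "pull S (rs_comp S g f) F = pull S f (pull T g F)" if "F \<in> obs_of U" for F
    unfolding pull_def using comp f.S.proj_carrier f.f_proj by auto
  have cov: "h.covers A D \<longleftrightarrow> (\<exists>B. g.covers A B \<and> f.covers B D)" if A: "A \<in> arrs_of U" for A D
  proof
    assume "\<exists>B. g.covers A B \<and> f.covers B D"
    then obtain B where B: "g.covers A B" "f.covers B D" by blast
    then have "rs_comp S g f ` D \<subseteq> A" using comp f.S.arr_carrier
      by (auto simp: g.covers_def f.covers_def image_subset_iff)
    then show "h.covers A D" using B pull[OF g.T.dom_of_obs[OF A]]
      by (simp add: g.covers_def f.covers_def h.covers_def)
  next
    assume D: "h.covers A D"
    then have Da: "D \<in> arrs_of S" by (simp add: h.covers_def)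
    obtain d where d: "d \<in> D" using f.S.arrs_ofD(2)[OF Da] by blast
    have dc: "d \<in> carrier S" "f d \<in> carrier T" "g (f d) \<in> A"
      using d D Da f.S.arr_carrier f.f_carrier comp by (auto simp: h.covers_def image_subset_iff)
    let ?B = "germ T (f d) (pull T g (dom_of U A))"
    have B: "g.covers A ?B" "f d \<in> ?B" using g.covers_germ[OF A dc(2,3)] by auto
    have Ba: "?B \<in> arrs_of T" using B by (simp add: g.covers_def)
    have D': "f.covers ?B (germ S d (pull S f (dom_of T ?B)))" by (rule f.covers_germ(1)[OF Ba dc(1) B(2)])
    have "pull S f (dom_of T ?B) = dom_of S D"
      using g.covers_dom[OF B(1)] h.covers_dom[OF D] pull[OF g.T.dom_of_obs[OF A]] by simp
    then have "f.covers ?B D" using D' f.S.arr_eq_germ[OF Da d] by simp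
    then show "\<exists>B. g.covers A B \<and> f.covers B D" using B by blast
  qed
  have ob: "on_ob (Spec_mor S U (rs_comp S g f)) = compose (ob_set (Spec U)) (on_ob (Spec_mor S T f)) (on_ob (Spec_mor T U g))"
    unfolding g.T.ob_set_Spec
  proof
    fix F show "on_ob (Spec_mor S U (rs_comp S g f)) F = compose (obs_of U) (on_ob (Spec_mor S T f)) (on_ob (Spec_mor T U g)) F"
    proof (cases "F \<in> obs_of U")
      case True then show ?thesis
        using h.Spec_mor_on_ob g.Spec_mor_on_ob f.Spec_mor_on_ob g.pull_ob pull by (simp add: compose_def)
    next
      case False then show ?thesis by (simp add: Spec_mor_def compose_def)
    qed
  qed
  have ar: "on_ar (Spec_mor S U (rs_comp S g f)) = (\<lambda>a\<in>ar_set (Spec U). \<Union>b\<in>on_ar (Spec_mor T U g) a. on_ar (Spec_mor S T f) b)"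
    unfolding g.T.ar_set_Spec
  proof
    fix A show "on_ar (Spec_mor S U (rs_comp S g f)) A = (\<lambda>a\<in>arrs_of U. \<Union>b\<in>on_ar (Spec_mor T U g) a. on_ar (Spec_mor S T f) b) A"
    proof (cases "A \<in> arrs_of U")
      case True
      have "(\<Union>b\<in>on_ar (Spec_mor T U g) A. on_ar (Spec_mor S T f) b) = {D. \<exists>B. g.covers A B \<and> f.covers B D}"
        using g.Spec_mor_on_ar[OF True] f.Spec_mor_on_ar by (auto simp: g.covers_def)
      moreover have "on_ar (Spec_mor S U (rs_comp S g f)) A = {D. \<exists>B. g.covers A B \<and> f.covers B D}"
        unfolding h.Spec_mor_on_ar[OF True] using cov[OF True] by blast
      ultimately show ?thesis using True by simp
    next
      case False then show ?thesis by (simp add: Spec_mor_def)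
    qed
  qed
  show ?thesis unfolding rc_comp_def using ob ar by (simp add: Spec_mor_def)
qed

section \<open>Relational coverings induce morphisms of semigroups\<close>

lemma relational_coveringD:
  assumes f: "relational_covering C D f"
  shows "continuous_map (obs C) (obs D) (on_ob f)"
    "\<And>a. a \<in> ar_set C \<Longrightarrow> on_ar f a \<subseteq> ar_set D"
    "\<And>a b. \<lbrakk>a \<in> ar_set C; b \<in> on_ar f a\<rbrakk> \<Longrightarrow> dm D b = on_ob f (dm C a)"
    "\<And>a b. \<lbrakk>a \<in> ar_set C; b \<in> on_ar f a\<rbrakk> \<Longrightarrow> cd D b = on_ob f (cd C a)"
    "\<And>a b s t. \<lbrakk>a \<in> ar_set C; b \<in> ar_set C; dm C a = cd C b; s \<in> on_ar f a; t \<in> on_ar f b; dm D s = cd D t\<rbrakk> \<Longrightarrow>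
       cmp D s t \<in> on_ar f (cmp C a b)"
    "\<And>a b s. \<lbrakk>a \<in> ar_set C; b \<in> ar_set C; dm C a = dm C b; s \<in> on_ar f a; s \<in> on_ar f b\<rbrakk> \<Longrightarrow> a = b"
    "\<And>a b s. \<lbrakk>a \<in> ar_set C; b \<in> ar_set C; cd C a = cd C b; s \<in> on_ar f a; s \<in> on_ar f b\<rbrakk> \<Longrightarrow> a = b"
    "\<And>q s. \<lbrakk>q \<in> ob_set C; s \<in> ar_set D; dm D s = on_ob f q\<rbrakk> \<Longrightarrow> \<exists>t\<in>ar_set C. dm C t = q \<and> s \<in> on_ar f t"
    "\<And>q s. \<lbrakk>q \<in> ob_set C; s \<in> ar_set D; cd D s = on_ob f q\<rbrakk> \<Longrightarrow> \<exists>t\<in>ar_set C. cd C t = q \<and> s \<in> on_ar f t"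
    "\<And>A. openin (arrs D) A \<Longrightarrow> openin (arrs C) {x \<in> ar_set C. on_ar f x \<inter> A \<noteq> {}}"
    "\<And>t. t \<in> ob_set C \<Longrightarrow> unt D (on_ob f t) \<in> on_ar f (unt C t)"
    "\<And>q. q \<in> ob_set C \<Longrightarrow> on_ob f q \<in> ob_set D"
proof -
  note F = f[unfolded relational_covering_def topspace_composables]
  show "continuous_map (obs C) (obs D) (on_ob f)" using F by (elim conjE)
  then show "\<And>q. q \<in> ob_set C \<Longrightarrow> on_ob f q \<in> ob_set D" using continuous_map_funspace by blast
  have sub: "on_ar f \<in> ar_set C \<rightarrow> Pow (ar_set D)" using F by (elim conjE)
  then show "\<And>a. a \<in> ar_set C \<Longrightarrow> on_ar f a \<subseteq> ar_set D" by blast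
  show "\<And>a b. \<lbrakk>a \<in> ar_set C; b \<in> on_ar f a\<rbrakk> \<Longrightarrow> dm D b = on_ob f (dm C a)"
    "\<And>a b. \<lbrakk>a \<in> ar_set C; b \<in> on_ar f a\<rbrakk> \<Longrightarrow> cd D b = on_ob f (cd C a)"
    "\<And>q s. \<lbrakk>q \<in> ob_set C; s \<in> ar_set D; dm D s = on_ob f q\<rbrakk> \<Longrightarrow> \<exists>t\<in>ar_set C. dm C t = q \<and> s \<in> on_ar f t"
    "\<And>q s. \<lbrakk>q \<in> ob_set C; s \<in> ar_set D; cd D s = on_ob f q\<rbrakk> \<Longrightarrow> \<exists>t\<in>ar_set C. cd C t = q \<and> s \<in> on_ar f t"
    "\<And>A. openin (arrs D) A \<Longrightarrow> openin (arrs C) {x \<in> ar_set C. on_ar f x \<inter> A \<noteq> {}}"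
    "\<And>t. t \<in> ob_set C \<Longrightarrow> unt D (on_ob f t) \<in> on_ar f (unt C t)"
    using F by simp_all
  have "\<forall>a\<in>ar_set C. \<forall>b\<in>ar_set C. (dm C a = dm C b \<or> cd C a = cd C b) \<and> on_ar f a \<inter> on_ar f b \<noteq> {} \<longrightarrow> a = b"
    using F by (elim conjE)
  then show "\<And>a b s. \<lbrakk>a \<in> ar_set C; b \<in> ar_set C; dm C a = dm C b; s \<in> on_ar f a; s \<in> on_ar f b\<rbrakk> \<Longrightarrow> a = b"
    "\<And>a b s. \<lbrakk>a \<in> ar_set C; b \<in> ar_set C; cd C a = cd C b; s \<in> on_ar f a; s \<in> on_ar f b\<rbrakk> \<Longrightarrow> a = b"
    by blast+
  fix a b s t
  assume "a \<in> ar_set C" "b \<in> ar_set C" "dm C a = cd C b" "s \<in> on_ar f a" "t \<in> on_ar f b" "dm D s = cd D t"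
  moreover from this have "s \<in> ar_set D" "t \<in> ar_set D" using sub by blast+
  ultimately show "cmp D s t \<in> on_ar f (cmp C a b)" using F by fastforce
qed

locale rc_mor = C: spectral_etale C + D: spectral_etale D
  for C :: "('o, 'm) tcat" and D :: "('p, 'n) tcat" +
  fixes f assumes cov: "relational_covering C D f" and coh: "coherent C D f"
begin

lemmas cv = relational_coveringD[OF cov]

definition pre :: "'n set \<Rightarrow> 'm set" where
  "pre A = {x \<in> ar_set C. on_ar f x \<inter> A \<noteq> {}}"

definition pre0 :: "'p set \<Rightarrow> 'o set" where
  "pre0 K = {q \<in> ob_set C. on_ob f q \<in> K}"

lemma Slices_mor_pre: "A \<in> compact_slices D \<Longrightarrow> Slices_mor C D f A = pre A"
  by (simp add: Slices_mor_def pre_def)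

lemma pre0_compact_open: "compact_open (obs D) K \<Longrightarrow> compact_open (obs C) (pre0 K)"
  using coh openin_continuous_map_preimage[OF cv(1)] unfolding coherent_def compact_open_def pre0_def by blast

lemma mem_preI: "\<lbrakk>x \<in> ar_set C; s \<in> on_ar f x; s \<in> A\<rbrakk> \<Longrightarrow> x \<in> pre A"
  by (auto simp: pre_def)

lemma mem_preE: assumes "x \<in> pre A" obtains s where "x \<in> ar_set C" "s \<in> on_ar f x" "s \<in> A" "s \<in> ar_set D"
  using assms cv(2) by (auto simp: pre_def)

text \<open>Existence of lifts (RM4) gives all objects over the domains of \<open>A\<close>.\<close>

lemma dm_pre: assumes A: "A \<in> compact_slices D" shows "dm C ` pre A = pre0 (dm D ` A)"
proof (intro equalityI subsetI)
  fix q assume "q \<in> dm C ` pre A"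
  then obtain x where x: "q = dm C x" "x \<in> pre A" by blast
  obtain s where "x \<in> ar_set C" "s \<in> on_ar f x" "s \<in> A" using x(2) by (rule mem_preE)
  moreover from this have "on_ob f q = dm D s" using cv(3) x by simp
  ultimately show "q \<in> pre0 (dm D ` A)" using x C.dm_ob unfolding pre0_def by blast
next
  fix q assume "q \<in> pre0 (dm D ` A)"
  then obtain s where s: "q \<in> ob_set C" "s \<in> A" "dm D s = on_ob f q" unfolding pre0_def by force
  then obtain t where "t \<in> ar_set C" "dm C t = q" "s \<in> on_ar f t" using cv(8) D.slice_sub[OF A] by blast
  then show "q \<in> dm C ` pre A" using mem_preI s by blast
qed

lemma cd_pre: assumes A: "A \<in> compact_slices D" shows "cd C ` pre A = pre0 (cd D ` A)"
proof (intro equalityI subsetI)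
  fix q assume "q \<in> cd C ` pre A"
  then obtain x where x: "q = cd C x" "x \<in> pre A" by blast
  obtain s where "x \<in> ar_set C" "s \<in> on_ar f x" "s \<in> A" using x(2) by (rule mem_preE)
  moreover from this have "on_ob f q = cd D s" using cv(4) x by simp
  ultimately show "q \<in> pre0 (cd D ` A)" using x C.cd_ob unfolding pre0_def by blast
next
  fix q assume "q \<in> pre0 (cd D ` A)"
  then obtain s where s: "q \<in> ob_set C" "s \<in> A" "cd D s = on_ob f q" unfolding pre0_def by force
  then obtain t where "t \<in> ar_set C" "cd C t = q" "s \<in> on_ar f t" using cv(9) D.slice_sub[OF A] by blast
  then show "q \<in> cd C ` pre A" using mem_preI s by blast
qed

text \<open>Two related arrows with a common domain lie over the same arrow of \<open>A\<close>, hence coincide by uniqueness of lifts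
  (RM3).  Compactness is inherited from the set of domains, where it is the coherence of the map on objects.\<close>

lemma pre_slice: assumes A: "A \<in> compact_slices D" shows "pre A \<in> compact_slices C"
proof -
  have op: "openin (arrs C) (pre A)" unfolding pre_def using cv(10) A D.slice_iff by blast
  have d: "inj_on (dm C) (pre A)"
  proof (rule inj_onI)
    fix x y assume xy: "x \<in> pre A" "y \<in> pre A" "dm C x = dm C y"
    obtain s where s: "x \<in> ar_set C" "s \<in> on_ar f x" "s \<in> A" using xy(1) by (rule mem_preE)
    obtain t where t: "y \<in> ar_set C" "t \<in> on_ar f y" "t \<in> A" using xy(2) by (rule mem_preE)
    have "dm D s = dm D t" using cv(3)[OF s(1,2)] cv(3)[OF t(1,2)] xy(3) by simp
    then have "s = t" using D.slice_dm_inj[OF A s(3) t(3)] by blast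
    then show "x = y" using cv(6)[OF s(1) t(1) xy(3) s(2)] t(2) by blast
  qed
  have r: "inj_on (cd C) (pre A)"
  proof (rule inj_onI)
    fix x y assume xy: "x \<in> pre A" "y \<in> pre A" "cd C x = cd C y"
    obtain s where s: "x \<in> ar_set C" "s \<in> on_ar f x" "s \<in> A" using xy(1) by (rule mem_preE)
    obtain t where t: "y \<in> ar_set C" "t \<in> on_ar f y" "t \<in> A" using xy(2) by (rule mem_preE)
    have "cd D s = cd D t" using cv(4)[OF s(1,2)] cv(4)[OF t(1,2)] xy(3) by simp
    then have "s = t" using D.slice_cd_inj[OF A s(3) t(3)] by blast
    then show "x = y" using cv(7)[OF s(1) t(1) xy(3) s(2)] t(2) by blast
  qed
  have "compactin (obs C) (dm C ` pre A)"
    unfolding dm_pre[OF A] using pre0_compact_open[OF D.slice_images(1)[OF A]] unfolding compact_open_def by blast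
  then show ?thesis unfolding C.slice_iff
    using op d r compactin_inj_image_iff[OF C.continuous_ops(2) C.open_ops(2) op d] by blast
qed

text \<open>An arrow related to a unit has the same domain as a unit related to it, so it is that unit by (RM3).\<close>

lemma pre_unit: assumes K: "K \<subseteq> ob_set D" shows "pre (unt D ` K) = unt C ` pre0 K"
proof (intro equalityI subsetI)
  fix x assume "x \<in> pre (unt D ` K)"
  then obtain s where "x \<in> ar_set C" "s \<in> on_ar f x" "s \<in> unt D ` K" by (rule mem_preE)
  then obtain p where p: "x \<in> ar_set C" "unt D p \<in> on_ar f x" "p \<in> K" by blast
  let ?q = "dm C x"
  have q: "?q \<in> ob_set C" using C.dm_ob p by blast
  have "p = on_ob f ?q" using cv(3)[OF p(1,2)] D.unit_dm p(3) K by (metis subsetD)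
  then have "unt D p \<in> on_ar f (unt C ?q)" using cv(11)[OF q] by simp
  then have "x = unt C ?q" using cv(6)[OF p(1) C.unit_ar[OF q] _ p(2)] C.unit_dm[OF q] by simp
  then show "x \<in> unt C ` pre0 K" using q p(3) \<open>p = on_ob f ?q\<close> unfolding pre0_def by blast
next
  fix x assume "x \<in> unt C ` pre0 K"
  then obtain q where q: "x = unt C q" "q \<in> ob_set C" "on_ob f q \<in> K" unfolding pre0_def by blast
  then show "x \<in> pre (unt D ` K)" using cv(11)[OF q(2)] C.unit_ar[OF q(2)] by (auto intro!: mem_preI)
qed

text \<open>If \<open>z\<close> is related to a product, lift the right factor to the domain of \<open>z\<close> and then the left factor to the codomain of
  this lift; the composite of the lifts is \<open>z\<close> by uniqueness.\<close>

lemma pre_tms: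
  assumes A: "A \<in> compact_slices D" "B \<in> compact_slices D"
  shows "pre (A \<cdot>\<^bsub>Slices D\<^esub> B) = pre A \<cdot>\<^bsub>Slices C\<^esub> pre B"
proof (intro equalityI subsetI)
  fix z assume "z \<in> pre (A \<cdot>\<^bsub>Slices D\<^esub> B)"
  then obtain w where w: "z \<in> ar_set C" "w \<in> on_ar f z" "w \<in> A \<cdot>\<^bsub>Slices D\<^esub> B" by (rule mem_preE)
  then obtain s t where st: "w = cmp D s t" "s \<in> A" "t \<in> B" "dm D s = cd D t" by auto
  have ar: "s \<in> ar_set D" "t \<in> ar_set D" using st D.slice_sub A by blast+
  have "dm D t = on_ob f (dm C z)" using cv(3)[OF w(1,2)] D.dm_cmp[OF ar st(4)] st(1) by simp
  then obtain y where y: "y \<in> ar_set C" "dm C y = dm C z" "t \<in> on_ar f y" using cv(8)[OF C.dm_ob[OF w(1)] ar(2)] by blast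
  have "dm D s = on_ob f (cd C y)" using cv(4)[OF y(1,3)] st(4) by simp
  then obtain x where x: "x \<in> ar_set C" "dm C x = cd C y" "s \<in> on_ar f x" using cv(8)[OF C.cd_ob[OF y(1)] ar(1)] by blast
  have "w \<in> on_ar f (cmp C x y)" using cv(5)[OF x(1) y(1) x(2,3) y(3) st(4)] st(1) by simp
  then have "z = cmp C x y"
    using cv(6)[OF w(1) C.cmp_ar[OF x(1) y(1) x(2)] _ w(2)] C.dm_cmp[OF x(1) y(1) x(2)] y(2) by simp
  then show "z \<in> pre A \<cdot>\<^bsub>Slices C\<^esub> pre B" using mem_preI[OF x(1,3) st(2)] mem_preI[OF y(1,3) st(3)] x(2)
    unfolding C.Slices_simps by blast
next
  fix z assume "z \<in> pre A \<cdot>\<^bsub>Slices C\<^esub> pre B"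
  then obtain x y where xy: "z = cmp C x y" "x \<in> pre A" "y \<in> pre B" "dm C x = cd C y" by auto
  obtain s where s: "x \<in> ar_set C" "s \<in> on_ar f x" "s \<in> A" using xy(2) by (rule mem_preE)
  obtain t where t: "y \<in> ar_set C" "t \<in> on_ar f y" "t \<in> B" using xy(3) by (rule mem_preE)
  have d: "dm D s = cd D t" using cv(3)[OF s(1,2)] cv(4)[OF t(1,2)] xy(4) by simp
  have "cmp D s t \<in> on_ar f z" using cv(5)[OF s(1) t(1) xy(4) s(2) t(2) d] xy(1) by simp
  moreover have "cmp D s t \<in> A \<cdot>\<^bsub>Slices D\<^esub> B" using s t d by auto
  ultimately show "z \<in> pre (A \<cdot>\<^bsub>Slices D\<^esub> B)" using mem_preI C.cmp_ar[OF s(1) t(1) xy(4)] xy(1) by blast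
qed

lemma rs_morphism_Slices_mor: "rs_morphism (Slices D) (Slices C) (Slices_mor C D f)"
  unfolding rs_morphism_def C.Slices_simps(1) D.Slices_simps(1)
proof (intro conjI ballI)
  show "Slices_mor C D f \<in> compact_slices D \<rightarrow> compact_slices C" using Slices_mor_pre pre_slice by auto
  show "Slices_mor C D f \<bottom>\<^bsub>proj_ord (Slices D)\<^esub> = \<bottom>\<^bsub>proj_ord (Slices C)\<^esub>"
    unfolding C.bottom_Slices(2) D.bottom_Slices(2) using Slices_mor_pre[OF D.proj_slice[OF D.empty_proj]]
    by (simp add: pre_def)
next
  fix A assume A: "A \<in> compact_slices D"
  note AA = D.slice_ob_images[OF A] D.slice_images[OF A]
  show "Slices_mor C D f (lam (Slices D) A) = lam (Slices C) (Slices_mor C D f A)"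
    using Slices_mor_pre[OF D.unit_slice[OF AA(3)]] Slices_mor_pre[OF A] pre_unit[OF AA(1)] dm_pre[OF A] by simp
  show "Slices_mor C D f (rho (Slices D) A) = rho (Slices C) (Slices_mor C D f A)"
    using Slices_mor_pre[OF D.unit_slice[OF AA(4)]] Slices_mor_pre[OF A] pre_unit[OF AA(2)] cd_pre[OF A] by simp
  fix B assume B: "B \<in> compact_slices D"
  show "Slices_mor C D f (A \<cdot>\<^bsub>Slices D\<^esub> B) = Slices_mor C D f A \<cdot>\<^bsub>Slices C\<^esub> Slices_mor C D f B"
    unfolding Slices_mor_pre[OF A] Slices_mor_pre[OF B] Slices_mor_pre[OF D.tms_slice[OF A B]] by (rule pre_tms[OF A B])
next
  have pr: "Slices_mor C D f P = pre P \<and> pre P \<in> projs (Slices C)" if P: "P \<in> projs (Slices D)" for P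
  proof -
    obtain K where K: "P = unt D ` K" "compact_open (obs D) K" "K \<subseteq> ob_set D" using P by (rule D.proj_SlicesE)
    then have "pre P \<in> projs (Slices C)" using pre_unit C.unit_proj[OF pre0_compact_open] by simp
    then show ?thesis using Slices_mor_pre D.proj_slice P by blast
  qed
  fix P Q assume P: "P \<in> projs (Slices D)" and Q: "Q \<in> projs (Slices D)"
  show "Slices_mor C D f (P \<squnion>\<^bsub>proj_ord (Slices D)\<^esub> Q) = Slices_mor C D f P \<squnion>\<^bsub>proj_ord (Slices C)\<^esub> Slices_mor C D f Q"
    using pr[OF P] pr[OF Q] pr[OF D.proj_Un[OF P Q]] D.pjoin_Slices[OF P Q] C.pjoin_Slices[of "pre P" "pre Q"]
    by (auto simp: pre_def)
  obtain K where K: "P = unt D ` K" "compact_open (obs D) K" "K \<subseteq> ob_set D" using P by (rule D.proj_SlicesE)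
  obtain L where L: "Q = unt D ` L" "compact_open (obs D) L" "L \<subseteq> ob_set D" using Q by (rule D.proj_SlicesE)
  have "pre (P \<inter> Q) = unt C ` pre0 (K \<inter> L)" using K L D.unit_image_Int pre_unit[of "K \<inter> L"] by auto
  also have "pre0 (K \<inter> L) = pre0 K \<inter> pre0 L" by (auto simp: pre0_def)
  also have "unt C ` (pre0 K \<inter> pre0 L) = unt C ` pre0 K \<inter> unt C ` pre0 L"
    using C.unit_image_Int[of "pre0 K" "pre0 L"] by (auto simp: pre0_def)
  also have "\<dots> = pre P \<inter> pre Q" using K L pre_unit by simp
  finally show "Slices_mor C D f (P \<sqinter>\<^bsub>proj_ord (Slices D)\<^esub> Q) = Slices_mor C D f P \<sqinter>\<^bsub>proj_ord (Slices C)\<^esub> Slices_mor C D f Q"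
    using pr[OF P] pr[OF Q] pr[OF D.proj_Int[OF P Q]] D.pmeet_Slices[OF P Q] C.pmeet_Slices[of "pre P" "pre Q"] by simp
next
  fix P assume P: "P \<in> projs (Slices C)"
  obtain K where K: "P = unt C ` K" "compact_open (obs C) K" "K \<subseteq> ob_set C" using P by (rule C.proj_SlicesE)
  \<comment> \<open>the image of a compact set of objects is compact, hence inside a compact-open set\<close>
  have "compactin (obs D) (on_ob f ` K)" using image_compactin[OF _ cv(1)] K unfolding compact_open_def by blast
  moreover have "on_ob f ` K \<subseteq> \<Union>(Collect (compact_open (obs D)))"
  proof
    fix p assume "p \<in> on_ob f ` K"
    then have "p \<in> ob_set D" using cv(12) K by blast
    then obtain L where "compact_open (obs D) L" "p \<in> L" by (rule spectral_space_base[OF D.spectral openin_topspace])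
    then show "p \<in> \<Union>(Collect (compact_open (obs D)))" by blast
  qed
  ultimately have "\<exists>\<F>. finite \<F> \<and> \<F> \<subseteq> Collect (compact_open (obs D)) \<and> on_ob f ` K \<subseteq> \<Union>\<F>"
    by (intro compactinD) (auto simp: compact_open_def)
  then obtain \<F> where F: "finite \<F>" "\<F> \<subseteq> Collect (compact_open (obs D))" "on_ob f ` K \<subseteq> \<Union>\<F>" by blast
  let ?L = "\<Union>\<F>"
  have L: "compact_open (obs D) ?L" by (rule compact_open_Union) (use F in auto)
  have Lsub: "?L \<subseteq> ob_set D" using L openin_subset unfolding compact_open_def by blast
  have "K \<subseteq> pre0 ?L" using F(3) K(3) unfolding pre0_def by blast
  then have "P \<subseteq> pre (unt D ` ?L)" unfolding pre_unit[OF Lsub] K(1) by blast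
  moreover have "pre (unt D ` ?L) \<in> projs (Slices C)" unfolding pre_unit[OF Lsub] by (rule C.unit_proj[OF pre0_compact_open[OF L]])
  ultimately have "P \<sqsubseteq>\<^bsub>proj_ord (Slices C)\<^esub> Slices_mor C D f (unt D ` ?L)"
    unfolding Slices_mor_pre[OF D.unit_slice[OF L]] using C.proj_le_iff[OF P] by blast
  then show "\<exists>Q\<in>projs (Slices D). P \<sqsubseteq>\<^bsub>proj_ord (Slices C)\<^esub> Slices_mor C D f Q" using D.unit_proj[OF L] by blast
qed

end

text \<open>Reduction of properties of compact slices to properties of neighbourhoods.  The empty slice is a member of the
  family, because joins are taken over non-empty families.\<close>

lemma (in spectral_etale) finite_slice_cover:
  assumes T: "T \<in> compact_slices C" and cover: "\<And>x. x \<in> T \<Longrightarrow> \<exists>W. openin (arrs C) W \<and> x \<in> W \<and> P W"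
    and mono: "\<And>V W. \<lbrakk>V \<subseteq> W; P W\<rbrakk> \<Longrightarrow> P V" and empty: "P {}"
  shows "\<exists>M. finite M \<and> M \<noteq> {} \<and> M \<subseteq> compact_slices C \<and> \<Union>M = T \<and> (\<forall>V\<in>M. P V)"
proof -
  let ?\<U> = "{V \<in> compact_slices C. V \<subseteq> T \<and> P V}"
  have "T \<subseteq> \<Union>?\<U>"
  proof
    fix x assume x: "x \<in> T"
    then obtain W where W: "openin (arrs C) W" "x \<in> W" "P W" using cover by blast
    have "openin (arrs C) (W \<inter> T)" using W T slice_iff by blast
    moreover have "x \<in> W \<inter> T" using x W by blast
    ultimately obtain V where V: "V \<in> compact_slices C" "x \<in> V" "V \<subseteq> W \<inter> T" by (rule slices_base)
    then have "P V" using mono[of V W] W(3) by blast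
    then show "x \<in> \<Union>?\<U>" using V by blast
  qed
  moreover have "compactin (arrs C) T" "\<And>V. V \<in> ?\<U> \<Longrightarrow> openin (arrs C) V" using T slice_iff by auto
  ultimately have "\<exists>\<F>. finite \<F> \<and> \<F> \<subseteq> ?\<U> \<and> T \<subseteq> \<Union>\<F>" by (intro compactinD)
  then obtain \<F> where F: "finite \<F>" "\<F> \<subseteq> ?\<U>" "T \<subseteq> \<Union>\<F>" by blast
  show ?thesis
  proof (intro exI[of _ "insert {} \<F>"] conjI)
    show "insert {} \<F> \<subseteq> compact_slices C" using F proj_slice[OF empty_proj] by auto
    show "\<Union>(insert {} \<F>) = T" using F by auto
    show "\<forall>V\<in>insert {} \<F>. P V" using F empty by auto
  qed (use F in auto)
qed

context rc_mor
begin

lemma proper_Slices_mor: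
  assumes "\<And>x. x \<in> ar_set C \<Longrightarrow> \<exists>s. s \<in> on_ar f x"
  shows "proper_morphism (Slices D) (Slices C) (Slices_mor C D f)"
proof (rule proper_morphism_if_cover)
  fix T assume "T \<in> carrier (Slices C)"
  then have T: "T \<in> compact_slices C" by simp
  have "\<exists>M. finite M \<and> M \<noteq> {} \<and> M \<subseteq> compact_slices C \<and> \<Union>M = T \<and>
    (\<forall>V\<in>M. \<exists>A\<in>compact_slices D. V \<subseteq> pre A)"
  proof (rule C.finite_slice_cover[OF T, of "\<lambda>V. \<exists>A\<in>compact_slices D. V \<subseteq> pre A"])
    fix x assume "x \<in> T"
    then have x: "x \<in> ar_set C" using C.slice_sub[OF T] by blast
    obtain s where s: "s \<in> on_ar f x" using assms[OF x] by blast
    then have "s \<in> ar_set D" using cv(2) x by blast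
    then obtain A where A: "A \<in> compact_slices D" "s \<in> A" by (rule D.slice_at)
    have "openin (arrs C) (pre A)" using pre_slice[OF A(1)] C.slice_iff by blast
    then show "\<exists>W. openin (arrs C) W \<and> x \<in> W \<and> (\<exists>A\<in>compact_slices D. W \<subseteq> pre A)"
      using mem_preI[OF x s A(2)] A(1) by blast
  next
    show "\<exists>A\<in>compact_slices D. {} \<subseteq> pre A" using D.proj_slice[OF D.empty_proj] by blast
  qed blast
  then obtain M where M: "finite M" "M \<noteq> {}" "M \<subseteq> compact_slices C" "\<Union>M = T"
    "\<forall>V\<in>M. \<exists>A\<in>compact_slices D. V \<subseteq> pre A" by (elim exE conjE)
  have "is_lub (nat_ord (Slices C)) T M" using C.slice_lub_iff[OF M(3)] M(4) T by simp
  moreover have "\<exists>A\<in>carrier (Slices D). V \<sqsubseteq>\<^bsub>nat_ord (Slices C)\<^esub> Slices_mor C D f A" if V: "V \<in> M" for V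
  proof -
    obtain A where A: "A \<in> compact_slices D" "V \<subseteq> pre A" using M(5) V by blast
    then have "V \<sqsubseteq>\<^bsub>nat_ord (Slices C)\<^esub> Slices_mor C D f A"
      using C.slice_le_iff[of V "pre A"] pre_slice Slices_mor_pre V M(3) by auto
    then show ?thesis using A by auto
  qed
  ultimately show "\<exists>M. finite M \<and> M \<noteq> {} \<and> M \<subseteq> carrier (Slices C) \<and> is_lub (nat_ord (Slices C)) T M \<and>
      (\<forall>m\<in>M. \<exists>s\<in>carrier (Slices D). m \<sqsubseteq>\<^bsub>nat_ord (Slices C)\<^esub> Slices_mor C D f s)"
    using M(1-3) unfolding C.Slices_simps(1) by blast
qed

text \<open>The arrows of \<open>D\<close> related to a point of \<open>T\<close> in \<open>A\<close> and in \<open>B\<close> are the same one, so locally \<open>T\<close> lies under a slice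
  inside \<open>A \<inter> B\<close>; finitely many such slices have a union that is a slice, being contained in \<open>A\<close>.\<close>

lemma weakly_meet_Slices_mor:
  assumes un: "\<And>x s t. \<lbrakk>x \<in> ar_set C; s \<in> on_ar f x; t \<in> on_ar f x\<rbrakk> \<Longrightarrow> s = t"
  shows "weakly_meet_preserving (Slices D) (Slices C) (Slices_mor C D f)"
  unfolding weakly_meet_preserving_def C.Slices_simps(1) D.Slices_simps(1)
proof (intro ballI impI; elim conjE)
  fix T A B assume T: "T \<in> compact_slices C" and A: "A \<in> compact_slices D" and B: "B \<in> compact_slices D"
    and le: "T \<sqsubseteq>\<^bsub>nat_ord (Slices C)\<^esub> Slices_mor C D f A" "T \<sqsubseteq>\<^bsub>nat_ord (Slices C)\<^esub> Slices_mor C D f B"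
  have sub: "T \<subseteq> pre A" "T \<subseteq> pre B"
    using le C.slice_le_iff[OF T pre_slice[OF A]] C.slice_le_iff[OF T pre_slice[OF B]] Slices_mor_pre A B by auto
  let ?Q = "\<lambda>E. E \<in> compact_slices D \<and> E \<subseteq> A \<inter> B"
  have "\<exists>M. finite M \<and> M \<noteq> {} \<and> M \<subseteq> compact_slices C \<and> \<Union>M = T \<and> (\<forall>V\<in>M. \<exists>E. ?Q E \<and> V \<subseteq> pre E)"
  proof (rule C.finite_slice_cover[OF T, of "\<lambda>V. \<exists>E. ?Q E \<and> V \<subseteq> pre E"])
    fix x assume "x \<in> T"
    then have x: "x \<in> pre A" "x \<in> pre B" using sub by auto
    obtain s where s: "x \<in> ar_set C" "s \<in> on_ar f x" "s \<in> A" using x(1) by (rule mem_preE)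
    obtain t where t: "t \<in> on_ar f x" "t \<in> B" using x(2) by (rule mem_preE)
    have "s \<in> A \<inter> B" using un[OF s(1,2) t(1)] s(3) t(2) by simp
    moreover have "openin (arrs D) (A \<inter> B)" using A B D.slice_iff by blast
    ultimately obtain E where E: "E \<in> compact_slices D" "s \<in> E" "E \<subseteq> A \<inter> B" using D.slices_base by metis
    have "openin (arrs C) (pre E)" using pre_slice[OF E(1)] C.slice_iff by blast
    then show "\<exists>W. openin (arrs C) W \<and> x \<in> W \<and> (\<exists>E. ?Q E \<and> W \<subseteq> pre E)"
      using mem_preI[OF s(1,2) E(2)] E(1,3) by blast
  next
    show "\<exists>E. ?Q E \<and> {} \<subseteq> pre E" using D.proj_slice[OF D.empty_proj] by blast
  qed blast
  then obtain M where M: "finite M" "M \<noteq> {}" "M \<subseteq> compact_slices C" "\<Union>M = T"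
    "\<forall>V\<in>M. \<exists>E. ?Q E \<and> V \<subseteq> pre E" by (elim exE conjE)
  obtain h where h: "\<And>V. V \<in> M \<Longrightarrow> ?Q (h V) \<and> V \<subseteq> pre (h V)" using M(5) by metis
  let ?E = "\<Union>(h ` M)"
  have E: "?E \<in> compact_slices D"
  proof (rule D.Union_slice)
    show "finite (h ` M)" "h ` M \<subseteq> compact_slices D" using M(1) h by auto
    fix V W assume "V \<in> h ` M" "W \<in> h ` M"
    then have "V \<union> W \<subseteq> A" using h by blast
    then show "inj_on (dm D) (V \<union> W) \<and> inj_on (cd D) (V \<union> W)" using A unfolding D.slice_iff by (meson inj_on_subset)
  qed
  have "?E \<subseteq> A" "?E \<subseteq> B" using h by blast+
  moreover have "T \<subseteq> pre ?E"
  proof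
    fix x assume "x \<in> T"
    then obtain V where V: "V \<in> M" "x \<in> V" using M(4) by blast
    then have "x \<in> pre (h V)" using h by blast
    then show "x \<in> pre ?E" using V(1) unfolding pre_def by blast
  qed
  ultimately show "\<exists>E\<in>compact_slices D. E \<sqsubseteq>\<^bsub>nat_ord (Slices D)\<^esub> A \<and> E \<sqsubseteq>\<^bsub>nat_ord (Slices D)\<^esub> B \<and>
      T \<sqsubseteq>\<^bsub>nat_ord (Slices C)\<^esub> Slices_mor C D f E"
    using E D.slice_le_iff[OF E A] D.slice_le_iff[OF E B] C.slice_le_iff[OF T pre_slice[OF E]] Slices_mor_pre[OF E] by auto
qed

end

lemma rc_homD:
  assumes "f \<in> rc_hom k C D"
  shows "relational_covering C D f" "coherent C D f" "on_ob f \<in> extensional (ob_set C)" "on_ar f \<in> extensional (ar_set C)"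
    "\<And>x. \<lbrakk>k \<in> {2, 4}; x \<in> ar_set C\<rbrakk> \<Longrightarrow> \<exists>s. s \<in> on_ar f x"
    "\<And>x s t. \<lbrakk>k \<in> {3, 4}; x \<in> ar_set C; s \<in> on_ar f x; t \<in> on_ar f x\<rbrakk> \<Longrightarrow> s = t"
  using assms unfolding rc_hom_def by simp_all

lemma Slices_mor_rs_hom:
  assumes C: "spectral_etale C" and D: "spectral_etale D" and f: "f \<in> rc_hom k C D"
  shows "Slices_mor C D f \<in> rs_hom k (Slices D) (Slices C)"
proof -
  interpret rc_mor C D f unfolding rc_mor_def rc_mor_axioms_def using C D rc_homD(1,2)[OF f] by blast
  have "Slices_mor C D f \<in> extensional (carrier (Slices D))" by (simp add: Slices_mor_def)
  then show ?thesis unfolding rs_hom_def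
    using rs_morphism_Slices_mor proper_Slices_mor weakly_meet_Slices_mor rc_homD(5,6)[OF f] by blast
qed

lemma Slices_mor_id:
  assumes "spectral_etale C" shows "Slices_mor C C (rc_id C) = rs_id (Slices C)"
proof -
  interpret spectral_etale C by fact
  have "{x \<in> ar_set C. (\<lambda>a\<in>ar_set C. {a}) x \<inter> A \<noteq> {}} = A" if "A \<in> compact_slices C" for A
    using slice_sub[OF that] by auto
  then show ?thesis unfolding Slices_mor_def rs_id_def rc_id_def by (auto intro!: restrict_ext)
qed

lemma Slices_mor_comp:
  assumes C: "spectral_etale X" "spectral_etale Y" "spectral_etale Z" and f: "f \<in> rc_hom k X Y" and g: "g \<in> rc_hom k Y Z"
  shows "Slices_mor X Z (rc_comp X g f) = rs_comp (Slices Z) (Slices_mor X Y f) (Slices_mor Y Z g)"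
proof -
  interpret g: rc_mor Y Z g unfolding rc_mor_def rc_mor_axioms_def using C rc_homD(1,2)[OF g] by blast
  note cv = relational_coveringD[OF rc_homD(1)[OF f]]
  have "{x \<in> ar_set X. on_ar (rc_comp X g f) x \<inter> A \<noteq> {}} = Slices_mor X Y f (Slices_mor Y Z g A)"
    if A: "A \<in> compact_slices Z" for A
  proof -
    have "Slices_mor X Y f (Slices_mor Y Z g A) = {x \<in> ar_set X. on_ar f x \<inter> g.pre A \<noteq> {}}"
      using g.pre_slice[OF A] g.Slices_mor_pre[OF A] by (simp add: Slices_mor_def)
    also have "\<dots> = {x \<in> ar_set X. on_ar (rc_comp X g f) x \<inter> A \<noteq> {}}"
      using cv(2) unfolding g.pre_def rc_comp_def by fastforce
    finally show ?thesis by simp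
  qed
  then show ?thesis unfolding rs_comp_def compose_def
    by (subst Slices_mor_def) (auto intro!: restrict_ext)
qed

section \<open>The two categories\<close>

lemma rs_morphism_comp:
  assumes D: "drs S" "drs T" "drs U" and f: "rs_morphism S T f" and g: "rs_morphism T U g"
  shows "rs_morphism S U (rs_comp S g f)"
proof -
  interpret f: rs_mor S T f unfolding rs_mor_iff using assms by blast
  interpret g: rs_mor T U g unfolding rs_mor_iff using assms by blast
  have c: "rs_comp S g f s = g (f s)" if "s \<in> carrier S" for s
    using that by (simp add: rs_comp_def compose_def)
  show ?thesis unfolding rs_morphism_def
  proof (intro conjI ballI)
    show "rs_comp S g f \<in> carrier S \<rightarrow> carrier U" using c f.f_carrier g.f_carrier by auto
    show "rs_comp S g f f.S.zero = g.T.zero" using c f.f_zero g.f_zero f.S.zero_carrier by simp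
  next
    fix a assume a: "a \<in> carrier S"
    show "rs_comp S g f (lam S a) = lam U (rs_comp S g f a)" "rs_comp S g f (rho S a) = rho U (rs_comp S g f a)"
      using a c f.f_lam g.f_lam f.f_rho g.f_rho f.f_carrier f.S.lam_carrier f.S.rho_carrier by auto
    fix b assume b: "b \<in> carrier S"
    show "rs_comp S g f (a \<cdot>\<^bsub>S\<^esub> b) = rs_comp S g f a \<cdot>\<^bsub>U\<^esub> rs_comp S g f b"
      using a b c f.f_tms g.f_tms f.f_carrier f.S.tms_closed by simp
  next
    fix x y assume xy: "x \<in> projs S" "y \<in> projs S"
    have cx: "rs_comp S g f x = g (f x)" "rs_comp S g f y = g (f y)" "rs_comp S g f (f.S.pjoin x y) = g (f (f.S.pjoin x y))"
      "rs_comp S g f (x \<sqinter>\<^bsub>proj_ord S\<^esub> y) = g (f (x \<sqinter>\<^bsub>proj_ord S\<^esub> y))"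
      using c xy f.S.proj_carrier f.S.pjoin_closed f.S.projs_closed by (simp_all add: f.S.meet_proj)
    show "rs_comp S g f (f.S.pjoin x y) = g.T.pjoin (rs_comp S g f x) (rs_comp S g f y)"
      unfolding cx using f.f_pjoin g.f_pjoin xy f.f_proj by simp
    show "rs_comp S g f (x \<sqinter>\<^bsub>proj_ord S\<^esub> y) = rs_comp S g f x \<sqinter>\<^bsub>proj_ord U\<^esub> rs_comp S g f y"
      unfolding cx using f.f_pmeet g.f_pmeet xy f.f_proj by simp
  next
    fix a assume a: "a \<in> projs U"
    obtain b where b: "b \<in> projs T" "a \<sqsubseteq>\<^bsub>nat_ord U\<^esub> g b" using g.f_cofinal a by blast
    obtain e where e: "e \<in> projs S" "b \<sqsubseteq>\<^bsub>nat_ord T\<^esub> f e" using f.f_cofinal b by blast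
    have "g b \<sqsubseteq>\<^bsub>nat_ord U\<^esub> g (f e)" using g.f_mono e f.f_carrier f.S.proj_carrier by blast
    then have "a \<sqsubseteq>\<^bsub>nat_ord U\<^esub> g (f e)"
      using b g.T.nat_le_trans g.f_carrier f.f_carrier f.S.proj_carrier e by blast
    then have "a \<sqsubseteq>\<^bsub>proj_ord U\<^esub> rs_comp S g f e" unfolding g.T.proj_ord_simps using c e f.S.proj_carrier by simp
    then show "\<exists>b\<in>projs S. a \<sqsubseteq>\<^bsub>proj_ord U\<^esub> rs_comp S g f b" using e by blast
  qed
qed

text \<open>For properness of a composite the pointwise criterion avoids refining joins of joins.\<close>

lemma rs_hom_comp:
  assumes D: "drs S" "drs T" "drs U" and f: "f \<in> rs_hom k S T" and g: "g \<in> rs_hom k T U"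
  shows "rs_comp S g f \<in> rs_hom k S U"
proof -
  note m = rs_morphism_comp[OF D rs_homD(1)[OF f] rs_homD(1)[OF g]]
  interpret f: rs_mor S T f unfolding rs_mor_iff using D rs_homD(1)[OF f] by blast
  interpret g: rs_mor T U g unfolding rs_mor_iff using D rs_homD(1)[OF g] by blast
  interpret h: rs_mor S U "rs_comp S g f" unfolding rs_mor_iff using D m by blast
  have c: "rs_comp S g f s = g (f s)" if "s \<in> carrier S" for s
    using that by (simp add: rs_comp_def compose_def)
  have "proper_morphism S U (rs_comp S g f)" if k: "k \<in> {2, 4}"
    unfolding h.proper_iff
  proof
    fix A assume A: "A \<in> arrs_of U"
    obtain t where t: "t \<in> carrier T" "g t \<in> A" using g.proper_iff rs_homD(3)[OF g k] A by blast
    obtain B where B: "g.covers A B" using g.covers_germ(1)[OF A t] by blast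
    then have "B \<in> arrs_of T" by (simp add: g.covers_def)
    then obtain s where s: "s \<in> carrier S" "f s \<in> B" using f.proper_iff rs_homD(3)[OF f k] by blast
    then show "\<exists>s\<in>carrier S. rs_comp S g f s \<in> A" using B c by (auto simp: g.covers_def image_subset_iff)
  qed
  moreover have "weakly_meet_preserving S U (rs_comp S g f)" if k: "k \<in> {3, 4}"
    unfolding weakly_meet_preserving_def
  proof (intro ballI impI; elim conjE)
    fix t a b assume t: "t \<in> carrier U" and ab: "a \<in> carrier S" "b \<in> carrier S"
      "t \<sqsubseteq>\<^bsub>nat_ord U\<^esub> rs_comp S g f a" "t \<sqsubseteq>\<^bsub>nat_ord U\<^esub> rs_comp S g f b"
    obtain d where d: "d \<in> carrier T" "d \<sqsubseteq>\<^bsub>nat_ord T\<^esub> f a" "d \<sqsubseteq>\<^bsub>nat_ord T\<^esub> f b" "t \<sqsubseteq>\<^bsub>nat_ord U\<^esub> g d"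
      using rs_homD(4)[OF g k] t f.f_carrier[OF ab(1)] f.f_carrier[OF ab(2)] ab(3,4) c[OF ab(1)] c[OF ab(2)]
      unfolding weakly_meet_preserving_def by metis
    obtain e where e: "e \<in> carrier S" "e \<sqsubseteq>\<^bsub>nat_ord S\<^esub> a" "e \<sqsubseteq>\<^bsub>nat_ord S\<^esub> b" "d \<sqsubseteq>\<^bsub>nat_ord T\<^esub> f e"
      using rs_homD(4)[OF f k] d(1-3) ab(1,2) unfolding weakly_meet_preserving_def by metis
    have "t \<sqsubseteq>\<^bsub>nat_ord U\<^esub> g (f e)"
      by (rule g.T.nat_le_trans[OF d(4) g.f_mono[OF e(4) f.f_carrier[OF e(1)]] g.f_carrier[OF f.f_carrier[OF e(1)]]])
    then show "\<exists>e\<in>carrier S. e \<sqsubseteq>\<^bsub>nat_ord S\<^esub> a \<and> e \<sqsubseteq>\<^bsub>nat_ord S\<^esub> b \<and> t \<sqsubseteq>\<^bsub>nat_ord U\<^esub> rs_comp S g f e"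
      using e c by auto
  qed
  moreover have "rs_comp S g f \<in> extensional (carrier S)" by (simp add: rs_comp_def)
  ultimately show ?thesis unfolding rs_hom_def using m by blast
qed

lemma rs_id_hom: assumes "drs S" shows "rs_id S \<in> rs_hom k S S"
proof -
  interpret drs S by fact
  have "operation_map S S (rs_id S)" unfolding operation_map_def rs_id_def using closed by simp
  moreover have "bij_betw (rs_id S) (carrier S) (carrier S)" unfolding rs_id_def bij_betw_def inj_on_def by auto
  ultimately interpret i: operation_iso S S "rs_id S" by unfold_locales
  show ?thesis by (rule i.rs_hom) (simp add: rs_id_def)
qed

lemma category_RSgp: "category (RSgp b v k)"
proof -
  have ob: "X \<in> Obj (RSgp b v k) \<Longrightarrow> drs X" for X :: "'a rsgp" using rs_objects_drs by (auto simp: RSgp_def)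
  have car: "f x \<in> carrier Y" if "f \<in> rs_hom k X Y" "x \<in> carrier X" for f x and X Y :: "'a rsgp"
    using rs_homD(1)[OF that(1)] that(2) unfolding rs_morphism_def by blast
  have sel: "Hom (RSgp b v k) = rs_hom k" "Idn (RSgp b v k) = rs_id" "Cmp (RSgp b v k) = (\<lambda>X Y Z g f. rs_comp X g f)"
    by (simp_all add: RSgp_def)
  show ?thesis unfolding category_def sel
  proof (intro conjI ballI)
    fix X :: "'a rsgp" assume X: "X \<in> Obj (RSgp b v k)"
    show "rs_id X \<in> rs_hom k X X" using rs_id_hom ob X by blast
  next
    fix X Y Z :: "'a rsgp" and f g assume "X \<in> Obj (RSgp b v k)" "Y \<in> Obj (RSgp b v k)" "Z \<in> Obj (RSgp b v k)"
      "f \<in> rs_hom k X Y" "g \<in> rs_hom k Y Z"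
    then show "rs_comp X g f \<in> rs_hom k X Z" using rs_hom_comp ob by blast
  next
    fix X Y :: "'a rsgp" and f assume f: "f \<in> rs_hom k X Y"
    show "rs_comp X f (rs_id X) = f" "rs_comp X (rs_id Y) f = f"
      using rs_homD(2)[OF f] car[OF f] unfolding rs_comp_def rs_id_def compose_def extensional_def by fastforce+
  next
    fix W X Y Z :: "'a rsgp" and f g h assume f: "f \<in> rs_hom k W X"
    show "rs_comp W h (rs_comp W g f) = rs_comp W (rs_comp X h g) f"
      using car[OF f] unfolding rs_comp_def compose_def by (auto intro!: restrict_ext)
  qed
qed

lemma relational_covering_comp:
  assumes f: "relational_covering C D f" and g: "relational_covering D E g"
    and C: "etale_category C"
  shows "relational_covering C E (rc_comp C g f)"
proof -
  note F = relational_coveringD[OF f] and G = relational_coveringD[OF g]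
  let ?h = "rc_comp C g f"
  note ob = etale_closed(1,2)[OF C] and un = etale_closed(3)[OF C] and cm = etale_closed(4)[OF C]
  have ho: "on_ob ?h q = on_ob g (on_ob f q)" if "q \<in> ob_set C" for q
    using that by (simp add: rc_comp_def compose_def)
  have ha: "on_ar ?h x = (\<Union>y\<in>on_ar f x. on_ar g y)" if "x \<in> ar_set C" for x
    using that by (simp add: rc_comp_def)
  show ?thesis unfolding relational_covering_def topspace_composables
  proof (intro conjI ballI allI impI)
    have "continuous_map (obs C) (obs E) (on_ob g \<circ> on_ob f)" by (rule continuous_map_compose[OF F(1) G(1)])
    then show "continuous_map (obs C) (obs E) (on_ob ?h)"
      by (rule continuous_map_eq) (simp add: ho)
    show "on_ar ?h \<in> ar_set C \<rightarrow> Pow (ar_set E)" using ha F(2) G(2) by fastforce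
  next
    fix a c assume a: "a \<in> ar_set C" and "c \<in> on_ar ?h a"
    then obtain y where y: "y \<in> on_ar f a" "c \<in> on_ar g y" using ha by blast
    have "y \<in> ar_set D" using F(2) a y by blast
    then show "dm E c = on_ob ?h (dm C a)" "cd E c = on_ob ?h (cd C a)"
      using F(3)[OF a y(1)] F(4)[OF a y(1)] G(3)[OF _ y(2)] G(4)[OF _ y(2)] ho ob[OF a] by simp_all
  next
    fix p assume p: "p \<in> {(a, b). a \<in> ar_set C \<and> b \<in> ar_set C \<and> dm C a = cd C b}"
    have "cmp E s t \<in> on_ar ?h (cmp C a b)"
      if ab: "a \<in> ar_set C" "b \<in> ar_set C" "dm C a = cd C b" and st: "dm E s = cd E t" "s \<in> on_ar ?h a" "t \<in> on_ar ?h b"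
      for a b s t
    proof -
      obtain y where y: "y \<in> on_ar f a" "s \<in> on_ar g y" using st ha ab by blast
      obtain z where z: "z \<in> on_ar f b" "t \<in> on_ar g z" using st ha ab by blast
      have yz: "y \<in> ar_set D" "z \<in> ar_set D" using F(2) y z ab by blast+
      have d: "dm D y = cd D z" using F(3)[OF ab(1) y(1)] F(4)[OF ab(2) z(1)] ab(3) by simp
      have "cmp D y z \<in> on_ar f (cmp C a b)" by (rule F(5)[OF ab y(1) z(1) d])
      moreover have "cmp E s t \<in> on_ar g (cmp D y z)" by (rule G(5)[OF yz d y(2) z(2) st(1)])
      ultimately show ?thesis using ha[OF cm[OF ab]] by blast
    qed
    then show "case p of (a, b) \<Rightarrow> \<forall>(s, t)\<in>{(a, b). a \<in> ar_set E \<and> b \<in> ar_set E \<and> dm E a = cd E b}.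
        s \<in> on_ar ?h a \<and> t \<in> on_ar ?h b \<longrightarrow> cmp E s t \<in> on_ar ?h (cmp C a b)" using p by auto
  next
    fix a b assume ab: "a \<in> ar_set C" "b \<in> ar_set C"
      and H: "(dm C a = dm C b \<or> cd C a = cd C b) \<and> on_ar ?h a \<inter> on_ar ?h b \<noteq> {}"
    then obtain s where "s \<in> on_ar ?h a" "s \<in> on_ar ?h b" by blast
    then obtain y z where yz: "y \<in> on_ar f a" "s \<in> on_ar g y" "z \<in> on_ar f b" "s \<in> on_ar g z" using ha ab by blast
    have D: "y \<in> ar_set D" "z \<in> ar_set D" using F(2) yz ab by blast+
    show "a = b"
    proof (cases "dm C a = dm C b")
      case True
      then have "dm D y = dm D z" using F(3)[OF ab(1) yz(1)] F(3)[OF ab(2) yz(3)] by simp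
      then have "y = z" using G(6)[OF D _ yz(2,4)] by blast
      then show ?thesis using F(6)[OF ab True yz(1)] yz(3) by blast
    next
      case False
      then have e: "cd C a = cd C b" using H by blast
      then have "cd D y = cd D z" using F(4)[OF ab(1) yz(1)] F(4)[OF ab(2) yz(3)] by simp
      then have "y = z" using G(7)[OF D _ yz(2,4)] by blast
      then show ?thesis using F(7)[OF ab e yz(1)] yz(3) by blast
    qed
  next
    fix q s assume q: "q \<in> ob_set C" and s: "s \<in> ar_set E" and e: "dm E s = on_ob ?h q"
    obtain y where y: "y \<in> ar_set D" "dm D y = on_ob f q" "s \<in> on_ar g y" using G(8)[OF F(12)[OF q] s] e ho[OF q] by auto
    obtain t where t: "t \<in> ar_set C" "dm C t = q" "y \<in> on_ar f t" using F(8)[OF q y(1,2)] by blast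
    then show "\<exists>t\<in>ar_set C. dm C t = q \<and> s \<in> on_ar ?h t" using ha[OF t(1)] y(3) by blast
  next
    fix q s assume q: "q \<in> ob_set C" and s: "s \<in> ar_set E" and e: "cd E s = on_ob ?h q"
    obtain y where y: "y \<in> ar_set D" "cd D y = on_ob f q" "s \<in> on_ar g y" using G(9)[OF F(12)[OF q] s] e ho[OF q] by auto
    obtain t where t: "t \<in> ar_set C" "cd C t = q" "y \<in> on_ar f t" using F(9)[OF q y(1,2)] by blast
    then show "\<exists>t\<in>ar_set C. cd C t = q \<and> s \<in> on_ar ?h t" using ha[OF t(1)] y(3) by blast
  next
    fix A assume A: "openin (arrs E) A"
    have "{x \<in> ar_set C. on_ar ?h x \<inter> A \<noteq> {}} = {x \<in> ar_set C. on_ar f x \<inter> {y \<in> ar_set D. on_ar g y \<inter> A \<noteq> {}} \<noteq> {}}"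
      using ha F(2) by fastforce
    then show "openin (arrs C) {x \<in> ar_set C. on_ar ?h x \<inter> A \<noteq> {}}" using F(10)[OF G(10)[OF A]] by simp
  next
    fix t assume t: "t \<in> ob_set C"
    show "unt E (on_ob ?h t) \<in> on_ar ?h (unt C t)"
      using ho[OF t] ha[OF un[OF t]] F(11)[OF t] G(11)[OF F(12)[OF t]] by auto
  qed
qed

lemma rc_hom_comp:
  assumes C: "etale_category C" and f: "f \<in> rc_hom k C D" and g: "g \<in> rc_hom k D E"
  shows "rc_comp C g f \<in> rc_hom k C E"
proof -
  note F = relational_coveringD[OF rc_homD(1)[OF f]]
  have ha: "on_ar (rc_comp C g f) x = (\<Union>y\<in>on_ar f x. on_ar g y)" if "x \<in> ar_set C" for x
    using that by (simp add: rc_comp_def)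
  have "coherent C E (rc_comp C g f)" unfolding coherent_def
  proof (intro allI impI)
    fix K assume K: "openin (obs E) K \<and> compactin (obs E) K"
    let ?L = "{q \<in> ob_set D. on_ob g q \<in> K}"
    have "openin (obs D) ?L \<and> compactin (obs D) ?L"
      using K rc_homD(2)[OF g] openin_continuous_map_preimage[OF relational_coveringD(1)[OF rc_homD(1)[OF g]]]
      unfolding coherent_def by blast
    then have "compactin (obs C) {q \<in> ob_set C. on_ob f q \<in> ?L}" using rc_homD(2)[OF f] unfolding coherent_def by blast
    moreover have "{q \<in> ob_set C. on_ob (rc_comp C g f) q \<in> K} = {q \<in> ob_set C. on_ob f q \<in> ?L}"
      using F(12) by (auto simp: rc_comp_def compose_def)
    ultimately show "compactin (obs C) {q \<in> ob_set C. on_ob (rc_comp C g f) q \<in> K}" by simp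
  qed
  moreover have "\<exists>s. s \<in> on_ar (rc_comp C g f) x" if k: "k \<in> {2, 4}" and x: "x \<in> ar_set C" for x
  proof -
    obtain y where y: "y \<in> on_ar f x" using rc_homD(5)[OF f k x] by blast
    then have "y \<in> ar_set D" using F(2)[OF x] by blast
    then obtain s where "s \<in> on_ar g y" using rc_homD(5)[OF g k] by blast
    then show ?thesis using ha[OF x] y by blast
  qed
  moreover have "s = t" if k: "k \<in> {3, 4}" and x: "x \<in> ar_set C" and s: "s \<in> on_ar (rc_comp C g f) x" "t \<in> on_ar (rc_comp C g f) x" for x s t
  proof -
    obtain y z where y: "y \<in> on_ar f x" "s \<in> on_ar g y" "z \<in> on_ar f x" "t \<in> on_ar g z" using s ha[OF x] by blast
    have "y = z" using rc_homD(6)[OF f k x y(1,3)] .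
    moreover have "y \<in> ar_set D" using F(2)[OF x] y by blast
    ultimately show ?thesis using rc_homD(6)[OF g k] y by blast
  qed
  moreover have "on_ob (rc_comp C g f) \<in> extensional (ob_set C)" "on_ar (rc_comp C g f) \<in> extensional (ar_set C)"
    by (simp_all add: rc_comp_def)
  ultimately show ?thesis unfolding rc_hom_def mem_Collect_eq
    using relational_covering_comp[OF rc_homD(1)[OF f] rc_homD(1)[OF g] C] by blast
qed

lemma rc_id_hom: assumes C: "etale_category C" shows "rc_id C \<in> rc_hom k C C"
proof -
  have "category_homeo C C (\<lambda>q. q) (\<lambda>a. a)"
    unfolding category_homeo_def by (simp add: homeomorphic_map_id[unfolded id_def])
  then have "rcm_of C (\<lambda>q. q) (\<lambda>a. a) \<in> rc_hom k C C" by (rule category_homeo_rc_hom[OF C])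
  then show ?thesis by (simp add: rcm_of_def rc_id_def)
qed

lemma category_ETCat: "category (ETCat b v k)"
proof -
  have ob: "X \<in> Obj (ETCat b v k) \<Longrightarrow> etale_category X" for X :: "('o, 'm) tcat"
    by (simp add: ETCat_def et_objects_def)
  have sel: "Hom (ETCat b v k) = rc_hom k" "Idn (ETCat b v k) = rc_id" "Cmp (ETCat b v k) = (\<lambda>X Y Z g f. rc_comp X g f)"
    by (simp_all add: ETCat_def)
  have eqI: "f = g" if "on_ob f = on_ob g" "on_ar f = on_ar g" for f g :: "('o, 'm, 'o, 'm) rcm"
    using that by simp
  show ?thesis unfolding category_def sel
  proof (intro conjI ballI)
    fix X :: "('o, 'm) tcat" assume X: "X \<in> Obj (ETCat b v k)"
    show "rc_id X \<in> rc_hom k X X" using rc_id_hom ob X by blast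
  next
    fix X Y Z :: "('o, 'm) tcat" and f g assume "X \<in> Obj (ETCat b v k)"
      "f \<in> rc_hom k X Y" "g \<in> rc_hom k Y Z"
    then show "rc_comp X g f \<in> rc_hom k X Z" using rc_hom_comp ob by blast
  next
    fix X Y :: "('o, 'm) tcat" and f assume X: "X \<in> Obj (ETCat b v k)" and f: "f \<in> rc_hom k X Y"
    note F = relational_coveringD[OF rc_homD(1)[OF f]] rc_homD(3,4)[OF f]
    show "rc_comp X f (rc_id X) = f"
    proof (rule eqI)
      show "on_ob (rc_comp X f (rc_id X)) = on_ob f" "on_ar (rc_comp X f (rc_id X)) = on_ar f"
        using F(13,14) by (auto simp: rc_comp_def rc_id_def compose_def extensional_def fun_eq_iff)
    qed
    show "rc_comp X (rc_id Y) f = f"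
    proof (rule eqI)
      show "on_ob (rc_comp X (rc_id Y) f) = on_ob f"
        using F(12,13) by (auto simp: rc_comp_def rc_id_def compose_def extensional_def fun_eq_iff)
      show "on_ar (rc_comp X (rc_id Y) f) = on_ar f"
      proof
        fix x show "on_ar (rc_comp X (rc_id Y) f) x = on_ar f x"
        proof (cases "x \<in> ar_set X")
          case True
          have "(\<Union>b\<in>on_ar f x. (\<lambda>a\<in>ar_set Y. {a}) b) = on_ar f x" using F(2)[OF True] by fastforce
          then show ?thesis using True by (simp add: rc_comp_def rc_id_def)
        next
          case False then show ?thesis using F(14) by (simp add: rc_comp_def extensional_def)
        qed
      qed
    qed
  next
    fix W X Y Z :: "('o, 'm) tcat" and f g h assume f: "f \<in> rc_hom k W X" and "g \<in> rc_hom k X Y" "h \<in> rc_hom k Y Z"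
    note F = relational_coveringD[OF rc_homD(1)[OF f]]
    show "rc_comp W h (rc_comp W g f) = rc_comp W (rc_comp X h g) f"
    proof (rule eqI)
      show "on_ob (rc_comp W h (rc_comp W g f)) = on_ob (rc_comp W (rc_comp X h g) f)"
        using F(12) unfolding rc_comp_def compose_def by (auto intro!: restrict_ext)
      show "on_ar (rc_comp W h (rc_comp W g f)) = on_ar (rc_comp W (rc_comp X h g) f)"
        unfolding rc_comp_def rcm.simps
      proof (rule restrict_ext)
        fix x assume x: "x \<in> ar_set W"
        then show "(\<Union>b\<in>(\<lambda>a\<in>ar_set W. \<Union>b\<in>on_ar f a. on_ar g b) x. on_ar h b) =
            (\<Union>b\<in>on_ar f x. (\<lambda>a\<in>ar_set X. \<Union>b\<in>on_ar g a. on_ar h b) b)"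
          using F(2)[OF x] by fastforce
      qed
    qed
  qed
qed

section \<open>Naturality\<close>

lemma rs_unit_natural:
  assumes S: "drs S" and T: "drs T" and f: "rs_morphism S T f"
  shows "rs_comp S (Slices_mor (Spec T) (Spec S) (Spec_mor S T f)) (rs_unit S) = rs_comp S (rs_unit T) f"
proof -
  interpret rs_mor S T f unfolding rs_mor_iff using S T f by blast
  have "Slices_mor (Spec T) (Spec S) (Spec_mor S T f) (rs_unit S s) = rs_unit T (f s)" if s: "s \<in> carrier S" for s
  proof -
    have "rs_unit S s = ar_basic S s" "rs_unit T (f s) = ar_basic T (f s)"
      using s f_carrier by (simp_all add: rs_unit_def ar_basic_def)
    moreover have "Slices_mor (Spec T) (Spec S) (Spec_mor S T f) (ar_basic S s) =
        {A \<in> arrs_of T. on_ar (Spec_mor S T f) A \<inter> ar_basic S s \<noteq> {}}"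
      unfolding Slices_mor_def T.ar_set_Spec using S.ar_basic_slice[OF s] by simp
    moreover have "\<dots> = ar_basic T (f s)"
      unfolding covers_meets_basic[OF s, symmetric] using Spec_mor_on_ar by auto
    ultimately show ?thesis by simp
  qed
  then show ?thesis unfolding rs_comp_def compose_def by (auto intro!: restrict_ext)
qed

text \<open>A filter of slices related to \<open>x\<close> is the filter of an arrow \<open>s\<close> over the image of the domain of \<open>x\<close>.  Every slice through
  \<open>s\<close> contains an arrow related to \<open>x\<close>, with the same domain as \<open>s\<close>, that is, \<open>s\<close> itself.\<close>

lemma et_unit_natural:
  assumes C: "spectral_etale C" and D: "spectral_etale D" and f: "f \<in> rc_hom k C D"
  shows "rc_comp C (Spec_mor (Slices D) (Slices C) (Slices_mor C D f)) (et_unit C) = rc_comp C (et_unit D) f"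
proof -
  interpret rc_mor C D f unfolding rc_mor_def rc_mor_axioms_def using C D rc_homD(1,2)[OF f] by blast
  interpret s: rs_mor "Slices D" "Slices C" "Slices_mor C D f"
    unfolding rs_mor_iff using C.drs_Slices D.drs_Slices rs_morphism_Slices_mor by blast
  have pull: "pull (Slices D) (Slices_mor C D f) (C.point_filter q) = D.point_filter (on_ob f q)" if q: "q \<in> ob_set C" for q
  proof -
    have "Slices_mor C D f P \<in> C.point_filter q \<longleftrightarrow> unt D (on_ob f q) \<in> P" if P: "P \<in> projs (Slices D)" for P
    proof -
      obtain K where K: "P = unt D ` K" "compact_open (obs D) K" "K \<subseteq> ob_set D" using P by (rule D.proj_SlicesE)
      have "Slices_mor C D f P = unt C ` pre0 K"
        using Slices_mor_pre[OF D.proj_slice[OF P]] K pre_unit by simp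
      then show ?thesis using C.unit_mem_point_filter[OF q pre0_compact_open[OF K(2)]] q K(1)
          D.mem_unit_image[OF cv(12)[OF q] K(3)] by (simp add: pre0_def)
    qed
    then show ?thesis unfolding pull_def D.point_filter_def by blast
  qed
  have arr: "Collect (s.covers (C.arrow_filter x)) = D.arrow_filter ` on_ar f x" if x: "x \<in> ar_set C" for x
  proof (intro equalityI subsetI)
    fix B assume "B \<in> Collect (s.covers (C.arrow_filter x))"
    then have B: "B \<in> arrs_of (Slices D)" "Slices_mor C D f ` B \<subseteq> C.arrow_filter x"
      "dom_of (Slices D) B = pull (Slices D) (Slices_mor C D f) (dom_of (Slices C) (C.arrow_filter x))"
      by (auto simp: s.covers_def)
    obtain s where s: "s \<in> ar_set D" "B = D.arrow_filter s" using D.arrs_of_Slices[OF B(1)] by blast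
    have "D.point_filter (dm D s) = D.point_filter (on_ob f (dm C x))"
      using B(3) D.dom_arrow_filter[OF s(1)] C.dom_arrow_filter[OF x] pull[OF C.dm_ob[OF x]] s(2) by simp
    then have d: "dm D s = on_ob f (dm C x)"
      using D.inj_point_filter D.dm_ob[OF s(1)] cv(12)[OF C.dm_ob[OF x]] unfolding inj_on_def by blast
    obtain A where A: "A \<in> compact_slices D" "s \<in> A" using s(1) by (rule D.slice_at)
    then have "A \<in> B" using s by (simp add: D.arrow_filter_def)
    then have "x \<in> pre A" using B(2) Slices_mor_pre[OF A(1)] by (auto simp: C.arrow_filter_def)
    then obtain t where t: "t \<in> on_ar f x" "t \<in> A" by (rule mem_preE)
    have "dm D t = dm D s" using cv(3)[OF x t(1)] d by simp
    then have "t = s" using D.slice_dm_inj[OF A(1) t(2) A(2)] by blast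
    then show "B \<in> D.arrow_filter ` on_ar f x" using s t by blast
  next
    fix B assume "B \<in> D.arrow_filter ` on_ar f x"
    then obtain s where s: "s \<in> on_ar f x" "B = D.arrow_filter s" by blast
    have sD: "s \<in> ar_set D" using cv(2)[OF x] s by blast
    have "Slices_mor C D f A \<in> C.arrow_filter x" if "A \<in> B" for A
    proof -
      have A: "A \<in> compact_slices D" "s \<in> A" using that s by (auto simp: D.arrow_filter_def)
      then show ?thesis using mem_preI[OF x s(1)] pre_slice Slices_mor_pre by (simp add: C.arrow_filter_def)
    qed
    then show "B \<in> Collect (s.covers (C.arrow_filter x))" unfolding s.covers_def mem_Collect_eq
      using D.arrow_filter_arr[OF sD] D.dom_arrow_filter[OF sD] C.dom_arrow_filter[OF x] pull[OF C.dm_ob[OF x]] cv(3)[OF x s(1)] s(2)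
      by auto
  qed
  show ?thesis unfolding C.et_unit_eq D.et_unit_eq
  proof (rule rcm.equality)
    show "on_ob (rc_comp C (Spec_mor (Slices D) (Slices C) (Slices_mor C D f)) (rcm_of C C.point_filter C.arrow_filter)) =
        on_ob (rc_comp C (rcm_of D D.point_filter D.arrow_filter) f)"
      unfolding rc_comp_def rcm_of_def compose_def rcm.simps
      using s.Spec_mor_on_ob C.point_filter_ob pull cv(12) by (auto intro!: restrict_ext)
    show "on_ar (rc_comp C (Spec_mor (Slices D) (Slices C) (Slices_mor C D f)) (rcm_of C C.point_filter C.arrow_filter)) =
        on_ar (rc_comp C (rcm_of D D.point_filter D.arrow_filter) f)"
      unfolding rc_comp_def rcm_of_def rcm.simps
    proof (rule restrict_ext)
      fix x assume x: "x \<in> ar_set C"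
      have "(\<Union>b\<in>on_ar f x. (\<lambda>a\<in>ar_set D. {D.arrow_filter a}) b) = D.arrow_filter ` on_ar f x"
        using cv(2)[OF x] by fastforce
      then show "(\<Union>b\<in>(\<lambda>a\<in>ar_set C. {C.arrow_filter a}) x. on_ar (Spec_mor (Slices D) (Slices C) (Slices_mor C D f)) b) =
          (\<Union>b\<in>on_ar f x. (\<lambda>a\<in>ar_set D. {D.arrow_filter a}) b)"
        using x arr[OF x] s.Spec_mor_on_ar[OF C.arrow_filter_arr[OF x]] by simp
    qed
  qed simp
qed

section \<open>The duality\<close>

lemma contravariant_functor_Spec: "contravariant_functor (RSgp b v k) (ETCat b v k) Spec Spec_mor"
proof -
  have ob: "X \<in> Obj (RSgp b v k) \<Longrightarrow> drs X" for X :: "'a rsgp" using rs_objects_drs by (auto simp: RSgp_def)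
  show ?thesis unfolding contravariant_functor_def
  proof (intro conjI ballI)
    fix X :: "'a rsgp" assume X: "X \<in> Obj (RSgp b v k)"
    then show "Spec X \<in> Obj (ETCat b v k)" using Spec_et_objects by (simp add: RSgp_def ETCat_def)
    show "Spec_mor X X (Idn (RSgp b v k) X) = Idn (ETCat b v k) (Spec X)"
      using Spec_mor_id[OF ob[OF X]] by (simp add: RSgp_def ETCat_def)
  next
    fix X Y :: "'a rsgp" and f
    assume "X \<in> Obj (RSgp b v k)" "Y \<in> Obj (RSgp b v k)" "f \<in> Hom (RSgp b v k) X Y"
    then show "Spec_mor X Y f \<in> Hom (ETCat b v k) (Spec Y) (Spec X)"
      using Spec_mor_rc_hom[of X Y f k] ob by (simp add: RSgp_def ETCat_def)
  next
    fix X Y Z :: "'a rsgp" and f g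
    assume X: "X \<in> Obj (RSgp b v k)" "Y \<in> Obj (RSgp b v k)" "Z \<in> Obj (RSgp b v k)"
      and "f \<in> Hom (RSgp b v k) X Y" "g \<in> Hom (RSgp b v k) Y Z"
    then have fg: "rs_morphism X Y f" "rs_morphism Y Z g" using rs_homD(1) by (auto simp: RSgp_def)
    note d = ob[OF X(1)] ob[OF X(2)] ob[OF X(3)]
    show "Spec_mor X Z (Cmp (RSgp b v k) X Y Z g f) =
        Cmp (ETCat b v k) (Spec Z) (Spec Y) (Spec X) (Spec_mor X Y f) (Spec_mor Y Z g)"
      using Spec_mor_comp[OF d fg rs_morphism_comp[OF d fg]] by (simp add: RSgp_def ETCat_def)
  qed
qed

lemma contravariant_functor_Slices: "contravariant_functor (ETCat b v k) (RSgp b v k) Slices Slices_mor"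
proof -
  have ob: "X \<in> Obj (ETCat b v k) \<Longrightarrow> spectral_etale X" for X :: "('o, 'm) tcat"
    using et_objects_spectral_etale(1) by (auto simp: ETCat_def)
  show ?thesis unfolding contravariant_functor_def
  proof (intro conjI ballI)
    fix X :: "('o, 'm) tcat" assume X: "X \<in> Obj (ETCat b v k)"
    then show "Slices X \<in> Obj (RSgp b v k)" using Slices_rs_objects by (simp add: RSgp_def ETCat_def)
    show "Slices_mor X X (Idn (ETCat b v k) X) = Idn (RSgp b v k) (Slices X)"
      using Slices_mor_id[OF ob[OF X]] by (simp add: RSgp_def ETCat_def)
  next
    fix X Y :: "('o, 'm) tcat" and f
    assume X: "X \<in> Obj (ETCat b v k)" "Y \<in> Obj (ETCat b v k)" and "f \<in> Hom (ETCat b v k) X Y"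
    then have "f \<in> rc_hom k X Y" by (simp add: ETCat_def)
    then show "Slices_mor X Y f \<in> Hom (RSgp b v k) (Slices Y) (Slices X)"
      using Slices_mor_rs_hom[OF ob[OF X(1)] ob[OF X(2)]] by (simp add: RSgp_def)
  next
    fix X Y Z :: "('o, 'm) tcat" and f g
    assume X: "X \<in> Obj (ETCat b v k)" "Y \<in> Obj (ETCat b v k)" "Z \<in> Obj (ETCat b v k)"
      and "f \<in> Hom (ETCat b v k) X Y" "g \<in> Hom (ETCat b v k) Y Z"
    then have "f \<in> rc_hom k X Y" "g \<in> rc_hom k Y Z" by (simp_all add: ETCat_def)
    then show "Slices_mor X Z (Cmp (ETCat b v k) X Y Z g f) =
        Cmp (RSgp b v k) (Slices Z) (Slices Y) (Slices X) (Slices_mor X Y f) (Slices_mor Y Z g)"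
      using Slices_mor_comp[OF ob[OF X(1)] ob[OF X(2)] ob[OF X(3)]] by (simp add: RSgp_def ETCat_def)
  qed
qed

theorem theorem8p19:
  fixes b :: base and v :: variant and k :: nat
  assumes "k \<in> {1, 2, 3, 4}"
  shows
    "category (RSgp b v k :: ('a rsgp, 'a \<Rightarrow> 'a) catgy) \<and>
     category (ETCat b v k :: (('o, 'm) tcat, ('o, 'm, 'o, 'm) rcm) catgy) \<and>
     \<comment> \<open>contravariant functors in both directions\<close>
     contravariant_functor (RSgp b v k :: ('a rsgp, 'a \<Rightarrow> 'a) catgy) (ETCat b v k) Spec Spec_mor \<and>
     contravariant_functor (ETCat b v k :: (('o, 'm) tcat, ('o, 'm, 'o, 'm) rcm) catgy) (RSgp b v k)
       Slices Slices_mor \<and>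
     \<comment> \<open>the natural isomorphism from S to Slices (Spec S)\<close>
     (\<forall>S \<in> Obj (RSgp b v k :: ('a rsgp, 'a \<Rightarrow> 'a) catgy).
        rs_iso k S (Slices (Spec S)) (rs_unit S)) \<and>
     (\<forall>S \<in> Obj (RSgp b v k :: ('a rsgp, 'a \<Rightarrow> 'a) catgy). \<forall>T \<in> Obj (RSgp b v k).
        \<forall>f \<in> Hom (RSgp b v k) S T.
          rs_comp S (Slices_mor (Spec T) (Spec S) (Spec_mor S T f)) (rs_unit S)
            = rs_comp S (rs_unit T) f) \<and>
     \<comment> \<open>the natural isomorphism from C to Spec (Slices C)\<close>
     (\<forall>C \<in> Obj (ETCat b v k :: (('o, 'm) tcat, ('o, 'm, 'o, 'm) rcm) catgy).
        rc_iso k C (Spec (Slices C)) (et_unit C)) \<and>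
     (\<forall>C \<in> Obj (ETCat b v k :: (('o, 'm) tcat, ('o, 'm, 'o, 'm) rcm) catgy). \<forall>D \<in> Obj (ETCat b v k).
        \<forall>f \<in> Hom (ETCat b v k) C D.
          rc_comp C (Spec_mor (Slices D) (Slices C) (Slices_mor C D f)) (et_unit C)
            = rc_comp C (et_unit D) f) \<and>
     \<comment> \<open>ample semigroups correspond to cancellative categories\<close>
     (\<forall>S \<in> Obj (RSgp b v k :: ('a rsgp, 'a \<Rightarrow> 'a) catgy).
        ample S \<longleftrightarrow> cancellative (Spec S)) \<and>
     (\<forall>C \<in> Obj (ETCat b v k :: (('o, 'm) tcat, ('o, 'm, 'o, 'm) rcm) catgy).
        cancellative C \<longleftrightarrow> ample (Slices C))"
proof (intro conjI ballI)
  have rs: "X \<in> Obj (RSgp b v k) \<Longrightarrow> drs X" for X :: "'a rsgp" using rs_objects_drs by (auto simp: RSgp_def)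
  have et: "X \<in> Obj (ETCat b v k) \<Longrightarrow> spectral_etale X" for X :: "('o, 'm) tcat"
    using et_objects_spectral_etale(1) by (auto simp: ETCat_def)
  show "category (RSgp b v k :: ('a rsgp, 'a \<Rightarrow> 'a) catgy)" by (rule category_RSgp)
  show "category (ETCat b v k :: (('o, 'm) tcat, ('o, 'm, 'o, 'm) rcm) catgy)" by (rule category_ETCat)
  show "contravariant_functor (RSgp b v k :: ('a rsgp, 'a \<Rightarrow> 'a) catgy) (ETCat b v k) Spec Spec_mor"
    by (rule contravariant_functor_Spec)
  show "contravariant_functor (ETCat b v k :: (('o, 'm) tcat, ('o, 'm, 'o, 'm) rcm) catgy) (RSgp b v k) Slices Slices_mor"
    by (rule contravariant_functor_Slices)
  { fix S :: "'a rsgp" assume S: "S \<in> Obj (RSgp b v k)"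
    show "rs_iso k S (Slices (Spec S)) (rs_unit S)" by (rule drs.rs_iso_rs_unit[OF rs[OF S]])
    show "ample S \<longleftrightarrow> cancellative (Spec S)" by (rule drs.ample_iff_cancellative[OF rs[OF S]])
    fix T :: "'a rsgp" and f assume T: "T \<in> Obj (RSgp b v k)" and "f \<in> Hom (RSgp b v k) S T"
    then have "rs_morphism S T f" using rs_homD(1) by (auto simp: RSgp_def)
    then show "rs_comp S (Slices_mor (Spec T) (Spec S) (Spec_mor S T f)) (rs_unit S) = rs_comp S (rs_unit T) f"
      by (rule rs_unit_natural[OF rs[OF S] rs[OF T]]) }
  { fix C :: "('o, 'm) tcat" assume C: "C \<in> Obj (ETCat b v k)"
    show "rc_iso k C (Spec (Slices C)) (et_unit C)" by (rule spectral_etale.rc_iso_et_unit[OF et[OF C]])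
    show "cancellative C \<longleftrightarrow> ample (Slices C)" by (rule spectral_etale.cancellative_iff_ample[OF et[OF C]])
    fix D :: "('o, 'm) tcat" and f assume D: "D \<in> Obj (ETCat b v k)" and "f \<in> Hom (ETCat b v k) C D"
    then have "f \<in> rc_hom k C D" by (simp add: ETCat_def)
    then show "rc_comp C (Spec_mor (Slices D) (Slices C) (Slices_mor C D f)) (et_unit C) = rc_comp C (et_unit D) f"
      by (rule et_unit_natural[OF et[OF C] et[OF D]]) }
qed
end
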